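(* Let $F \in \mathbb{D}^\infty$. If the law of the Bouleau derivative $\sharp_G F$ is smooth (that is, has a $\mathscr{C}^\infty$ density on $\mathbb{R}$), then the law of $F$ is smooth (that is, has a $\mathscr{C}^\infty$ density on $\mathbb{R}$).
   Context: Wiener space: the product $\bigotimes_{k\in\mathbb{N}} (\mathbb{R}, \mathfrak{B}(\mathbb{R}), \gamma)$ with $\gamma$ the standard Gaussian measure; its coordinates $(Y_k)$ are i.i.d. standard Gaussian. For smooth cylindrical $F,R$, $\Gamma(F,R) = \sum_k (\partial_{y_k}F)(\partial_{y_k}R)$ (carré du champ); $\partial_{y_k}$ and $\Gamma$ are extended by closure. $\mathsf{L}$ is the associated self-adjoint (Ornstein--Uhlenbeck) generator, characterized by $\mathbf{E}[\Gamma(F,R)] = -\mathbf{E}[F\,\mathsf{L}R]$. $\mathbb{D}^\infty = \{F : \mathsf{L}^k F \in \mathrm{Dom}(\mathsf{L}) \cap \bigcap_{1<p<\infty} L^p \text{ for all } k\geq 0\}$. The Bouleau derivative of $F \in \mathbb{D}^\infty$ is $\sharp_G F = \sum_k (\partial_{y_k}F)\, G_k$, where $(G_k)$ is a sequence of independent standard Gaussian variables, independent of the underlying Wiener space. Thus $\sharp_G F$ has the law of $\Gamma(F,F)^{1/2} N$ with $N$ standard Gaussian independent of $\Gamma(F,F)$. *)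

theory Defs
  imports "HOL-Probability.Probability"
begin

definition wiener :: "(nat \<Rightarrow> real) measure" where
  "wiener = Pi\<^sub>M UNIV (\<lambda>k. density lborel (\<lambda>x. ennreal (std_normal_density x)))"

text \<open>Elements of \<open>Lp M p\<close> are functions, not classes modulo null sets. Accordingly the operators
  \<open>grad\<close>, \<open>OU\<close> and \<open>bouleau\<close> below select a representative; it is unique up to null sets,
  and everything built from it is independent of the selection.\<close>

definition Lp :: "'a measure \<Rightarrow> real \<Rightarrow> ('a \<Rightarrow> real) set" where
  "Lp M p = {f \<in> borel_measurable M. integrable M (\<lambda>x. \<bar>f x\<bar> powr p)}"

definition pderivative :: "nat \<Rightarrow> ((nat \<Rightarrow> real) \<Rightarrow> real) \<Rightarrow> (nat \<Rightarrow> real) \<Rightarrow> real" where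
  "pderivative k F y = deriv (\<lambda>t. F (y(k := t))) (y k)"

text \<open>Functions of finitely many coordinates \<open>y\<^sub>0, \<dots>, y\<^sub>n\<^sub>-\<^sub>1\<close> that are infinitely differentiable
  in these, with all derivatives (including order 0) of at most polynomial growth. Smoothness is
  the existence and continuity of all iterated partial derivatives; continuity for the product
  topology agrees with continuity in the first \<open>n\<close> coordinates.\<close>

definition smooth_cylindrical :: "((nat \<Rightarrow> real) \<Rightarrow> real) \<Rightarrow> bool" where
  "smooth_cylindrical F \<longleftrightarrow> (\<exists>n.
     (\<forall>y z. (\<forall>i<n. y i = z i) \<longrightarrow> F y = F z) \<and>
     (\<forall>ks. continuous_on UNIV (foldr pderivative ks F) \<and>
           (\<forall>k y. (\<lambda>t. foldr pderivative ks F (y(k := t))) differentiable (at (y k))) \<and>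
           (\<exists>C m. \<forall>y. \<bar>foldr pderivative ks F y\<bar> \<le> C * (1 + (\<Sum>i<n. \<bar>y i\<bar>)) ^ m)))"

text \<open>The closure of \<open>F \<mapsto> (\<partial>F/\<partial>y\<^sub>k)\<^sub>k\<close> as an operator from \<open>L\<^sup>2\<close> to the \<open>\<ell>\<^sup>2\<close>-valued \<open>L\<^sup>2\<close> space,
  that is, the closure for the norm \<open>(E[F\<^sup>2] + E[\<Gamma>(F,F)])\<^sup>1\<^sup>/\<^sup>2\<close>.\<close>

definition has_gradient ::
    "((nat \<Rightarrow> real) \<Rightarrow> real) \<Rightarrow> (nat \<Rightarrow> (nat \<Rightarrow> real) \<Rightarrow> real) \<Rightarrow> bool" where
  "has_gradient F U \<longleftrightarrow>
     F \<in> Lp wiener 2 \<and> (\<forall>k. U k \<in> borel_measurable wiener) \<and>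
     (\<exists>\<Phi>. (\<forall>n. smooth_cylindrical (\<Phi> n)) \<and>
       (\<lambda>n. \<integral>\<^sup>+ y. ennreal ((\<Phi> n y - F y)\<^sup>2) \<partial>wiener) \<longlonglongrightarrow> 0 \<and>
       (\<lambda>n. \<integral>\<^sup>+ y. (\<Sum>k. ennreal ((pderivative k (\<Phi> n) y - U k y)\<^sup>2)) \<partial>wiener) \<longlonglongrightarrow> 0)"

definition grad_dom :: "((nat \<Rightarrow> real) \<Rightarrow> real) set" where
  "grad_dom = {F. \<exists>U. has_gradient F U}"

definition grad :: "((nat \<Rightarrow> real) \<Rightarrow> real) \<Rightarrow> nat \<Rightarrow> (nat \<Rightarrow> real) \<Rightarrow> real" where
  "grad F = (SOME U. has_gradient F U)"

text \<open>On \<open>grad_dom\<close> the series below converges absolutely almost everywhere.\<close>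

definition carre_du_champ ::
    "((nat \<Rightarrow> real) \<Rightarrow> real) \<Rightarrow> ((nat \<Rightarrow> real) \<Rightarrow> real) \<Rightarrow> (nat \<Rightarrow> real) \<Rightarrow> real" where
  "carre_du_champ F R y = (\<Sum>k. grad F k y * grad R k y)"

text \<open>The generator of the Dirichlet form \<open>(F, R) \<mapsto> E[\<Gamma>(F,R)]\<close>.\<close>

definition is_generator :: "((nat \<Rightarrow> real) \<Rightarrow> real) \<Rightarrow> ((nat \<Rightarrow> real) \<Rightarrow> real) \<Rightarrow> bool" where
  "is_generator R H \<longleftrightarrow>
     R \<in> grad_dom \<and> H \<in> Lp wiener 2 \<and>
     (\<forall>F\<in>grad_dom. (\<integral>y. carre_du_champ F R y \<partial>wiener) = - (\<integral>y. F y * H y \<partial>wiener))"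

definition OU_dom :: "((nat \<Rightarrow> real) \<Rightarrow> real) set" where
  "OU_dom = {R. \<exists>H. is_generator R H}"

definition OU :: "((nat \<Rightarrow> real) \<Rightarrow> real) \<Rightarrow> (nat \<Rightarrow> real) \<Rightarrow> real" where
  "OU R = (SOME H. is_generator R H)"

definition D_infinity :: "((nat \<Rightarrow> real) \<Rightarrow> real) set" where
  "D_infinity = {F. \<forall>k. (OU ^^ k) F \<in> OU_dom \<inter> (\<Inter>p\<in>{1<..}. Lp wiener p)}"

definition iid_std_normal :: "'b measure \<Rightarrow> (nat \<Rightarrow> 'b \<Rightarrow> real) \<Rightarrow> bool" where
  "iid_std_normal M G \<longleftrightarrow>
     prob_space M \<and> prob_space.indep_vars M (\<lambda>_. borel) G UNIV \<and>
     (\<forall>k. distributed M lborel (G k) (\<lambda>x. ennreal (std_normal_density x)))"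

text \<open>The sequence \<open>G\<close> lives on \<open>M\<close>, and the product measure makes it independent of the Wiener
  space. The series \<open>\<Sum>k. grad F k y * G k w\<close> is understood in \<open>L\<^sup>2\<close> of the product.\<close>

definition bouleau :: "'b measure \<Rightarrow> (nat \<Rightarrow> 'b \<Rightarrow> real) \<Rightarrow> ((nat \<Rightarrow> real) \<Rightarrow> real) \<Rightarrow>
    (nat \<Rightarrow> real) \<times> 'b \<Rightarrow> real" where
  "bouleau M G F = (SOME S. S \<in> Lp (wiener \<Otimes>\<^sub>M M) 2 \<and>
     (\<lambda>n. \<integral>\<^sup>+ (y, w). ennreal (((\<Sum>k<n. grad F k y * G k w) - S (y, w))\<^sup>2) \<partial>(wiener \<Otimes>\<^sub>M M))
       \<longlonglongrightarrow> 0)"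

text \<open>Nonnegativity of \<open>f\<close> cannot be dropped: \<open>ennreal\<close> truncates negative values, so without it
  the density would only be the positive part of a smooth function.\<close>

definition smooth_law :: "'a measure \<Rightarrow> ('a \<Rightarrow> real) \<Rightarrow> bool" where
  "smooth_law M X \<longleftrightarrow> (\<exists>f::real \<Rightarrow> real.
     (\<forall>n x. (deriv ^^ n) f differentiable (at x)) \<and> (\<forall>x. 0 \<le> f x) \<and>
     distributed M lborel X (\<lambda>x. ennreal (f x)))"

end

theory Submission imports Defs begin

text \<open>The rotations \<open>R\<^sub>t(y, z) = (cos t y + sin t z, cos t z - sin t y)\<close> preserve two copies of Wiener
  space, and the derivative of \<open>F(y)\<close> along them at \<open>t = 0\<close> is the Bouleau derivative
  \<open>S = \<Sum>\<^sub>k \<partial>\<^sub>kF(y) z\<^sub>k\<close>. The functions \<open>b\<^sub>k(t) = E[F \<cdot> (L\<^sup>kF) \<circ> R\<^sub>t]\<close> satisfy \<open>b\<^sub>k' = tan t \<cdot> b\<^sub>k\<^sub>+\<^sub>1\<close>, so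
  for \<open>F \<in> \<D>\<^sup>\<infinity>\<close> the autocorrelation \<open>b\<^sub>0\<close> is smooth near \<open>0\<close>. As \<open>R\<close> is a one-parameter group,
  this makes \<open>F\<close> infinitely differentiable along \<open>R\<close> in every \<open>L\<^sup>p\<close>. Integrating by parts \<open>n\<close> times along
  \<open>R\<close>, where each factor \<open>S\<close> gained from the exponential compensates the zero of \<open>1 - cos (s S)\<close>, yields
  \<open>E[exp (itF) (2 - 2 cos (s S))\<^sup>n] = O(s\<^sup>3\<^sup>n t\<^sup>-\<^sup>n)\<close>.

  Expanding the power into cosines and integrating over \<open>z\<close> first, its constant term contributes
  a positive multiple of \<open>E[exp (itF)]\<close>, while all other terms are dominated by
  \<open>\<Lambda>(s) = E[exp (- s\<^sup>2 \<Gamma>(F,F) / 2)] = E[cos (s S)]\<close>. As \<open>\<Lambda>\<close> is nonnegative and decreasing, smoothness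
  of the density of \<open>S\<close> at the single point \<open>0\<close> forces rapid decay of \<open>\<Lambda>\<close>. With \<open>s = t\<^sup>1\<^sup>/\<^sup>6\<close>
  the characteristic function of \<open>F\<close> decays rapidly, and Fourier inversion gives the density.\<close>

section \<open>Real-valued \<open>L\<^sup>p\<close> functions\<close>

text \<open>The classical route to a density divides by \<Gamma>(F,F) and asks for its inverse
  moments. Nothing is divided here. The weight (2 - 2 cos (s S))^n vanishes to order 2n with S; each
  integration by parts uses up two powers of S, so n steps are paid for in advance. The weight is
  removed again because its constant Fourier coefficient, binom(2n,n), is at least 1. The main
  obstacle is integrability: powers of the generator control L^2 correlations only, whereas the
  product rule needs every derivative in every L^p. Bounds of order t^k for the k-th L^2 difference,
  for every k, combined with the moments of F, take the place of Meyer's inequalities. The factor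
  tan t has two sources: integrating out z gives sin t, the generator identity on slices gives cos
  t. Each extraction of S from the weight and each derivative of it costs a power of s, whence
  s^(3n) t^(-n); with n = 2m and s = t^(1/6) this is t^(-m), matched by decay of \<Lambda> of order
  6m. The noise G of the Bouleau derivative is arbitrary, but \<Lambda> depends on the gradient
  alone; this moves the information to the second Wiener copy, where the rotations live.\<close>

definition LL :: "'a measure \<Rightarrow> nat \<Rightarrow> ('a \<Rightarrow> real) set" where
  "LL M p = {f \<in> borel_measurable M. integrable M (\<lambda>x. \<bar>f x\<bar> ^ p)}"

text \<open>The exponent 0 is degenerate: \<open>root 0\<close> is 0, hence so is
  \<open>nrm M 0 f\<close>. Estimates that recover the integral from the norm therefore assume
  \<open>0 < p\<close>.\<close>

definition nrm :: "'a measure \<Rightarrow> nat \<Rightarrow> ('a \<Rightarrow> real) \<Rightarrow> real" where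
  "nrm M p f = root p (\<integral>x. \<bar>f x\<bar> ^ p \<partial>M)"

lemma LL_measurable [measurable_dest]: "f \<in> LL M p \<Longrightarrow> f \<in> borel_measurable M"
  by (simp add: LL_def)

lemma LL_integrable: "f \<in> LL M p \<Longrightarrow> integrable M (\<lambda>x. \<bar>f x\<bar> ^ p)"
  by (simp add: LL_def)

lemma LL_2_iff: "f \<in> LL M 2 \<longleftrightarrow> f \<in> borel_measurable M \<and> integrable M (\<lambda>x. (f x)\<^sup>2)"
  by (simp add: LL_def)

lemma LL_bound:
  assumes "f \<in> borel_measurable M" "integrable M h" "\<And>x. \<bar>f x\<bar> ^ p \<le> h x"
  shows "f \<in> LL M p"
proof -
  have [measurable]: "f \<in> borel_measurable M" by fact
  have "integrable M (\<lambda>x. \<bar>f x\<bar> ^ p)"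
    by (rule Bochner_Integration.integrable_bound[OF assms(2)])
       (use assms(3) in \<open>auto simp: power_abs intro!: AE_I2 order_trans[OF _ abs_ge_self]\<close>)
  then show ?thesis by (simp add: LL_def)
qed

lemma abs_add_power_le: "\<bar>a + b :: real\<bar> ^ p \<le> 2 ^ p * (\<bar>a\<bar> ^ p + \<bar>b\<bar> ^ p)"
proof -
  have "\<bar>a + b\<bar> ^ p \<le> (2 * max \<bar>a\<bar> \<bar>b\<bar>) ^ p"
    by (intro power_mono) (auto simp: max_def)
  also have "\<dots> = 2 ^ p * max \<bar>a\<bar> \<bar>b\<bar> ^ p" by (simp add: power_mult_distrib)
  also have "\<dots> \<le> 2 ^ p * (\<bar>a\<bar> ^ p + \<bar>b\<bar> ^ p)"
    by (intro mult_left_mono) (auto simp: max_def)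
  finally show ?thesis .
qed

lemma LL_add:
  assumes "f \<in> LL M p" "g \<in> LL M p"
  shows "(\<lambda>x. f x + g x) \<in> LL M p"
proof (rule LL_bound)
  show "integrable M (\<lambda>x. 2 ^ p * (\<bar>f x\<bar> ^ p + \<bar>g x\<bar> ^ p))"
    using assms by (auto simp: LL_def)
  show "(\<lambda>x. f x + g x) \<in> borel_measurable M"
    using assms by (auto simp: LL_def)
qed (rule abs_add_power_le)

lemma LL_cmult: "f \<in> LL M p \<Longrightarrow> (\<lambda>x. c * f x) \<in> LL M p"
  by (auto simp: LL_def abs_mult power_mult_distrib)

lemma LL_diff: "f \<in> LL M p \<Longrightarrow> g \<in> LL M p \<Longrightarrow> (\<lambda>x. f x - g x) \<in> LL M p"
  using LL_add[of f M p "\<lambda>x. (-1) * g x"] LL_cmult[of g M p "-1"] by simp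

lemma LL_divide: "f \<in> LL M p \<Longrightarrow> (\<lambda>x. f x / c) \<in> LL M p"
  using LL_cmult[of f M p "inverse c"] by (simp add: field_simps)

lemma nrm_nonneg: "0 \<le> nrm M p f"
proof (cases "p = 0")
  case True then show ?thesis by (simp add: nrm_def)
next
  case False then show ?thesis unfolding nrm_def
    by (intro real_root_ge_zero integral_nonneg_AE) auto
qed

lemma nrm_power: "0 < p \<Longrightarrow> nrm M p f ^ p = (\<integral>x. \<bar>f x\<bar> ^ p \<partial>M)"
  unfolding nrm_def by (intro real_root_pow_pos2 integral_nonneg_AE) auto

lemma nrm_le: "0 < p \<Longrightarrow> 0 \<le> c \<Longrightarrow> (\<integral>x. \<bar>f x\<bar> ^ p \<partial>M) \<le> c ^ p \<Longrightarrow> nrm M p f \<le> c"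
  by (metis nrm_power nrm_nonneg power_mono_iff)

lemma nrm_cmult: "0 < p \<Longrightarrow> nrm M p (\<lambda>x. c * f x) = \<bar>c\<bar> * nrm M p f"
  unfolding nrm_def by (simp add: abs_mult power_mult_distrib real_root_mult real_root_power_cancel)

lemma convex_real_power: "convex_on {0..} (\<lambda>x::real. x ^ n)"
proof (cases "even n")
  case True
  then show ?thesis using convex_power_even convex_on_subset by blast
qed (auto intro: convex_power_odd)

text \<open>Minkowski's inequality, from convexity of the p-th power at |f|/A and |g|/B with weights
  A/(A+B) and B/(A+B). Taking A and B strictly above the norms keeps the divisions legal when a norm
  vanishes; an epsilon closes the gap.\<close>

lemma nrm_add:
  assumes "0 < p" and f: "f \<in> LL M p" and g: "g \<in> LL M p"
  shows "nrm M p (\<lambda>x. f x + g x) \<le> nrm M p f + nrm M p g"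
proof -
  define a b where "a = nrm M p f" and "b = nrm M p g"
  have ab0: "0 \<le> a" "0 \<le> b" by (auto simp: a_def b_def nrm_nonneg)
  have *: "nrm M p (\<lambda>x. f x + g x) \<le> A + B" if A: "a < A" and B: "b < B" for A B
  proof (rule nrm_le)
    have pos: "A > 0" "B > 0" using that ab0 by auto
    show "0 \<le> A + B" using pos by simp
    have pt: "\<bar>f x + g x\<bar> ^ p \<le> (A + B) ^ p * (A / (A+B) * (\<bar>f x\<bar> / A) ^ p + B / (A+B) * (\<bar>g x\<bar> / B) ^ p)" for x
    proof -
      have "\<bar>f x + g x\<bar> ^ p \<le> (\<bar>f x\<bar> + \<bar>g x\<bar>) ^ p" by (intro power_mono) auto
      also have "\<bar>f x\<bar> + \<bar>g x\<bar> = (A + B) * (A / (A+B) * (\<bar>f x\<bar> / A) + B / (A+B) * (\<bar>g x\<bar> / B))"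
      proof -
        have "(A + B) * (c / (A + B) * u) = c * u" for c u using pos by simp
        then have "(A + B) * (A / (A+B) * (\<bar>f x\<bar> / A) + B / (A+B) * (\<bar>g x\<bar> / B))
            = A * (\<bar>f x\<bar> / A) + B * (\<bar>g x\<bar> / B)"
          by (simp only: distrib_left)
        then show ?thesis using pos by simp
      qed
      also have "\<dots> ^ p = (A + B) ^ p * (A / (A+B) * (\<bar>f x\<bar> / A) + B / (A+B) * (\<bar>g x\<bar> / B)) ^ p"
        by (simp add: power_mult_distrib)
      also have "\<dots> \<le> (A + B) ^ p * (A / (A+B) * (\<bar>f x\<bar> / A) ^ p + B / (A+B) * (\<bar>g x\<bar> / B) ^ p)"
      proof (intro mult_left_mono)
        have e: "1 - B / (A + B) = A / (A + B)" using pos by (simp add: field_simps)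
        show "(A / (A+B) * (\<bar>f x\<bar> / A) + B / (A+B) * (\<bar>g x\<bar> / B)) ^ p
            \<le> A / (A+B) * (\<bar>f x\<bar> / A) ^ p + B / (A+B) * (\<bar>g x\<bar> / B) ^ p"
          using convex_onD[OF convex_real_power[of p], of "B / (A+B)" "\<bar>f x\<bar> / A" "\<bar>g x\<bar> / B"] pos
          unfolding e by simp
      qed (use pos in auto)
      finally show ?thesis .
    qed
    have "(\<integral>x. \<bar>f x + g x\<bar> ^ p \<partial>M) \<le> (\<integral>x. (A + B) ^ p * (A / (A+B) * (\<bar>f x\<bar> / A) ^ p + B / (A+B) * (\<bar>g x\<bar> / B) ^ p) \<partial>M)"
      using LL_add[OF f g] f g
      by (intro integral_mono pt) (auto simp: LL_def power_divide)
    also have "\<dots> = (A + B) ^ p * (A / (A+B) * (a / A) ^ p + B / (A+B) * (b / B) ^ p)"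
      using f g by (simp add: LL_def power_divide a_def b_def nrm_power[OF \<open>0 < p\<close>])
    also have "\<dots> \<le> (A + B) ^ p * (A / (A+B) * 1 + B / (A+B) * 1)"
      using pos A B ab0 by (intro mult_left_mono add_mono power_le_one) auto
    also have "\<dots> = (A + B) ^ p" using pos by (simp add: add_divide_distrib[symmetric])
    finally show "(\<integral>x. \<bar>f x + g x\<bar> ^ p \<partial>M) \<le> (A + B) ^ p" .
  qed fact
  show ?thesis
  proof (rule field_le_epsilon)
    fix e :: real assume "e > 0"
    then show "nrm M p (\<lambda>x. f x + g x) \<le> nrm M p f + nrm M p g + e"
      using *[of "a + e/2" "b + e/2"] by (simp add: a_def b_def)
  qed
qed

lemma nrm_diff:
  assumes "0 < p" "f \<in> LL M p" "g \<in> LL M p"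
  shows "nrm M p (\<lambda>x. f x - g x) \<le> nrm M p f + nrm M p g"
  using nrm_add[OF assms(1,2) LL_cmult[OF assms(3), of "-1"]] nrm_cmult[OF assms(1), of M "-1" g] by simp

lemma nrm_triangle:
  assumes "0 < p" "f \<in> LL M p" "g \<in> LL M p" "h \<in> LL M p"
  shows "nrm M p (\<lambda>x. f x - h x) \<le> nrm M p (\<lambda>x. f x - g x) + nrm M p (\<lambda>x. g x - h x)"
  using nrm_add[OF assms(1) LL_diff[OF assms(2,3)] LL_diff[OF assms(3,4)]] by simp

lemma nrm_le_diff:
  assumes "0 < p" "f \<in> LL M p" "g \<in> LL M p"
  shows "nrm M p f \<le> nrm M p (\<lambda>x. f x - g x) + nrm M p g"
  using nrm_add[OF assms(1) LL_diff[OF assms(2,3)] assms(3)] by simp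

text \<open>Integrates 2 |u v| \<le> c u^2 + v^2 / c. The weight c = B/A, with A and B strictly
  above the two norms, gives the bound A B even when a norm is 0; then A and B tend to the
  norms.\<close>

lemma Cauchy_Schwarz_LL:
  assumes f: "f \<in> LL M 2" and g: "g \<in> LL M 2"
  shows "integrable M (\<lambda>x. f x * g x)" "\<bar>\<integral>x. f x * g x \<partial>M\<bar> \<le> nrm M 2 f * nrm M 2 g"
    "(\<integral>x. \<bar>f x * g x\<bar> \<partial>M) \<le> nrm M 2 f * nrm M 2 g"
proof -
  have [measurable]: "f \<in> borel_measurable M" "g \<in> borel_measurable M"
    using f g by (auto simp: LL_def)
  have i: "integrable M (\<lambda>x. (f x)\<^sup>2)" "integrable M (\<lambda>x. (g x)\<^sup>2)"
    using f g by (auto simp: LL_2_iff)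
  have am: "\<bar>u * v\<bar> \<le> (c * u\<^sup>2 + v\<^sup>2 / c) / 2" if "c > 0" for u v c :: real
  proof -
    have "0 \<le> (c * \<bar>u\<bar> - \<bar>v\<bar>)\<^sup>2 / c" using that by simp
    also have "\<dots> = c * u\<^sup>2 + v\<^sup>2 / c - 2 * (\<bar>u\<bar> * \<bar>v\<bar>)"
      using that by (simp add: field_simps power2_eq_square)
    finally show ?thesis by (simp add: abs_mult)
  qed
  show int: "integrable M (\<lambda>x. f x * g x)"
    by (rule Bochner_Integration.integrable_bound[where f="\<lambda>x. (1 * (f x)\<^sup>2 + (g x)\<^sup>2 / 1) / 2"])
       (use i am[of 1] in \<open>auto intro!: AE_I2 order_trans[OF _ abs_ge_self]\<close>)
  define a b where "a = nrm M 2 f" and "b = nrm M 2 g"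
  have ab: "(\<integral>x. (f x)\<^sup>2 \<partial>M) = a\<^sup>2" "(\<integral>x. (g x)\<^sup>2 \<partial>M) = b\<^sup>2" "0 \<le> a" "0 \<le> b"
    using nrm_power[of 2 M f] nrm_power[of 2 M g] by (auto simp: a_def b_def nrm_nonneg)
  have *: "(\<integral>x. \<bar>f x * g x\<bar> \<partial>M) \<le> A * B" if "a < A" "b < B" for A B
  proof -
    have pos: "A > 0" "B > 0" using that ab by auto
    have "(\<integral>x. \<bar>f x * g x\<bar> \<partial>M) \<le> (\<integral>x. ((B/A) * (f x)\<^sup>2 + (g x)\<^sup>2 / (B/A)) / 2 \<partial>M)"
      using i int pos by (intro integral_mono am) auto
    also have "\<dots> = ((B/A) * a\<^sup>2 + b\<^sup>2 / (B/A)) / 2" using i by (simp add: ab)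
    also have "\<dots> \<le> ((B/A) * A\<^sup>2 + B\<^sup>2 / (B/A)) / 2"
      using that ab pos by (intro divide_right_mono add_mono mult_left_mono power_mono) auto
    also have "\<dots> = A * B" using pos by (simp add: field_simps power2_eq_square)
    finally show ?thesis .
  qed
  show 2: "(\<integral>x. \<bar>f x * g x\<bar> \<partial>M) \<le> nrm M 2 f * nrm M 2 g"
  proof -
    have "((\<lambda>e. (a + e) * (b + e)) \<longlongrightarrow> (a + 0) * (b + 0)) (at_right 0)"
      by (intro tendsto_intros)
    moreover have "eventually (\<lambda>e. (\<integral>x. \<bar>f x * g x\<bar> \<partial>M) \<le> (a + e) * (b + e)) (at_right 0)"
      by (auto simp: eventually_at_right_field intro!: exI[of _ 1] *)
    ultimately have "(\<integral>x. \<bar>f x * g x\<bar> \<partial>M) \<le> (a + 0) * (b + 0)"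
      using tendsto_lowerbound by (metis trivial_limit_at_right_real)
    then show ?thesis by (simp add: a_def b_def)
  qed
  show "\<bar>\<integral>x. f x * g x \<partial>M\<bar> \<le> nrm M 2 f * nrm M 2 g"
    using integral_abs_bound[of M "\<lambda>x. f x * g x"] 2 by linarith
qed

lemma LL_mult:
  assumes f: "f \<in> LL M (2 * p)" and g: "g \<in> LL M (2 * p)"
  shows "(\<lambda>x. f x * g x) \<in> LL M p"
    and "(\<integral>x. \<bar>f x * g x\<bar> ^ p \<partial>M) \<le> sqrt (\<integral>x. \<bar>f x\<bar> ^ (2*p) \<partial>M) * sqrt (\<integral>x. \<bar>g x\<bar> ^ (2*p) \<partial>M)"
proof -
  have [measurable]: "f \<in> borel_measurable M" "g \<in> borel_measurable M"
    using f g by (auto simp: LL_def)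
  have e: "\<bar>\<bar>u\<bar> ^ p\<bar> ^ 2 = \<bar>u\<bar> ^ (2*p)" for u :: real by (simp add: power_mult[symmetric] mult.commute)
  have 1: "(\<lambda>x. \<bar>f x\<bar> ^ p) \<in> LL M 2" "(\<lambda>x. \<bar>g x\<bar> ^ p) \<in> LL M 2"
    using f g by (auto simp: LL_def power_mult[symmetric] mult.commute)
  note cs = Cauchy_Schwarz_LL[OF 1]
  show "(\<lambda>x. f x * g x) \<in> LL M p" using cs(1) by (simp add: LL_def abs_mult power_mult_distrib)
  show "(\<integral>x. \<bar>f x * g x\<bar> ^ p \<partial>M) \<le> sqrt (\<integral>x. \<bar>f x\<bar> ^ (2*p) \<partial>M) * sqrt (\<integral>x. \<bar>g x\<bar> ^ (2*p) \<partial>M)"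
    using cs(3) unfolding nrm_def e by (simp add: abs_mult power_mult_distrib sqrt_def)
qed

text \<open>Cauchy-Schwarz for the factorization |h|^p = |h| |h|^(p-1). It turns smallness in L^2
  into smallness in L^p once a higher moment is bounded, first for high differences and later for
  difference quotients.\<close>

lemma interpolation_2:
  assumes p: "1 \<le> p" and h: "h \<in> LL M 2" "h \<in> LL M (2 * p - 2)"
  shows "h \<in> LL M p" "(\<integral>x. \<bar>h x\<bar> ^ p \<partial>M) \<le> nrm M 2 h * sqrt (\<integral>x. \<bar>h x\<bar> ^ (2 * p - 2) \<partial>M)"
proof -
  have e: "\<bar>\<bar>u\<bar> ^ (p - 1)\<bar> ^ 2 = \<bar>u\<bar> ^ (2*p-2)" for u :: real
    by (simp add: power_mult[symmetric] mult.commute diff_mult_distrib2)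
  have 1: "(\<lambda>x. \<bar>h x\<bar> ^ (p - 1)) \<in> LL M 2"
    using h unfolding LL_def mem_Collect_eq e by auto
  have 2: "(\<lambda>x. \<bar>h x\<bar>) \<in> LL M 2" using h by (auto simp: LL_def)
  have e2: "\<bar>h x\<bar> * \<bar>h x\<bar> ^ (p - 1) = \<bar>h x\<bar> ^ p" for x
    using p by (metis power_eq_if not_one_le_zero)
  note cs = Cauchy_Schwarz_LL[OF 2 1, unfolded e2]
  show "h \<in> LL M p" using cs(1) h by (auto simp: LL_def)
  show "(\<integral>x. \<bar>h x\<bar> ^ p \<partial>M) \<le> nrm M 2 h * sqrt (\<integral>x. \<bar>h x\<bar> ^ (2 * p - 2) \<partial>M)"
    using cs(3) unfolding nrm_def e by (simp add: sqrt_def)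
qed

lemma (in prob_space) LL_const: "(\<lambda>x. c) \<in> LL M p"
  by (simp add: LL_def)

lemma (in prob_space) LL_mono:
  assumes "q \<le> p" "f \<in> LL M p" shows "f \<in> LL M q"
proof (rule LL_bound)
  show "integrable M (\<lambda>x. 1 + \<bar>f x\<bar> ^ p)" using assms by (auto simp: LL_def)
  show "f \<in> borel_measurable M" using assms by (auto simp: LL_def)
  fix x show "\<bar>f x\<bar> ^ q \<le> 1 + \<bar>f x\<bar> ^ p"
  proof (cases "\<bar>f x\<bar> \<le> 1")
    case True then show ?thesis by (smt (verit) power_le_one zero_le_power abs_ge_zero)
  next
    case False
    then have "\<bar>f x\<bar> ^ q \<le> \<bar>f x\<bar> ^ p" using assms(1) by (intro power_increasing) auto
    then show ?thesis by simp
  qed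
qed

text \<open>Lets moment bounds pass to an almost sure limit: once for the completeness of L^2, once
  to place a derivative in every L^p.\<close>

lemma Fatou_LL:
  assumes [measurable]: "\<And>n. f n \<in> borel_measurable M" "g \<in> borel_measurable M"
    and conv: "AE x in M. (\<lambda>n. f n x) \<longlonglongrightarrow> g x"
    and f: "\<And>n. f n \<in> LL M p" and b: "\<And>n. (\<integral>x. \<bar>f n x\<bar> ^ p \<partial>M) \<le> c"
  shows "g \<in> LL M p" "(\<integral>x. \<bar>g x\<bar> ^ p \<partial>M) \<le> c"
proof -
  have "0 \<le> (\<integral>x. \<bar>f 0 x\<bar> ^ p \<partial>M)" by (intro integral_nonneg_AE) auto
  then have c0: "0 \<le> c" using b[of 0] by linarith
  have "(\<integral>\<^sup>+x. ennreal (\<bar>g x\<bar> ^ p) \<partial>M) = (\<integral>\<^sup>+x. liminf (\<lambda>n. ennreal (\<bar>f n x\<bar> ^ p)) \<partial>M)"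
  proof (intro nn_integral_cong_AE)
    show "AE x in M. ennreal (\<bar>g x\<bar> ^ p) = liminf (\<lambda>n. ennreal (\<bar>f n x\<bar> ^ p))"
      using conv
    proof eventually_elim
      case (elim x)
      then have "(\<lambda>n. ennreal (\<bar>f n x\<bar> ^ p)) \<longlonglongrightarrow> ennreal (\<bar>g x\<bar> ^ p)"
        by (intro tendsto_intros)
      from lim_imp_Liminf[OF sequentially_bot this] show ?case by simp
    qed
  qed
  also have "\<dots> \<le> liminf (\<lambda>n. \<integral>\<^sup>+x. ennreal (\<bar>f n x\<bar> ^ p) \<partial>M)"
    by (rule nn_integral_liminf) auto
  also have "\<dots> = liminf (\<lambda>n. ennreal (\<integral>x. \<bar>f n x\<bar> ^ p \<partial>M))"
    using f by (intro arg_cong[where f=liminf] ext nn_integral_eq_integral) (auto simp: LL_def)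
  also have "\<dots> \<le> liminf (\<lambda>n. ennreal c)"
    by (intro Liminf_mono always_eventually allI ennreal_leI b)
  also have "\<dots> = ennreal c" by (simp add: Liminf_const)
  finally have le: "(\<integral>\<^sup>+x. ennreal (\<bar>g x\<bar> ^ p) \<partial>M) \<le> ennreal c" .
  have int: "integrable M (\<lambda>x. \<bar>g x\<bar> ^ p)"
    by (rule integrableI_nonneg) (use le in \<open>auto intro: le_less_trans\<close>)
  then show "g \<in> LL M p" by (auto simp: LL_def)
  show "(\<integral>x. \<bar>g x\<bar> ^ p \<partial>M) \<le> c"
    using le int c0 by (simp add: nn_integral_eq_integral)
qed

text \<open>Riesz-Fischer for functions instead of classes: a fast subsequence converges almost
  everywhere, its limit is the candidate, and Fatou's lemma bounds the distance of the whole
  sequence to it.\<close>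

lemma L2_complete:
  assumes f: "\<And>n. f n \<in> LL M 2"
    and Cauchy: "\<And>e. e > 0 \<Longrightarrow> \<exists>N. \<forall>m\<ge>N. \<forall>n\<ge>N. (\<integral>x. (f m x - f n x)\<^sup>2 \<partial>M) \<le> e"
  obtains g where "g \<in> LL M 2" "(\<lambda>n. \<integral>x. (f n x - g x)\<^sup>2 \<partial>M) \<longlonglongrightarrow> 0"
proof -
  have [measurable]: "\<And>n. f n \<in> borel_measurable M" using f by (auto simp: LL_def)
  have "\<forall>k. \<exists>N. \<forall>m\<ge>N. \<forall>n\<ge>N. (\<integral>x. (f m x - f n x)\<^sup>2 \<partial>M) \<le> (1/4)^k"
    using Cauchy by auto
  then obtain N0 where N0: "\<And>k m n. m \<ge> N0 k \<Longrightarrow> n \<ge> N0 k \<Longrightarrow> (\<integral>x. (f m x - f n x)\<^sup>2 \<partial>M) \<le> (1/4)^k"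
    by metis
  \<comment> \<open>Partial sums of \<open>N0\<close> are nondecreasing and dominate
    \<open>N0 k\<close>, so they can serve as indices of the fast subsequence.\<close>
  define r where "r k = (\<Sum>i\<le>k. N0 i)" for k
  have r: "r k \<ge> N0 k" for k unfolding r_def by (intro member_le_sum) auto
  have rm: "r k \<le> r (Suc k)" for k by (simp add: r_def)
  have rmono: "k \<le> l \<Longrightarrow> r k \<le> r l" for k l by (rule lift_Suc_mono_le[of r]) (use rm in auto)
  \<comment> \<open>The squared norms of the increments are at most 4^(-k), so the weights 2^k still
    leave a convergent sum. Pointwise, 2 |d| \<le> 2^(-k) + 2^k d^2 then yields absolute convergence
    without taking roots.\<close>
  define d where "d k x = f (r (Suc k)) x - f (r k) x" for k x
  have [measurable]: "\<And>k. d k \<in> borel_measurable M" unfolding d_def by measurable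
  have d2: "d k \<in> LL M 2" for k unfolding d_def by (intro LL_diff f)
  have dint: "(\<integral>x. (d k x)\<^sup>2 \<partial>M) \<le> (1/4)^k" for k
    unfolding d_def by (intro N0) (use r rm order_trans in blast)+
  have "(\<integral>\<^sup>+x. (\<Sum>k. ennreal (2^k * (d k x)\<^sup>2)) \<partial>M) = (\<Sum>k. \<integral>\<^sup>+x. ennreal (2^k * (d k x)\<^sup>2) \<partial>M)"
    by (rule nn_integral_suminf) auto
  also have "\<dots> \<le> (\<Sum>k. ennreal ((1/2)^k))"
  proof (intro suminf_le)
    fix k
    have "(\<integral>\<^sup>+x. ennreal (2^k * (d k x)\<^sup>2) \<partial>M) = ennreal (\<integral>x. 2^k * (d k x)\<^sup>2 \<partial>M)"
      using d2[of k] by (intro nn_integral_eq_integral) (auto simp: LL_2_iff)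
    also have "\<dots> \<le> ennreal (2^k * (1/4)^k)"
      using dint[of k] by (intro ennreal_leI) simp
    also have "(2::real)^k * (1/4)^k = (1/2)^k" by (simp add: power_mult_distrib[symmetric])
    finally show "(\<integral>\<^sup>+x. ennreal (2^k * (d k x)\<^sup>2) \<partial>M) \<le> ennreal ((1/2)^k)" .
  qed auto
  also have "\<dots> = ennreal 2"
    using geometric_sums[of "1/2::real"] by (intro suminf_ennreal_eq) auto
  finally have fin: "(\<integral>\<^sup>+x. (\<Sum>k. ennreal (2^k * (d k x)\<^sup>2)) \<partial>M) < \<infinity>"
    by (auto intro: le_less_trans)
  have "AE x in M. (\<Sum>k. ennreal (2^k * (d k x)\<^sup>2)) \<noteq> \<infinity>"
    by (rule nn_integral_PInf_AE) (use fin in auto)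
  then have ae: "AE x in M. convergent (\<lambda>k. f (r k) x)"
  proof eventually_elim
    case (elim x)
    have "summable (\<lambda>k. 2^k * (d k x)\<^sup>2)"
      by (rule summable_suminf_not_top) (use elim in auto)
    then have "summable (\<lambda>k. ((1/2)^k + 2^k * (d k x)\<^sup>2) / 2)"
      by (intro summable_divide summable_add summable_geometric) auto
    then have "summable (\<lambda>k. d k x)"
    proof (rule summable_comparison_test'[where N=0])
      fix k
      have "0 \<le> (1 - 2^k * \<bar>d k x\<bar>)\<^sup>2 / 2^k" by simp
      also have "\<dots> = (1/2)^k + 2^k * (d k x)\<^sup>2 - 2 * \<bar>d k x\<bar>"
        by (simp add: field_simps power2_eq_square)
      finally show "norm (d k x) \<le> ((1/2)^k + 2^k * (d k x)\<^sup>2) / 2" by simp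
    qed
    then have "convergent (\<lambda>n. \<Sum>k<n. d k x)" by (simp add: summable_iff_convergent)
    moreover have "(\<Sum>k<n. d k x) = f (r n) x - f (r 0) x" for n
      unfolding d_def by (rule sum_lessThan_telescope)
    ultimately have "convergent (\<lambda>n. f (r n) x - f (r 0) x)" by simp
    then have "convergent (\<lambda>n. f (r n) x - f (r 0) x + f (r 0) x)"
      by (intro convergent_add convergent_const)
    then show ?case by simp
  qed
  define g where "g x = lim (\<lambda>k. f (r k) x)" for x
  have [measurable]: "g \<in> borel_measurable M"
    unfolding g_def by (rule borel_measurable_lim_metric) simp
  have gl: "AE x in M. (\<lambda>k. f (r k) x) \<longlonglongrightarrow> g x"
    using ae by eventually_elim (simp add: g_def convergent_LIMSEQ_iff)
  have key: "(\<lambda>x. f n x - g x) \<in> LL M 2 \<and> (\<integral>x. (f n x - g x)\<^sup>2 \<partial>M) \<le> (1/4)^j" if "n \<ge> N0 j" for n j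
  proof -
    have 1: "AE x in M. (\<lambda>k. f n x - f (r (k + j)) x) \<longlonglongrightarrow> f n x - g x"
      using gl by eventually_elim (intro tendsto_intros LIMSEQ_ignore_initial_segment)
    have 2: "(\<lambda>x. f n x - f (r (k + j)) x) \<in> LL M 2" for k by (intro LL_diff f)
    have 3: "(\<integral>x. \<bar>f n x - f (r (k + j)) x\<bar>\<^sup>2 \<partial>M) \<le> (1/4)^j" for k
      using N0[of j n "r (k+j)"] that r[of j] rmono[of j "k+j"] by simp
    from Fatou_LL[OF _ _ 1 2 3] show ?thesis by simp
  qed
  have "(\<lambda>x. f (N0 0) x - (f (N0 0) x - g x)) \<in> LL M 2"
    by (rule LL_diff[OF f]) (use key[of 0 "N0 0"] in auto)
  then have "g \<in> LL M 2" by simp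
  moreover have "(\<lambda>n. \<integral>x. (f n x - g x)\<^sup>2 \<partial>M) \<longlonglongrightarrow> 0"
  proof (rule LIMSEQ_I)
    fix e :: real assume "e > 0"
    then obtain j where j: "(1/4)^j < e" using real_arch_pow_inv[of e "1/4"] by auto
    show "\<exists>no. \<forall>n\<ge>no. norm ((\<integral>x. (f n x - g x)\<^sup>2 \<partial>M) - 0) < e"
      by (intro exI[of _ "N0 j"] allI impI)
         (use key j in \<open>auto intro!: le_less_trans[of _ "(1/4)^j" e]\<close>)
  qed
  ultimately show ?thesis by (rule that)
qed

text \<open>The increment \<open>a\<close> is signed and may be 0, which spares every later use a
  case distinction on the order of the end points.\<close>

lemma mvt_segment:
  fixes f f' :: "real \<Rightarrow> real"
  assumes "\<And>u. \<bar>u - x\<bar> \<le> \<bar>a\<bar> \<Longrightarrow> (f has_real_derivative f' u) (at u)"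
  obtains u where "\<bar>u - x\<bar> \<le> \<bar>a\<bar>" "f (x + a) - f x = a * f' u"
proof (cases a "0::real" rule: linorder_cases)
  case less
  then obtain u where "x + a < u" "u < x" "f x - f (x + a) = (x - (x + a)) * f' u"
    using MVT2[of "x + a" x f f'] assms by (auto simp: abs_if)
  then show ?thesis using less by (intro that[of u]) (auto simp: algebra_simps)
next
  case equal
  then show ?thesis by (intro that[of x]) auto
next
  case greater
  then obtain u where "x < u" "u < x + a" "f (x + a) - f x = (x + a - x) * f' u"
    using MVT2[of x "x + a" f f'] assms by (auto simp: abs_if)
  then show ?thesis using greater by (intro that[of u]) auto
qed

text \<open>The mean value theorem twice: in the first increment for u \<mapsto> D(u+b) - D(u), then
  in the second. It will identify inner products of difference quotients with values of the second
  derivative of an autocorrelation, and bound iterated symmetric differences of a density.\<close>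

lemma second_difference:
  fixes D :: "nat \<Rightarrow> real \<Rightarrow> real"
  assumes D: "\<And>i u. \<bar>u\<bar> < r \<Longrightarrow> (D i has_real_derivative D (Suc i) u) (at u)"
    and r: "\<bar>x\<bar> + \<bar>a\<bar> + \<bar>b\<bar> < r"
  obtains u where "\<bar>u - x\<bar> \<le> \<bar>a\<bar> + \<bar>b\<bar>"
    "D i (x + a + b) - D i (x + a) - D i (x + b) + D i x = a * b * D (Suc (Suc i)) u"
proof -
  obtain v where v: "\<bar>v - x\<bar> \<le> \<bar>a\<bar>"
    "(D i ((x + a) + b) - D i (x + a)) - (D i (x + b) - D i x) = a * (D (Suc i) (v + b) - D (Suc i) v)"
  proof (rule mvt_segment[of x a "\<lambda>u. D i (u + b) - D i u" "\<lambda>u. D (Suc i) (u + b) - D (Suc i) u"])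
    fix u assume u: "\<bar>u - x\<bar> \<le> \<bar>a\<bar>"
    have "(D i has_real_derivative D (Suc i) (u + b)) (at (u + b))" "(D i has_real_derivative D (Suc i) u) (at u)"
      using u r by (auto intro!: D)
    then show "((\<lambda>u. D i (u + b) - D i u) has_real_derivative D (Suc i) (u + b) - D (Suc i) u) (at u)"
      by (intro DERIV_diff) (auto simp: DERIV_shift)
  qed
  obtain u where "\<bar>u - v\<bar> \<le> \<bar>b\<bar>" "D (Suc i) (v + b) - D (Suc i) v = b * D (Suc (Suc i)) u"
    by (rule mvt_segment[of v b "D (Suc i)" "D (Suc (Suc i))"]) (use v r in \<open>auto intro!: D\<close>)
  then show ?thesis using v by (intro that[of u]) (auto simp: algebra_simps)
qed

lemma tendsto_0_squeeze:
  fixes a b :: "'a \<Rightarrow> real"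
  assumes "(a \<longlongrightarrow> 0) F" "\<And>t. b t \<le> a t" "\<And>t. 0 \<le> b t"
  shows "(b \<longlongrightarrow> 0) F"
  by (rule Lim_null_comparison[OF _ assms(1)]) (use assms in auto)

lemma tendsto_inner:
  assumes f: "\<And>t. f t \<in> LL M 2" "f0 \<in> LL M 2" and g: "\<And>t. g t \<in> LL M 2" "g0 \<in> LL M 2"
    and cf: "((\<lambda>t. nrm M 2 (\<lambda>x. f t x - f0 x)) \<longlongrightarrow> 0) F"
    and cg: "((\<lambda>t. nrm M 2 (\<lambda>x. g t x - g0 x)) \<longlongrightarrow> 0) F"
  shows "((\<lambda>t. \<integral>x. f t x * g t x \<partial>M) \<longlongrightarrow> (\<integral>x. f0 x * g0 x \<partial>M)) F"
proof -
  let ?a = "\<lambda>t. nrm M 2 (\<lambda>x. f t x - f0 x)" and ?b = "\<lambda>t. nrm M 2 (\<lambda>x. g t x - g0 x)"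
  have "((\<lambda>t. (\<integral>x. f t x * g t x \<partial>M) - (\<integral>x. f0 x * g0 x \<partial>M)) \<longlongrightarrow> 0) F"
  proof (rule Lim_null_comparison)
    show "((\<lambda>t. ?a t * ?b t + ?a t * nrm M 2 g0 + nrm M 2 f0 * ?b t) \<longlongrightarrow> 0) F"
      by (rule tendsto_eq_intros cf cg refl)+ simp
    have "norm ((\<integral>x. f t x * g t x \<partial>M) - (\<integral>x. f0 x * g0 x \<partial>M)) \<le> ?a t * ?b t + ?a t * nrm M 2 g0 + nrm M 2 f0 * ?b t" for t
    proof -
      have d: "(\<lambda>x. f t x - f0 x) \<in> LL M 2" "(\<lambda>x. g t x - g0 x) \<in> LL M 2"
        using f g by (auto intro: LL_diff)
      have "(\<integral>x. f t x * g t x \<partial>M) = (\<integral>x. (f t x - f0 x) * (g t x - g0 x) + (f t x - f0 x) * g0 x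
          + f0 x * (g t x - g0 x) + f0 x * g0 x \<partial>M)"
        by (intro Bochner_Integration.integral_cong) (auto simp: algebra_simps)
      also have "\<dots> = (\<integral>x. (f t x - f0 x) * (g t x - g0 x) \<partial>M) + (\<integral>x. (f t x - f0 x) * g0 x \<partial>M)
          + (\<integral>x. f0 x * (g t x - g0 x) \<partial>M) + (\<integral>x. f0 x * g0 x \<partial>M)"
        using Cauchy_Schwarz_LL(1)[OF d] Cauchy_Schwarz_LL(1)[OF d(1) g(2)]
          Cauchy_Schwarz_LL(1)[OF f(2) d(2)] Cauchy_Schwarz_LL(1)[OF f(2) g(2)] by simp
      finally show ?thesis
        using Cauchy_Schwarz_LL(2)[OF d] Cauchy_Schwarz_LL(2)[OF d(1) g(2)] Cauchy_Schwarz_LL(2)[OF f(2) d(2)]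
        unfolding real_norm_def by linarith
    qed
    then show "\<forall>\<^sub>F t in F. norm ((\<integral>x. f t x * g t x \<partial>M) - (\<integral>x. f0 x * g0 x \<partial>M)) \<le> ?a t * ?b t + ?a t * nrm M 2 g0 + nrm M 2 f0 * ?b t"
      by simp
  qed
  then show ?thesis by (simp add: LIM_zero_iff)
qed

section \<open>Differentiation along a measure preserving flow\<close>

text \<open>Invariance makes composition with \<open>R t\<close> an isometry of every L^p, and the
  group law makes all differences commute. Everything in this part rests on these two facts;
  coordinates and Gaussian structure enter only with the rotations.\<close>

locale flow = prob_space M for M :: "'a measure" +
  fixes R :: "real \<Rightarrow> 'a \<Rightarrow> 'a"
  assumes R_measurable [measurable]: "R t \<in> M \<rightarrow>\<^sub>M M"
    and distr_R: "distr M M (R t) = M"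
    and R_add: "R s (R t x) = R (s + t) x"
    and R_0: "R 0 x = x"
begin

definition Dl :: "real \<Rightarrow> ('a \<Rightarrow> real) \<Rightarrow> 'a \<Rightarrow> real" where
  "Dl t f x = f (R t x) - f x"

text \<open>\<open>quot 0 f\<close> is 0 by the convention on division. Limits are taken at
  punctured 0, but bounds over all times include this value.\<close>

definition quot :: "real \<Rightarrow> ('a \<Rightarrow> real) \<Rightarrow> 'a \<Rightarrow> real" where
  "quot t f x = (f (R t x) - f x) / t"

lemma integral_R: "f \<in> borel_measurable M \<Longrightarrow> (\<integral>x. f (R t x) \<partial>M) = (\<integral>x. f x \<partial>M)" for f :: "'a \<Rightarrow> real"
  using integral_distr[of "R t" M M f] by (simp add: distr_R)

lemma integrable_R: "integrable M f \<Longrightarrow> integrable M (\<lambda>x. f (R t x))" for f :: "'a \<Rightarrow> real"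
  using integrable_distr[of "R t" M M f] by (simp add: distr_R)

lemma LL_R: "f \<in> LL M p \<Longrightarrow> (\<lambda>x. f (R t x)) \<in> LL M p"
  using integrable_R[of "\<lambda>x. \<bar>f x\<bar> ^ p"] by (auto simp: LL_def)

lemma nrm_R: "f \<in> LL M p \<Longrightarrow> nrm M p (\<lambda>x. f (R t x)) = nrm M p f"
  unfolding nrm_def by (subst integral_R[of "\<lambda>x. \<bar>f x\<bar> ^ p"]) (auto simp: LL_def)

lemma LL_Dl: "f \<in> LL M p \<Longrightarrow> Dl t f \<in> LL M p"
  unfolding Dl_def by (intro LL_diff LL_R)

lemma LL_quot: "f \<in> LL M p \<Longrightarrow> quot t f \<in> LL M p"
  unfolding quot_def by (intro LL_divide LL_diff LL_R)

lemma nrm_Dl: "0 < p \<Longrightarrow> f \<in> LL M p \<Longrightarrow> nrm M p (Dl t f) \<le> 2 * nrm M p f"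
  unfolding Dl_def using nrm_diff[of p "\<lambda>x. f (R t x)" M f] by (simp add: LL_R nrm_R)

lemma nrm_quot: "0 < p \<Longrightarrow> nrm M p (quot t f) = nrm M p (Dl t f) / \<bar>t\<bar>"
  using nrm_cmult[of p M "inverse t" "Dl t f"] unfolding quot_def Dl_def by (simp add: divide_inverse mult.commute)

lemma nrm_Dl_quot: "0 < p \<Longrightarrow> nrm M p (Dl t f) = \<bar>t\<bar> * nrm M p (quot t f)"
proof (cases "t = 0")
  case True
  assume "0 < p"
  then show ?thesis using True by (simp add: Dl_def[abs_def] R_0 nrm_def)
qed (simp add: nrm_quot)

lemma LL_Dl_pow: "f \<in> LL M p \<Longrightarrow> (Dl t ^^ k) f \<in> LL M p"
  by (induction k) (auto intro: LL_Dl)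

lemma nrm_Dl_pow: "0 < p \<Longrightarrow> f \<in> LL M p \<Longrightarrow> nrm M p ((Dl t ^^ k) f) \<le> 2 ^ k * nrm M p f"
proof (induction k)
  case (Suc k)
  then show ?case using nrm_Dl[of p "(Dl t ^^ k) f" t] LL_Dl_pow[of f p k t] by simp
qed simp

lemma Dl_pow_add: "(Dl t ^^ k) (\<lambda>x. f x + g x) = (\<lambda>x. (Dl t ^^ k) f x + (Dl t ^^ k) g x)"
  by (induction k) (auto simp: Dl_def fun_eq_iff)

lemma Dl_pow_cmult: "(Dl t ^^ k) (\<lambda>x. c * f x) = (\<lambda>x. c * (Dl t ^^ k) f x)"
  by (induction k) (auto simp: Dl_def fun_eq_iff algebra_simps)

text \<open>The increment over n steps telescopes into n copies of a single increment composed with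
  the flow, all of equal norm.\<close>

lemma nrm_Dl_of_nat:
  assumes "0 < p" "f \<in> LL M p"
  shows "nrm M p (Dl (real n * s) f) \<le> n * nrm M p (Dl s f)"
proof (induction n)
  case 0
  then show ?case using assms by (simp add: Dl_def[abs_def] R_0 nrm_def power_0_left)
next
  case (Suc n)
  have e: "Dl (real (Suc n) * s) f = (\<lambda>x. Dl (real n * s) f (R s x) + Dl s f x)"
    by (auto simp: Dl_def fun_eq_iff R_add algebra_simps)
  have "nrm M p (Dl (real (Suc n) * s) f) \<le> nrm M p (\<lambda>x. Dl (real n * s) f (R s x)) + nrm M p (Dl s f)"
    unfolding e by (intro nrm_add assms LL_R LL_Dl)
  also have "\<dots> \<le> Suc n * nrm M p (Dl s f)"
    using Suc assms by (simp add: nrm_R LL_Dl algebra_simps)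
  finally show ?case .
qed

text \<open>\<open>g\<close> is the strong L^2 derivative of \<open>f\<close> along the flow:
  \<open>f\<close> lies in the domain of the generator of the unitary group given by composition
  with \<open>R t\<close>. A relation is used because \<open>g\<close> is determined only up to null
  sets.\<close>

definition d2 :: "('a \<Rightarrow> real) \<Rightarrow> ('a \<Rightarrow> real) \<Rightarrow> bool" where
  "d2 f g \<longleftrightarrow> f \<in> LL M 2 \<and> g \<in> LL M 2 \<and> ((\<lambda>t. nrm M 2 (\<lambda>x. quot t f x - g x)) \<longlongrightarrow> 0) (at 0)"

lemma d2_LL: "d2 f g \<Longrightarrow> f \<in> LL M 2" "d2 f g \<Longrightarrow> g \<in> LL M 2"
  by (auto simp: d2_def)

text \<open>Cutting the time t into n+1 equal steps leaves |t| times the norm of a quotient of step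
  t/(n+1), which tends to the norm of \<open>g\<close>. The bound has no error term and holds for
  every t, so it can be iterated for higher differences.\<close>

lemma d2_nrm_Dl:
  assumes "d2 f g"
  shows "nrm M 2 (Dl t f) \<le> \<bar>t\<bar> * nrm M 2 g"
proof (cases "t = 0")
  case True then show ?thesis by (simp add: Dl_def[abs_def] R_0 nrm_def)
next
  case False
  note LL = d2_LL[OF assms]
  have lim: "filterlim (\<lambda>n. t / real (Suc n)) (at 0) sequentially"
    unfolding filterlim_at using False
    by (auto simp del: of_nat_Suc intro!: always_eventually LIMSEQ_Suc[OF lim_const_over_n])
  have "(\<lambda>n. \<bar>t\<bar> * (nrm M 2 (\<lambda>x. quot (t / real (Suc n)) f x - g x) + nrm M 2 g)) \<longlonglongrightarrow> \<bar>t\<bar> * (0 + nrm M 2 g)"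
    by (intro tendsto_intros filterlim_compose[OF _ lim]) (use assms in \<open>simp add: d2_def\<close>)
  moreover have "nrm M 2 (Dl t f) \<le> \<bar>t\<bar> * (nrm M 2 (\<lambda>x. quot (t / real (Suc n)) f x - g x) + nrm M 2 g)" for n
  proof -
    have "nrm M 2 (Dl t f) = nrm M 2 (Dl (real (Suc n) * (t / real (Suc n))) f)" by simp
    also have "\<dots> \<le> real (Suc n) * nrm M 2 (Dl (t / real (Suc n)) f)"
      by (rule nrm_Dl_of_nat) (use LL in auto)
    also have "\<dots> = \<bar>t\<bar> * nrm M 2 (quot (t / real (Suc n)) f)"
      by (subst nrm_Dl_quot) auto
    also have "\<dots> \<le> \<bar>t\<bar> * (nrm M 2 (\<lambda>x. quot (t / real (Suc n)) f x - g x) + nrm M 2 g)"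
      by (intro mult_left_mono nrm_le_diff LL_quot LL) auto
    finally show ?thesis .
  qed
  ultimately show ?thesis by (intro LIMSEQ_le_const) auto
qed

text \<open>By the group law \<open>Dl s\<close> commutes with difference quotients, and it at most
  doubles the norm of their error.\<close>

lemma d2_Dl:
  assumes "d2 f g" shows "d2 (Dl s f) (Dl s g)"
  unfolding d2_def
proof (intro conjI)
  note LL = d2_LL[OF assms]
  show "Dl s f \<in> LL M 2" "Dl s g \<in> LL M 2" using LL by (auto intro: LL_Dl)
  have "((\<lambda>t. 2 * nrm M 2 (\<lambda>x. quot t f x - g x)) \<longlongrightarrow> 2 * 0) (at 0)"
    using assms unfolding d2_def by (intro tendsto_intros) auto
  then have lim: "((\<lambda>t. 2 * nrm M 2 (\<lambda>x. quot t f x - g x)) \<longlongrightarrow> 0) (at 0)" by simp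
  have e: "(\<lambda>x. quot t (Dl s f) x - Dl s g x) = Dl s (\<lambda>x. quot t f x - g x)" for t
    by (auto simp: quot_def Dl_def fun_eq_iff R_add diff_divide_distrib add.commute)
  show "((\<lambda>t. nrm M 2 (\<lambda>x. quot t (Dl s f) x - Dl s g x)) \<longlongrightarrow> 0) (at 0)"
    unfolding e using LL
    by (intro tendsto_0_squeeze[OF lim] nrm_Dl nrm_nonneg) (auto intro: LL_diff LL_quot)
qed

lemma d2_unique:
  assumes "d2 f g" "d2 f g'" shows "AE x in M. g x = g' x"
proof -
  note LL = d2_LL[OF assms(1)] d2_LL[OF assms(2)]
  have "((\<lambda>t. nrm M 2 (\<lambda>x. quot t f x - g x) + nrm M 2 (\<lambda>x. quot t f x - g' x)) \<longlongrightarrow> 0 + 0) (at 0)"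
    using assms unfolding d2_def by (intro tendsto_intros) auto
  moreover have "nrm M 2 (\<lambda>x. g x - g' x) \<le> nrm M 2 (\<lambda>x. quot t f x - g x) + nrm M 2 (\<lambda>x. quot t f x - g' x)" for t
    using nrm_triangle[of 2 g M "quot t f" g'] LL LL_quot[of f 2 t]
      nrm_cmult[of 2 M "-1" "\<lambda>x. quot t f x - g x"] by simp
  ultimately have "nrm M 2 (\<lambda>x. g x - g' x) \<le> 0 + 0"
    by (intro tendsto_lowerbound[OF _ _ trivial_limit_at]) auto
  then have "nrm M 2 (\<lambda>x. g x - g' x) = 0" using nrm_nonneg[of M 2 "\<lambda>x. g x - g' x"] by simp
  then have "(\<integral>x. \<bar>g x - g' x\<bar> ^ 2 \<partial>M) = 0"
    using nrm_power[of 2 M "\<lambda>x. g x - g' x"] by simp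
  moreover have "integrable M (\<lambda>x. \<bar>g x - g' x\<bar> ^ 2)"
    by (intro LL_integrable LL_diff LL)
  ultimately have "AE x in M. \<bar>g x - g' x\<bar> ^ 2 = 0"
    by (subst (asm) integral_nonneg_eq_0_iff_AE) auto
  then show ?thesis by eventually_elim simp
qed

text \<open>The point is uniformity in t: applying \<open>d2_nrm_Dl\<close> to f m - f n and letting
  m grow bounds the quotient of f0 - f n by the norm of g n - g0 for all t \<noteq> 0 at once. One
  fixed good n then settles the limit in t.\<close>

lemma d2_closed:
  assumes d: "\<And>n. d2 (f n) (g n)" and LL: "f0 \<in> LL M 2" "g0 \<in> LL M 2"
    and cf: "(\<lambda>n. nrm M 2 (\<lambda>x. f n x - f0 x)) \<longlonglongrightarrow> 0"
    and cg: "(\<lambda>n. nrm M 2 (\<lambda>x. g n x - g0 x)) \<longlonglongrightarrow> 0"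
  shows "d2 f0 g0"
  unfolding d2_def
proof (intro conjI LL)
  note LLn = d2_LL[OF d]
  have dd: "d2 (\<lambda>x. f m x - f n x) (\<lambda>x. g m x - g n x)" for m n
    unfolding d2_def
  proof (intro conjI LL_diff LLn)
    have "((\<lambda>t. nrm M 2 (\<lambda>x. quot t (f m) x - g m x) + nrm M 2 (\<lambda>x. quot t (f n) x - g n x)) \<longlongrightarrow> 0 + 0) (at 0)"
      using d unfolding d2_def by (intro tendsto_intros) auto
    then have lim: "((\<lambda>t. nrm M 2 (\<lambda>x. quot t (f m) x - g m x) + nrm M 2 (\<lambda>x. quot t (f n) x - g n x)) \<longlongrightarrow> 0) (at 0)"
      by simp
    have e: "(\<lambda>x. quot t (\<lambda>x. f m x - f n x) x - (g m x - g n x)) = (\<lambda>x. (quot t (f m) x - g m x) - (quot t (f n) x - g n x))" for t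
      by (auto simp: quot_def fun_eq_iff diff_divide_distrib)
    show "((\<lambda>t. nrm M 2 (\<lambda>x. quot t (\<lambda>x. f m x - f n x) x - (g m x - g n x))) \<longlongrightarrow> 0) (at 0)"
      unfolding e by (intro tendsto_0_squeeze[OF lim] nrm_diff nrm_nonneg LL_diff LL_quot LLn) auto
  qed
  have b: "nrm M 2 (\<lambda>x. quot t f0 x - g0 x) \<le> nrm M 2 (\<lambda>x. quot t (f n) x - g n x) + 2 * nrm M 2 (\<lambda>x. g n x - g0 x)" if t: "t \<noteq> 0" for t n
  proof -
    have 1: "nrm M 2 (Dl t (\<lambda>x. f0 x - f n x)) \<le> \<bar>t\<bar> * nrm M 2 (\<lambda>x. g n x - g0 x)"
    proof -
      have "(\<lambda>m. 2 * nrm M 2 (\<lambda>x. f m x - f0 x) + \<bar>t\<bar> * (nrm M 2 (\<lambda>x. g n x - g0 x) + nrm M 2 (\<lambda>x. g m x - g0 x)))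
          \<longlonglongrightarrow> 2 * 0 + \<bar>t\<bar> * (nrm M 2 (\<lambda>x. g n x - g0 x) + 0)"
        by (intro tendsto_intros cf cg)
      moreover have "nrm M 2 (Dl t (\<lambda>x. f0 x - f n x)) \<le> 2 * nrm M 2 (\<lambda>x. f m x - f0 x) + \<bar>t\<bar> * (nrm M 2 (\<lambda>x. g n x - g0 x) + nrm M 2 (\<lambda>x. g m x - g0 x))" for m
      proof -
        have e: "Dl t (\<lambda>x. f0 x - f n x) = (\<lambda>x. Dl t (\<lambda>x. f m x - f n x) x - Dl t (\<lambda>x. f m x - f0 x) x)"
          by (auto simp: Dl_def fun_eq_iff)
        have "nrm M 2 (Dl t (\<lambda>x. f0 x - f n x)) \<le> nrm M 2 (Dl t (\<lambda>x. f m x - f n x)) + nrm M 2 (Dl t (\<lambda>x. f m x - f0 x))"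
          unfolding e by (intro nrm_diff LL_Dl LL_diff LLn LL) auto
        moreover have "nrm M 2 (Dl t (\<lambda>x. f m x - f0 x)) \<le> 2 * nrm M 2 (\<lambda>x. f m x - f0 x)"
          by (intro nrm_Dl LL_diff LLn LL) auto
        moreover have "nrm M 2 (Dl t (\<lambda>x. f m x - f n x)) \<le> \<bar>t\<bar> * nrm M 2 (\<lambda>x. g m x - g n x)"
          by (rule d2_nrm_Dl[OF dd])
        moreover have "nrm M 2 (\<lambda>x. g m x - g n x) \<le> nrm M 2 (\<lambda>x. g m x - g0 x) + nrm M 2 (\<lambda>x. g n x - g0 x)"
          using nrm_diff[of 2 "\<lambda>x. g m x - g0 x" M "\<lambda>x. g n x - g0 x"] LLn LL by (simp add: LL_diff)
        then have "\<bar>t\<bar> * nrm M 2 (\<lambda>x. g m x - g n x) \<le> \<bar>t\<bar> * (nrm M 2 (\<lambda>x. g n x - g0 x) + nrm M 2 (\<lambda>x. g m x - g0 x))"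
          by (intro mult_left_mono) auto
        ultimately show ?thesis by linarith
      qed
      ultimately show ?thesis by (intro LIMSEQ_le_const[where X = "\<lambda>m. 2 * nrm M 2 (\<lambda>x. f m x - f0 x) + \<bar>t\<bar> * (nrm M 2 (\<lambda>x. g n x - g0 x) + nrm M 2 (\<lambda>x. g m x - g0 x))"]) auto
    qed
    have 2: "nrm M 2 (quot t (\<lambda>x. f0 x - f n x)) \<le> nrm M 2 (\<lambda>x. g n x - g0 x)"
      using 1 t by (subst nrm_quot) (auto simp: divide_le_eq mult.commute)
    have e: "(\<lambda>x. quot t f0 x - g0 x) = (\<lambda>x. quot t (\<lambda>x. f0 x - f n x) x + ((quot t (f n) x - g n x) + (g n x - g0 x)))"
      by (auto simp: quot_def fun_eq_iff diff_divide_distrib)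
    have "nrm M 2 (\<lambda>x. quot t f0 x - g0 x) \<le> nrm M 2 (quot t (\<lambda>x. f0 x - f n x)) + nrm M 2 (\<lambda>x. (quot t (f n) x - g n x) + (g n x - g0 x))"
      unfolding e by (intro nrm_add LL_add LL_diff LL_quot LL LLn) auto
    also have "nrm M 2 (\<lambda>x. (quot t (f n) x - g n x) + (g n x - g0 x)) \<le> nrm M 2 (\<lambda>x. quot t (f n) x - g n x) + nrm M 2 (\<lambda>x. g n x - g0 x)"
      by (intro nrm_add LL_add LL_diff LL_quot LL LLn) auto
    finally show ?thesis using 2 by simp
  qed
  show "((\<lambda>t. nrm M 2 (\<lambda>x. quot t f0 x - g0 x)) \<longlongrightarrow> 0) (at 0)"
  proof (rule tendstoI)
    fix e :: real assume "e > 0"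
    then have "\<forall>\<^sub>F n in sequentially. nrm M 2 (\<lambda>x. g n x - g0 x) < e / 4"
      using cg by (intro order_tendstoD) auto
    then obtain n where n: "nrm M 2 (\<lambda>x. g n x - g0 x) < e / 4"
      using eventually_happens'[OF sequentially_bot] by blast
    have "\<forall>\<^sub>F t in at 0. nrm M 2 (\<lambda>x. quot t (f n) x - g n x) < e / 4"
      using d[of n] \<open>e > 0\<close> unfolding d2_def by (intro order_tendstoD(2)[where y=0]) auto
    moreover have "\<forall>\<^sub>F t in at 0. t \<noteq> (0::real)" by (simp add: eventually_at_filter)
    ultimately show "\<forall>\<^sub>F t in at 0. dist (nrm M 2 (\<lambda>x. quot t f0 x - g0 x)) 0 < e"
    proof eventually_elim
      case (elim t)
      then show ?case using b[of t n] n nrm_nonneg[of M 2 "\<lambda>x. quot t f0 x - g0 x"] by (simp add: dist_real_def)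
    qed
  qed
qed

lemma d2_inner:
  assumes "d2 f g" "h \<in> LL M 2"
  shows "((\<lambda>t. \<integral>x. h x * quot t f x \<partial>M) \<longlongrightarrow> (\<integral>x. h x * g x \<partial>M)) (at 0)"
  by (rule tendsto_inner) (use assms in \<open>auto simp: d2_def nrm_def intro: LL_quot\<close>)

end

section \<open>Marchaud's inequality and its iteration over dyadic scales\<close>

text \<open>Doubling t multiplies t^(3/2) by 2 sqrt 2 \<le> 3, which is below 2^j when j \<ge> 2, so
  the bound reproduces itself from scale 2t to scale t. In K = 4 A + C the part 4 A covers t \<ge>
  1/2, where t sqrt t \<ge> 1/4, and C absorbs the inhomogeneous term: 3 K + C \<le> 4 K.\<close>

lemma marchaud_iterate_ge2:
  fixes a :: "real \<Rightarrow> real"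
  assumes j: "2 \<le> j" and bdd: "\<And>t. a t \<le> A" and C: "0 \<le> C"
    and rec: "\<And>t. 0 < t \<Longrightarrow> t \<le> 1 \<Longrightarrow> 2 ^ j * a t \<le> a (2 * t) + C * (t * sqrt t)"
    and nonneg: "\<And>t. 0 \<le> a t"
  obtains K where "0 \<le> K" "\<And>t. 0 < t \<Longrightarrow> t \<le> 1 \<Longrightarrow> a t \<le> K * (t * sqrt t)"
proof -
  define K where "K = 4 * A + C"
  have A: "0 \<le> A" using bdd nonneg order_trans by blast
  have K0: "0 \<le> K" using A C by (simp add: K_def)
  have sq2: "sqrt 2 \<le> 3/2" by (rule real_le_lsqrt) (auto simp: power2_eq_square)
  have *: "a t \<le> K * (t * sqrt t)" if "0 < t" "t \<le> 1" "1 \<le> 2 ^ n * t" for n t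
    using that
  proof (induction n arbitrary: t)
    case 0
    then have "t = 1" by simp
    then show ?case using bdd[of 1] A C by (simp add: K_def)
  next
    case (Suc n)
    show ?case
    proof (cases "t \<le> 1/2")
      case True
      have ih: "a (2 * t) \<le> K * (2 * t * sqrt (2 * t))"
        using Suc.prems True by (intro Suc.IH) (auto simp: mult.assoc mult.left_commute)
      have "4 * a t \<le> 2 ^ j * a t"
        using nonneg[of t] power_increasing[OF j, of "2::real"] by (intro mult_right_mono) auto
      also have "\<dots> \<le> K * (2 * t * sqrt (2 * t)) + C * (t * sqrt t)"
        using rec[of t] Suc.prems ih by linarith
      also have "K * (2 * t * sqrt (2 * t)) = sqrt 2 * (2 * K * (t * sqrt t))"
        by (simp add: real_sqrt_mult)
      also have "\<dots> \<le> 3/2 * (2 * K * (t * sqrt t))"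
        using sq2 K0 Suc.prems by (intro mult_right_mono) auto
      also have "C * (t * sqrt t) \<le> K * (t * sqrt t)"
        using A Suc.prems by (intro mult_right_mono) (auto simp: K_def)
      finally show ?thesis by simp
    next
      case False
      have "1/4 \<le> t * sqrt t"
      proof -
        have "1/2 \<le> sqrt t" by (rule real_le_rsqrt) (use False in \<open>auto simp: power2_eq_square\<close>)
        then have "1/2 * (1/2) \<le> t * sqrt t" using False by (intro mult_mono) auto
        then show ?thesis by simp
      qed
      then have "K * (1/4) \<le> K * (t * sqrt t)" using K0 by (intro mult_left_mono)
      then show ?thesis using bdd[of t] C by (simp add: K_def)
    qed
  qed
  have "a t \<le> K * (t * sqrt t)" if "0 < t" "t \<le> 1" for t
  proof -
    obtain n where "1 / t < 2 ^ n" using real_arch_pow[of 2 "1/t"] by auto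
    then show ?thesis using that by (intro *[of t n]) (auto simp: field_simps)
  qed
  then show ?thesis using K0 by (intro that) auto
qed

text \<open>At order one the factor 2 is exactly consumed by doubling t, so plain induction would
  add a constant at every scale. The sharper claim t (K - K' sqrt t) leaves room: passing from 2t to
  t gains (2 sqrt 2 - 2) K' t^(3/2), which exceeds C t^(3/2) for K' = 3 C. The value K = 2 A + K'
  starts the induction on [1/2, 1].\<close>

lemma marchaud_iterate_1:
  fixes a :: "real \<Rightarrow> real"
  assumes bdd: "\<And>t. a t \<le> A" and C: "0 \<le> C"
    and rec: "\<And>t. 0 < t \<Longrightarrow> t \<le> 1 \<Longrightarrow> 2 * a t \<le> a (2 * t) + C * (t * sqrt t)"
    and nonneg: "\<And>t. 0 \<le> a t"
  obtains K where "0 \<le> K" "\<And>t. 0 < t \<Longrightarrow> t \<le> 1 \<Longrightarrow> a t \<le> K * t"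
proof -
  define K' where "K' = 3 * C"
  define K where "K = 2 * A + K'"
  have A: "0 \<le> A" using bdd nonneg order_trans by blast
  have K0: "0 \<le> K" "0 \<le> K'" using A C by (simp_all add: K_def K'_def)
  have sq2: "4/3 \<le> sqrt 2" by (rule real_le_rsqrt) (auto simp: power2_eq_square)
  have *: "a t \<le> t * (K - K' * sqrt t)" if "0 < t" "t \<le> 1" "1 \<le> 2 ^ n * t" for n t
    using that
  proof (induction n arbitrary: t)
    case 0
    then have "t = 1" by simp
    then show ?case using bdd[of 1] A C by (simp add: K_def)
  next
    case (Suc n)
    show ?case
    proof (cases "t \<le> 1/2")
      case True
      have ih: "a (2 * t) \<le> 2 * t * (K - K' * sqrt (2 * t))"
        using Suc.prems True by (intro Suc.IH) (auto simp: mult.assoc mult.left_commute)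
      have 1: "4/3 * (2 * (K' * (t * sqrt t))) \<le> sqrt 2 * (2 * (K' * (t * sqrt t)))"
        using sq2 K0 Suc.prems by (intro mult_right_mono) auto
      have 2: "C * (t * sqrt t) = K' * (t * sqrt t) / 3" by (simp add: K'_def)
      have "2 * t * (K - K' * sqrt (2 * t)) = 2 * (t * K) - sqrt 2 * (2 * (K' * (t * sqrt t)))"
        by (simp add: real_sqrt_mult algebra_simps)
      then have "2 * a t \<le> 2 * (t * K) - sqrt 2 * (2 * (K' * (t * sqrt t))) + K' * (t * sqrt t) / 3"
        using rec[of t] Suc.prems ih unfolding 2 by linarith
      moreover have "0 \<le> K' * (t * sqrt t)" using K0 Suc.prems by simp
      ultimately have "2 * a t \<le> 2 * (t * K) - 2 * (K' * (t * sqrt t))"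
        using 1 by linarith
      then show ?thesis by (simp add: algebra_simps)
    next
      case False
      have "K' * sqrt t \<le> K'" using K0 Suc.prems by (simp add: mult_left_le)
      then have 3: "2 * A \<le> K - K' * sqrt t" by (simp add: K_def)
      have "a t \<le> 1/2 * (2 * A)" using bdd[of t] by simp
      also have "\<dots> \<le> t * (K - K' * sqrt t)" using 3 False A by (intro mult_mono) auto
      finally show ?thesis .
    qed
  qed
  have "a t \<le> K * t" if "0 < t" "t \<le> 1" for t
  proof -
    obtain n where "1 / t < 2 ^ n" using real_arch_pow[of 2 "1/t"] by auto
    then have "a t \<le> t * (K - K' * sqrt t)" using that by (intro *[of t n]) (auto simp: field_simps)
    also have "\<dots> \<le> t * K" using that K0 by (intro mult_left_mono) auto
    finally show ?thesis by (simp add: mult.commute)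
  qed
  then show ?thesis using K0 by (intro that) auto
qed

context flow
begin

text \<open>In terms of the shift T by t, (T^2 - 1)^j - 2^j (T - 1)^j is divisible by (T - 1)^(j+1),
  and shifts are isometries. The constant depends on neither \<open>h\<close> nor \<open>t\<close>,
  which is what the dyadic iteration requires.\<close>

lemma marchaud:
  assumes p: "0 < p"
  shows "\<exists>c\<ge>0. \<forall>h t. h \<in> LL M p \<longrightarrow>
    2 ^ j * nrm M p ((Dl t ^^ j) h) \<le> nrm M p ((Dl (2 * t) ^^ j) h) + c * nrm M p ((Dl t ^^ Suc j) h)"
proof -
  have "\<exists>c\<ge>0. \<forall>h t. h \<in> LL M p \<longrightarrow>
    nrm M p (\<lambda>x. (Dl (2 * t) ^^ j) h x - 2 ^ j * (Dl t ^^ j) h x) \<le> c * nrm M p ((Dl t ^^ Suc j) h)"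
  proof (induction j)
    case 0
    show ?case by (rule exI[of _ 0]) (use p in \<open>auto simp: nrm_def power_0_left\<close>)
  next
    case (Suc j)
    then obtain c where c: "0 \<le> c" "\<And>h t. h \<in> LL M p \<Longrightarrow>
      nrm M p (\<lambda>x. (Dl (2 * t) ^^ j) h x - 2 ^ j * (Dl t ^^ j) h x) \<le> c * nrm M p ((Dl t ^^ Suc j) h)"
      by blast
    have "nrm M p (\<lambda>x. (Dl (2 * t) ^^ Suc j) h x - 2 ^ Suc j * (Dl t ^^ Suc j) h x)
        \<le> (4 * c + 2 ^ j) * nrm M p ((Dl t ^^ Suc (Suc j)) h)" if h: "h \<in> LL M p" for h t
    proof -
      \<comment> \<open>With D the difference of step t, the difference of step 2t is D^2 + 2 D. The
        induction hypothesis is applied to \<open>k\<close>; its error involves D^(j+3) h + 2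
        D^(j+2) h, of norm at most four times that of D^(j+2) h, and a remainder 2^j D^(j+2) h is
        left. Hence the new constant 4 c + 2^j.\<close>
      define k where "k = (\<lambda>x. Dl t (Dl t h) x + 2 * Dl t h x)"
      have k: "Dl (2 * t) h = k"
        by (auto simp: k_def Dl_def fun_eq_iff R_add)
      have kLL: "k \<in> LL M p" unfolding k_def by (intro LL_add LL_cmult LL_Dl h)
      have pow: "(Dl t ^^ i) k = (\<lambda>x. (Dl t ^^ Suc (Suc i)) h x + 2 * (Dl t ^^ Suc i) h x)" for i
        unfolding k_def Dl_pow_add Dl_pow_cmult by (simp add: funpow_swap1)
      have s1: "(Dl (2 * t) ^^ Suc j) h = (Dl (2 * t) ^^ j) k"
        by (simp add: funpow_Suc_right k del: funpow.simps)
      have e: "(\<lambda>x. (Dl (2 * t) ^^ Suc j) h x - 2 ^ Suc j * (Dl t ^^ Suc j) h x)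
        = (\<lambda>x. ((Dl (2 * t) ^^ j) k x - 2 ^ j * (Dl t ^^ j) k x) + 2 ^ j * (Dl t ^^ Suc (Suc j)) h x)"
        unfolding s1 pow by (simp add: fun_eq_iff algebra_simps del: funpow.simps)
      have "nrm M p (\<lambda>x. (Dl (2 * t) ^^ Suc j) h x - 2 ^ Suc j * (Dl t ^^ Suc j) h x)
         \<le> nrm M p (\<lambda>x. (Dl (2 * t) ^^ j) k x - 2 ^ j * (Dl t ^^ j) k x) + nrm M p (\<lambda>x. 2 ^ j * (Dl t ^^ Suc (Suc j)) h x)"
        unfolding e by (intro nrm_add LL_diff LL_cmult LL_Dl_pow kLL h p)
      also have "\<dots> \<le> c * nrm M p ((Dl t ^^ Suc j) k) + 2 ^ j * nrm M p ((Dl t ^^ Suc (Suc j)) h)"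
        using c(2)[OF kLL, of t] by (simp add: nrm_cmult p del: funpow.simps)
      finally have 1: "nrm M p (\<lambda>x. (Dl (2 * t) ^^ Suc j) h x - 2 ^ Suc j * (Dl t ^^ Suc j) h x)
         \<le> c * nrm M p ((Dl t ^^ Suc j) k) + 2 ^ j * nrm M p ((Dl t ^^ Suc (Suc j)) h)" .
      have "nrm M p ((Dl t ^^ Suc j) k) \<le> 4 * nrm M p ((Dl t ^^ Suc (Suc j)) h)"
      proof -
        have "nrm M p ((Dl t ^^ Suc j) k) \<le> nrm M p ((Dl t ^^ Suc (Suc (Suc j))) h) + nrm M p (\<lambda>x. 2 * (Dl t ^^ Suc (Suc j)) h x)"
          unfolding pow by (intro nrm_add LL_cmult LL_Dl_pow h p)
        moreover have "nrm M p ((Dl t ^^ Suc (Suc (Suc j))) h) \<le> 2 * nrm M p ((Dl t ^^ Suc (Suc j)) h)"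
          unfolding funpow.simps(2)[of "Suc (Suc j)"] o_apply by (intro nrm_Dl LL_Dl_pow h p)
        ultimately show ?thesis by (simp add: nrm_cmult p del: funpow.simps)
      qed
      then have "c * nrm M p ((Dl t ^^ Suc j) k) \<le> c * (4 * nrm M p ((Dl t ^^ Suc (Suc j)) h))"
        using c(1) by (intro mult_left_mono)
      then show ?thesis using 1 by (simp add: algebra_simps del: funpow.simps)
    qed
    then show ?case using c(1) by (intro exI[of _ "4 * c + 2 ^ j"]) (auto simp del: funpow.simps)
  qed
  then obtain c where c: "0 \<le> c" "\<And>h t. h \<in> LL M p \<Longrightarrow>
      nrm M p (\<lambda>x. (Dl (2 * t) ^^ j) h x - 2 ^ j * (Dl t ^^ j) h x) \<le> c * nrm M p ((Dl t ^^ Suc j) h)"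
    by blast
  have "2 ^ j * nrm M p ((Dl t ^^ j) h) \<le> nrm M p ((Dl (2 * t) ^^ j) h) + c * nrm M p ((Dl t ^^ Suc j) h)"
    if h: "h \<in> LL M p" for h t
  proof -
    have e: "(\<lambda>x. 2 ^ j * (Dl t ^^ j) h x) = (\<lambda>x. (Dl (2 * t) ^^ j) h x - ((Dl (2 * t) ^^ j) h x - 2 ^ j * (Dl t ^^ j) h x))"
      by simp
    have "nrm M p (\<lambda>x. 2 ^ j * (Dl t ^^ j) h x) \<le> nrm M p ((Dl (2 * t) ^^ j) h) + nrm M p (\<lambda>x. (Dl (2 * t) ^^ j) h x - 2 ^ j * (Dl t ^^ j) h x)"
      by (subst e) (intro nrm_diff LL_diff LL_cmult LL_Dl_pow h p)
    then show ?thesis using c(2)[OF h, of t] by (simp add: nrm_cmult p del: funpow.simps)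
  qed
  then show ?thesis using c(1) by blast
qed

lemma nrm_minus_t: "f \<in> LL M p \<Longrightarrow> nrm M p (Dl (- t) f) = nrm M p (Dl t f)"
proof -
  assume f: "f \<in> LL M p"
  have "nrm M p (Dl t f) = nrm M p (\<lambda>x. Dl t f (R (- t) x))"
    by (rule nrm_R[symmetric]) (intro LL_Dl f)
  also have "\<dots> = nrm M p (Dl (- t) f)"
    unfolding nrm_def by (simp add: Dl_def R_add R_0 abs_minus_commute)
  finally show ?thesis by simp
qed

text \<open>Interpolation between an \<open>L\<^sup>2\<close> estimate of high order and the bare integrability of \<open>f\<close>
  gives order \<open>3/2\<close> for a high difference in \<open>L\<^sup>p\<close>; Marchaud's inequality brings this down to
  the first difference.\<close>

lemma Lp_Lipschitz:
  assumes f: "\<And>p. f \<in> LL M p"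
    and L2: "\<And>k. \<exists>C. \<forall>t. nrm M 2 ((Dl t ^^ k) f) \<le> C * \<bar>t\<bar> ^ k"
    and p: "2 \<le> p"
  obtains K where "0 \<le> K" "\<And>t. \<bar>t\<bar> \<le> 1 \<Longrightarrow> nrm M p (Dl t f) \<le> K * \<bar>t\<bar>"
proof -
  let ?P = "\<lambda>j. \<exists>K\<ge>0. \<forall>t. 0 < t \<longrightarrow> t \<le> 1 \<longrightarrow> nrm M p ((Dl t ^^ j) f) \<le> K * (t * sqrt t)"
  have p0: "0 < p" using p by simp
  \<comment> \<open>Order 2p is chosen because the L^2 bound t^(2p) controls the p-th moment, whose
    p-th root leaves t^2, better than the required t^(3/2).\<close>
  have top: "?P (2 * p)"
  proof -
    obtain C where C: "\<And>t. nrm M 2 ((Dl t ^^ (2 * p)) f) \<le> C * \<bar>t\<bar> ^ (2 * p)" using L2 by blast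
    have C0: "0 \<le> C" using order_trans[OF nrm_nonneg C[of 1]] by simp
    define B where "B = sqrt ((2 ^ (2 * p) * nrm M (2 * p - 2) f) ^ (2 * p - 2))"
    have B0: "0 \<le> B" by (simp add: B_def nrm_nonneg)
    \<comment> \<open>The maximum with 1 ensures K \<le> K^p, so the constant can be drawn under the
      p-th root.\<close>
    define K where "K = max 1 (C * B)"
    have "nrm M p ((Dl t ^^ (2 * p)) f) \<le> K * (t * sqrt t)" if t: "0 < t" "t \<le> 1" for t
    proof -
      let ?h = "(Dl t ^^ (2 * p)) f"
      have b: "(\<integral>x. \<bar>?h x\<bar> ^ (2 * p - 2) \<partial>M) \<le> (2 ^ (2 * p) * nrm M (2 * p - 2) f) ^ (2 * p - 2)"
        using p by (subst nrm_power[symmetric]) (auto intro!: power_mono nrm_Dl_pow f nrm_nonneg)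
      have "(\<integral>x. \<bar>?h x\<bar> ^ p \<partial>M) \<le> nrm M 2 ?h * sqrt (\<integral>x. \<bar>?h x\<bar> ^ (2 * p - 2) \<partial>M)"
        by (rule interpolation_2) (use p in \<open>auto intro: LL_Dl_pow f\<close>)
      also have "\<dots> \<le> (C * \<bar>t\<bar> ^ (2 * p)) * B"
        unfolding B_def using b C[of t] C0 by (intro mult_mono real_sqrt_le_mono) auto
      also have "\<dots> \<le> K * t ^ (2 * p)"
        using t by (auto simp: K_def mult_ac intro!: mult_left_mono)
      also have "\<dots> \<le> K ^ p * t ^ (2 * p)"
        using t p self_le_power[of K p] by (intro mult_right_mono) (auto simp: K_def)
      also have "\<dots> = (K * t\<^sup>2) ^ p" by (simp add: power_mult_distrib power_mult)
      finally have "nrm M p ?h \<le> K * t\<^sup>2"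
        by (intro nrm_le) (auto simp: p0 K_def)
      also have "t\<^sup>2 \<le> t * sqrt t"
        using t by (auto simp: power2_eq_square intro!: mult_left_mono real_le_rsqrt mult_left_le)
      finally show ?thesis by (simp add: K_def mult_left_mono)
    qed
    moreover have "0 \<le> K" by (simp add: K_def)
    ultimately show ?thesis by blast
  qed
  \<comment> \<open>Downward induction on the order: the exponent 3/2 survives each step as long as
    it stays below the order, hence exactly until order 2.\<close>
  have P2: "?P 2"
  proof (rule inc_induct[of 2 "2 * p"])
    show "2 \<le> 2 * p" using p by simp
    show "?P (2 * p)" by (rule top)
    fix j assume j: "2 \<le> j" "j < 2 * p" and "?P (Suc j)"
    then obtain K where K: "0 \<le> K" "\<And>t. 0 < t \<Longrightarrow> t \<le> 1 \<Longrightarrow> nrm M p ((Dl t ^^ Suc j) f) \<le> K * (t * sqrt t)"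
      by blast
    obtain c where c: "0 \<le> c" "\<And>t. 2 ^ j * nrm M p ((Dl t ^^ j) f) \<le> nrm M p ((Dl (2 * t) ^^ j) f) + c * nrm M p ((Dl t ^^ Suc j) f)"
      using marchaud[OF p0, of j] f by blast
    obtain K' where "0 \<le> K'" "\<And>t. 0 < t \<Longrightarrow> t \<le> 1 \<Longrightarrow> nrm M p ((Dl t ^^ j) f) \<le> K' * (t * sqrt t)"
    proof (rule marchaud_iterate_ge2[OF j(1), of "\<lambda>t. nrm M p ((Dl t ^^ j) f)" "2 ^ j * nrm M p f" "c * K"])
      fix t :: real assume t: "0 < t" "t \<le> 1"
      have "c * nrm M p ((Dl t ^^ Suc j) f) \<le> c * (K * (t * sqrt t))"
        using K t c by (intro mult_left_mono) auto
      then show "2 ^ j * nrm M p ((Dl t ^^ j) f) \<le> nrm M p ((Dl (2 * t) ^^ j) f) + c * K * (t * sqrt t)"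
        using c(2)[of t] by (simp add: mult.assoc)
    qed (use c K in \<open>auto intro: nrm_Dl_pow p0 f nrm_nonneg\<close>)
    then show "?P j" by blast
  qed
  then obtain K where K: "0 \<le> K" "\<And>t. 0 < t \<Longrightarrow> t \<le> 1 \<Longrightarrow> nrm M p ((Dl t ^^ 2) f) \<le> K * (t * sqrt t)"
    by blast
  obtain c where c: "0 \<le> c" "\<And>t. 2 * nrm M p (Dl t f) \<le> nrm M p (Dl (2 * t) f) + c * nrm M p ((Dl t ^^ 2) f)"
    using marchaud[OF p0, of 1] f by (auto simp: numeral_2_eq_2)
  \<comment> \<open>Here the exponent 3/2 exceeds the order of the difference; only the rate t can
    survive, which is the Lipschitz bound.\<close>
  obtain K' where K': "0 \<le> K'" "\<And>t. 0 < t \<Longrightarrow> t \<le> 1 \<Longrightarrow> nrm M p (Dl t f) \<le> K' * t"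
  proof (rule marchaud_iterate_1[of "\<lambda>t. nrm M p (Dl t f)" "2 * nrm M p f" "c * K"])
    fix t :: real assume t: "0 < t" "t \<le> 1"
    have "c * nrm M p ((Dl t ^^ 2) f) \<le> c * (K * (t * sqrt t))"
      using K t c by (intro mult_left_mono) auto
    then show "2 * nrm M p (Dl t f) \<le> nrm M p (Dl (2 * t) f) + c * K * (t * sqrt t)"
      using c(2)[of t] by (simp add: mult.assoc)
  qed (use c K in \<open>auto intro: nrm_Dl p0 f nrm_nonneg\<close>)
  have "nrm M p (Dl t f) \<le> K' * \<bar>t\<bar>" if "\<bar>t\<bar> \<le> 1" for t
  proof (cases t "0::real" rule: linorder_cases)
    case less then show ?thesis using K'(2)[of "- t"] that f[of p] by (simp add: nrm_minus_t)
  next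
    case equal then show ?thesis using p0 by (simp add: Dl_def[abs_def] R_0 nrm_def power_0_left)
  next
    case greater then show ?thesis using K'(2)[of t] that by simp
  qed
  then show ?thesis using K'(1) that by blast
qed

text \<open>Smoothness of the autocorrelation near 0, with the derivatives carried as a sequence.
  The interval (-1, 1) fits the application, where derivatives contain tan t and cos t must not
  vanish.\<close>

definition psi_smooth :: "('a \<Rightarrow> real) \<Rightarrow> bool" where
  "psi_smooth f \<longleftrightarrow> f \<in> LL M 2 \<and> (\<exists>D :: nat \<Rightarrow> real \<Rightarrow> real.
     (\<forall>t. \<bar>t\<bar> < 1 \<longrightarrow> D 0 t = (\<integral>x. f x * f (R t x) \<partial>M)) \<and>
     (\<forall>i t. \<bar>t\<bar> < 1 \<longrightarrow> (D i has_real_derivative D (Suc i) t) (at t)))"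

text \<open>Inner products of difference quotients are second differences of the autocorrelation
  \<psi>, hence values of -\<psi>'' at nearby points. Continuity of \<psi>'' at 0 makes the
  quotients Cauchy in L^2, and the autocorrelation of their limit is -\<psi>'', so the argument can
  be repeated.\<close>

lemma psi_smooth_d2:
  assumes "psi_smooth f"
  obtains g where "d2 f g" "psi_smooth g"
proof -
  from assms obtain D :: "nat \<Rightarrow> real \<Rightarrow> real" where f: "f \<in> LL M 2"
    and D0: "\<And>t. \<bar>t\<bar> < 1 \<Longrightarrow> (\<integral>x. f x * f (R t x) \<partial>M) = D 0 t"
    and D: "\<And>i t. \<bar>t\<bar> < 1 \<Longrightarrow> (D i has_real_derivative D (Suc i) t) (at t)"
    unfolding psi_smooth_def by metis
  have [measurable]: "f \<in> borel_measurable M" using f by (simp add: LL_def)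
  have ff: "integrable M (\<lambda>x. f (R s x) * f (R t x))" for s t
    by (intro Cauchy_Schwarz_LL(1) LL_R f)
  have cor: "(\<integral>x. f (R s x) * f (R t x) \<partial>M) = D 0 (t - s)" if "\<bar>t - s\<bar> < 1" for s t
  proof -
    have "(\<integral>x. f (R s x) * f (R t x) \<partial>M) = (\<integral>x. f (R s (R (-s) x)) * f (R t (R (-s) x)) \<partial>M)"
      by (subst integral_R) auto
    then show ?thesis using D0[OF that] by (simp add: R_add R_0)
  qed
  have incr: "(\<integral>x. (f (R s x) - f x) * (f (R (u + t) x) - f (R u x)) \<partial>M)
      = D 0 (u + t - s) - D 0 (u - s) - D 0 (u + t) + D 0 u"
    if "\<bar>u\<bar> + \<bar>s\<bar> + \<bar>t\<bar> < 1" for s t u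
  proof -
    have "(\<integral>x. (f (R s x) - f x) * (f (R (u + t) x) - f (R u x)) \<partial>M)
      = (\<integral>x. f (R s x) * f (R (u+t) x) - f (R s x) * f (R u x) - f (R 0 x) * f (R (u+t) x) + f (R 0 x) * f (R u x) \<partial>M)"
      by (intro Bochner_Integration.integral_cong) (auto simp: algebra_simps R_0)
    also have "\<dots> = D 0 (u + t - s) - D 0 (u - s) - D 0 (u + t) + D 0 u"
      using that by (simp add: ff cor)
    finally show ?thesis .
  qed
  \<comment> \<open>The increments are -s and t because shifting the first factor by s moves the
    argument of \<psi> by -s; this is where the sign comes from. The base point \<open>u\<close> is
    needed to read off the whole autocorrelation of the derivative, and u = 0 for the Cauchy
    property.\<close>
  have qq: "\<exists>v. \<bar>v - u\<bar> \<le> \<bar>s\<bar> + \<bar>t\<bar> \<and> (\<integral>x. quot s f x * quot t f (R u x) \<partial>M) = - D 2 v"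
    if st: "\<bar>u\<bar> + \<bar>s\<bar> + \<bar>t\<bar> < 1" "s \<noteq> 0" "t \<noteq> 0" for s t u
  proof -
    obtain v where v: "\<bar>v - u\<bar> \<le> \<bar>- s\<bar> + \<bar>t\<bar>"
       "D 0 (u + - s + t) - D 0 (u + - s) - D 0 (u + t) + D 0 u = - s * t * D (Suc (Suc 0)) v"
      by (rule second_difference[of 1 D u "-s" t 0]) (use D st in auto)
    have "(\<integral>x. quot s f x * quot t f (R u x) \<partial>M)
        = (\<integral>x. ((f (R s x) - f x) * (f (R (u + t) x) - f (R u x))) / (s * t) \<partial>M)"
      by (intro Bochner_Integration.integral_cong) (auto simp: quot_def R_add add.commute)
    also have "\<dots> = (D 0 (u + t - s) - D 0 (u - s) - D 0 (u + t) + D 0 u) / (s * t)"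
      using incr[OF st(1)] by simp
    also have "D 0 (u + t - s) - D 0 (u - s) - D 0 (u + t) + D 0 u = - s * t * D 2 v"
    proof -
      have a: "u + - s = u - s" "u - s + t = u + t - s" by auto
      show ?thesis using v(2) unfolding a numeral_2_eq_2 .
    qed
    finally have "(\<integral>x. quot s f x * quot t f (R u x) \<partial>M) = - s * t * D 2 v / (s * t)" .
    also have "\<dots> = - D 2 v" using st by simp
    finally show ?thesis using v by auto
  qed
  \<comment> \<open>The square expands into three correlations, -\<psi>''(v1) - \<psi>''(v2) + 2
    \<psi>''(v3), which nearly cancel since all three points are close to 0.\<close>
  have cauchy: "\<exists>d>0. \<forall>s t. s \<noteq> 0 \<longrightarrow> t \<noteq> 0 \<longrightarrow> \<bar>s\<bar> < d \<longrightarrow> \<bar>t\<bar> < d \<longrightarrow> (\<integral>x. (quot s f x - quot t f x)\<^sup>2 \<partial>M) \<le> e"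
    if e: "e > 0" for e
  proof -
    have "isCont (D 2) 0" using D[of 0 2] by (intro DERIV_isCont) auto
    then obtain d where d: "d > 0" "\<And>v. \<bar>v\<bar> < d \<Longrightarrow> \<bar>D 2 v - D 2 0\<bar> < e / 4"
      using e unfolding continuous_at_eps_delta dist_real_def by (metis diff_zero divide_pos_pos zero_less_numeral)
    have "(\<integral>x. (quot s f x - quot t f x)\<^sup>2 \<partial>M) \<le> e"
      if st: "s \<noteq> 0" "t \<noteq> 0" "\<bar>s\<bar> < min (d / 2) (1/2)" "\<bar>t\<bar> < min (d / 2) (1/2)" for s t
    proof -
      obtain v1 v2 v3 where v: "\<bar>v1\<bar> \<le> \<bar>s\<bar> + \<bar>s\<bar>" "\<bar>v2\<bar> \<le> \<bar>t\<bar> + \<bar>t\<bar>" "\<bar>v3\<bar> \<le> \<bar>s\<bar> + \<bar>t\<bar>"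
        "(\<integral>x. quot s f x * quot s f x \<partial>M) = - D 2 v1"
        "(\<integral>x. quot t f x * quot t f x \<partial>M) = - D 2 v2"
        "(\<integral>x. quot s f x * quot t f x \<partial>M) = - D 2 v3"
        using qq[of 0 s s] qq[of 0 t t] qq[of 0 s t] st by (auto simp: R_0)
      have i: "integrable M (\<lambda>x. quot s f x * quot t f x)" for s t
        by (intro Cauchy_Schwarz_LL(1) LL_quot f)
      have "(\<integral>x. (quot s f x - quot t f x)\<^sup>2 \<partial>M)
        = (\<integral>x. quot s f x * quot s f x + quot t f x * quot t f x - 2 * (quot s f x * quot t f x) \<partial>M)"
        by (intro Bochner_Integration.integral_cong) (auto simp: power2_eq_square algebra_simps)
      also have "\<dots> = - D 2 v1 - D 2 v2 + 2 * D 2 v3" using i v by simp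
      also have "\<dots> \<le> e"
      proof -
        have st': "\<bar>s\<bar> < d / 2" "\<bar>t\<bar> < d / 2" using st by auto
        have "\<bar>v1\<bar> < d" "\<bar>v2\<bar> < d" "\<bar>v3\<bar> < d" using v(1-3) st' by linarith+
        then have "\<bar>D 2 v1 - D 2 0\<bar> < e / 4" "\<bar>D 2 v2 - D 2 0\<bar> < e / 4" "\<bar>D 2 v3 - D 2 0\<bar> < e / 4"
          by (blast intro: d(2))+
        then show ?thesis unfolding abs_less_iff by linarith
      qed
      finally show ?thesis .
    qed
    then show ?thesis using d(1) by (intro exI[of _ "min (d/2) (1/2)"]) auto
  qed
  define s where "s n = 1 / real (Suc n)" for n
  have s: "s n \<noteq> 0" for n by (simp add: s_def)
  have s0: "s \<longlonglongrightarrow> 0" unfolding s_def by (rule LIMSEQ_Suc[OF lim_const_over_n])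
  have ev: "\<exists>N. \<forall>n\<ge>N. \<bar>s n\<bar> < d" if "d > 0" for d
    using LIMSEQ_D[OF s0 that] by simp
  obtain g where g: "g \<in> LL M 2" "(\<lambda>n. \<integral>x. (quot (s n) f x - g x)\<^sup>2 \<partial>M) \<longlonglongrightarrow> 0"
  proof (rule L2_complete[of "\<lambda>n. quot (s n) f" M])
    show "\<And>n. quot (s n) f \<in> LL M 2" by (intro LL_quot f)
    fix e :: real assume "e > 0"
    from cauchy[OF this] ev s show "\<exists>N. \<forall>m\<ge>N. \<forall>n\<ge>N. (\<integral>x. (quot (s m) f x - quot (s n) f x)\<^sup>2 \<partial>M) \<le> e"
      by metis
  qed
  have nrm2: "nrm M 2 h = sqrt (\<integral>x. (h x)\<^sup>2 \<partial>M)" for h by (simp add: nrm_def sqrt_def)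
  have gs: "(\<lambda>n. nrm M 2 (\<lambda>x. quot (s n) f x - g x)) \<longlonglongrightarrow> 0"
    unfolding nrm2 using tendsto_real_sqrt[OF g(2)] by simp
  have d2: "d2 f g"
    unfolding d2_def
  proof (intro conjI f g(1) tendstoI)
    fix e :: real assume e: "e > 0"
    obtain d where d: "d > 0" "\<And>s t. s \<noteq> 0 \<Longrightarrow> t \<noteq> 0 \<Longrightarrow> \<bar>s\<bar> < d \<Longrightarrow> \<bar>t\<bar> < d \<Longrightarrow> (\<integral>x. (quot s f x - quot t f x)\<^sup>2 \<partial>M) \<le> (e/2)\<^sup>2"
      using cauchy[of "(e/2)\<^sup>2"] e by auto
    have "nrm M 2 (\<lambda>x. quot t f x - g x) < e" if t: "t \<noteq> 0" "\<bar>t\<bar> < d" for t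
    proof -
      obtain N where "\<And>n. n \<ge> N \<Longrightarrow> \<bar>s n\<bar> < d" using ev[OF d(1)] by blast
      moreover obtain N' where "\<And>n. n \<ge> N' \<Longrightarrow> nrm M 2 (\<lambda>x. quot (s n) f x - g x) < e / 2"
        using LIMSEQ_D[OF gs, of "e/2"] e by (auto simp: nrm_nonneg)
      ultimately obtain n where n: "\<bar>s n\<bar> < d" "nrm M 2 (\<lambda>x. quot (s n) f x - g x) < e / 2"
        by (metis nat_le_linear)
      have "nrm M 2 (\<lambda>x. quot t f x - quot (s n) f x) \<le> e / 2"
        unfolding nrm2 using d(2)[OF t(1) s t(2) n(1)] e by (intro real_le_lsqrt) auto
      then show ?thesis
        using nrm_triangle[of 2 "quot t f" M "quot (s n) f" g] n f g by (auto simp: LL_quot)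
    qed
    then show "\<forall>\<^sub>F t in at 0. dist (nrm M 2 (\<lambda>x. quot t f x - g x)) 0 < e"
      using d(1) by (auto simp: eventually_at dist_real_def nrm_nonneg intro!: exI[of _ d])
  qed
  moreover have "psi_smooth g"
    unfolding psi_smooth_def
  proof (intro conjI g(1) exI[of _ "\<lambda>i t. - D (i + 2) t"] allI impI)
    fix t :: real assume t: "\<bar>t\<bar> < 1"
    have "(\<lambda>n. \<integral>x. quot (s n) f x * quot (s n) f (R t x) \<partial>M) \<longlonglongrightarrow> (\<integral>x. g x * g (R t x) \<partial>M)"
    proof (rule tendsto_inner)
      have "nrm M 2 (\<lambda>x. quot (s n) f (R t x) - g (R t x)) = nrm M 2 (\<lambda>x. quot (s n) f x - g x)" for n
        by (rule nrm_R[of "\<lambda>x. quot (s n) f x - g x"]) (intro LL_diff LL_quot f g)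
      then show "(\<lambda>n. nrm M 2 (\<lambda>x. quot (s n) f (R t x) - g (R t x))) \<longlonglongrightarrow> 0" using gs by simp
    qed (use f g gs in \<open>auto intro: LL_quot LL_R\<close>)
    moreover have "(\<lambda>n. \<integral>x. quot (s n) f x * quot (s n) f (R t x) \<partial>M) \<longlonglongrightarrow> - D 2 t"
    proof (rule tendstoI)
      fix e :: real assume e: "e > 0"
      have "isCont (D 2) t" using D[of t 2] t by (intro DERIV_isCont) auto
      then obtain d where d: "d > 0" "\<And>v. \<bar>v - t\<bar> < d \<Longrightarrow> \<bar>D 2 v - D 2 t\<bar> < e"
        using e unfolding continuous_at_eps_delta dist_real_def by metis
      obtain N where N: "\<And>n. n \<ge> N \<Longrightarrow> \<bar>s n\<bar> < min (d / 2) ((1 - \<bar>t\<bar>) / 2)"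
        using ev[of "min (d / 2) ((1 - \<bar>t\<bar>) / 2)"] d(1) t by auto
      show "\<forall>\<^sub>F n in sequentially. dist (\<integral>x. quot (s n) f x * quot (s n) f (R t x) \<partial>M) (- D 2 t) < e"
        unfolding eventually_sequentially
      proof (intro exI[of _ N] allI impI)
        fix n assume "n \<ge> N"
        note n = N[OF this]
        obtain v where v: "\<bar>v - t\<bar> \<le> \<bar>s n\<bar> + \<bar>s n\<bar>" "(\<integral>x. quot (s n) f x * quot (s n) f (R t x) \<partial>M) = - D 2 v"
          using qq[of t "s n" "s n"] n s by (auto simp: min_less_iff_conj)
        then show "dist (\<integral>x. quot (s n) f x * quot (s n) f (R t x) \<partial>M) (- D 2 t) < e"
          using d(2)[of v] n by (simp add: dist_real_def abs_minus_commute)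
      qed
    qed
    ultimately have "(\<integral>x. g x * g (R t x) \<partial>M) = - D 2 t" by (rule LIMSEQ_unique)
    then show "- D (0 + 2) t = (\<integral>x. g x * g (R t x) \<partial>M)" by (simp add: numeral_2_eq_2)
  next
    fix i and t :: real assume "\<bar>t\<bar> < 1"
    then show "((\<lambda>t. - D (i + 2) t) has_real_derivative - D (Suc i + 2) t) (at t)"
      using D[of t "i + 2"] by (auto intro!: derivative_eq_intros)
  qed
  ultimately show ?thesis by (rule that)
qed

lemma d2_Dl_pow: "d2 f g \<Longrightarrow> d2 ((Dl s ^^ k) f) ((Dl s ^^ k) g)"
  by (induction k) (auto intro: d2_Dl)

text \<open>Every order of difference is traded for one derivative and one factor |t|, since the
  derivative again has a smooth autocorrelation.\<close>

lemma psi_smooth_differences: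
  assumes "psi_smooth f"
  shows "\<exists>C. \<forall>t. nrm M 2 ((Dl t ^^ k) f) \<le> C * \<bar>t\<bar> ^ k"
  using assms
proof (induction k arbitrary: f)
  case 0
  show ?case by (intro exI[of _ "nrm M 2 f"]) simp
next
  case (Suc k)
  obtain g where g: "d2 f g" "psi_smooth g" using psi_smooth_d2[OF Suc.prems] .
  obtain C where C: "\<And>t. nrm M 2 ((Dl t ^^ k) g) \<le> C * \<bar>t\<bar> ^ k" using Suc.IH[OF g(2)] by blast
  have "nrm M 2 ((Dl t ^^ Suc k) f) \<le> C * \<bar>t\<bar> ^ Suc k" for t
  proof -
    have "nrm M 2 ((Dl t ^^ Suc k) f) \<le> \<bar>t\<bar> * nrm M 2 ((Dl t ^^ k) g)"
      using d2_nrm_Dl[OF d2_Dl_pow[OF g(1)]] by simp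
    also have "\<dots> \<le> \<bar>t\<bar> * (C * \<bar>t\<bar> ^ k)" by (intro mult_left_mono C) auto
    finally show ?thesis by (simp add: mult_ac)
  qed
  then show ?case by blast
qed

text \<open>Differentiability along the flow in all L^p simultaneously: multiplying halves the
  available exponent, so only the intersection over p is stable under products. The exponent is
  \<open>Suc p\<close> because exponent 0 would make the integral 1.\<close>

definition dv :: "('a \<Rightarrow> real) \<Rightarrow> ('a \<Rightarrow> real) \<Rightarrow> bool" where
  "dv f g \<longleftrightarrow> (\<forall>p. f \<in> LL M p) \<and> (\<forall>p. g \<in> LL M p) \<and>
     (\<forall>p. ((\<lambda>t. \<integral>x. \<bar>quot t f x - g x\<bar> ^ Suc p \<partial>M) \<longlongrightarrow> 0) (at 0))"

lemma L1_le_nrm2: "h \<in> LL M 2 \<Longrightarrow> (\<integral>x. \<bar>h x\<bar> \<partial>M) \<le> nrm M 2 h"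
  using Cauchy_Schwarz_LL(3)[of h M "\<lambda>_. 1"] by (simp add: LL_const nrm_def prob_space)

text \<open>The Lipschitz bounds keep the quotients bounded in every L^p. An almost surely
  convergent subsequence and Fatou's lemma put \<open>g\<close> into every L^p, and interpolation
  upgrades the L^2 convergence.\<close>

lemma d2_imp_dv:
  assumes f: "\<And>p. f \<in> LL M p" and d: "d2 f g"
    and L2: "\<And>k. \<exists>C. \<forall>t. nrm M 2 ((Dl t ^^ k) f) \<le> C * \<bar>t\<bar> ^ k"
  shows "dv f g"
proof -
  note LL = d2_LL[OF d]
  have [measurable]: "f \<in> borel_measurable M" "g \<in> borel_measurable M" using LL by (auto simp: LL_def)
  have [measurable]: "quot t f \<in> borel_measurable M" for t unfolding quot_def by measurable
  have bound: "\<exists>K. \<forall>t. t \<noteq> 0 \<longrightarrow> \<bar>t\<bar> \<le> 1 \<longrightarrow> nrm M p (quot t f) \<le> K" if p: "2 \<le> p" for p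
  proof -
    obtain K where "\<And>t. \<bar>t\<bar> \<le> 1 \<Longrightarrow> nrm M p (Dl t f) \<le> K * \<bar>t\<bar>"
      by (rule Lp_Lipschitz[OF f L2 p]) blast
    then show ?thesis using p by (intro exI[of _ K]) (auto simp: nrm_quot divide_le_eq)
  qed
  define s where "s n = 1 / real (Suc n)" for n
  have s: "s n \<noteq> 0" "\<bar>s n\<bar> \<le> 1" for n by (auto simp: s_def)
  have s0: "filterlim s (at 0) sequentially"
    unfolding filterlim_at s_def using LIMSEQ_Suc[OF lim_const_over_n[of 1]] by auto
  have lim: "(\<lambda>n. nrm M 2 (\<lambda>x. quot (s n) f x - g x)) \<longlonglongrightarrow> 0"
    by (rule filterlim_compose[OF _ s0]) (use d in \<open>simp add: d2_def\<close>)
  have "(\<lambda>n. \<integral>x. norm (quot (s n) f x - g x) \<partial>M) \<longlonglongrightarrow> 0"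
    unfolding real_norm_def
    by (rule tendsto_0_squeeze[OF lim L1_le_nrm2]) (auto intro!: LL_diff LL_quot LL)
  moreover have "integrable M (\<lambda>x. quot (s n) f x - g x)" for n
  proof -
    have "(\<lambda>x. quot (s n) f x - g x) \<in> LL M 1"
      by (rule LL_mono[of 1 2]) (auto intro!: LL_diff LL_quot LL)
    then show ?thesis by (auto simp: LL_def integrable_abs_iff)
  qed
  ultimately obtain r :: "nat \<Rightarrow> nat" where r: "AE x in M. (\<lambda>n. quot (s (r n)) f x - g x) \<longlonglongrightarrow> 0"
    using tendsto_L1_AE_subseq[of M "\<lambda>n x. quot (s n) f x - g x"] by auto
  have gLL2: "g \<in> LL M p" if p: "2 \<le> p" for p
  proof -
    obtain K where K: "\<And>t. t \<noteq> 0 \<Longrightarrow> \<bar>t\<bar> \<le> 1 \<Longrightarrow> nrm M p (quot t f) \<le> K" using bound[OF p] by blast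
    show ?thesis
    proof (rule Fatou_LL(1)[where f = "\<lambda>n. quot (s (r n)) f" and c = "K ^ p"])
      show "AE x in M. (\<lambda>n. quot (s (r n)) f x) \<longlonglongrightarrow> g x"
        using r by eventually_elim (simp add: LIM_zero_iff)
      show "(\<integral>x. \<bar>quot (s (r n)) f x\<bar> ^ p \<partial>M) \<le> K ^ p" for n
        using p by (subst nrm_power[symmetric]) (auto intro!: power_mono K s nrm_nonneg)
    qed (use f in \<open>auto intro: LL_quot\<close>)
  qed
  have gLL: "g \<in> LL M p" for p using LL_mono[OF _ gLL2[of "max p 2"], of p] by auto
  have "((\<lambda>t. \<integral>x. \<bar>quot t f x - g x\<bar> ^ Suc p \<partial>M) \<longlongrightarrow> 0) (at 0)" for p
  proof -
    have "\<exists>B. \<forall>t. t \<noteq> 0 \<longrightarrow> \<bar>t\<bar> \<le> 1 \<longrightarrow> sqrt (\<integral>x. \<bar>quot t f x - g x\<bar> ^ (2 * p) \<partial>M) \<le> B"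
    proof (cases "p = 0")
      case True
      then show ?thesis by (intro exI[of _ 1]) (simp add: prob_space)
    next
      case False
      then obtain K where K: "\<And>t. t \<noteq> 0 \<Longrightarrow> \<bar>t\<bar> \<le> 1 \<Longrightarrow> nrm M (2 * p) (quot t f) \<le> K"
        using bound[of "2 * p"] by auto
      have "(\<integral>x. \<bar>quot t f x - g x\<bar> ^ (2 * p) \<partial>M) \<le> (K + nrm M (2 * p) g) ^ (2 * p)" if "t \<noteq> 0" "\<bar>t\<bar> \<le> 1" for t
      proof (subst nrm_power[symmetric])
        show "nrm M (2 * p) (\<lambda>x. quot t f x - g x) ^ (2 * p) \<le> (K + nrm M (2 * p) g) ^ (2 * p)"
        proof (intro power_mono nrm_nonneg)
          show "nrm M (2 * p) (\<lambda>x. quot t f x - g x) \<le> K + nrm M (2 * p) g"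
            using nrm_diff[of "2 * p" "quot t f" M g] K[OF that] f gLL False by (fastforce intro: LL_quot)
        qed
      qed (use False in auto)
      then show ?thesis by (intro exI[of _ "sqrt ((K + nrm M (2 * p) g) ^ (2 * p))"]) (auto intro: real_sqrt_le_mono)
    qed
    then obtain B where B: "\<And>t. t \<noteq> 0 \<Longrightarrow> \<bar>t\<bar> \<le> 1 \<Longrightarrow> sqrt (\<integral>x. \<bar>quot t f x - g x\<bar> ^ (2 * p) \<partial>M) \<le> B" by blast
    have ev: "\<forall>\<^sub>F t in at (0::real). t \<noteq> 0 \<and> \<bar>t\<bar> \<le> 1"
      by (auto simp: eventually_at dist_real_def intro!: exI[of _ 1])
    show ?thesis
    proof (rule Lim_null_comparison)
      have "((\<lambda>t. nrm M 2 (\<lambda>x. quot t f x - g x) * B) \<longlongrightarrow> 0 * B) (at 0)"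
        using d unfolding d2_def by (intro tendsto_intros) auto
      then show "((\<lambda>t. nrm M 2 (\<lambda>x. quot t f x - g x) * B) \<longlongrightarrow> 0) (at 0)" by simp
      show "\<forall>\<^sub>F t in at 0. norm (\<integral>x. \<bar>quot t f x - g x\<bar> ^ Suc p \<partial>M) \<le> nrm M 2 (\<lambda>x. quot t f x - g x) * B"
        using ev
      proof eventually_elim
        case (elim t)
        have "(\<integral>x. \<bar>quot t f x - g x\<bar> ^ Suc p \<partial>M) \<le> nrm M 2 (\<lambda>x. quot t f x - g x) * sqrt (\<integral>x. \<bar>quot t f x - g x\<bar> ^ (2 * Suc p - 2) \<partial>M)"
          by (rule interpolation_2) (auto intro: LL_diff LL_quot f gLL)
        also have "\<dots> \<le> nrm M 2 (\<lambda>x. quot t f x - g x) * B"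
          using B[of t] elim by (intro mult_left_mono nrm_nonneg) auto
        finally show ?case by (simp add: integral_nonneg_AE)
      qed
    qed
  qed
  then show ?thesis unfolding dv_def using f gLL by blast
qed

text \<open>The first derivative is prescribed, because the later argument needs it to be the
  Gaussian series itself; the further ones are chosen successively among representatives.\<close>

theorem smooth_chain:
  assumes f: "\<And>p. f \<in> LL M p" and psi: "psi_smooth f" and d: "d2 f g"
  obtains X where "X 0 = f" "X 1 = g" "\<And>k. dv (X k) (X (Suc k))"
proof -
  have step: "dv h k" if "\<And>p. h \<in> LL M p" "psi_smooth h" "d2 h k" for h k
    by (rule d2_imp_dv[OF that(1,3) psi_smooth_differences[OF that(2)]])
  define Q where "Q h \<longleftrightarrow> (\<forall>p. h \<in> LL M p) \<and> psi_smooth h" for h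
  have ex: "\<exists>k. dv h k \<and> Q k" if "Q h" for h
  proof -
    have "psi_smooth h" using that by (simp add: Q_def)
    then obtain k where k: "d2 h k" "psi_smooth k" by (rule psi_smooth_d2)
    then have "dv h k" using step that by (auto simp: Q_def)
    then show ?thesis using k by (auto simp: Q_def dv_def)
  qed
  have dvg: "dv f g" by (rule step[OF f psi d])
  \<comment> \<open>The derivative produced by \<open>psi_smooth_d2\<close> may differ from the
    given \<open>g\<close> on a null set. Invariance of the measure carries that null set along the
    flow, so both have the same autocorrelation.\<close>
  have "psi_smooth g"
  proof -
    obtain h where h: "d2 f h" "psi_smooth h" using psi_smooth_d2[OF psi] .
    have ae: "AE x in M. h x = g x" by (rule d2_unique[OF h(1) d])
    have [measurable]: "h \<in> borel_measurable M" "g \<in> borel_measurable M"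
      using d2_LL[OF d] d2_LL[OF h(1)] by (auto simp: LL_def)
    have "AE x in M. h (R t x) = g (R t x)" for t
    proof -
      have "AE x in distr M M (R t). h x = g x" unfolding distr_R by (rule ae)
      then show ?thesis by (subst (asm) AE_distr_iff) auto
    qed
    then have both: "AE x in M. h x = g x \<and> h (R t x) = g (R t x)" for t
      using ae by simp
    have ae2: "AE x in M. h x * h (R t x) = g x * g (R t x)" for t
      using both[of t] by (rule eventually_mono) simp
    have "(\<integral>x. h x * h (R t x) \<partial>M) = (\<integral>x. g x * g (R t x) \<partial>M)" for t
      by (intro integral_cong_AE ae2) auto
    then show ?thesis using h(2) d2_LL[OF d] unfolding psi_smooth_def by simp
  qed
  then have Qg: "Q g" using dvg by (auto simp: Q_def dv_def)
  have "\<exists>Y. \<forall>n. (Q (Y n) \<and> (n = 0 \<longrightarrow> Y n = g)) \<and> dv (Y n) (Y (Suc n))"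
  proof (rule dependent_nat_choice)
    show "\<exists>x. Q x \<and> (0 = 0 \<longrightarrow> x = g)" using Qg by blast
    show "\<exists>y. (Q y \<and> (Suc n = 0 \<longrightarrow> y = g)) \<and> dv x y" if "Q x \<and> (n = 0 \<longrightarrow> x = g)" for x n
      using ex[of x] that by auto
  qed
  then obtain Y where Y: "Y 0 = g" "\<And>n. Q (Y n) \<and> dv (Y n) (Y (Suc n))"
    by blast
  show ?thesis
    by (rule that[of "case_nat f Y"]) (use Y dvg in \<open>auto split: nat.split\<close>)
qed

end

section \<open>Product rule, chain rule and integration by parts for \<open>dv\<close>\<close>

context flow
begin

definition LLall :: "('a \<Rightarrow> real) set" where "LLall = (\<Inter>p. LL M p)"

lemma LLall_iff: "f \<in> LLall \<longleftrightarrow> (\<forall>p. f \<in> LL M p)"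
  by (simp add: LLall_def)

lemma LLall_D: "f \<in> LLall \<Longrightarrow> f \<in> LL M p"
  by (simp add: LLall_def)

lemma LLall_measurable [measurable_dest]: "f \<in> LLall \<Longrightarrow> f \<in> borel_measurable M"
  using LL_measurable LLall_D by blast

lemma LLall_integrable: "f \<in> LLall \<Longrightarrow> integrable M f"
  using LL_integrable[OF LLall_D[of f 1]] by (simp add: integrable_abs_iff LLall_measurable)

lemma LLall_add: "f \<in> LLall \<Longrightarrow> g \<in> LLall \<Longrightarrow> (\<lambda>x. f x + g x) \<in> LLall"
  by (auto simp: LLall_iff intro: LL_add)

lemma LLall_diff: "f \<in> LLall \<Longrightarrow> g \<in> LLall \<Longrightarrow> (\<lambda>x. f x - g x) \<in> LLall"
  by (auto simp: LLall_iff intro: LL_diff)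

lemma LLall_mult: "f \<in> LLall \<Longrightarrow> g \<in> LLall \<Longrightarrow> (\<lambda>x. f x * g x) \<in> LLall"
  by (auto simp: LLall_iff intro: LL_mult(1))

lemma LLall_const: "(\<lambda>x. c) \<in> LLall"
  by (auto simp: LLall_iff intro: LL_const)

lemma LLall_R: "f \<in> LLall \<Longrightarrow> (\<lambda>x. f (R t x)) \<in> LLall"
  by (auto simp: LLall_iff intro: LL_R)

lemma LLall_quot: "f \<in> LLall \<Longrightarrow> quot t f \<in> LLall"
  by (auto simp: LLall_iff intro: LL_quot)

lemma LLall_bounded:
  assumes [measurable]: "f \<in> borel_measurable M" and b: "\<And>x. \<bar>f x\<bar> \<le> c"
  shows "f \<in> LLall"
  unfolding LLall_iff
proof
  fix p show "f \<in> LL M p"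
    by (rule LL_bound[where h="\<lambda>_. c ^ p"]) (auto intro!: power_mono b)
qed

text \<open>Families tending to 0 in every L^p as t tends to 0. Membership in \<open>LLall\<close>
  is required at all t, so that products and sums of families stay meaningful without restricting
  t.\<close>

definition null :: "(real \<Rightarrow> 'a \<Rightarrow> real) \<Rightarrow> bool" where
  "null h \<longleftrightarrow> (\<forall>t. h t \<in> LLall) \<and> (\<forall>p. ((\<lambda>t. \<integral>x. \<bar>h t x\<bar> ^ Suc p \<partial>M) \<longlongrightarrow> 0) (at 0))"

lemma dv_null: "dv f g \<longleftrightarrow> f \<in> LLall \<and> g \<in> LLall \<and> null (\<lambda>t x. quot t f x - g x)"
  unfolding dv_def null_def LLall_iff by (auto intro: LL_diff LL_quot)

lemma null_add:
  assumes "null h" "null k"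
  shows "null (\<lambda>t x. h t x + k t x)"
  unfolding null_def
proof (intro conjI allI)
  have LL: "\<And>t. h t \<in> LLall" "\<And>t. k t \<in> LLall" using assms by (auto simp: null_def)
  show "(\<lambda>x. h t x + k t x) \<in> LLall" for t by (intro LLall_add LL)
  fix p
  have "((\<lambda>t. 2 ^ Suc p * ((\<integral>x. \<bar>h t x\<bar> ^ Suc p \<partial>M) + (\<integral>x. \<bar>k t x\<bar> ^ Suc p \<partial>M))) \<longlongrightarrow> 2 ^ Suc p * (0 + 0)) (at 0)"
    using assms unfolding null_def by (intro tendsto_intros) auto
  then have lim: "((\<lambda>t. 2 ^ Suc p * ((\<integral>x. \<bar>h t x\<bar> ^ Suc p \<partial>M) + (\<integral>x. \<bar>k t x\<bar> ^ Suc p \<partial>M))) \<longlongrightarrow> 0) (at 0)" by simp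
  show "((\<lambda>t. \<integral>x. \<bar>h t x + k t x\<bar> ^ Suc p \<partial>M) \<longlongrightarrow> 0) (at 0)"
  proof (rule tendsto_0_squeeze[OF lim])
    fix t
    note i = LL_integrable[OF LLall_D[OF LL(1)], of t "Suc p"] LL_integrable[OF LLall_D[OF LL(2)], of t "Suc p"]
    have "(\<integral>x. \<bar>h t x + k t x\<bar> ^ Suc p \<partial>M) \<le> (\<integral>x. 2 ^ Suc p * (\<bar>h t x\<bar> ^ Suc p + \<bar>k t x\<bar> ^ Suc p) \<partial>M)"
      using i LL_integrable[OF LLall_D[OF LLall_add[OF LL(1) LL(2)]], of t t "Suc p"]
      by (intro integral_mono abs_add_power_le) auto
    also have "\<dots> = 2 ^ Suc p * ((\<integral>x. \<bar>h t x\<bar> ^ Suc p \<partial>M) + (\<integral>x. \<bar>k t x\<bar> ^ Suc p \<partial>M))"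
      using i by simp
    finally show "(\<integral>x. \<bar>h t x + k t x\<bar> ^ Suc p \<partial>M) \<le> 2 ^ Suc p * ((\<integral>x. \<bar>h t x\<bar> ^ Suc p \<partial>M) + (\<integral>x. \<bar>k t x\<bar> ^ Suc p \<partial>M))" .
  qed (auto intro: integral_nonneg_AE)
qed

text \<open>Cauchy-Schwarz at the doubled exponent, with the second factor bounded in each L^p
  uniformly in t.\<close>

lemma null_mult:
  assumes h: "null h" and k: "\<And>t. k t \<in> LLall"
    and b: "\<And>p. \<exists>B. \<forall>t. (\<integral>x. \<bar>k t x\<bar> ^ p \<partial>M) \<le> B"
  shows "null (\<lambda>t x. h t x * k t x)"
  unfolding null_def
proof (intro conjI allI)
  have LL: "\<And>t. h t \<in> LLall" using h by (auto simp: null_def)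
  show "(\<lambda>x. h t x * k t x) \<in> LLall" for t by (intro LLall_mult LL k)
  fix p
  obtain B where B: "\<And>t. (\<integral>x. \<bar>k t x\<bar> ^ (2 * Suc p) \<partial>M) \<le> B" using b by blast
  have e: "2 * Suc p = Suc (2 * p + 1)" by simp
  have "((\<lambda>t. sqrt (\<integral>x. \<bar>h t x\<bar> ^ (2 * Suc p) \<partial>M) * sqrt B) \<longlongrightarrow> sqrt 0 * sqrt B) (at 0)"
    using h unfolding null_def e by (intro tendsto_intros) blast
  then have lim: "((\<lambda>t. sqrt (\<integral>x. \<bar>h t x\<bar> ^ (2 * Suc p) \<partial>M) * sqrt B) \<longlongrightarrow> 0) (at 0)" by simp
  show "((\<lambda>t. \<integral>x. \<bar>h t x * k t x\<bar> ^ Suc p \<partial>M) \<longlongrightarrow> 0) (at 0)"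
  proof (rule tendsto_0_squeeze[OF lim])
    fix t
    have "(\<integral>x. \<bar>h t x * k t x\<bar> ^ Suc p \<partial>M) \<le> sqrt (\<integral>x. \<bar>h t x\<bar> ^ (2 * Suc p) \<partial>M) * sqrt (\<integral>x. \<bar>k t x\<bar> ^ (2 * Suc p) \<partial>M)"
      by (intro LL_mult(2) LLall_D LL k)
    also have "\<dots> \<le> sqrt (\<integral>x. \<bar>h t x\<bar> ^ (2 * Suc p) \<partial>M) * sqrt B"
      by (intro mult_left_mono real_sqrt_le_mono B) (auto intro: integral_nonneg_AE)
    finally show "(\<integral>x. \<bar>h t x * k t x\<bar> ^ Suc p \<partial>M) \<le> sqrt (\<integral>x. \<bar>h t x\<bar> ^ (2 * Suc p) \<partial>M) * sqrt B" .
  qed (auto intro: integral_nonneg_AE)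
qed

lemma null_mult_fixed: "null h \<Longrightarrow> k \<in> LLall \<Longrightarrow> null (\<lambda>t x. h t x * k x)"
  by (rule null_mult) auto

lemma null_mult_R: "null h \<Longrightarrow> k \<in> LLall \<Longrightarrow> null (\<lambda>t x. h t x * k (R t x))"
proof (rule null_mult)
  fix p
  assume k: "k \<in> LLall"
  then have [measurable]: "k \<in> borel_measurable M" by measurable
  show "\<exists>B. \<forall>t. (\<integral>x. \<bar>k (R t x)\<bar> ^ p \<partial>M) \<le> B"
    by (subst integral_R[of "\<lambda>x. \<bar>k x\<bar> ^ p"]) auto
qed (auto intro: LLall_R)

lemma null_cong:
  assumes "null h" "\<And>t x. t \<noteq> 0 \<Longrightarrow> k t x = h t x" "k 0 \<in> LLall"
  shows "null k"
  unfolding null_def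
proof (intro conjI allI)
  have e: "k t = h t" if "t \<noteq> 0" for t using assms(2)[OF that] by auto
  show "k t \<in> LLall" for t using assms e by (cases "t = 0") (auto simp: null_def)
  fix p
  have "((\<lambda>t. \<integral>x. \<bar>h t x\<bar> ^ Suc p \<partial>M) \<longlongrightarrow> 0) (at 0)" using assms by (auto simp: null_def)
  then show "((\<lambda>t. \<integral>x. \<bar>k t x\<bar> ^ Suc p \<partial>M) \<longlongrightarrow> 0) (at 0)"
    by (rule Lim_transform_eventually) (auto simp: eventually_at_filter e)
qed

lemma null_t: "k \<in> LLall \<Longrightarrow> null (\<lambda>t x. t * k x)"
  unfolding null_def
proof (intro conjI allI)
  assume k: "k \<in> LLall"
  show "(\<lambda>x. t * k x) \<in> LLall" for t by (intro LLall_mult LLall_const k)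
  fix p
  have "((\<lambda>t. \<bar>t\<bar> ^ Suc p * (\<integral>x. \<bar>k x\<bar> ^ Suc p \<partial>M)) \<longlongrightarrow> \<bar>0\<bar> ^ Suc p * (\<integral>x. \<bar>k x\<bar> ^ Suc p \<partial>M)) (at 0)"
    by (intro tendsto_intros)
  then show "((\<lambda>t. \<integral>x. \<bar>t * k x\<bar> ^ Suc p \<partial>M) \<longlongrightarrow> 0) (at 0)"
    by (simp add: abs_mult power_mult_distrib mult.assoc[symmetric] del: power_Suc)
qed

lemma null_dominated:
  assumes h: "null h" and [measurable]: "\<And>t. k t \<in> borel_measurable M" and b: "\<And>t x. \<bar>k t x\<bar> \<le> \<bar>h t x\<bar>"
  shows "null k"
  unfolding null_def
proof (intro conjI allI)
  have hL: "h t \<in> LLall" for t using h by (auto simp: null_def)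
  show kL: "k t \<in> LLall" for t
    unfolding LLall_iff
    by (auto intro!: LL_bound[OF _ LL_integrable[OF LLall_D[OF hL[of t]]]] power_mono b)
  fix p
  have lim: "((\<lambda>t. \<integral>x. \<bar>h t x\<bar> ^ Suc p \<partial>M) \<longlongrightarrow> 0) (at 0)" using h unfolding null_def by blast
  show "((\<lambda>t. \<integral>x. \<bar>k t x\<bar> ^ Suc p \<partial>M) \<longlongrightarrow> 0) (at 0)"
    by (rule tendsto_0_squeeze[OF lim])
       (auto intro!: integral_nonneg_AE integral_mono LL_integrable LLall_D hL kL power_mono b simp del: power_Suc)
qed

lemma dv_LLall: "dv f g \<Longrightarrow> f \<in> LLall" "dv f g \<Longrightarrow> g \<in> LLall"
  by (auto simp: dv_null)

text \<open>The increment \<open>f \<circ> R t - f\<close> equals \<open>t\<close> times a convergent family, hence vanishes.\<close>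

lemma null_increment:
  assumes "dv f g" shows "null (\<lambda>t x. f (R t x) - f x)"
proof -
  note LL = dv_LLall[OF assms]
  have q: "null (\<lambda>t x. quot t f x - g x)" using assms by (simp add: dv_null)
  \<comment> \<open>\<open>null_mult\<close> asks for a factor bounded for all t, so t is truncated
    to [-1, 1]; near 0 the truncation does nothing.\<close>
  have b: "null (\<lambda>t x. (quot t f x - g x) * max (-1) (min 1 t))"
    by (rule null_mult[OF q]) (auto simp: LLall_const prob_space intro!: exI[of _ 1] power_le_one)
  have "null (\<lambda>t x. ((quot t f x - g x) * max (-1) (min 1 t) + t * g x))"
    by (intro null_add b null_t LL)
  then have "((\<lambda>t. \<integral>x. \<bar>(quot t f x - g x) * max (-1) (min 1 t) + t * g x\<bar> ^ Suc p \<partial>M) \<longlongrightarrow> 0) (at 0)" for p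
    by (simp add: null_def)
  moreover have "\<forall>\<^sub>F t in at (0::real). t \<noteq> 0 \<and> \<bar>t\<bar> < 1"
    by (auto simp: eventually_at dist_real_def intro!: exI[of _ 1])
  then have "\<forall>\<^sub>F t in at 0. (\<integral>x. \<bar>(quot t f x - g x) * max (-1) (min 1 t) + t * g x\<bar> ^ Suc p \<partial>M)
      = (\<integral>x. \<bar>f (R t x) - f x\<bar> ^ Suc p \<partial>M)" for p
  proof eventually_elim
    case (elim t)
    then have "max (-1) (min 1 t) = t" by (auto simp: max_def min_def)
    moreover have "(quot t f x - g x) * t + t * g x = f (R t x) - f x" for x
    proof -
      have "quot t f x * t = f (R t x) - f x" using elim by (simp add: quot_def)
      then show ?thesis by (simp add: algebra_simps)
    qed
    ultimately show ?case by simp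
  qed
  ultimately have "((\<lambda>t. \<integral>x. \<bar>f (R t x) - f x\<bar> ^ Suc p \<partial>M) \<longlongrightarrow> 0) (at 0)" for p
    by (rule Lim_transform_eventually)
  then show ?thesis by (auto simp: null_def simp del: power_Suc intro!: LLall_diff LLall_R LL)
qed

lemma dv_add:
  assumes "dv f g" "dv f' g'"
  shows "dv (\<lambda>x. f x + f' x) (\<lambda>x. g x + g' x)"
proof -
  note LL = dv_LLall[OF assms(1)] dv_LLall[OF assms(2)]
  have "null (\<lambda>t x. (quot t f x - g x) + (quot t f' x - g' x))"
    by (rule null_add) (use assms in \<open>auto simp: dv_null\<close>)
  also have "(\<lambda>t x. (quot t f x - g x) + (quot t f' x - g' x)) = (\<lambda>t x. quot t (\<lambda>x. f x + f' x) x - (g x + g' x))"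
    by (auto simp: quot_def fun_eq_iff add_divide_distrib diff_divide_distrib)
  finally show ?thesis unfolding dv_null using LL by (auto intro: LLall_add)
qed

text \<open>Discrete Leibniz rule: the error splits into the errors of the two quotients and a term
  containing the increment of f', because one factor is evaluated at the moved point.\<close>

lemma dv_mult:
  assumes "dv f g" "dv f' g'"
  shows "dv (\<lambda>x. f x * f' x) (\<lambda>x. g x * f' x + f x * g' x)"
proof -
  note LL = dv_LLall[OF assms(1)] dv_LLall[OF assms(2)]
  have q: "null (\<lambda>t x. quot t f x - g x)" "null (\<lambda>t x. quot t f' x - g' x)"
    using assms by (auto simp: dv_null)
  have "null (\<lambda>t x. ((quot t f x - g x) * f' (R t x) + (f' (R t x) - f' x) * g x) + (quot t f' x - g' x) * f x)"
    by (intro null_add null_mult_R null_mult_fixed q null_increment[OF assms(2)] LL)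
  then have "null (\<lambda>t x. quot t (\<lambda>x. f x * f' x) x - (g x * f' x + f x * g' x))"
  proof (rule null_cong)
    show "(\<lambda>x. quot 0 (\<lambda>x. f x * f' x) x - (g x * f' x + f x * g' x)) \<in> LLall"
      by (intro LLall_diff LLall_quot LLall_add LLall_mult LL)
  qed (auto simp: quot_def field_simps)
  then show ?thesis unfolding dv_null using LL by (auto intro: LLall_add LLall_mult)
qed

lemma dv_const: "dv (\<lambda>x. c) (\<lambda>x. 0)"
  unfolding dv_null by (auto simp: quot_def null_def LLall_const)

text \<open>By invariance every difference quotient has mean zero. Together with the product rule
  this is integration by parts along the flow.\<close>

lemma dv_integral_0:
  assumes "dv f g" shows "(\<integral>x. g x \<partial>M) = 0"
proof -
  note LL = dv_LLall[OF assms]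
  have "((\<lambda>t. \<integral>x. \<bar>quot t f x - g x\<bar> ^ Suc 0 \<partial>M) \<longlongrightarrow> 0) (at 0)" using assms unfolding dv_def by blast
  then have lim: "((\<lambda>t. \<integral>x. \<bar>quot t f x - g x\<bar> \<partial>M) \<longlongrightarrow> 0) (at 0)" by simp
  have "\<bar>\<integral>x. g x \<partial>M\<bar> \<le> (\<integral>x. \<bar>quot t f x - g x\<bar> \<partial>M)" for t
  proof -
    have i: "integrable M (\<lambda>x. f (R t x))" "integrable M f" "integrable M g"
      using LL by (auto intro: LLall_integrable LLall_R)
    have "(\<integral>x. quot t f x - g x \<partial>M) = ((\<integral>x. f (R t x) \<partial>M) - (\<integral>x. f x \<partial>M)) / t - (\<integral>x. g x \<partial>M)"
      unfolding quot_def using i by simp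
    also have "\<dots> = - (\<integral>x. g x \<partial>M)" using i by (subst integral_R) auto
    finally show ?thesis
      using integral_abs_bound[of M "\<lambda>x. quot t f x - g x"] by simp
  qed
  then have "\<bar>\<integral>x. g x \<partial>M\<bar> \<le> 0"
    by (intro tendsto_lowerbound[OF lim _ trivial_limit_at]) auto
  then show ?thesis by simp
qed

text \<open>The Taylor remainder is at most a constant times the squared increment; divided by t it
  is a quotient times an increment, hence a bounded family times a null one.\<close>

lemma dv_chain:
  assumes d: "dv f g" and [measurable]: "\<phi> \<in> borel_measurable borel" "\<phi>' \<in> borel_measurable borel"
    and b: "\<And>u. \<bar>\<phi> u\<bar> \<le> c" "\<And>u. \<bar>\<phi>' u\<bar> \<le> c"
    and taylor: "\<And>u v. \<bar>\<phi> v - \<phi> u - \<phi>' u * (v - u)\<bar> \<le> c * (v - u)\<^sup>2"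
  shows "dv (\<lambda>x. \<phi> (f x)) (\<lambda>x. \<phi>' (f x) * g x)"
proof -
  note LL = dv_LLall[OF d]
  then have [measurable]: "f \<in> borel_measurable M" "g \<in> borel_measurable M" by auto
  have c0: "0 \<le> c" using b(1)[of 0] by simp
  have LL\<phi>: "(\<lambda>x. \<phi> (f x)) \<in> LLall" "(\<lambda>x. \<phi>' (f x)) \<in> LLall"
    by (rule LLall_bounded[where c=c]; use b in auto)+
  have q: "null (\<lambda>t x. quot t f x - g x)" using d by (simp add: dv_null)
  \<comment> \<open>The sum collapses to c (f \<circ> R t - f)^2 / t. It is written around
    \<open>quot t f x - g x\<close> because that difference is known to be null, whereas the
    quotient itself is bounded only near 0.\<close>
  define N where "N t x = ((quot t f x - g x) * (f (R t x) - f x) + (f (R t x) - f x) * g x) * c" for t x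
  have N: "null N"
    unfolding N_def
  proof (intro null_mult_fixed null_add null_increment[OF d] LL LLall_const null_mult[OF q])
    show "(\<lambda>x. f (R t x) - f x) \<in> LLall" for t by (intro LLall_diff LLall_R LL)
    fix p
    have "(\<integral>x. \<bar>f (R t x) - f x\<bar> ^ p \<partial>M) \<le> 2 ^ p * (2 * (\<integral>x. \<bar>f x\<bar> ^ p \<partial>M))" for t
    proof -
      have i: "integrable M (\<lambda>x. \<bar>f (R t x)\<bar> ^ p)" "integrable M (\<lambda>x. \<bar>f x\<bar> ^ p)"
        "integrable M (\<lambda>x. \<bar>f (R t x) - f x\<bar> ^ p)"
        by (intro LL_integrable LLall_D LLall_R LLall_diff LL)+
      have "(\<integral>x. \<bar>f (R t x) - f x\<bar> ^ p \<partial>M) \<le> (\<integral>x. 2 ^ p * (\<bar>f (R t x)\<bar> ^ p + \<bar>f x\<bar> ^ p) \<partial>M)"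
        using i abs_add_power_le[of _ "- f _" p] by (intro integral_mono) auto
      also have "\<dots> = 2 ^ p * (2 * (\<integral>x. \<bar>f x\<bar> ^ p \<partial>M))"
        using i integral_R[of "\<lambda>x. \<bar>f x\<bar> ^ p" t] by simp
      finally show ?thesis .
    qed
    then show "\<exists>B. \<forall>t. (\<integral>x. \<bar>f (R t x) - f x\<bar> ^ p \<partial>M) \<le> B" by blast
  qed
  define E where "E t x = (\<phi> (f (R t x)) - \<phi> (f x) - \<phi>' (f x) * (f (R t x) - f x)) / t" for t x
  have E: "null E"
  proof (rule null_dominated[OF N])
    show "E t \<in> borel_measurable M" for t unfolding E_def by measurable
    show "\<bar>E t x\<bar> \<le> \<bar>N t x\<bar>" for t x
    proof -
      have "\<bar>E t x\<bar> \<le> c * (f (R t x) - f x)\<^sup>2 / \<bar>t\<bar>"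
        unfolding E_def abs_divide by (intro divide_right_mono taylor) simp
      also have "\<dots> = \<bar>N t x\<bar>"
      proof -
        have "N t x = c * (f (R t x) - f x)\<^sup>2 / t"
          by (simp add: N_def quot_def power2_eq_square algebra_simps)
        then show ?thesis using c0 by (simp add: abs_mult)
      qed
      finally show ?thesis .
    qed
  qed
  have "null (\<lambda>t x. (quot t f x - g x) * \<phi>' (f x) + E t x)"
    by (intro null_add null_mult_fixed q E LL\<phi>)
  also have "(\<lambda>t x. (quot t f x - g x) * \<phi>' (f x) + E t x) = (\<lambda>t x. quot t (\<lambda>x. \<phi> (f x)) x - \<phi>' (f x) * g x)"
    by (auto simp: quot_def E_def fun_eq_iff diff_divide_distrib add_divide_distrib algebra_simps)
  finally show ?thesis unfolding dv_null using LL\<phi> LL by (auto intro: LLall_mult)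
qed

end

section \<open>Oscillatory integrals\<close>

definition Cb :: "(real \<Rightarrow> real) \<Rightarrow> bool" where
  "Cb h \<longleftrightarrow> (\<exists>D :: nat \<Rightarrow> real \<Rightarrow> real. D 0 = h \<and>
     (\<forall>k u. (D k has_real_derivative D (Suc k) u) (at u)) \<and> (\<forall>k. \<exists>c. \<forall>u. \<bar>D k u\<bar> \<le> c))"

lemma integral_pull_constant:
  fixes f g :: "'a \<Rightarrow> real"
  assumes "\<And>x. f x = c * g x"
  shows "(\<integral>x. f x \<partial>M) = c * (\<integral>x. g x \<partial>M)"
  by (simp add: assms)

lemma DERIV_scale:
  fixes h :: "real \<Rightarrow> real"
  assumes "\<And>u. (h has_real_derivative h' u) (at u)"
  shows "((\<lambda>u. h (s * u)) has_real_derivative s * h' (s * u)) (at u)"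
  by (rule DERIV_cong[OF DERIV_chain2[OF assms DERIV_cmult_Id]]) simp

lemma Cb_D:
  assumes "Cb h"
  obtains h' c where "Cb h'" "\<And>u. (h has_real_derivative h' u) (at u)" "0 \<le> c" "\<And>u. \<bar>h u\<bar> \<le> c"
proof -
  obtain D :: "nat \<Rightarrow> real \<Rightarrow> real" where D: "D 0 = h" "\<And>k u. (D k has_real_derivative D (Suc k) u) (at u)" "\<And>k. \<exists>c. \<forall>u. \<bar>D k u\<bar> \<le> c"
    using assms unfolding Cb_def by blast
  obtain c where c: "\<And>u. \<bar>h u\<bar> \<le> c" using D(3)[of 0] D(1) by auto
  have "Cb (D 1)" unfolding Cb_def by (rule exI[of _ "\<lambda>k. D (Suc k)"]) (use D in auto)
  moreover have "(h has_real_derivative D 1 u) (at u)" for u using D(2)[of 0 u] D(1) by simp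
  moreover have "0 \<le> c" using c[of 0] by linarith
  ultimately show ?thesis using c that by blast
qed

text \<open>A class of bounded functions in which every member has a derivative in the class
  consists of functions with all derivatives bounded; dependent choice assembles the sequence. This
  avoids explicit formulas for higher derivatives.\<close>

lemma Cb_coinduct:
  assumes "P h" and step: "\<And>f. P f \<Longrightarrow> (\<exists>c. \<forall>u. \<bar>f u\<bar> \<le> c) \<and> (\<exists>f'. P f' \<and> (\<forall>u. (f has_real_derivative f' u) (at u)))"
  shows "Cb h"
proof -
  have "\<exists>D. \<forall>n. (P (D n) \<and> (n = 0 \<longrightarrow> D n = h)) \<and> (\<forall>u. (D n has_real_derivative D (Suc n) u) (at u))"
  proof (rule dependent_nat_choice)
    show "\<exists>x. P x \<and> (0 = 0 \<longrightarrow> x = h)" using assms(1) by blast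
    show "\<exists>y. (P y \<and> (Suc n = 0 \<longrightarrow> y = h)) \<and> (\<forall>u. (x has_real_derivative y u) (at u))"
      if "P x \<and> (n = 0 \<longrightarrow> x = h)" for x n
      using step[of x] that by auto
  qed
  then obtain D where "\<And>n. (P (D n) \<and> (n = 0 \<longrightarrow> D n = h)) \<and> (\<forall>u. (D n has_real_derivative D (Suc n) u) (at u))"
    by blast
  then show ?thesis unfolding Cb_def using step by (intro exI[of _ D]) blast
qed

text \<open>The derivative of a product is a sum of products. Closing under both operations gives a
  class stable under differentiation and replaces the general Leibniz formula.\<close>

inductive Cb_closure :: "(real \<Rightarrow> real) \<Rightarrow> bool" where
  base: "Cb f \<Longrightarrow> Cb_closure f"
| add: "Cb_closure f \<Longrightarrow> Cb_closure g \<Longrightarrow> Cb_closure (\<lambda>u. f u + g u)"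
| mult: "Cb_closure f \<Longrightarrow> Cb_closure g \<Longrightarrow> Cb_closure (\<lambda>u. f u * g u)"

lemma Cb_closure_imp_Cb: "Cb_closure h \<Longrightarrow> Cb h"
proof (erule Cb_coinduct)
  fix f assume "Cb_closure f"
  then show "(\<exists>c. \<forall>u. \<bar>f u\<bar> \<le> c) \<and> (\<exists>f'. Cb_closure f' \<and> (\<forall>u. (f has_real_derivative f' u) (at u)))"
  proof induction
    case (base f)
    then obtain f' c where "Cb f'" "\<And>u. (f has_real_derivative f' u) (at u)" "\<And>u. \<bar>f u\<bar> \<le> c"
      using Cb_D by metis
    then show ?case using Cb_closure.base by blast
  next
    case (add f g)
    then obtain a b f' g' where *: "\<And>u. \<bar>f u\<bar> \<le> a" "\<And>u. \<bar>g u\<bar> \<le> b" "Cb_closure f'" "Cb_closure g'"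
      "\<And>u. (f has_real_derivative f' u) (at u)" "\<And>u. (g has_real_derivative g' u) (at u)" by blast
    have "\<bar>f u + g u\<bar> \<le> a + b" for u using *(1)[of u] *(2)[of u] by linarith
    moreover have "((\<lambda>u. f u + g u) has_real_derivative f' u + g' u) (at u)" for u
      by (intro derivative_intros *)
    ultimately show ?case using Cb_closure.add[OF *(3,4)]
      by (intro conjI exI[of _ "a + b"] exI[of _ "\<lambda>u. f' u + g' u"]) auto
  next
    case (mult f g)
    then obtain a b f' g' where *: "\<And>u. \<bar>f u\<bar> \<le> a" "\<And>u. \<bar>g u\<bar> \<le> b" "Cb_closure f'" "Cb_closure g'"
      "\<And>u. (f has_real_derivative f' u) (at u)" "\<And>u. (g has_real_derivative g' u) (at u)" by blast
    have "\<bar>f u * g u\<bar> \<le> a * b" for u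
      unfolding abs_mult using *(1,2)[of u] by (intro mult_mono) auto
    moreover have "((\<lambda>u. f u * g u) has_real_derivative f' u * g u + g' u * f u) (at u)" for u
      by (intro derivative_intros *)
    moreover have "Cb_closure (\<lambda>u. f' u * g u + g' u * f u)"
      using * mult.hyps by (intro Cb_closure.intros(2,3))
    ultimately show ?case
      by (intro conjI exI[of _ "a * b"] exI[of _ "\<lambda>u. f' u * g u + g' u * f u"]) auto
  qed
qed

lemma Cb_mult: "Cb f \<Longrightarrow> Cb g \<Longrightarrow> Cb (\<lambda>u. f u * g u)"
  by (rule Cb_closure_imp_Cb, rule Cb_closure.mult; rule Cb_closure.base)

lemma Cb_const: "Cb (\<lambda>u. c)"
  by (rule Cb_coinduct[where P = "\<lambda>f. \<exists>c. f = (\<lambda>u. c)"]) (blast intro: DERIV_const)+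

lemma Cb_power: "Cb f \<Longrightarrow> Cb (\<lambda>u. f u ^ n)"
  by (induction n) (auto intro: Cb_const Cb_mult)

lemma Cb_scale:
  assumes "Cb h" shows "Cb (\<lambda>u. h (s * u))"
proof -
  obtain D :: "nat \<Rightarrow> real \<Rightarrow> real" where D: "D 0 = h" "\<And>k u. (D k has_real_derivative D (Suc k) u) (at u)" "\<And>k. \<exists>c. \<forall>u. \<bar>D k u\<bar> \<le> c"
    using assms unfolding Cb_def by blast
  show ?thesis unfolding Cb_def
  proof (intro exI[of _ "\<lambda>k u. s ^ k * D k (s * u)"] conjI allI)
    show "((\<lambda>u. s ^ k * D k (s * u)) has_real_derivative s ^ Suc k * D (Suc k) (s * u)) (at u)" for k u
      by (rule derivative_eq_intros DERIV_chain2[OF D(2)] refl)+ simp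
    fix k
    obtain c where "\<And>u. \<bar>D k u\<bar> \<le> c" using D(3) by blast
    then show "\<exists>c. \<forall>u. \<bar>s ^ k * D k (s * u)\<bar> \<le> c"
      by (intro exI[of _ "\<bar>s ^ k\<bar> * c"]) (auto simp: abs_mult intro: mult_left_mono)
  qed (use D in auto)
qed

text \<open>Differentiation shifts the phase by pi/2, which gives all derivatives in one
  formula.\<close>

lemma Cb_sin: "Cb sin" and Cb_cos: "Cb cos"
proof -
  have d: "((\<lambda>u. sin (u + real k * (pi/2))) has_real_derivative sin (u + real (Suc k) * (pi/2))) (at u)" for k u
  proof -
    have "sin (u + real (Suc k) * (pi/2)) = sin ((u + real k * (pi/2)) + pi/2)" by (simp add: algebra_simps add_divide_distrib)
    also have "\<dots> = cos (u + real k * (pi/2))" by (simp add: sin_add)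
    finally show ?thesis by (auto intro!: derivative_eq_intros)
  qed
  show "Cb sin" unfolding Cb_def
    by (rule exI[of _ "\<lambda>k u. sin (u + real k * (pi/2))"]) (use d in \<open>auto intro: exI[of _ 1]\<close>)
  have "Cb (\<lambda>u. sin (u + real (Suc 0) * (pi/2)))" unfolding Cb_def
    by (rule exI[of _ "\<lambda>k u. sin (u + real (Suc k) * (pi/2))"]) (use d in \<open>auto intro: exI[of _ 1] simp del: of_nat_Suc\<close>)
  then show "Cb cos" by (simp add: sin_add)
qed

text \<open>\<sigma>(u) is the integral of cos(u v) over v in [0, 1]. In this form smoothness at u =
  0 needs no separate treatment, and the k-th derivative, with integrand v^k cos(u v + k pi/2), is
  bounded by 1.\<close>

lemma sinc_Cb:
  obtains \<sigma> where "Cb \<sigma>" "\<And>u. sin u = u * \<sigma> u"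
proof -
  define D where "D k u = integral {0..1} (\<lambda>v. v ^ k * cos (u * v + real k * (pi/2)))" for k :: nat and u :: real
  have cosshift: "cos (w + real (Suc k) * (pi/2)) = - sin (w + real k * (pi/2))" for w k
  proof -
    have "cos (w + real (Suc k) * (pi/2)) = cos ((w + real k * (pi/2)) + pi/2)" by (simp add: algebra_simps add_divide_distrib)
    then show ?thesis by (simp add: cos_add)
  qed
  have deriv: "(D k has_real_derivative D (Suc k) u) (at u)" for k u
    unfolding D_def
  proof (rule leibniz_rule_field_derivative[where U=UNIV and a="0::real" and b=1, unfolded cbox_interval])
    fix x t :: real
    show "((\<lambda>x. t ^ k * cos (x * t + real k * (pi / 2))) has_real_derivative t ^ Suc k * cos (x * t + real (Suc k) * (pi/2))) (at x)"
      unfolding cosshift by (auto intro!: derivative_eq_intros)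
    show "(\<lambda>v. v ^ k * cos (x * v + real k * (pi / 2))) integrable_on {0..1}"
      by (intro integrable_continuous_real continuous_intros)
  qed (auto intro!: continuous_intros simp: case_prod_beta)
  have "Cb (D 0)" unfolding Cb_def
  proof (intro exI[of _ D] conjI allI deriv)
    fix k
    have "\<bar>D k u\<bar> \<le> 1" for u
    proof -
      have "norm (integral {0..1} (\<lambda>v. v ^ k * cos (u * v + real k * (pi/2)))) \<le> integral {0..1} (\<lambda>v::real. 1)"
      proof (rule Henstock_Kurzweil_Integration.integral_norm_bound_integral)
        fix v :: real assume v: "v \<in> {0..1}"
        have "\<bar>v ^ k\<bar> * \<bar>cos (u * v + real k * (pi/2))\<bar> \<le> 1 * 1"
          using v by (intro mult_mono) (auto simp: power_abs intro!: power_le_one)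
        then show "norm (v ^ k * cos (u * v + real k * (pi/2))) \<le> 1" by (simp add: abs_mult)
      qed (intro integrable_continuous_real continuous_intros)+
      then show ?thesis by (simp add: D_def)
    qed
    then show "\<exists>c. \<forall>u. \<bar>D k u\<bar> \<le> c" by blast
  qed simp
  moreover have "sin u = u * D 0 u" for u
  proof -
    have "((\<lambda>v. u * cos (u * v)) has_integral (sin (u * 1) - sin (u * 0))) {0..1}"
      by (rule fundamental_theorem_of_calculus)
         (auto intro!: derivative_eq_intros simp flip: has_real_derivative_iff_has_vector_derivative)
    then have "integral {0..1} (\<lambda>v. u * cos (u * v)) = sin (u * 1) - sin (u * 0)" by (rule integral_unique)
    then show ?thesis by (simp add: D_def)
  qed
  ultimately show ?thesis by (rule that)
qed

context flow
begin

lemma dv_comp_Cb: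
  assumes "dv f g" "Cb h" and h': "\<And>u. (h has_real_derivative h' u) (at u)"
  shows "dv (\<lambda>x. h (f x)) (\<lambda>x. h' (f x) * g x)"
proof -
  obtain k a where k: "Cb k" "\<And>u. (h has_real_derivative k u) (at u)" "0 \<le> a" "\<And>u. \<bar>h u\<bar> \<le> a"
    using Cb_D[OF assms(2)] by metis
  have "k = h'" by (rule ext, rule DERIV_unique[OF k(2) h'])
  then obtain h'' b where h'': "Cb h''" "\<And>u. (h' has_real_derivative h'' u) (at u)" "0 \<le> b" "\<And>u. \<bar>h' u\<bar> \<le> b"
    using Cb_D[OF k(1)] by metis
  obtain e where e: "0 \<le> e" "\<And>u. \<bar>h'' u\<bar> \<le> e" using Cb_D[OF h''(1)] by metis
  have m: "h \<in> borel_measurable borel" "h' \<in> borel_measurable borel"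
    using h' h''(2) by (auto intro!: borel_measurable_continuous_onI DERIV_isCont continuous_at_imp_continuous_on)
  show ?thesis
  proof (rule dv_chain[OF assms(1) m, where c="a + b + e"])
    show "\<bar>h u\<bar> \<le> a + b + e" "\<bar>h' u\<bar> \<le> a + b + e" for u
      using k(3) k(4)[of u] h''(3) h''(4)[of u] e(1) by linarith+
    fix u v
    obtain w where w: "\<bar>w - u\<bar> \<le> \<bar>v - u\<bar>" "h (u + (v - u)) - h u = (v - u) * h' w"
      by (rule mvt_segment[of u "v - u" h h']) (use h' in auto)
    obtain z where z: "h' (u + (w - u)) - h' u = (w - u) * h'' z"
      by (rule mvt_segment[of u "w - u" h' h'']) (use h'' in auto)
    have "h v - h u - h' u * (v - u) = (v - u) * (h' w - h' u)" using w(2) by (simp add: algebra_simps)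
    also have "\<dots> = (v - u) * ((w - u) * h'' z)" using z by simp
    finally have "\<bar>h v - h u - h' u * (v - u)\<bar> = \<bar>v - u\<bar> * (\<bar>w - u\<bar> * \<bar>h'' z\<bar>)" by (simp add: abs_mult)
    also have "\<dots> \<le> \<bar>v - u\<bar> * (\<bar>v - u\<bar> * (a + b + e))"
      using w(1) e(2)[of z] k(3) h''(3) by (intro mult_left_mono mult_mono) auto
    also have "\<dots> = (a + b + e) * (v - u)\<^sup>2" by (simp add: power2_eq_square)
    finally show "\<bar>h v - h u - h' u * (v - u)\<bar> \<le> (a + b + e) * (v - u)\<^sup>2" .
  qed
qed

lemma dv_power: "dv f g \<Longrightarrow> dv (\<lambda>x. f x ^ Suc m) (\<lambda>x. real (Suc m) * f x ^ m * g x)"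
proof (induction m)
  case (Suc m)
  have "(\<lambda>x. g x * f x ^ Suc m + f x * (real (Suc m) * f x ^ m * g x)) = (\<lambda>x. real (Suc (Suc m)) * f x ^ Suc m * g x)"
    by (auto simp: fun_eq_iff algebra_simps)
  with dv_mult[OF Suc.prems Suc.IH[OF Suc.prems]] show ?case by simp
qed simp

text \<open>Repeated integration by parts produces weights that are polynomials in the successive
  derivatives. This class is stable under differentiation and so carries the induction on the number
  of steps.\<close>

inductive alg :: "(nat \<Rightarrow> 'a \<Rightarrow> real) \<Rightarrow> ('a \<Rightarrow> real) \<Rightarrow> bool" for X where
  alg_X: "alg X (X k)"
| alg_const: "alg X (\<lambda>x. c)"
| alg_add: "alg X f \<Longrightarrow> alg X g \<Longrightarrow> alg X (\<lambda>x. f x + g x)"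
| alg_mult: "alg X f \<Longrightarrow> alg X g \<Longrightarrow> alg X (\<lambda>x. f x * g x)"

lemma alg_dv:
  assumes X: "\<And>k. dv (X k) (X (Suc k))"
  shows "alg X f \<Longrightarrow> \<exists>g. alg X g \<and> dv f g"
proof (induction rule: alg.induct)
  case (alg_X k) show ?case using X alg.alg_X by blast
next
  case (alg_const c) show ?case using dv_const alg.alg_const by blast
next
  case (alg_add f g)
  then show ?case using dv_add alg.alg_add by blast
next
  case (alg_mult f g)
  then obtain f' g' where *: "alg X f'" "dv f f'" "alg X g'" "dv g g'" by blast
  show ?case
    by (rule exI[of _ "\<lambda>x. f' x * g x + f x * g' x"])
       (use * alg_mult in \<open>auto intro: alg.intros dv_mult\<close>)
qed

text \<open>Each integration by parts gains 1/t. It consumes two powers of X 1: one is the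
  derivative of the phase, the other is lost when the remaining power is differentiated.
  Differentiating h(s X 1) costs a factor s, so n steps give (s/t)^n. Sine and cosine are treated
  together since they exchange roles.\<close>

lemma oscillatory_decay:
  assumes X: "\<And>k. dv (X k) (X (Suc k))" and "alg X W" "Cb h"
  shows "\<exists>C\<ge>0. \<forall>s t. 1 \<le> s \<longrightarrow> 0 < t \<longrightarrow>
    \<bar>\<integral>x. sin (t * X 0 x) * (W x * X 1 x ^ (2 * n) * h (s * X 1 x)) \<partial>M\<bar> \<le> C * (s / t) ^ n \<and>
    \<bar>\<integral>x. cos (t * X 0 x) * (W x * X 1 x ^ (2 * n) * h (s * X 1 x)) \<partial>M\<bar> \<le> C * (s / t) ^ n"
  using assms(2,3)
proof (induction n arbitrary: W h)
  case 0
  obtain c where c: "0 \<le> c" "\<And>u. \<bar>h u\<bar> \<le> c" using Cb_D[OF \<open>Cb h\<close>] by metis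
  obtain W' where "dv W W'" using alg_dv[OF X 0(1)] by blast
  then have W: "W \<in> LLall" by (rule dv_LLall)
  have hm: "h \<in> borel_measurable borel"
    using Cb_D[OF \<open>Cb h\<close>] by (metis DERIV_isCont borel_measurable_continuous_onI continuous_at_imp_continuous_on)
  have [measurable]: "\<And>k. X k \<in> borel_measurable M" "W \<in> borel_measurable M"
    using dv_LLall[OF X] W by auto
  have Wi: "integrable M (\<lambda>x. \<bar>W x\<bar>)" using LLall_integrable[OF W] by simp
  have main: "\<bar>\<integral>x. e (t * X 0 x) * (W x * h (s * X 1 x)) \<partial>M\<bar> \<le> c * (\<integral>x. \<bar>W x\<bar> \<partial>M)"
    if e: "\<And>u. \<bar>e u\<bar> \<le> 1" "e \<in> borel_measurable borel" for e :: "real \<Rightarrow> real" and s t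
  proof -
    note [measurable] = hm e(2)
    have b: "\<bar>e (t * X 0 x) * (W x * h (s * X 1 x))\<bar> \<le> c * \<bar>W x\<bar>" for x
    proof -
      have "\<bar>e (t * X 0 x) * (W x * h (s * X 1 x))\<bar> \<le> 1 * (\<bar>W x\<bar> * c)"
        unfolding abs_mult using e c by (intro mult_mono) auto
      then show ?thesis by (simp add: mult.commute)
    qed
    have i: "integrable M (\<lambda>x. e (t * X 0 x) * (W x * h (s * X 1 x)))"
      by (rule Bochner_Integration.integrable_bound[where f="\<lambda>x. c * \<bar>W x\<bar>"])
         (use Wi b c in \<open>auto intro!: order_trans[OF b]\<close>)
    have "\<bar>\<integral>x. e (t * X 0 x) * (W x * h (s * X 1 x)) \<partial>M\<bar> \<le> (\<integral>x. \<bar>e (t * X 0 x) * (W x * h (s * X 1 x))\<bar> \<partial>M)"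
      by (rule integral_abs_bound)
    also have "\<dots> \<le> (\<integral>x. c * \<bar>W x\<bar> \<partial>M)" using i Wi b by (intro integral_mono) auto
    finally show ?thesis by simp
  qed
  show ?case
    by (rule exI[of _ "c * (\<integral>x. \<bar>W x\<bar> \<partial>M)"]) (use main[of sin] main[of cos] c in \<open>auto intro: integral_nonneg_AE\<close>)
next
  case (Suc n)
  obtain h' where h': "Cb h'" "\<And>u. (h has_real_derivative h' u) (at u)" using Cb_D[OF \<open>Cb h\<close>] by metis
  obtain W' where W': "alg X W'" "dv W W'" using alg_dv[OF X Suc.prems(1)] by blast
  \<comment> \<open>\<open>W1\<close> collects the terms where the weight or the power of X 1 is
    differentiated, \<open>W2\<close> those where h is; both retain the common factor X 1 ^
    (2n).\<close>
  define W1 where "W1 x = W' x * X 1 x + real (Suc (2 * n)) * (W x * X 2 x)" for x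
  define W2 where "W2 x = W x * (X 1 x * X 2 x)" for x
  have alg12: "alg X W1" "alg X W2"
    unfolding W1_def[abs_def] W2_def[abs_def] by (intro alg.intros W'(1) Suc.prems(1))+
  define I where "I e V k s t = (\<integral>x. e (t * X 0 x) * (V x * X 1 x ^ (2 * n) * k (s * X 1 x)) \<partial>M)"
    for e k :: "real \<Rightarrow> real" and V s t
  obtain C1 where C1: "0 \<le> C1" "\<And>s t. 1 \<le> s \<Longrightarrow> 0 < t \<Longrightarrow> \<bar>I sin W1 h s t\<bar> \<le> C1 * (s / t) ^ n \<and> \<bar>I cos W1 h s t\<bar> \<le> C1 * (s / t) ^ n"
    using Suc.IH[OF alg12(1) \<open>Cb h\<close>] unfolding I_def by blast
  obtain C2 where C2: "0 \<le> C2" "\<And>s t. 1 \<le> s \<Longrightarrow> 0 < t \<Longrightarrow> \<bar>I sin W2 h' s t\<bar> \<le> C2 * (s / t) ^ n \<and> \<bar>I cos W2 h' s t\<bar> \<le> C2 * (s / t) ^ n"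
    using Suc.IH[OF alg12(2) h'(1)] unfolding I_def by blast
  have "\<bar>\<integral>x. sin (t * X 0 x) * (W x * X 1 x ^ (2 * Suc n) * h (s * X 1 x)) \<partial>M\<bar> \<le> (C1 + C2) * (s / t) ^ Suc n \<and>
    \<bar>\<integral>x. cos (t * X 0 x) * (W x * X 1 x ^ (2 * Suc n) * h (s * X 1 x)) \<partial>M\<bar> \<le> (C1 + C2) * (s / t) ^ Suc n"
    if st: "1 \<le> s" "0 < t" for s t
  proof -
    \<comment> \<open>The exponent is odd: the missing power of X 1 comes from the derivative of
      sin(t X 0) or cos(t X 0).\<close>
    define A where "A x = W x * (X 1 x ^ Suc (2 * n) * h (s * X 1 x))" for x
    define B where "B x = W1 x * X 1 x ^ (2 * n) * h (s * X 1 x) + s * (W2 x * X 1 x ^ (2 * n) * h' (s * X 1 x))" for x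
    have dh: "((\<lambda>u. h (s * u)) has_real_derivative s * h' (s * u)) (at u)" for u
      by (rule DERIV_scale[OF h'(2)])
    have X12: "dv (X 1) (X 2)" using X[of 1] by (simp add: numeral_2_eq_2)
    have AB: "dv A B"
    proof -
      have "dv A (\<lambda>x. W' x * (X 1 x ^ Suc (2 * n) * h (s * X 1 x)) + W x *
         ((real (Suc (2 * n)) * X 1 x ^ (2 * n) * X 2 x) * h (s * X 1 x) + X 1 x ^ Suc (2 * n) * (s * h' (s * X 1 x) * X 2 x)))"
        unfolding A_def[abs_def]
        by (intro dv_mult W'(2) dv_power X12 dv_comp_Cb[OF X12 Cb_scale[OF \<open>Cb h\<close>] dh])
      also have "(\<lambda>x. W' x * (X 1 x ^ Suc (2 * n) * h (s * X 1 x)) + W x *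
         ((real (Suc (2 * n)) * X 1 x ^ (2 * n) * X 2 x) * h (s * X 1 x) + X 1 x ^ Suc (2 * n) * (s * h' (s * X 1 x) * X 2 x))) = B"
        unfolding B_def[abs_def] W1_def W2_def by (auto simp: fun_eq_iff algebra_simps)
      finally show ?thesis .
    qed
    have dsin: "dv (\<lambda>x. sin (t * X 0 x)) (\<lambda>x. t * cos (t * X 0 x) * X 1 x)"
    proof -
      have "((\<lambda>u. sin (t * u)) has_real_derivative t * cos (t * u)) (at u)" for u
        by (auto intro!: derivative_eq_intros)
      from dv_comp_Cb[OF X[of 0] Cb_scale[OF Cb_sin] this] show ?thesis by simp
    qed
    have dcos: "dv (\<lambda>x. cos (t * X 0 x)) (\<lambda>x. - t * sin (t * X 0 x) * X 1 x)"
    proof -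
      have "((\<lambda>u. cos (t * u)) has_real_derivative - t * sin (t * u)) (at u)" for u
        by (auto intro!: derivative_eq_intros)
      from dv_comp_Cb[OF X[of 0] Cb_scale[OF Cb_cos] this] show ?thesis by simp
    qed
    note LL = dv_LLall[OF AB] dv_LLall[OF dsin] dv_LLall[OF dcos]
    have i: "integrable M (\<lambda>x. sin (t * X 0 x) * B x)" "integrable M (\<lambda>x. cos (t * X 0 x) * B x)"
      "integrable M (\<lambda>x. t * cos (t * X 0 x) * X 1 x * A x)" "integrable M (\<lambda>x. - t * sin (t * X 0 x) * X 1 x * A x)"
      by (intro LLall_integrable LLall_mult LL)+
    have "(\<integral>x. t * cos (t * X 0 x) * X 1 x * A x + sin (t * X 0 x) * B x \<partial>M) = 0"
      by (rule dv_integral_0[OF dv_mult[OF dsin AB]])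
    then have eqs: "(\<integral>x. t * cos (t * X 0 x) * X 1 x * A x \<partial>M) = - (\<integral>x. sin (t * X 0 x) * B x \<partial>M)"
      using i by simp
    have "(\<integral>x. - t * sin (t * X 0 x) * X 1 x * A x + cos (t * X 0 x) * B x \<partial>M) = 0"
      by (rule dv_integral_0[OF dv_mult[OF dcos AB]])
    then have eqc: "(\<integral>x. - t * sin (t * X 0 x) * X 1 x * A x \<partial>M) = - (\<integral>x. cos (t * X 0 x) * B x \<partial>M)"
      using i by (subst (asm) Bochner_Integration.integral_add) auto
    obtain V1 V2 where V: "dv W1 V1" "dv W2 V2" using alg_dv[OF X alg12(1)] alg_dv[OF X alg12(2)] by blast
    have LLh: "(\<lambda>x. h (s * X 1 x)) \<in> LLall"
      by (rule dv_LLall(1)[OF dv_comp_Cb[OF X12 Cb_scale[OF \<open>Cb h\<close>] dh]])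
    obtain h'' where h'': "Cb h''" "\<And>u. (h' has_real_derivative h'' u) (at u)" using Cb_D[OF h'(1)] by metis
    have dh': "((\<lambda>u. h' (s * u)) has_real_derivative s * h'' (s * u)) (at u)" for u
      by (rule DERIV_scale[OF h''(2)])
    have LLh': "(\<lambda>x. h' (s * X 1 x)) \<in> LLall"
      by (rule dv_LLall(1)[OF dv_comp_Cb[OF X12 Cb_scale[OF h'(1)] dh']])
    have LLp: "(\<lambda>x. X 1 x ^ (2 * n)) \<in> LLall"
    proof (cases "2 * n")
      case 0 then show ?thesis by (simp add: LLall_const)
    next
      case (Suc m) then show ?thesis using dv_LLall(1)[OF dv_power[OF X12, of m]] by simp
    qed
    have split: "(\<integral>x. e (t * X 0 x) * B x \<partial>M) = I e W1 h s t + s * I e W2 h' s t"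
      if e: "(\<lambda>x. e (t * X 0 x)) \<in> LLall" for e
    proof -
      have i: "integrable M (\<lambda>x. e (t * X 0 x) * (W1 x * X 1 x ^ (2 * n) * h (s * X 1 x)))"
        "integrable M (\<lambda>x. e (t * X 0 x) * (W2 x * X 1 x ^ (2 * n) * h' (s * X 1 x)))"
        by (intro LLall_integrable LLall_mult e dv_LLall(1)[OF V(1)] dv_LLall(1)[OF V(2)] LLh LLh' LLp)+
      have "(\<integral>x. e (t * X 0 x) * B x \<partial>M) = (\<integral>x. e (t * X 0 x) * (W1 x * X 1 x ^ (2 * n) * h (s * X 1 x))
          + s * (e (t * X 0 x) * (W2 x * X 1 x ^ (2 * n) * h' (s * X 1 x))) \<partial>M)"
        by (intro Bochner_Integration.integral_cong) (auto simp: B_def algebra_simps)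
      also have "\<dots> = I e W1 h s t + s * I e W2 h' s t" unfolding I_def using i by simp
      finally show ?thesis .
    qed
    \<comment> \<open>The \<open>W1\<close> term carries no factor s; it is absorbed into the s of
      the other term because s \<ge> 1.\<close>
    have bound: "a + s * b \<le> (C1 + C2) * s * (s / t) ^ n"
      if "a \<le> C1 * (s / t) ^ n" "b \<le> C2 * (s / t) ^ n" for a b
    proof -
      have p: "0 \<le> (s / t) ^ n" using st by simp
      have "a + s * b \<le> C1 * (s / t) ^ n + s * (C2 * (s / t) ^ n)"
        using that st by (intro add_mono mult_left_mono) auto
      also have "C1 * (s / t) ^ n \<le> s * (C1 * (s / t) ^ n)"
        using mult_right_mono[OF st(1), of "C1 * (s / t) ^ n"] C1 p by simp
      finally show ?thesis by (simp add: algebra_simps)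
    qed
    have tri: "\<bar>I e W1 h s t + s * I e W2 h' s t\<bar> \<le> \<bar>I e W1 h s t\<bar> + s * \<bar>I e W2 h' s t\<bar>" for e
      using st abs_triangle_ineq[of "I e W1 h s t" "s * I e W2 h' s t"] by (simp add: abs_mult)
    have fin: "\<bar>J\<bar> \<le> (C1 + C2) * (s / t) ^ Suc n" if "\<bar>t * J\<bar> \<le> (C1 + C2) * s * (s / t) ^ n" for J
    proof -
      have "t * \<bar>J\<bar> \<le> t * ((C1 + C2) * (s / t) ^ Suc n)"
        using that st by (simp add: abs_mult)
      then show ?thesis by (rule mult_left_le_imp_le[OF _ st(2)])
    qed
    have "(\<integral>x. t * cos (t * X 0 x) * X 1 x * A x \<partial>M) = t * (\<integral>x. cos (t * X 0 x) * (W x * X 1 x ^ (2 * Suc n) * h (s * X 1 x)) \<partial>M)"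
      by (rule integral_pull_constant) (simp add: A_def)
    then have c: "\<bar>t * (\<integral>x. cos (t * X 0 x) * (W x * X 1 x ^ (2 * Suc n) * h (s * X 1 x)) \<partial>M)\<bar> \<le> (C1 + C2) * s * (s / t) ^ n"
      using eqs split[of sin] LL tri[of sin] bound[of "\<bar>I sin W1 h s t\<bar>" "\<bar>I sin W2 h' s t\<bar>"] C1(2)[OF st] C2(2)[OF st]
      by simp
    have "(\<integral>x. - t * sin (t * X 0 x) * X 1 x * A x \<partial>M) = - t * (\<integral>x. sin (t * X 0 x) * (W x * X 1 x ^ (2 * Suc n) * h (s * X 1 x)) \<partial>M)"
      by (rule integral_pull_constant) (simp add: A_def)
    then have d: "\<bar>t * (\<integral>x. sin (t * X 0 x) * (W x * X 1 x ^ (2 * Suc n) * h (s * X 1 x)) \<partial>M)\<bar> \<le> (C1 + C2) * s * (s / t) ^ n"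
      using eqc split[of cos] LL tri[of cos] bound[of "\<bar>I cos W1 h s t\<bar>" "\<bar>I cos W2 h' s t\<bar>"] C1(2)[OF st] C2(2)[OF st]
      by simp
    show ?thesis using fin[OF c] fin[OF d] by blast
  qed
  then show ?case using C1(1) C2(1) by (intro exI[of _ "C1 + C2"]) auto
qed

text \<open>By the half-angle formula 2 - 2 cos(s y) is the square of s y \<sigma>(s y / 2). Its
  n-th power is s^(2n) times y^(2n) times a function of s y bounded with all derivatives, the shape
  that \<open>oscillatory_decay\<close> treats with weight 1.\<close>

theorem oscillatory_decay_cos:
  assumes X: "\<And>k. dv (X k) (X (Suc k))"
  obtains C where "\<And>s t. 1 \<le> s \<Longrightarrow> 0 < t \<Longrightarrow>
    \<bar>\<integral>x. sin (t * X 0 x) * (2 - 2 * cos (s * X 1 x)) ^ n \<partial>M\<bar> \<le> C * s ^ (2 * n) * (s / t) ^ n"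
    "\<And>s t. 1 \<le> s \<Longrightarrow> 0 < t \<Longrightarrow>
    \<bar>\<integral>x. cos (t * X 0 x) * (2 - 2 * cos (s * X 1 x)) ^ n \<partial>M\<bar> \<le> C * s ^ (2 * n) * (s / t) ^ n"
proof -
  obtain \<sigma> where \<sigma>: "Cb \<sigma>" "\<And>u. sin u = u * \<sigma> u" by (rule sinc_Cb) blast
  define h where "h u = \<sigma> (1/2 * u) ^ (2 * n)" for u
  have h: "Cb h" unfolding h_def[abs_def] by (intro Cb_power Cb_scale \<sigma>)
  have e: "(2 - 2 * cos (s * y)) ^ n = s ^ (2 * n) * (1 * y ^ (2 * n) * h (s * y))" for s y :: real
  proof -
    have "2 - 2 * cos (s * y) = (2 * sin (1/2 * (s * y)))\<^sup>2"
      using cos_double_sin[of "1/2 * (s * y)"] by (simp add: power2_eq_square)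
    also have "2 * sin (1/2 * (s * y)) = s * y * \<sigma> (1/2 * (s * y))" by (subst \<sigma>(2)) simp
    finally show ?thesis by (simp add: h_def power_mult_distrib power_mult)
  qed
  obtain C where C: "\<And>s t. 1 \<le> s \<Longrightarrow> 0 < t \<Longrightarrow>
    \<bar>\<integral>x. sin (t * X 0 x) * (1 * X 1 x ^ (2 * n) * h (s * X 1 x)) \<partial>M\<bar> \<le> C * (s / t) ^ n \<and>
    \<bar>\<integral>x. cos (t * X 0 x) * (1 * X 1 x ^ (2 * n) * h (s * X 1 x)) \<partial>M\<bar> \<le> C * (s / t) ^ n"
    using oscillatory_decay[OF X alg_const[of X 1] h, of n] by blast
  have pull: "(\<integral>x. e (t * X 0 x) * (2 - 2 * cos (s * X 1 x)) ^ n \<partial>M)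
     = s ^ (2 * n) * (\<integral>x. e (t * X 0 x) * (1 * X 1 x ^ (2 * n) * h (s * X 1 x)) \<partial>M)" for e :: "real \<Rightarrow> real" and s t
    by (rule integral_pull_constant) (simp add: e)
  show ?thesis
    by (rule that[of C]; unfold pull abs_mult; use C in \<open>auto simp: mult.assoc mult.left_commute intro: mult_left_mono\<close>)
qed

end

section \<open>Fourier decay and smooth densities\<close>

lemma deriv_under_integral:
  fixes g g' :: "real \<Rightarrow> 'a \<Rightarrow> real"
  assumes g [measurable]: "\<And>x. integrable M (g x)" and [measurable]: "\<And>x. g' x \<in> borel_measurable M"
    and w: "integrable M w" and b: "\<And>x t. \<bar>g' x t\<bar> \<le> w t"
    and d: "\<And>x t. ((\<lambda>x. g x t) has_real_derivative g' x t) (at x)"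
  shows "((\<lambda>x. \<integral>t. g x t \<partial>M) has_real_derivative (\<integral>t. g' x t \<partial>M)) (at x)"
  unfolding DERIV_def tendsto_at_iff_sequentially comp_def
proof (intro allI impI)
  fix X :: "nat \<Rightarrow> real" assume X: "\<forall>i. X i \<in> UNIV - {0}" "X \<longlonglongrightarrow> 0"
  have lim: "(\<lambda>n. \<integral>t. (g (x + X n) t - g x t) / X n \<partial>M) \<longlonglongrightarrow> (\<integral>t. g' x t \<partial>M)"
  proof (rule integral_dominated_convergence[OF _ _ w])
    show "AE t in M. (\<lambda>n. (g (x + X n) t - g x t) / X n) \<longlonglongrightarrow> g' x t"
      using d[of _ x, unfolded DERIV_def tendsto_at_iff_sequentially comp_def] X by (intro AE_I2) blast
    show "AE t in M. norm ((g (x + X n) t - g x t) / X n) \<le> w t" for n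
    proof (intro AE_I2)
      fix t
      obtain u where "g (x + X n) t - g x t = X n * g' u t"
        by (rule mvt_segment[of x "X n" "\<lambda>x. g x t" "\<lambda>x. g' x t"]) (use d in auto)
      then show "norm ((g (x + X n) t - g x t) / X n) \<le> w t" using X b[of u t] by simp
    qed
  qed measurable
  have e: "(\<integral>t. (g (x + X n) t - g x t) / X n \<partial>M) = ((\<integral>t. g (x + X n) t \<partial>M) - (\<integral>t. g x t \<partial>M)) / X n" for n
    using g by simp
  show "(\<lambda>n. ((\<integral>t. g (x + X n) t \<partial>M) - (\<integral>t. g x t \<partial>M)) / X n) \<longlonglongrightarrow> (\<integral>t. g' x t \<partial>M)"
    using lim unfolding e .
qed

section \<open>Fourier inversion for a rapidly decaying characteristic function\<close>

context real_distribution
begin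

text \<open>\<open>inv_integrand k x\<close> is the \<open>k\<close>-th \<open>x\<close>-derivative of \<open>Re (exp (- i t x) char M t)\<close>.\<close>

definition inv_integrand :: "nat \<Rightarrow> real \<Rightarrow> real \<Rightarrow> real" where
  "inv_integrand k x t = t ^ k * (cos (t * x + real k * (pi/2)) * Re (char M t) + sin (t * x + real k * (pi/2)) * Im (char M t))"

text \<open>The primitive in x of \<open>inv_integrand 0\<close> that vanishes at x = 0; at t = 0 it
  takes the limiting value. Levy's formula concerns intervals, so it yields the primitive first and
  the density by differentiation.\<close>

definition inv_primitive :: "real \<Rightarrow> real \<Rightarrow> real" where
  "inv_primitive x t = (if t = 0 then x * Re (char M 0) else (sin (t * x) * Re (char M t) + (1 - cos (t * x)) * Im (char M t)) / t)"

lemma char_measurable' [measurable]: "char M \<in> borel_measurable borel"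
  using isCont_char by (intro borel_measurable_continuous_onI) (simp add: continuous_at_imp_continuous_on)

lemma char_decay_integrable:
  assumes decay: "\<And>n. \<exists>C. \<forall>t\<ge>1. cmod (char M t) \<le> C / t ^ n"
  shows "integrable lborel (\<lambda>t. \<bar>t\<bar> ^ k * cmod (char M t))"
proof -
  \<comment> \<open>Two powers beyond k leave 1/t^2, comparable to the integrable 1/(1 + t^2). In
    the majorant 2 C serves |t| \<ge> 1 and 2 serves |t| < 1.\<close>
  obtain C where C: "\<And>t. t \<ge> 1 \<Longrightarrow> cmod (char M t) \<le> C / t ^ (k + 2)" using decay by blast
  have C0: "0 \<le> C" using order_trans[OF norm_ge_zero C[of 1]] by simp
  \<comment> \<open>The decay hypothesis concerns positive t only; negative t follow because the
    characteristic function of -t is the complex conjugate.\<close>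
  have sym: "cmod (char M t) = cmod (char M \<bar>t\<bar>)" for t
  proof (cases "t \<ge> 0")
    case False
    have "char M (- \<bar>t\<bar>) = cnj (char M \<bar>t\<bar>)"
      unfolding char_def by (simp add: Bochner_Integration.integral_cnj[symmetric] exp_cnj del: Bochner_Integration.integral_cnj)
    then show ?thesis using False by (simp add: abs_if)
  qed simp
  have "integrable lborel (\<lambda>t::real. (2 * C + 2) * inverse (1 + t\<^sup>2))"
    using integrable_inverse_1_plus_square by (simp add: set_integrable_def)
  then show ?thesis
  proof (rule Bochner_Integration.integrable_bound)
    show "AE t in lborel. norm (\<bar>t\<bar> ^ k * cmod (char M t)) \<le> norm ((2 * C + 2) * inverse (1 + t\<^sup>2))"
    proof (intro AE_I2)
      fix t :: real
      have p: "0 < 1 + t\<^sup>2" by (simp add: add_pos_nonneg)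
      have "\<bar>t\<bar> ^ k * cmod (char M t) \<le> (2 * C + 2) * inverse (1 + t\<^sup>2)"
      proof (cases "\<bar>t\<bar> \<ge> 1")
        case True
        have "\<bar>t\<bar> ^ k * cmod (char M t) \<le> \<bar>t\<bar> ^ k * (C / \<bar>t\<bar> ^ (k + 2))"
          using C[OF True] sym[of t] by (intro mult_left_mono) auto
        also have "\<dots> = C / t\<^sup>2" using True by (auto simp: power_add power2_eq_square)
        also have "\<dots> \<le> (2 * C + 2) * inverse (1 + t\<^sup>2)"
        proof -
          have "1 \<le> t\<^sup>2" using True by (simp add: abs_le_square_iff[of 1 t, simplified])
          then have "C * (1 + t\<^sup>2) \<le> C * (2 * t\<^sup>2)" using C0 by (intro mult_left_mono) auto
          also have "\<dots> \<le> (2 * C + 2) * t\<^sup>2" using C0 by (simp add: algebra_simps)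
          finally show ?thesis using p True by (simp add: field_simps)
        qed
        finally show ?thesis .
      next
        case False
        have "\<bar>t\<bar> ^ k * cmod (char M t) \<le> 1 * 1"
          using False by (intro mult_mono power_le_one cmod_char_le_1) auto
        also have "\<dots> \<le> (2 * C + 2) * inverse (1 + t\<^sup>2)"
        proof -
          have "t\<^sup>2 \<le> 1" using False by (simp add: abs_square_le_1)
          then show ?thesis using p C0 by (simp add: field_simps)
        qed
        finally show ?thesis .
      qed
      then show "norm (\<bar>t\<bar> ^ k * cmod (char M t)) \<le> norm ((2 * C + 2) * inverse (1 + t\<^sup>2))" by simp
    qed
  qed measurable
qed

lemma inv_integrand_measurable [measurable]: "inv_integrand k x \<in> borel_measurable borel"
  unfolding inv_integrand_def[abs_def] by measurable

lemma inv_primitive_measurable [measurable]: "inv_primitive x \<in> borel_measurable borel"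
  unfolding inv_primitive_def[abs_def] by measurable

lemma trig_char_bound: "\<bar>cos u * Re (char M t) + sin u * Im (char M t)\<bar> \<le> 2 * cmod (char M t)"
proof -
  have "\<bar>cos u * Re (char M t)\<bar> \<le> 1 * cmod (char M t)" "\<bar>sin u * Im (char M t)\<bar> \<le> 1 * cmod (char M t)"
    unfolding abs_mult by (intro mult_mono abs_Re_le_cmod abs_Im_le_cmod; simp)+
  then show ?thesis by linarith
qed

lemma inv_integrand_bound: "\<bar>inv_integrand k x t\<bar> \<le> 2 * (\<bar>t\<bar> ^ k * cmod (char M t))"
  unfolding inv_integrand_def abs_mult power_abs
  using mult_left_mono[OF trig_char_bound, of "\<bar>t\<bar> ^ k" "t * x + real k * (pi/2)" t] by simp

lemma inv_integrand_deriv: "((\<lambda>x. inv_integrand k x t) has_real_derivative inv_integrand (Suc k) x t) (at x)"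
proof -
  have c: "cos (w + real (Suc k) * (pi/2)) = - sin (w + real k * (pi/2))" for w
  proof -
    have "cos (w + real (Suc k) * (pi/2)) = cos ((w + real k * (pi/2)) + pi/2)" by (simp add: algebra_simps add_divide_distrib)
    then show ?thesis by (simp add: cos_add)
  qed
  have s: "sin (w + real (Suc k) * (pi/2)) = cos (w + real k * (pi/2))" for w
  proof -
    have "sin (w + real (Suc k) * (pi/2)) = sin ((w + real k * (pi/2)) + pi/2)" by (simp add: algebra_simps add_divide_distrib)
    then show ?thesis by (simp add: sin_add)
  qed
  show ?thesis unfolding inv_integrand_def c s
    by (auto intro!: derivative_eq_intros simp: algebra_simps)
qed

lemma inv_primitive_deriv: "((\<lambda>x. inv_primitive x t) has_real_derivative inv_integrand 0 x t) (at x)"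
proof (cases "t = 0")
  case True
  have "char M 0 = 1" by (rule char_zero)
  then show ?thesis using True by (auto simp: inv_primitive_def inv_integrand_def intro!: derivative_eq_intros)
next
  case False
  then show ?thesis unfolding inv_primitive_def inv_integrand_def
    by (auto intro!: derivative_eq_intros simp: field_simps)
qed

lemma inv_primitive_increment: "\<bar>inv_primitive y t - inv_primitive x t\<bar> \<le> \<bar>y - x\<bar> * (2 * cmod (char M t))"
proof -
  obtain u where "inv_primitive (x + (y - x)) t - inv_primitive x t = (y - x) * inv_integrand 0 u t"
    by (rule mvt_segment[of x "y - x" "\<lambda>x. inv_primitive x t" "\<lambda>x. inv_integrand 0 x t"]) (rule inv_primitive_deriv)
  then show ?thesis using inv_integrand_bound[of 0 u t] by (simp add: abs_mult mult_left_mono)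
qed

lemma inv_primitive_0: "inv_primitive 0 t = 0"
  by (simp add: inv_primitive_def)

lemma Re_inversion_kernel:
  assumes "t \<noteq> 0"
  shows "Re ((iexp (- (t * x)) - iexp (- (t * y))) / (\<i> * complex_of_real t) * char M t) = inv_primitive y t - inv_primitive x t"
proof -
  have "(iexp (- (t * x)) - iexp (- (t * y))) / (\<i> * complex_of_real t)
      = Complex ((sin (t * y) - sin (t * x)) / t) ((cos (t * y) - cos (t * x)) / t)"
    using assms by (auto simp: complex_eq_iff Re_divide Im_divide Re_exp Im_exp field_simps power2_eq_square)
  then show ?thesis using assms by (simp add: inv_primitive_def field_simps)
qed

text \<open>Levy's theorem gives a limit of truncated integrals. Decay makes the integrand
  absolutely integrable, with the bounded kernel controlled by y - x, so dominated convergence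
  removes the truncation; only real parts matter.\<close>

lemma interval_measure_eq:
  assumes decay: "\<And>n. \<exists>C. \<forall>t\<ge>1. cmod (char M t) \<le> C / t ^ n"
    and xy: "x \<le> y" and atoms: "measure M {x} = 0" "measure M {y} = 0"
  shows "measure M {x<..y} = 1 / (2 * pi) * (\<integral>t. inv_primitive y t - inv_primitive x t \<partial>lborel)"
proof -
  let ?h = "\<lambda>t. (iexp (- (t * x)) - iexp (- (t * y))) / (\<i> * complex_of_real t) * char M t"
  let ?d = "\<lambda>t. inv_primitive y t - inv_primitive x t"
  have ci: "integrable lborel (\<lambda>t. cmod (char M t))" using char_decay_integrable[OF decay, of 0] by simp
  have [measurable]: "?h \<in> borel_measurable borel" by measurable
  have hb: "cmod (?h t) \<le> (y - x) * cmod (char M t)" for t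
  proof (cases "t = 0")
    case False
    have 1: "cmod ((iexp (- (t * x)) - iexp (- (t * y))) / (\<i> * t)) \<le> y - x"
      using Levy_Inversion_aux2[of "-y" "-x" t] xy False by simp
    show ?thesis unfolding norm_mult[of _ "char M t"] using 1 by (rule mult_right_mono) simp
  qed (use xy in simp)
  have ei: "einterval (ereal (real_of_int (- int T))) (ereal (real T)) = {- real T<..<real T}" for T
    by (auto simp: einterval_def)
  have int: "(CLBINT t=ereal (real_of_int (- int T))..ereal (real T). ?h t) = (CLINT t|lborel. indicator {- real T<..<real T} t *\<^sub>R ?h t)" for T
    unfolding interval_lebesgue_integral_def set_lebesgue_integral_def ei by simp
  have hint: "integrable lborel (\<lambda>t. indicator {- real T<..<real T} t *\<^sub>R ?h t)" for T
  proof (rule Bochner_Integration.integrable_bound[OF integrable_mult_right[OF ci, of "y - x"]])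
    show "AE t in lborel. norm (indicator {- real T<..<real T} t *\<^sub>R ?h t) \<le> norm ((y - x) * cmod (char M t))"
      using hb xy by (intro AE_I2) (auto simp: indicator_def)
  qed measurable
  have re: "Re (complex_of_real (1 / (2 * pi)) * (CLBINT t=ereal (real_of_int (- int T))..ereal (real T). ?h t))
     = 1 / (2 * pi) * (\<integral>t. indicator {- real T<..<real T} t * ?d t \<partial>lborel)" for T
  proof -
    have "Re (CLINT t|lborel. indicator {- real T<..<real T} t *\<^sub>R ?h t) = (\<integral>t. Re (indicator {- real T<..<real T} t *\<^sub>R ?h t) \<partial>lborel)"
      by (rule integral_Re[OF hint, symmetric])
    also have "\<dots> = (\<integral>t. indicator {- real T<..<real T} t * ?d t \<partial>lborel)"
    proof (rule integral_cong_AE)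
      show "AE t in lborel. Re (indicator {- real T<..<real T} t *\<^sub>R ?h t) = indicator {- real T<..<real T} t * ?d t"
        using AE_lborel_singleton[of "0::real"]
      proof eventually_elim
        case (elim t)
        then show ?case unfolding scaleR_complex.sel Re_inversion_kernel[OF elim] by simp
      qed
    qed measurable
    finally show ?thesis unfolding int by simp
  qed
  have "(\<lambda>T. 1 / (2 * pi) * (\<integral>t. indicator {- real T<..<real T} t * ?d t \<partial>lborel)) \<longlonglongrightarrow> measure M {x<..y}"
    using tendsto_Re[OF Levy_Inversion[OF xy atoms]] unfolding re by simp
  moreover have "(\<lambda>T. 1 / (2 * pi) * (\<integral>t. indicator {- real T<..<real T} t * ?d t \<partial>lborel)) \<longlonglongrightarrow> 1 / (2 * pi) * (\<integral>t. ?d t \<partial>lborel)"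
  proof (intro tendsto_mult tendsto_const integral_dominated_convergence)
    show "integrable lborel (\<lambda>t. \<bar>y - x\<bar> * (2 * cmod (char M t)))" using ci by simp
    show "AE t in lborel. (\<lambda>T. indicator {- real T<..<real T} t * ?d t) \<longlonglongrightarrow> ?d t"
    proof (intro AE_I2 tendsto_eventually)
      fix t :: real
      obtain N where "\<bar>t\<bar> < real N" using reals_Archimedean2 by blast
      then show "\<forall>\<^sub>F T in sequentially. indicator {- real T<..<real T} t * ?d t = ?d t"
        unfolding eventually_sequentially by (intro exI[of _ N]) (auto simp: indicator_def abs_less_iff)
    qed
    show "AE t in lborel. norm (indicator {- real T<..<real T} t * ?d t) \<le> \<bar>y - x\<bar> * (2 * cmod (char M t))" for T
      using inv_primitive_increment[of y _ x] by (intro AE_I2) (auto simp: indicator_def)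
  qed measurable
  ultimately show ?thesis by (rule LIMSEQ_unique)
qed

text \<open>Differentiation under the integral makes the inversion integral a smooth primitive
  \<open>K\<close>. Its increments are interval masses, so its derivative \<open>D 0\<close> is
  nonnegative and is the density.\<close>

theorem char_decay_smooth_density:
  assumes decay: "\<And>n. \<exists>C. \<forall>t\<ge>1. cmod (char M t) \<le> C / t ^ n"
  obtains f :: "real \<Rightarrow> real" where "\<And>n x. (deriv ^^ n) f differentiable (at x)" "\<And>x. 0 \<le> f x"
    "M = density lborel (\<lambda>x. ennreal (f x))"
proof -
  define K where "K x = 1 / (2 * pi) * (\<integral>t. inv_primitive x t \<partial>lborel)" for x
  define D where "D k x = 1 / (2 * pi) * (\<integral>t. inv_integrand k x t \<partial>lborel)" for k x
  have wi: "integrable lborel (\<lambda>t. 2 * (\<bar>t\<bar> ^ k * cmod (char M t)))" for k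
    using char_decay_integrable[OF decay, of k] by simp
  have gi: "integrable lborel (inv_integrand k x)" for k x
    by (rule Bochner_Integration.integrable_bound[OF wi[of k]])
       (use inv_integrand_bound in \<open>auto intro!: AE_I2 simp: abs_mult\<close>)
  have pi': "integrable lborel (inv_primitive x)" for x
    by (rule Bochner_Integration.integrable_bound[OF integrable_mult_right[OF wi[of 0], of "\<bar>x\<bar>"]])
       (use inv_primitive_increment[of x _ 0] in \<open>auto intro!: AE_I2 simp: inv_primitive_0 abs_mult\<close>)
  have DD: "(D k has_real_derivative D (Suc k) x) (at x)" for k x
    unfolding D_def[abs_def]
    by (intro DERIV_cmult deriv_under_integral[where g = "inv_integrand k" and g' = "inv_integrand (Suc k)", OF gi _ wi[of "Suc k"] inv_integrand_bound inv_integrand_deriv]) measurable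
  have KD: "(K has_real_derivative D 0 x) (at x)" for x
    unfolding K_def[abs_def] D_def
    by (intro DERIV_cmult deriv_under_integral[where g = inv_primitive and g' = "inv_integrand 0", OF pi' _ wi[of 0] inv_integrand_bound inv_primitive_deriv]) measurable
  have Kc: "isCont K x" for x using KD by (rule DERIV_isCont)
  define A where "A = {x. measure M {x} \<noteq> 0}"
  have A: "countable A" unfolding A_def by (rule countable_support)
  have dense: "\<exists>z. u < z \<and> z < v \<and> measure M {z} = 0" if "u < v" for u v
  proof -
    have "uncountable ({u<..<v} - A)" using A that by (intro uncountable_minus_countable) (auto simp: uncountable_open_interval)
    then obtain z where "z \<in> {u<..<v} - A" by (metis countable_empty ex_in_conv)
    then show ?thesis by (auto simp: A_def)
  qed
  have meas0: "measure M {x<..y} = K y - K x" if "x \<le> y" "measure M {x} = 0" "measure M {y} = 0" for x y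
    using interval_measure_eq[OF decay that] pi' by (simp add: K_def right_diff_distrib diff_divide_distrib)
  \<comment> \<open>Inversion requires massless end points. Atoms are countable, so such points
    exist arbitrarily close on both sides of x, and continuity of \<open>K\<close> squeezes the mass
    at x.\<close>
  have noatom: "measure M {x} = 0" for x
  proof -
    have "measure M {x} \<le> e" if e: "e > 0" for e
    proof -
      obtain d where d: "d > 0" "\<And>y. \<bar>y - x\<bar> < d \<Longrightarrow> \<bar>K y - K x\<bar> < e / 2"
        using Kc[of x] half_gt_zero[OF e] unfolding continuous_at_eps_delta dist_real_def by metis
      obtain u where u: "x - d < u" "u < x" "measure M {u} = 0" using dense[of "x - d" x] d by auto
      obtain v where v: "x < v" "v < x + d" "measure M {v} = 0" using dense[of x "x + d"] d by auto
      have "measure M {x} \<le> measure M {u<..v}" using u v by (intro finite_measure_mono) auto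
      also have "\<dots> = K v - K u" using u v by (intro meas0) auto
      also have "\<dots> \<le> e" using d(2)[of u] d(2)[of v] u v unfolding abs_less_iff by linarith
      finally show ?thesis .
    qed
    then have "measure M {x} \<le> 0" by (rule field_le_epsilon[of _ 0, simplified])
    then show ?thesis by (simp add: measure_le_0_iff)
  qed
  have meas: "measure M {x<..y} = K y - K x" if "x \<le> y" for x y by (rule meas0[OF that noatom noatom])
  have f0: "0 \<le> D 0 x" for x
  proof (rule ccontr)
    assume "\<not> 0 \<le> D 0 x"
    then obtain d where d: "d > 0" "\<forall>h>0. h < d \<longrightarrow> K (x + h) < K x"
      using DERIV_neg_dec_right[OF KD[of x]] by auto
    then have "K (x + d / 2) < K x" by auto
    moreover have "0 \<le> K (x + d / 2) - K x" using meas[of x "x + d/2"] d measure_nonneg[of M "{x<..x + d/2}"] by simp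
    ultimately show False by simp
  qed
  have Dm [measurable]: "D 0 \<in> borel_measurable borel"
    by (intro borel_measurable_continuous_onI continuous_at_imp_continuous_on ballI DERIV_isCont[OF DD])
  \<comment> \<open>Increments of \<open>K\<close> and of the distribution function agree, so the
    integral of \<open>D 0\<close> over a half-line equals the tail mass of \<open>M\<close>;
    half-lines determine the measure.\<close>
  have lim: "(K \<longlongrightarrow> K x + (1 - cdf M x)) at_top" for x
  proof -
    have "((\<lambda>y. K x + (cdf M y - cdf M x)) \<longlongrightarrow> K x + (1 - cdf M x)) at_top"
      by (intro tendsto_intros cdf_lim_at_top_prob)
    moreover have "\<forall>\<^sub>F y in at_top. K x + (cdf M y - cdf M x) = K y"
      using eventually_gt_at_top[of x] by eventually_elim (simp add: cdf_diff_eq meas)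
    ultimately show ?thesis by (rule Lim_transform_eventually)
  qed
  have eq: "M = density lborel (\<lambda>x. ennreal (D 0 x))"
  proof (rule measure_eqI_lessThan)
    fix x
    show "emeasure M {x<..} < \<infinity>" by (simp add: less_top[symmetric])
    have "emeasure (density lborel (\<lambda>x. ennreal (D 0 x))) {x<..} = (\<integral>\<^sup>+y. ennreal (D 0 y) * indicator {x<..} y \<partial>lborel)"
      by (rule emeasure_density) auto
    also have "\<dots> = (\<integral>\<^sup>+y. ennreal (D 0 y) * indicator {x..} y \<partial>lborel)"
      by (rule nn_integral_cong_AE) (use AE_lborel_singleton[of x] in \<open>eventually_elim, auto simp: indicator_def\<close>)
    also have "\<dots> = ennreal (K x + (1 - cdf M x) - K x)"
      by (rule nn_integral_FTC_atLeast[OF Dm KD f0 lim])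
    also have "K x + (1 - cdf M x) - K x = measure M {x<..}"
    proof -
      have "measure M (space M - {..x}) = 1 - measure M {..x}" by (rule prob_compl) simp
      moreover have "space M - {..x} = {x<..}" by (auto simp: space_eq_univ)
      ultimately show ?thesis by (simp add: cdf_def)
    qed
    finally show "emeasure M {x<..} = emeasure (density lborel (\<lambda>x. ennreal (D 0 x))) {x<..}"
      by (simp add: emeasure_eq_measure)
  qed auto
  have "(deriv ^^ n) (D 0) = D n" for n
  proof (induction n)
    case (Suc n)
    have "deriv (D n) = D (Suc n)" by (rule ext, rule DERIV_imp_deriv[OF DD])
    then show ?case using Suc.IH by simp
  qed simp
  then have "(deriv ^^ n) (D 0) differentiable (at x)" for n x
    using DD[of n x] by (auto simp: real_differentiable_def)
  then show ?thesis using f0 eq by (intro that[of "D 0"])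
qed

end

section \<open>Decay of a nonnegative decreasing cosine transform from smoothness of the
  density\<close>

text \<open>Minus the symmetric second difference. With this sign it multiplies the frequency v by 2
  - 2 cos(v x) \<ge> 0, so its powers preserve positivity on the Fourier side.\<close>

definition sdiff :: "real \<Rightarrow> (real \<Rightarrow> real) \<Rightarrow> real \<Rightarrow> real" where
  "sdiff x h a = 2 * h a - h (a + x) - h (a - x)"

lemma sdiff_pow_deriv:
  assumes "\<And>u. (h has_real_derivative h' u) (at u)"
  shows "((sdiff x ^^ n) h has_real_derivative (sdiff x ^^ n) h' u) (at u)"
proof (induction n arbitrary: u)
  case 0 then show ?case using assms by simp
next
  case (Suc n)
  have "((\<lambda>u. (sdiff x ^^ n) h (u + x)) has_real_derivative (sdiff x ^^ n) h' (u + x)) (at u)"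
    "((\<lambda>u. (sdiff x ^^ n) h (u - x)) has_real_derivative (sdiff x ^^ n) h' (u - x)) (at u)"
    using Suc[of "u + x"] Suc[of "u + - x"] DERIV_shift[of "(sdiff x ^^ n) h" _ u "- x"] DERIV_shift[of "(sdiff x ^^ n) h" _ u x] by auto
  moreover have "(sdiff x ^^ Suc n) k = (\<lambda>a. 2 * (sdiff x ^^ n) k a - (sdiff x ^^ n) k (a + x) - (sdiff x ^^ n) k (a - x))" for k
    by (simp add: sdiff_def fun_eq_iff)
  ultimately show ?case by (auto intro!: DERIV_diff DERIV_cmult Suc)
qed

text \<open>Each application uses two derivatives and yields x^2, while the intermediate point moves
  by at most 2 |x|; after n rounds all points stay within |a| + 2 n |x|.\<close>

lemma sdiff_bound:
  fixes D :: "nat \<Rightarrow> real \<Rightarrow> real"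
  assumes D: "\<And>i u. (D i has_real_derivative D (Suc i) u) (at u)"
    and "\<And>v. \<bar>v\<bar> \<le> r \<Longrightarrow> \<bar>D (j + 2 * n) v\<bar> \<le> C" and "\<bar>a\<bar> + 2 * real n * \<bar>x\<bar> \<le> r"
  shows "\<bar>(sdiff x ^^ n) (D j) a\<bar> \<le> C * x ^ (2 * n)"
  using assms(2,3)
proof (induction n arbitrary: j a)
  case (Suc n)
  define E where "E i = (sdiff x ^^ n) (D (j + i))" for i
  have E: "(E i has_real_derivative E (Suc i) u) (at u)" for i u
    unfolding E_def add_Suc_right by (rule sdiff_pow_deriv[OF D])
  obtain u where u: "\<bar>u - a\<bar> \<le> \<bar>x\<bar> + \<bar>- x\<bar>"
    "E 0 (a + x + - x) - E 0 (a + x) - E 0 (a + - x) + E 0 a = x * - x * E (Suc (Suc 0)) u"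
    by (rule second_difference[of "\<bar>a\<bar> + \<bar>x\<bar> + \<bar>- x\<bar> + 1" E a x "- x" 0]) (use E in auto)
  have "\<bar>(sdiff x ^^ n) (D (j + 2)) u\<bar> \<le> C * x ^ (2 * n)"
  proof (rule Suc.IH)
    show "\<bar>D (j + 2 + 2 * n) v\<bar> \<le> C" if "\<bar>v\<bar> \<le> r" for v using Suc.prems(1)[OF that] by (simp add: add.commute add.left_commute)
    have "\<bar>u\<bar> \<le> \<bar>a\<bar> + 2 * \<bar>x\<bar>" using u(1) by linarith
    then show "\<bar>u\<bar> + 2 * real n * \<bar>x\<bar> \<le> r" using Suc.prems(2) by (simp add: algebra_simps)
  qed
  then have "x\<^sup>2 * \<bar>E 2 u\<bar> \<le> x\<^sup>2 * (C * x ^ (2 * n))" by (intro mult_left_mono) (auto simp: E_def)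
  moreover have "(sdiff x ^^ Suc n) (D j) a = - (x\<^sup>2 * E 2 u)"
    using u(2) by (simp add: sdiff_def E_def power2_eq_square numeral_2_eq_2)
  ultimately show ?case by (simp add: abs_mult power_add power2_eq_square mult_ac)
qed simp

lemma sdiff_pow_tendsto:
  assumes "\<And>a. ((\<lambda>t. h t a) \<longlongrightarrow> g a) F"
  shows "((\<lambda>t. (sdiff x ^^ n) (h t) a) \<longlongrightarrow> (sdiff x ^^ n) g a) F"
  by (induction n arbitrary: a) (use assms in \<open>auto simp: sdiff_def intro!: tendsto_intros\<close>)

lemma sdiff_pow_cmult: "(sdiff x ^^ n) (\<lambda>a. c * h a) = (\<lambda>a. c * (sdiff x ^^ n) h a)"
  by (induction n) (auto simp: sdiff_def fun_eq_iff algebra_simps)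

text \<open>Gaussian mollifiers: away from \<open>a\<close> the kernel is bounded by \<open>2 \<eta> / \<delta>\<^sup>2\<close>, using
  \<open>exp (- u) \<le> 1 / u\<close>.\<close>

lemma normal_mollifier_tendsto:
  fixes f :: "real \<Rightarrow> real" and \<eta> :: "nat \<Rightarrow> real"
  assumes f: "isCont f a" "\<And>v. 0 \<le> f v" "integrable lborel f" and \<eta>: "\<And>n. 0 < \<eta> n" "\<eta> \<longlonglongrightarrow> 0"
  shows "(\<lambda>n. \<integral>v. f v * normal_density a (\<eta> n) v \<partial>lborel) \<longlonglongrightarrow> f a"
proof (rule tendstoI)
  fix e :: real assume e: "e > 0"
  have [measurable]: "f \<in> borel_measurable borel" using borel_measurable_integrable[OF f(3)] by simp
  obtain d where d: "d > 0" "\<And>v. \<bar>v - a\<bar> < d \<Longrightarrow> \<bar>f v - f a\<bar> < e / 2"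
    using f(1) half_gt_zero[OF e] unfolding continuous_at_eps_delta dist_real_def by metis
  let ?\<rho> = "\<lambda>n v. normal_density a (\<eta> n) v"
  define I where "I = (\<integral>v. f v \<partial>lborel)"
  define B where "B n = e / 2 + 2 * \<eta> n / d\<^sup>2 * I + f a / d\<^sup>2 * (\<eta> n)\<^sup>2" for n
  have far: "?\<rho> n v \<le> 2 * \<eta> n / d\<^sup>2" if "\<bar>v - a\<bar> \<ge> d" for n v
  proof -
    let ?u = "(v - a)\<^sup>2 / (2 * (\<eta> n)\<^sup>2)"
    have "d\<^sup>2 \<le> (v - a)\<^sup>2" using that d(1) by (simp add: abs_le_square_iff[symmetric])
    moreover have "0 < d\<^sup>2" using d(1) by simp
    ultimately have v2: "0 < (v - a)\<^sup>2" by linarith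
    then have u: "0 < ?u" using \<eta>(1)[of n] by simp
    have "?u \<le> exp ?u" using exp_ge_add_one_self[of ?u] by linarith
    then have "1 / exp ?u \<le> 1 / ?u"
      by (rule divide_left_mono) (use mult_pos_pos[OF exp_gt_zero u] in auto)
    then have "exp (- ?u) \<le> 1 / ?u" by (simp only: exp_minus inverse_eq_divide)
    also have "\<dots> = 2 * (\<eta> n)\<^sup>2 / (v - a)\<^sup>2" by simp
    also have "\<dots> \<le> 2 * (\<eta> n)\<^sup>2 / d\<^sup>2" by (rule divide_left_mono[OF \<open>d\<^sup>2 \<le> (v - a)\<^sup>2\<close> _ mult_pos_pos[OF v2 \<open>0 < d\<^sup>2\<close>]]) simp
    finally have ex: "exp (- ?u) \<le> 2 * (\<eta> n)\<^sup>2 / d\<^sup>2" .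
    have "1 \<le> sqrt (2 * pi)" using pi_gt3 by (intro real_le_rsqrt) auto
    then have "1 / sqrt (2 * pi * (\<eta> n)\<^sup>2) \<le> 1 / \<eta> n"
      using \<eta>(1)[of n] by (simp add: real_sqrt_mult field_simps)
    then have "1 / sqrt (2 * pi * (\<eta> n)\<^sup>2) * exp (- ?u) \<le> 1 / \<eta> n * (2 * (\<eta> n)\<^sup>2 / d\<^sup>2)"
      using ex \<eta>(1)[of n] by (intro mult_mono) auto
    then show ?thesis using \<eta>(1)[of n] by (simp add: normal_density_def power2_eq_square)
  qed
  have pt: "\<bar>f v * ?\<rho> n v - f a * ?\<rho> n v\<bar> \<le> e / 2 * ?\<rho> n v + 2 * \<eta> n / d\<^sup>2 * f v + f a / d\<^sup>2 * (?\<rho> n v * (v - a)\<^sup>2)" for n v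
  proof -
    have p: "0 \<le> ?\<rho> n v" by simp
    have nn: "0 \<le> 2 * \<eta> n / d\<^sup>2 * f v" "0 \<le> f a / d\<^sup>2 * (?\<rho> n v * (v - a)\<^sup>2)" "0 \<le> e / 2 * ?\<rho> n v"
      using \<eta>(1)[of n] f(2) e by (auto intro!: mult_nonneg_nonneg divide_nonneg_nonneg)
    show ?thesis
    proof (cases "\<bar>v - a\<bar> < d")
      case True
      have "\<bar>f v * ?\<rho> n v - f a * ?\<rho> n v\<bar> = \<bar>f v - f a\<bar> * ?\<rho> n v"
        using p by (simp add: left_diff_distrib[symmetric] abs_mult)
      also have "\<dots> \<le> e / 2 * ?\<rho> n v" using d(2)[OF True] p by (intro mult_right_mono) auto
      finally show ?thesis using nn by linarith
    next
      case False
      have a1: "f v * ?\<rho> n v \<le> 2 * \<eta> n / d\<^sup>2 * f v"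
        using mult_left_mono[OF far[of v n] f(2)[of v]] False by (simp add: mult.commute)
      have "1 \<le> (v - a)\<^sup>2 / d\<^sup>2" using False d(1) by (simp add: abs_le_square_iff[symmetric])
      then have a2: "f a * ?\<rho> n v * 1 \<le> f a * ?\<rho> n v * ((v - a)\<^sup>2 / d\<^sup>2)" using f(2) p by (intro mult_left_mono) auto
      have "0 \<le> f v * ?\<rho> n v" "0 \<le> f a * ?\<rho> n v" using f(2) p by auto
      then have "\<bar>f v * ?\<rho> n v - f a * ?\<rho> n v\<bar> \<le> f v * ?\<rho> n v + f a * ?\<rho> n v" by linarith
      also have "\<dots> \<le> 2 * \<eta> n / d\<^sup>2 * f v + f a / d\<^sup>2 * (?\<rho> n v * (v - a)\<^sup>2)" using a1 a2 by (simp add: mult_ac)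
      finally show ?thesis using nn by linarith
    qed
  qed
  have r1: "integrable lborel (?\<rho> n)" "(\<integral>v. ?\<rho> n v \<partial>lborel) = 1" for n using \<eta>(1)[of n] by auto
  have r2: "has_bochner_integral lborel (\<lambda>v. ?\<rho> n v * (v - a)\<^sup>2) ((\<eta> n)\<^sup>2)" for n
    using normal_moment_even[OF \<eta>(1)[of n], of a 1] by (simp add: fact_numeral numeral_2_eq_2[symmetric] power2_eq_square)
  note r2' = has_bochner_integral_integral_eq[OF r2] r2[THEN integrable.intros]
  have fr: "integrable lborel (\<lambda>v. f v * ?\<rho> n v)" for n
  proof (rule Bochner_Integration.integrable_bound)
    show "integrable lborel (\<lambda>v. f a * ?\<rho> n v + (e / 2 * ?\<rho> n v + 2 * \<eta> n / d\<^sup>2 * f v + f a / d\<^sup>2 * (?\<rho> n v * (v - a)\<^sup>2)))"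
      using r1 r2' f(3) by simp
    show "AE v in lborel. norm (f v * ?\<rho> n v) \<le> norm (f a * ?\<rho> n v + (e / 2 * ?\<rho> n v + 2 * \<eta> n / d\<^sup>2 * f v + f a / d\<^sup>2 * (?\<rho> n v * (v - a)\<^sup>2)))"
    proof (intro AE_I2)
      fix v
      have "0 \<le> f v * ?\<rho> n v" using f(2) by simp
      then show "norm (f v * ?\<rho> n v) \<le> norm (f a * ?\<rho> n v + (e / 2 * ?\<rho> n v + 2 * \<eta> n / d\<^sup>2 * f v + f a / d\<^sup>2 * (?\<rho> n v * (v - a)\<^sup>2)))"
        using pt[of v n] unfolding real_norm_def by linarith
    qed
  qed measurable
  have main: "\<bar>(\<integral>v. f v * ?\<rho> n v \<partial>lborel) - f a\<bar> \<le> B n" for n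
  proof -
    have "(\<integral>v. f v * ?\<rho> n v \<partial>lborel) - f a = (\<integral>v. f v * ?\<rho> n v - f a * ?\<rho> n v \<partial>lborel)"
      using fr r1 by simp
    also have "\<bar>\<dots>\<bar> \<le> (\<integral>v. \<bar>f v * ?\<rho> n v - f a * ?\<rho> n v\<bar> \<partial>lborel)" by (rule integral_abs_bound)
    also have "\<dots> \<le> (\<integral>v. e / 2 * ?\<rho> n v + 2 * \<eta> n / d\<^sup>2 * f v + f a / d\<^sup>2 * (?\<rho> n v * (v - a)\<^sup>2) \<partial>lborel)"
      using fr r1 r2' f(3) by (intro integral_mono pt) auto
    also have "\<dots> = B n" using r1 r2' f(3) by (simp add: B_def I_def)
    finally show ?thesis .
  qed
  have "B \<longlonglongrightarrow> e / 2 + 2 * 0 / d\<^sup>2 * I + f a / d\<^sup>2 * 0\<^sup>2"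
    unfolding B_def[abs_def] by (intro tendsto_intros \<eta>(2)) (use d in auto)
  then have "\<forall>\<^sub>F n in sequentially. B n < e" by (rule order_tendstoD(2)) (use e in simp)
  then show "\<forall>\<^sub>F n in sequentially. dist (\<integral>v. f v * ?\<rho> n v \<partial>lborel) (f a) < e"
    by eventually_elim (use main in \<open>auto simp: dist_real_def intro: le_less_trans\<close>)
qed

lemma std_normal_cos: "(\<integral>u. cos (t * u) \<partial>density lborel (\<lambda>x. ennreal (std_normal_density x))) = exp (- t\<^sup>2 / 2)"
proof -
  interpret N: prob_space "density lborel (\<lambda>x. ennreal (std_normal_density x))" by (rule prob_space_normal_density) simp
  have "Re (char std_normal_distribution t) = exp (- t\<^sup>2 / 2)" by (simp add: char_std_normal_distribution)
  moreover have "Re (char std_normal_distribution t) = (\<integral>u. Re (iexp (t * u)) \<partial>std_normal_distribution)"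
    unfolding char_def by (rule integral_Re[symmetric]) (rule N.integrable_const_bound[where B=1], auto)
  ultimately show ?thesis by (simp add: Re_exp)
qed

context prob_space
begin

text \<open>The Gaussian kernel is the characteristic function of a standard normal variable at (X -
  a)/\<eta>, so Fubini writes the mollified density as an integral of cosine transforms of X.
  Differencing in a then acts as a multiplier.\<close>

lemma mollified_differences:
  assumes [measurable]: "X \<in> borel_measurable M" and \<eta>: "0 < \<eta>"
  defines "\<gamma> \<equiv> density lborel (\<lambda>x. ennreal (std_normal_density x))"
  shows "(sdiff x ^^ n) (\<lambda>a. \<integral>w. exp (- (X w - a)\<^sup>2 / (2 * \<eta>\<^sup>2)) \<partial>M) a
    = (\<integral>u. (2 - 2 * cos (u * (x / \<eta>))) ^ n * (\<integral>w. cos (u / \<eta> * (X w - a)) \<partial>M) \<partial>\<gamma>)"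
proof -
  interpret N: prob_space \<gamma> unfolding \<gamma>_def by (rule prob_space_normal_density) simp
  interpret P: pair_prob_space \<gamma> M ..
  have [measurable_cong]: "sets \<gamma> = sets borel" by (simp add: \<gamma>_def)
  have im: "(\<lambda>u. \<integral>w. cos (u / \<eta> * (X w - a)) \<partial>M) \<in> borel_measurable \<gamma>" for a by measurable
  note [measurable] = im
  have ib: "\<bar>\<integral>w. cos (u / \<eta> * (X w - a)) \<partial>M\<bar> \<le> 1" for u a
  proof -
    have "\<bar>\<integral>w. cos (u / \<eta> * (X w - a)) \<partial>M\<bar> \<le> (\<integral>w. \<bar>cos (u / \<eta> * (X w - a))\<bar> \<partial>M)" by (rule integral_abs_bound)
    also have "\<dots> \<le> (\<integral>w. 1 \<partial>M)" by (intro integral_mono integrable_const_bound[where B=1]) auto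
    finally show ?thesis by (simp add: prob_space)
  qed
  have icos: "integrable M (\<lambda>w. cos (u / \<eta> * (X w - a)))" for u a
    by (rule integrable_const_bound[where B=1]) auto
  have isin: "integrable M (\<lambda>w. sin (u / \<eta> * (X w - a)))" for u a
    by (rule integrable_const_bound[where B=1]) auto
  show ?thesis
  proof (induction n arbitrary: a)
    case 0
    have "(\<integral>w. exp (- (X w - a)\<^sup>2 / (2 * \<eta>\<^sup>2)) \<partial>M) = (\<integral>w. \<integral>u. cos (u / \<eta> * (X w - a)) \<partial>\<gamma> \<partial>M)"
    proof (intro Bochner_Integration.integral_cong refl)
      fix w
      show "exp (- (X w - a)\<^sup>2 / (2 * \<eta>\<^sup>2)) = (\<integral>u. cos (u / \<eta> * (X w - a)) \<partial>\<gamma>)"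
        using std_normal_cos[of "(X w - a) / \<eta>"] by (simp add: \<gamma>_def power_divide field_simps mult.commute)
    qed
    also have "\<dots> = (\<integral>u. \<integral>w. cos (u / \<eta> * (X w - a)) \<partial>M \<partial>\<gamma>)"
      by (rule P.Fubini_integral[of "\<lambda>u w. cos (u / \<eta> * (X w - a))"])
         (rule P.P.integrable_const_bound[where B=1], auto simp: case_prod_beta)
    finally show ?case by simp
  next
    case (Suc n)
    let ?c = "\<lambda>u a. \<integral>w. cos (u / \<eta> * (X w - a)) \<partial>M"
    have i: "integrable \<gamma> (\<lambda>u. (2 - 2 * cos (u * (x / \<eta>))) ^ n * ?c u a)" for a
    proof (rule N.integrable_const_bound[where B="4 ^ n"])
      show "AE u in \<gamma>. norm ((2 - 2 * cos (u * (x / \<eta>))) ^ n * ?c u a) \<le> 4 ^ n"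
      proof (intro AE_I2)
        fix u :: real
        have "\<bar>2 - 2 * cos (u * (x / \<eta>))\<bar> \<le> 4"
          using cos_le_one[of "u * (x / \<eta>)"] cos_ge_minus_one[of "u * (x / \<eta>)"] unfolding abs_le_iff by linarith
        then have "\<bar>2 - 2 * cos (u * (x / \<eta>))\<bar> ^ n * \<bar>?c u a\<bar> \<le> 4 ^ n * 1"
          by (intro mult_mono power_mono ib) auto
        then show "norm ((2 - 2 * cos (u * (x / \<eta>))) ^ n * ?c u a) \<le> 4 ^ n" by (simp add: abs_mult power_abs)
      qed
    qed measurable
    have trig: "2 * ?c u a - ?c u (a + x) - ?c u (a - x) = (2 - 2 * cos (u * (x / \<eta>))) * ?c u a" for u
    proof -
      have "2 * ?c u a - ?c u (a + x) - ?c u (a - x)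
          = (\<integral>w. 2 * cos (u / \<eta> * (X w - a)) - cos (u / \<eta> * (X w - (a + x))) - cos (u / \<eta> * (X w - (a - x))) \<partial>M)"
        using icos by simp
      also have "\<dots> = (\<integral>w. (2 - 2 * cos (u * (x / \<eta>))) * cos (u / \<eta> * (X w - a)) \<partial>M)"
      proof (intro Bochner_Integration.integral_cong refl)
        fix w
        have 1: "u / \<eta> * (X w - (a + x)) = u / \<eta> * (X w - a) - u * (x / \<eta>)" "u / \<eta> * (X w - (a - x)) = u / \<eta> * (X w - a) + u * (x / \<eta>)"
          using \<eta> by (simp_all add: field_simps)
        show "2 * cos (u / \<eta> * (X w - a)) - cos (u / \<eta> * (X w - (a + x))) - cos (u / \<eta> * (X w - (a - x)))
          = (2 - 2 * cos (u * (x / \<eta>))) * cos (u / \<eta> * (X w - a))"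
          unfolding 1 cos_add cos_diff by (simp add: algebra_simps)
      qed
      finally show ?thesis by simp
    qed
    have "(sdiff x ^^ Suc n) (\<lambda>a. \<integral>w. exp (- (X w - a)\<^sup>2 / (2 * \<eta>\<^sup>2)) \<partial>M) a
      = (\<integral>u. (2 - 2 * cos (u * (x / \<eta>))) ^ n * (2 * ?c u a - ?c u (a + x) - ?c u (a - x)) \<partial>\<gamma>)"
    proof -
      have "(\<integral>u. (2 - 2 * cos (u * (x / \<eta>))) ^ n * (2 * ?c u a - ?c u (a + x) - ?c u (a - x)) \<partial>\<gamma>)
        = (\<integral>u. 2 * ((2 - 2 * cos (u * (x / \<eta>))) ^ n * ?c u a) - (2 - 2 * cos (u * (x / \<eta>))) ^ n * ?c u (a + x)
            - (2 - 2 * cos (u * (x / \<eta>))) ^ n * ?c u (a - x) \<partial>\<gamma>)"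
        by (intro Bochner_Integration.integral_cong) (auto simp: algebra_simps)
      also have "\<dots> = 2 * (\<integral>u. (2 - 2 * cos (u * (x / \<eta>))) ^ n * ?c u a \<partial>\<gamma>) - (\<integral>u. (2 - 2 * cos (u * (x / \<eta>))) ^ n * ?c u (a + x) \<partial>\<gamma>)
            - (\<integral>u. (2 - 2 * cos (u * (x / \<eta>))) ^ n * ?c u (a - x) \<partial>\<gamma>)"
        using i[of a] i[of "a + x"] i[of "a - x"] by simp
      finally have fin: "(\<integral>u. (2 - 2 * cos (u * (x / \<eta>))) ^ n * (2 * ?c u a - ?c u (a + x) - ?c u (a - x)) \<partial>\<gamma>)
        = 2 * (\<integral>u. (2 - 2 * cos (u * (x / \<eta>))) ^ n * ?c u a \<partial>\<gamma>) - (\<integral>u. (2 - 2 * cos (u * (x / \<eta>))) ^ n * ?c u (a + x) \<partial>\<gamma>)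
            - (\<integral>u. (2 - 2 * cos (u * (x / \<eta>))) ^ n * ?c u (a - x) \<partial>\<gamma>)" .
      have sd: "(sdiff x ^^ Suc n) k a = 2 * (sdiff x ^^ n) k a - (sdiff x ^^ n) k (a + x) - (sdiff x ^^ n) k (a - x)" for k
        by (simp add: sdiff_def)
      show ?thesis unfolding sd Suc.IH fin ..
    qed
    then show ?case unfolding trig by (simp only: power_Suc mult.assoc mult.left_commute)
  qed
qed

text \<open>No control of the derivatives of f at infinity is available, so f cannot be integrated
  by parts on the line. Instead, its iterated symmetric difference at 0 is bounded above by
  smoothness on a bounded interval. From below, positivity of the transform allows keeping the
  single frequency band [S, 2S], where monotonicity replaces it by its value at 2S.\<close>

theorem smooth_density_cos_decay:
  assumes X [measurable]: "X \<in> borel_measurable M"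
    and dens: "distributed M lborel X (\<lambda>x. ennreal (f x))" and f0: "\<And>x. 0 \<le> f x"
    and smooth: "\<And>n x. (deriv ^^ n) f differentiable (at x)"
    and L0: "\<And>s. 0 \<le> (\<integral>w. cos (s * X w) \<partial>M)"
    and Lmono: "\<And>s t. \<bar>s\<bar> \<le> \<bar>t\<bar> \<Longrightarrow> (\<integral>w. cos (t * X w) \<partial>M) \<le> (\<integral>w. cos (s * X w) \<partial>M)"
  shows "\<exists>C. \<forall>s\<ge>1. (\<integral>w. cos (s * X w) \<partial>M) \<le> C / s ^ n"
proof -
  define L where "L s = (\<integral>w. cos (s * X w) \<partial>M)" for s
  define D where "D i = (deriv ^^ i) f" for i
  have D: "(D i has_real_derivative D (Suc i) u) (at u)" for i u
    using smooth[of i u] by (simp add: D_def DERIV_deriv_iff_real_differentiable)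
  have fc: "isCont f u" for u using DERIV_isCont[OF D[of 0 u]] by (simp add: D_def)
  have [measurable]: "f \<in> borel_measurable borel"
    by (intro borel_measurable_continuous_onI continuous_at_imp_continuous_on ballI fc)
  have fint: "integrable lborel f"
    using distributed_integrable[OF dens, of "\<lambda>_. 1"] f0 by simp
  define \<eta> where "\<eta> m = 1 / real (Suc m)" for m
  have \<eta>: "0 < \<eta> m" "\<eta> \<longlonglongrightarrow> 0" for m unfolding \<eta>_def using LIMSEQ_Suc[OF lim_const_over_n[of 1]] by auto
  define h where "h m a = 1 / (\<eta> m * sqrt (2 * pi)) * (\<integral>w. exp (- (X w - a)\<^sup>2 / (2 * (\<eta> m)\<^sup>2)) \<partial>M)" for m a
  have h: "h m a = (\<integral>v. f v * normal_density a (\<eta> m) v \<partial>lborel)" for m a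
  proof -
    have "(\<integral>v. f v * normal_density a (\<eta> m) v \<partial>lborel) = (\<integral>w. normal_density a (\<eta> m) (X w) \<partial>M)"
      by (rule distributed_integral[OF dens]) (use f0 in auto)
    also have "\<dots> = (\<integral>w. 1 / (\<eta> m * sqrt (2 * pi)) * exp (- (X w - a)\<^sup>2 / (2 * (\<eta> m)\<^sup>2)) \<partial>M)"
      using \<eta>(1)[of m] by (simp add: normal_density_def real_sqrt_mult mult.commute)
    finally show ?thesis by (simp add: h_def)
  qed
  have hl: "(\<lambda>m. h m a) \<longlonglongrightarrow> f a" for a
    unfolding h by (rule normal_mollifier_tendsto[OF fc f0 fint \<eta>])
  let ?n = "Suc n"
  \<comment> \<open>Steps are at most 1 and there are \<open>?n\<close> differences centred at 0, so
    all intermediate points lie in this interval.\<close>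
  have "compact ((D (2 * ?n)) ` {- (2 * real ?n) .. 2 * real ?n})"
    by (intro compact_continuous_image continuous_at_imp_continuous_on ballI DERIV_isCont[OF D]) auto
  then obtain C where C: "\<And>v. \<bar>v\<bar> \<le> 2 * real ?n \<Longrightarrow> \<bar>D (2 * ?n) v\<bar> \<le> C"
    using compact_imp_bounded[THEN bounded_iff[THEN iffD1]] by (force simp: abs_le_iff)
  have C0: "0 \<le> C" using C[of 0] by simp
  define c where "c = 2 - 2 * cos (1::real)"
  have c: "0 < c" using cos_monotone_0_pi[of 0 1] pi_gt3 by (simp add: c_def)
  have key: "c ^ ?n * L (2 * S) * S / (2 * pi) \<le> C * (1 / S) ^ (2 * ?n)" if S: "1 \<le> S" for S
  proof -
    \<comment> \<open>With step 1/S the product of frequency and step runs through [1, 2] on the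
      band, so the multiplier is at least 2 - 2 cos 1 there.\<close>
    define x where "x = 1 / S"
    have x: "0 < x" "x \<le> 1" using S by (auto simp: x_def)
    let ?\<gamma> = "density lborel (\<lambda>x. ennreal (std_normal_density x))"
    interpret N: prob_space ?\<gamma> by (rule prob_space_normal_density) simp
    \<comment> \<open>In the Gaussian variable the band is [\<eta> S, 2 \<eta> S], of length \<eta>
      S. Its length, the normalization 1/(\<eta> sqrt(2 pi)) and the lower bound exp(-2 (\<eta>
      S)^2)/sqrt(2 pi) of the density combine to S/(2 pi) times an exponential that tends to 1 as
      \<eta> tends to 0.\<close>
    have lower: "c ^ ?n * L (2 * S) * S / (2 * pi) * exp (- 2 * (\<eta> m * S)\<^sup>2) \<le> (sdiff x ^^ ?n) (h m) 0" for m
    proof -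
      let ?e = "\<eta> m"
      let ?I = "\<lambda>u. (2 - 2 * cos (u * (x / ?e))) ^ ?n * (\<integral>w. cos (u / ?e * (X w - 0)) \<partial>M)"
      have Im: "(\<lambda>u. \<integral>w. cos (u / ?e * (X w - 0)) \<partial>M) \<in> borel_measurable borel" by measurable
      note [measurable] = Im
      have nn: "0 \<le> ?I u" for u using L0[of "u / ?e"] cos_le_one[of "u * (x / ?e)"] by simp
      have bound: "?I u \<le> 4 ^ ?n" for u
      proof -
        have "(2 - 2 * cos (u * (x / ?e))) ^ ?n \<le> 4 ^ ?n"
          using cos_le_one[of "u * (x / ?e)"] cos_ge_minus_one[of "u * (x / ?e)"] by (intro power_mono; linarith)
        moreover have "(\<integral>w. cos (u / ?e * (X w - 0)) \<partial>M) \<le> 1"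
          using Lmono[of 0 "u / ?e"] by (simp add: prob_space)
        ultimately have "?I u \<le> 4 ^ ?n * 1" using L0[of "u / ?e"] by (intro mult_mono) auto
        then show ?thesis by simp
      qed
      define J where "J = {?e * S..2 * (?e * S)}"
      have eS: "0 < ?e * S" using \<eta>(1)[of m] S by simp
      define d where "d = c ^ ?n * L (2 * S) * (1 / sqrt (2 * pi) * exp (- 2 * (?e * S)\<^sup>2))"
      have pt: "d * indicator J u \<le> std_normal_density u * ?I u" for u
      proof (cases "u \<in> J")
        case True
        then have u: "?e * S \<le> u" "u \<le> 2 * (?e * S)" by (auto simp: J_def)
        have ux: "1 \<le> u * (x / ?e)" "u * (x / ?e) \<le> 2" using u \<eta>(1)[of m] S by (auto simp: x_def field_simps)
        have "cos (u * (x / ?e)) \<le> cos 1" using ux pi_gt3 by (intro cos_monotone_0_pi_le) auto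
        then have 1: "c ^ ?n \<le> (2 - 2 * cos (u * (x / ?e))) ^ ?n" using c by (intro power_mono) (auto simp: c_def)
        have 2: "L (2 * S) \<le> (\<integral>w. cos (u / ?e * (X w - 0)) \<partial>M)"
          unfolding L_def using Lmono[of "u / ?e" "2 * S"] u eS \<eta>(1)[of m] S by (simp add: field_simps abs_le_iff)
        have "u\<^sup>2 \<le> (2 * (?e * S))\<^sup>2" using u eS by (intro power_mono) auto
        then have "1 / sqrt (2 * pi) * exp (- 2 * (?e * S)\<^sup>2) \<le> std_normal_density u"
          unfolding std_normal_density_def by (intro mult_left_mono) (auto simp: power_mult_distrib)
        then have "(c ^ ?n * L (2 * S)) * (1 / sqrt (2 * pi) * exp (- 2 * (?e * S)\<^sup>2)) \<le> ?I u * std_normal_density u"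
          using 1 2 c L0[of "2 * S"] nn[of u] by (intro mult_mono) (auto simp: L_def)
        then show ?thesis using True by (simp add: d_def mult.commute)
      next
        case False then show ?thesis using nn[of u] by simp
      qed
      have int: "integrable lborel (\<lambda>u. std_normal_density u * ?I u)"
      proof (rule Bochner_Integration.integrable_bound)
        show "integrable lborel (\<lambda>u. std_normal_density u * 4 ^ ?n)" by simp
        show "AE u in lborel. norm (std_normal_density u * ?I u) \<le> norm (std_normal_density u * 4 ^ ?n)"
          using nn bound by (intro AE_I2) (auto simp del: power_Suc intro!: mult_left_mono)
      qed measurable
      have "d * (?e * S) = (\<integral>u. d * indicator J u \<partial>lborel)"
        using eS less_imp_le[OF eS] by (simp add: J_def mult.commute)
      also have "\<dots> \<le> (\<integral>u. std_normal_density u * ?I u \<partial>lborel)"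
      proof (rule integral_mono[OF _ int pt])
        have "integrable lborel (indicator J :: real \<Rightarrow> real)"
          using eS by (intro integrable_real_indicator) (auto simp: J_def emeasure_lborel_Icc_eq)
        then show "integrable lborel (\<lambda>u. d * indicator J u)" by simp
      qed
      also have "\<dots> = (\<integral>u. ?I u \<partial>?\<gamma>)" by (subst integral_density) auto
      also have "\<dots> = (sdiff x ^^ ?n) (\<lambda>a. \<integral>w. exp (- (X w - a)\<^sup>2 / (2 * ?e\<^sup>2)) \<partial>M) 0"
        by (rule mollified_differences[symmetric]) (use \<eta> in auto)
      finally have "1 / (?e * sqrt (2 * pi)) * (d * (?e * S)) \<le> (sdiff x ^^ ?n) (h m) 0"
        unfolding h_def[abs_def] sdiff_pow_cmult using \<eta>(1)[of m] by (intro mult_left_mono) auto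
      moreover have "1 / (?e * sqrt (2 * pi)) * (d * (?e * S)) = c ^ ?n * L (2 * S) * S / (sqrt (2 * pi) * sqrt (2 * pi)) * exp (- 2 * (?e * S)\<^sup>2)"
        using \<eta>(1)[of m] by (simp add: d_def)
      ultimately show ?thesis by simp
    qed
    have "(\<lambda>m. c ^ ?n * L (2 * S) * S / (2 * pi) * exp (- 2 * (\<eta> m * S)\<^sup>2)) \<longlonglongrightarrow> c ^ ?n * L (2 * S) * S / (2 * pi) * exp (- 2 * (0 * S)\<^sup>2)"
      by (intro tendsto_intros \<eta>(2)) auto
    moreover have "(\<lambda>m. (sdiff x ^^ ?n) (h m) 0) \<longlonglongrightarrow> (sdiff x ^^ ?n) f 0" by (rule sdiff_pow_tendsto[OF hl])
    ultimately have "c ^ ?n * L (2 * S) * S / (2 * pi) * exp (- 2 * (0 * S)\<^sup>2) \<le> (sdiff x ^^ ?n) f 0"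
      by (rule LIMSEQ_le) (use lower in auto)
    also have "\<dots> \<le> \<bar>(sdiff x ^^ ?n) (D 0) 0\<bar>" by (simp add: D_def del: funpow.simps)
    also have "\<dots> \<le> C * x ^ (2 * ?n)"
    proof (rule sdiff_bound[where D = D and j = 0 and r = "2 * real ?n", OF D])
      show "\<bar>0\<bar> + 2 * real ?n * \<bar>x\<bar> \<le> 2 * real ?n" using x by (simp add: mult_left_le del: of_nat_Suc)
    qed (use C in auto)
    finally show ?thesis by (simp add: x_def)
  qed
  define K where "K = 2 * pi * C / c ^ ?n"
  have K0: "0 \<le> K" using C0 c by (simp add: K_def)
  have large: "L s \<le> K * 2 ^ n / s ^ n" if s: "2 \<le> s" for s
  proof -
    define S where "S = s / 2"
    have S: "1 \<le> S" using s by (simp add: S_def)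
    have Ls: "0 \<le> L s" unfolding L_def by (rule L0)
    have "c ^ ?n * L s * 1 / (2 * pi) \<le> c ^ ?n * L s * S / (2 * pi)"
      using S Ls c by (intro divide_right_mono mult_left_mono) auto
    also have "\<dots> \<le> C * (1 / S) ^ (2 * ?n)" using key[OF S] by (simp add: S_def)
    also have "\<dots> \<le> C * (1 / S) ^ n" using S C0 by (intro mult_left_mono power_decreasing) auto
    finally have "c ^ ?n * L s \<le> c ^ ?n * (K * (1 / S) ^ n)"
      using c by (simp add: K_def field_simps del: power_Suc)
    then have "L s \<le> K * (1 / S) ^ n" using c by (simp del: power_Suc)
    then show ?thesis by (simp add: S_def power_divide)
  qed
  have "L s \<le> (K * 2 ^ n + 2 ^ n) / s ^ n" if s: "1 \<le> s" for s
  proof (cases "2 \<le> s")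
    case True
    then show ?thesis using large[OF True] by (simp add: add_divide_distrib) (smt (verit) divide_nonneg_nonneg zero_le_power s)
  next
    case False
    have "L s \<le> 1" unfolding L_def using Lmono[of 0 s] by (simp add: prob_space)
    also have "1 \<le> 2 ^ n / s ^ n"
      using False s by (simp add: power_mono)
    also have "\<dots> \<le> (K * 2 ^ n + 2 ^ n) / s ^ n" using s K0 by (intro divide_right_mono) auto
    finally show ?thesis .
  qed
  then show ?thesis unfolding L_def by blast
qed

end

section \<open>Rotations of Gaussian space\<close>

abbreviation gauss :: "real measure" where
  "gauss \<equiv> density lborel (\<lambda>x. ennreal (std_normal_density x))"

lemma prob_space_gauss: "prob_space gauss"
  by (rule prob_space_normal_density) simp

lemma sets_wiener [measurable_cong]: "sets wiener = sets (Pi\<^sub>M UNIV (\<lambda>_. borel))"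
  unfolding wiener_def by (intro sets_PiM_cong) auto

lemma space_wiener [simp]: "space wiener = UNIV"
  unfolding wiener_def by (auto simp: space_PiM)

interpretation gauss_product: product_prob_space "\<lambda>_::nat. gauss" UNIV
  by (intro product_prob_spaceI prob_space_gauss)

interpretation wiener: prob_space wiener
  unfolding wiener_def by (intro prob_space_PiM prob_space_gauss)

interpretation wiener2: pair_prob_space wiener wiener ..

lemma nn_integral_wiener_prod:
  fixes h :: "nat \<Rightarrow> real \<Rightarrow> ennreal"
  assumes J: "finite J" and [measurable]: "\<And>k. h k \<in> borel_measurable borel"
  shows "(\<integral>\<^sup>+y. (\<Prod>k\<in>J. h k (y k)) \<partial>wiener) = (\<Prod>k\<in>J. \<integral>\<^sup>+x. h k x \<partial>gauss)"
proof -
  have "(\<Prod>k\<in>J. \<integral>\<^sup>+x. h k x \<partial>gauss) = (\<integral>\<^sup>+x. (\<Prod>k\<in>J. h k (x k)) \<partial>Pi\<^sub>M J (\<lambda>_. gauss))"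
    by (rule gauss_product.product_nn_integral_prod[symmetric]) (use J in auto)
  also have "Pi\<^sub>M J (\<lambda>_. gauss) = distr wiener (Pi\<^sub>M J (\<lambda>_. gauss)) (\<lambda>x. restrict x J)"
    unfolding wiener_def using gauss_product.distr_PiM_restrict_finite[of J] J by simp
  also have "(\<integral>\<^sup>+x. (\<Prod>k\<in>J. h k (x k)) \<partial>\<dots>) = (\<integral>\<^sup>+x. (\<Prod>k\<in>J. h k (restrict x J k)) \<partial>wiener)"
  proof -
    have 1: "(\<lambda>x. restrict x J) \<in> wiener \<rightarrow>\<^sub>M Pi\<^sub>M J (\<lambda>_. gauss)"
      unfolding wiener_def by (rule measurable_restrict_subset) auto
    have 2: "(\<lambda>x. \<Prod>k\<in>J. h k (x k)) \<in> borel_measurable (Pi\<^sub>M J (\<lambda>_. gauss))"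
      by (intro borel_measurable_prod_ennreal measurable_compose[OF measurable_component_singleton]) auto
    show ?thesis by (rule nn_integral_distr) (use 1 2 in simp_all)
  qed
  also have "\<dots> = (\<integral>\<^sup>+y. (\<Prod>k\<in>J. h k (y k)) \<partial>wiener)"
    by (intro nn_integral_cong prod.cong) auto
  finally show ?thesis by simp
qed

definition rot2 :: "real \<Rightarrow> real \<times> real \<Rightarrow> real \<times> real" where
  "rot2 t p = (cos t * fst p + sin t * snd p, - sin t * fst p + cos t * snd p)"

lemma rot2_measurable [measurable]: "rot2 t \<in> borel \<Otimes>\<^sub>M borel \<rightarrow>\<^sub>M borel \<Otimes>\<^sub>M borel"
  unfolding rot2_def by measurable

lemma rot2_add: "rot2 s (rot2 t p) = rot2 (s + t) p"
  by (simp add: rot2_def cos_add sin_add algebra_simps)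

lemma nn_integral_translate:
  fixes f :: "real \<Rightarrow> ennreal"
  assumes "f \<in> borel_measurable borel"
  shows "(\<integral>\<^sup>+x. f (x + a) \<partial>lborel) = (\<integral>\<^sup>+x. f x \<partial>lborel)"
  using nn_integral_real_affine[OF assms, of 1 a] by (simp add: add.commute)

text \<open>A plane rotation with \<open>sin t \<noteq> 0\<close> is a product of three shears, each of which preserves
  Lebesgue measure.\<close>

lemma nn_integral_lborel_rot2:
  fixes f :: "real \<times> real \<Rightarrow> ennreal"
  assumes [measurable]: "f \<in> borel_measurable (borel \<Otimes>\<^sub>M borel)" and s: "sin t \<noteq> 0"
  shows "(\<integral>\<^sup>+x. \<integral>\<^sup>+y. f (rot2 t (x, y)) \<partial>lborel \<partial>lborel) = (\<integral>\<^sup>+x. \<integral>\<^sup>+y. f (x, y) \<partial>lborel \<partial>lborel)"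
proof -
  \<comment> \<open>a = tan(t/2). The rotation is the shear x + a y, then y - x sin t, then again x
    + a y.\<close>
  define a where "a = (1 - cos t) / sin t"
  define b where "b = - sin t"
  have X: "(\<integral>\<^sup>+x. \<integral>\<^sup>+y. g (x + a * y, y) \<partial>lborel \<partial>lborel) = (\<integral>\<^sup>+x. \<integral>\<^sup>+y. g (x, y) \<partial>lborel \<partial>lborel)"
    if [measurable]: "g \<in> borel_measurable (borel \<Otimes>\<^sub>M borel)" for g :: "real \<times> real \<Rightarrow> ennreal"
  proof -
    have "(\<integral>\<^sup>+x. \<integral>\<^sup>+y. g (x + a * y, y) \<partial>lborel \<partial>lborel) = (\<integral>\<^sup>+y. \<integral>\<^sup>+x. g (x + a * y, y) \<partial>lborel \<partial>lborel)"
      by (rule lborel_pair.Fubini') measurable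
    also have "\<dots> = (\<integral>\<^sup>+y. \<integral>\<^sup>+x. g (x, y) \<partial>lborel \<partial>lborel)"
      by (rule nn_integral_cong, rule nn_integral_translate[where f="\<lambda>x. g (x, _)"]) measurable
    also have "\<dots> = (\<integral>\<^sup>+x. \<integral>\<^sup>+y. g (x, y) \<partial>lborel \<partial>lborel)"
      by (rule lborel_pair.Fubini') measurable
    finally show ?thesis .
  qed
  have Y: "(\<integral>\<^sup>+x. \<integral>\<^sup>+y. g (x, b * x + y) \<partial>lborel \<partial>lborel) = (\<integral>\<^sup>+x. \<integral>\<^sup>+y. g (x, y) \<partial>lborel \<partial>lborel)"
    if [measurable]: "g \<in> borel_measurable (borel \<Otimes>\<^sub>M borel)" for g :: "real \<times> real \<Rightarrow> ennreal"
  proof (rule nn_integral_cong)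
    fix x
    show "(\<integral>\<^sup>+y. g (x, b * x + y) \<partial>lborel) = (\<integral>\<^sup>+y. g (x, y) \<partial>lborel)"
      using nn_integral_translate[of "\<lambda>y. g (x, y)" "b * x"] by (simp add: add.commute)
  qed
  have sc: "(sin t)\<^sup>2 = 1 - (cos t)\<^sup>2" by (simp add: sin_squared_eq)
  have ab: "1 + a * b = cos t" "a * (1 + a * b) + a = sin t"
  proof -
    show 1: "1 + a * b = cos t" using s by (simp add: a_def b_def)
    have "a * (1 + a * b) + a = (1 - cos t) * (1 + cos t) / sin t"
      unfolding 1 by (simp add: a_def algebra_simps add_divide_distrib diff_divide_distrib)
    also have "(1 - cos t) * (1 + cos t) = sin t * sin t"
      using sc by (simp add: power2_eq_square algebra_simps)
    finally show "a * (1 + a * b) + a = sin t" using s by simp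
  qed
  have rot: "rot2 t (x, y) = (let x1 = x + a * y; y1 = b * x1 + y in (x1 + a * y1, y1))" for x y
  proof -
    have "x + a * y + a * (b * (x + a * y) + y) = (1 + a * b) * x + (a * (1 + a * b) + a) * y"
      by (simp add: algebra_simps)
    moreover have "b * (x + a * y) + y = b * x + (1 + a * b) * y" by (simp add: algebra_simps)
    ultimately have "x + a * y + a * (b * (x + a * y) + y) = cos t * x + sin t * y"
      "b * (x + a * y) + y = - sin t * x + cos t * y"
      unfolding ab(2) unfolding ab(1) by (simp_all add: b_def)
    then show ?thesis by (simp add: rot2_def Let_def)
  qed
  have "(\<integral>\<^sup>+x. \<integral>\<^sup>+y. f (rot2 t (x, y)) \<partial>lborel \<partial>lborel)
      = (\<integral>\<^sup>+x. \<integral>\<^sup>+y. (\<lambda>(x, y). f (x + a * (b * x + y), b * x + y)) (x + a * y, y) \<partial>lborel \<partial>lborel)"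
    by (simp add: rot Let_def)
  also have "\<dots> = (\<integral>\<^sup>+x. \<integral>\<^sup>+y. f (x + a * (b * x + y), b * x + y) \<partial>lborel \<partial>lborel)"
    by (subst X) (auto simp: case_prod_beta)
  also have "\<dots> = (\<integral>\<^sup>+x. \<integral>\<^sup>+y. (\<lambda>(x, y). f (x + a * y, y)) (x, b * x + y) \<partial>lborel \<partial>lborel)"
    by simp
  also have "\<dots> = (\<integral>\<^sup>+x. \<integral>\<^sup>+y. f (x + a * y, y) \<partial>lborel \<partial>lborel)"
    by (subst Y) (auto simp: case_prod_beta)
  also have "\<dots> = (\<integral>\<^sup>+x. \<integral>\<^sup>+y. f (x, y) \<partial>lborel \<partial>lborel)"
    by (rule X) measurable
  finally show ?thesis .
qed

lemma gauss_pair: "gauss \<Otimes>\<^sub>M gauss = density (lborel \<Otimes>\<^sub>M lborel) (\<lambda>(x, y). ennreal (std_normal_density x) * ennreal (std_normal_density y))"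
  by (rule pair_measure_density) (auto intro: prob_space_imp_sigma_finite prob_space_gauss lborel.sigma_finite_measure_axioms)

lemma nn_integral_gauss_pair:
  fixes f :: "real \<times> real \<Rightarrow> ennreal"
  assumes [measurable]: "f \<in> borel_measurable (borel \<Otimes>\<^sub>M borel)"
  shows "(\<integral>\<^sup>+p. f p \<partial>(gauss \<Otimes>\<^sub>M gauss)) = (\<integral>\<^sup>+x. \<integral>\<^sup>+y. f (x, y) * ennreal (exp (- (x\<^sup>2 + y\<^sup>2) / 2) / (2 * pi)) \<partial>lborel \<partial>lborel)"
proof -
  have "(\<integral>\<^sup>+p. f p \<partial>(gauss \<Otimes>\<^sub>M gauss)) = (\<integral>\<^sup>+p. (\<lambda>(x, y). ennreal (std_normal_density x) * ennreal (std_normal_density y)) p * f p \<partial>(lborel \<Otimes>\<^sub>M lborel))"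
    unfolding gauss_pair by (rule nn_integral_density) auto
  also have "\<dots> = (\<integral>\<^sup>+x. \<integral>\<^sup>+y. ennreal (std_normal_density x) * ennreal (std_normal_density y) * f (x, y) \<partial>lborel \<partial>lborel)"
    by (subst lborel.nn_integral_fst[symmetric]) (auto simp: case_prod_beta)
  also have "\<dots> = (\<integral>\<^sup>+x. \<integral>\<^sup>+y. f (x, y) * ennreal (exp (- (x\<^sup>2 + y\<^sup>2) / 2) / (2 * pi)) \<partial>lborel \<partial>lborel)"
  proof (intro nn_integral_cong)
    fix x y :: real
    have "std_normal_density x * std_normal_density y = exp (- (x\<^sup>2 + y\<^sup>2) / 2) / (2 * pi)"
      by (simp add: std_normal_density_def exp_add[symmetric] field_simps real_sqrt_mult_self)
    then show "ennreal (std_normal_density x) * ennreal (std_normal_density y) * f (x, y) = f (x, y) * ennreal (exp (- (x\<^sup>2 + y\<^sup>2) / 2) / (2 * pi))"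
      by (simp add: ennreal_mult[symmetric] mult.commute)
  qed
  finally show ?thesis .
qed

text \<open>The joint density depends on the radius only, so invariance of Lebesgue measure is
  enough. If sin t = 0 the rotation is split into t - pi/2 and pi/2, both with nonzero sine.\<close>

lemma distr_rot2: "distr (gauss \<Otimes>\<^sub>M gauss) (gauss \<Otimes>\<^sub>M gauss) (rot2 t) = gauss \<Otimes>\<^sub>M gauss"
proof -
  have sets: "sets (gauss \<Otimes>\<^sub>M gauss) = sets (borel \<Otimes>\<^sub>M borel)" by (intro sets_pair_measure_cong) auto
  have m [measurable]: "rot2 t \<in> gauss \<Otimes>\<^sub>M gauss \<rightarrow>\<^sub>M gauss \<Otimes>\<^sub>M gauss" for t
    using rot2_measurable[of t] by (simp add: measurable_cong_sets[OF sets sets])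
  have gen: "distr (gauss \<Otimes>\<^sub>M gauss) (gauss \<Otimes>\<^sub>M gauss) (rot2 t) = gauss \<Otimes>\<^sub>M gauss" if s: "sin t \<noteq> 0" for t
  proof (rule measure_eqI)
    fix A assume "A \<in> sets (distr (gauss \<Otimes>\<^sub>M gauss) (gauss \<Otimes>\<^sub>M gauss) (rot2 t))"
    then have A: "A \<in> sets (gauss \<Otimes>\<^sub>M gauss)" and [measurable]: "A \<in> sets (borel \<Otimes>\<^sub>M borel)" using sets by auto
    let ?E = "\<lambda>p :: real \<times> real. ennreal (exp (- ((fst p)\<^sup>2 + (snd p)\<^sup>2) / 2) / (2 * pi))"
    have inv: "?E (rot2 t p) = ?E p" for p
    proof -
      have "(fst (rot2 t p))\<^sup>2 + (snd (rot2 t p))\<^sup>2 = ((cos t)\<^sup>2 + (sin t)\<^sup>2) * ((fst p)\<^sup>2 + (snd p)\<^sup>2)"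
        unfolding rot2_def fst_conv snd_conv by algebra
      then show ?thesis by simp
    qed
    have "emeasure (distr (gauss \<Otimes>\<^sub>M gauss) (gauss \<Otimes>\<^sub>M gauss) (rot2 t)) A = (\<integral>\<^sup>+p. indicator A p \<partial>distr (gauss \<Otimes>\<^sub>M gauss) (gauss \<Otimes>\<^sub>M gauss) (rot2 t))"
      using A by simp
    also have "\<dots> = (\<integral>\<^sup>+p. indicator A (rot2 t p) \<partial>(gauss \<Otimes>\<^sub>M gauss))"
      using A by (intro nn_integral_distr m) auto
    also have "\<dots> = (\<integral>\<^sup>+x. \<integral>\<^sup>+y. indicator A (rot2 t (x, y)) * ?E (rot2 t (x, y)) \<partial>lborel \<partial>lborel)"
      unfolding inv by (subst nn_integral_gauss_pair) auto
    also have "\<dots> = (\<integral>\<^sup>+x. \<integral>\<^sup>+y. indicator A (x, y) * ?E (x, y) \<partial>lborel \<partial>lborel)"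
      by (rule nn_integral_lborel_rot2[OF _ s, where f = "\<lambda>p. indicator A p * ?E p"]) measurable
    also have "\<dots> = (\<integral>\<^sup>+p. indicator A p \<partial>(gauss \<Otimes>\<^sub>M gauss))"
      by (subst nn_integral_gauss_pair) auto
    finally show "emeasure (distr (gauss \<Otimes>\<^sub>M gauss) (gauss \<Otimes>\<^sub>M gauss) (rot2 t)) A = emeasure (gauss \<Otimes>\<^sub>M gauss) A"
      using A by simp
  qed simp
  show ?thesis
  proof (cases "sin t = 0")
    case True
    then have "cos t \<noteq> 0" using sin_zero_abs_cos_one by fastforce
    then have 1: "sin (t - pi/2) \<noteq> 0" by (simp add: sin_diff)
    have "rot2 t = rot2 (t - pi/2) \<circ> rot2 (pi/2)" by (auto simp: fun_eq_iff rot2_add)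
    then have "distr (gauss \<Otimes>\<^sub>M gauss) (gauss \<Otimes>\<^sub>M gauss) (rot2 t)
        = distr (distr (gauss \<Otimes>\<^sub>M gauss) (gauss \<Otimes>\<^sub>M gauss) (rot2 (pi/2))) (gauss \<Otimes>\<^sub>M gauss) (rot2 (t - pi/2))"
      using distr_distr[OF m m] by metis
    then show ?thesis by (simp add: gen 1)
  qed (rule gen)
qed

definition rot :: "real \<Rightarrow> (nat \<Rightarrow> real) \<times> (nat \<Rightarrow> real) \<Rightarrow> (nat \<Rightarrow> real) \<times> (nat \<Rightarrow> real)" where
  "rot t p = ((\<lambda>k. cos t * fst p k + sin t * snd p k), (\<lambda>k. - sin t * fst p k + cos t * snd p k))"

lemma rot_measurable [measurable]: "rot t \<in> wiener \<Otimes>\<^sub>M wiener \<rightarrow>\<^sub>M wiener \<Otimes>\<^sub>M wiener"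
proof -
  have [measurable]: "(\<lambda>p. fst p k) \<in> borel_measurable (wiener \<Otimes>\<^sub>M wiener)" "(\<lambda>p. snd p k) \<in> borel_measurable (wiener \<Otimes>\<^sub>M wiener)" for k
    by measurable
  have "(\<lambda>p k. cos t * fst p k + sin t * snd p k) \<in> wiener \<Otimes>\<^sub>M wiener \<rightarrow>\<^sub>M Pi\<^sub>M UNIV (\<lambda>_. borel)"
    "(\<lambda>p k. - sin t * fst p k + cos t * snd p k) \<in> wiener \<Otimes>\<^sub>M wiener \<rightarrow>\<^sub>M Pi\<^sub>M UNIV (\<lambda>_. borel)"
    by (rule measurable_PiM_single'; simp)+
  then show ?thesis unfolding rot_def
    by (intro measurable_Pair) (auto simp: measurable_cong_sets[OF refl sets_wiener])
qed

abbreviation zipped :: "(nat \<Rightarrow> real) \<times> (nat \<Rightarrow> real) \<Rightarrow> nat \<Rightarrow> real \<times> real" where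
  "zipped p \<equiv> (\<lambda>k. (fst p k, snd p k))"

text \<open>Two sequences are regrouped into one sequence of pairs, on which a planar map acts
  coordinatewise; cylinder sets and Fubini reduce the claim to a single pair.\<close>

lemma distr_wiener_pair:
  assumes m: "\<rho> \<in> gauss \<Otimes>\<^sub>M gauss \<rightarrow>\<^sub>M gauss \<Otimes>\<^sub>M gauss"
    and inv: "distr (gauss \<Otimes>\<^sub>M gauss) (gauss \<Otimes>\<^sub>M gauss) \<rho> = gauss \<Otimes>\<^sub>M gauss"
  shows "distr (wiener \<Otimes>\<^sub>M wiener) (Pi\<^sub>M UNIV (\<lambda>_. gauss \<Otimes>\<^sub>M gauss)) (\<lambda>p k. \<rho> (zipped p k)) = Pi\<^sub>M UNIV (\<lambda>_. gauss \<Otimes>\<^sub>M gauss)"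
    (is "distr ?W ?P ?S = ?P")
proof (rule measure_eqI_PiM_infinite)
  have sets: "sets (gauss \<Otimes>\<^sub>M gauss) = sets (borel \<Otimes>\<^sub>M borel)" by (intro sets_pair_measure_cong) auto
  have zm [measurable]: "(\<lambda>p. zipped p k) \<in> ?W \<rightarrow>\<^sub>M gauss \<Otimes>\<^sub>M gauss" for k
    by (simp add: measurable_cong_sets[OF refl sets])
  have S: "?S \<in> ?W \<rightarrow>\<^sub>M ?P"
    by (rule measurable_PiM_single') (auto simp: space_pair_measure intro!: measurable_compose[OF zm m])
  show "sets (distr ?W ?P ?S) = sets ?P" "sets ?P = sets ?P" by auto
  interpret gg: pair_prob_space gauss gauss
    by (simp add: pair_prob_space_def pair_sigma_finite_def prob_space_gauss prob_space_imp_sigma_finite)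
  interpret P: product_prob_space "\<lambda>_::nat. gauss \<Otimes>\<^sub>M gauss" UNIV
    by (intro product_prob_spaceI) unfold_locales
  interpret D: prob_space "distr ?W ?P ?S" by (rule wiener2.prob_space_distr[OF S])
  show "finite_measure (distr ?W ?P ?S)" by (rule D.finite_measure_axioms)
  fix A :: "nat \<Rightarrow> (real \<times> real) set" and J :: "nat set"
  assume J: "finite J" "J \<subseteq> UNIV" and A: "\<And>i. i \<in> J \<Longrightarrow> A i \<in> sets (gauss \<Otimes>\<^sub>M gauss)"
  define B where "B k = (if k \<in> J then \<rho> -` A k \<inter> space (gauss \<Otimes>\<^sub>M gauss) else {})" for k
  have Bs: "B k \<in> sets (gauss \<Otimes>\<^sub>M gauss)" for k unfolding B_def using measurable_sets[OF m A] by simp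
  then have [measurable]: "B k \<in> sets (borel \<Otimes>\<^sub>M borel)" for k using sets by blast
  have E: "prod_emb UNIV (\<lambda>_. gauss \<Otimes>\<^sub>M gauss) J (Pi\<^sub>E J A) \<in> sets ?P"
    using J A by (intro sets_PiM_I) auto
  have "emeasure (distr ?W ?P ?S) (prod_emb UNIV (\<lambda>_. gauss \<Otimes>\<^sub>M gauss) J (Pi\<^sub>E J A))
     = emeasure ?W (?S -` prod_emb UNIV (\<lambda>_. gauss \<Otimes>\<^sub>M gauss) J (Pi\<^sub>E J A) \<inter> space ?W)"
    by (rule emeasure_distr[OF S E])
  also have "\<dots> = (\<integral>\<^sup>+p. indicator (?S -` prod_emb UNIV (\<lambda>_. gauss \<Otimes>\<^sub>M gauss) J (Pi\<^sub>E J A) \<inter> space ?W) p \<partial>?W)"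
    by (rule nn_integral_indicator[symmetric]) (rule measurable_sets[OF S E])
  also have "\<dots> = (\<integral>\<^sup>+p. (\<Prod>k\<in>J. indicator (B k) (fst p k, snd p k)) \<partial>?W)"
  proof (intro nn_integral_cong)
    fix p
    have "(\<Prod>k\<in>J. indicator (B k) (fst p k, snd p k)) = (indicator {p. \<forall>k\<in>J. \<rho> (fst p k, snd p k) \<in> A k} p :: ennreal)"
    proof -
      have "(\<Prod>k\<in>J. indicator (B k) (fst p k, snd p k)) = (\<Prod>k\<in>J. indicator (\<rho> -` A k) (fst p k, snd p k) :: ennreal)"
        by (intro prod.cong) (auto simp: B_def indicator_def space_pair_measure)
      also have "\<dots> = indicator {p. \<forall>k\<in>J. \<rho> (fst p k, snd p k) \<in> A k} p"
        using J(1) by (induction J rule: finite_induct) (auto simp: indicator_def)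
      finally show ?thesis .
    qed
    then show "indicator (?S -` prod_emb UNIV (\<lambda>_. gauss \<Otimes>\<^sub>M gauss) J (Pi\<^sub>E J A) \<inter> space ?W) p
       = ((\<Prod>k\<in>J. indicator (B k) (fst p k, snd p k)) :: ennreal)"
      by (auto simp: prod_emb_def indicator_def space_pair_measure PiE_iff)
  qed
  also have "\<dots> = (\<integral>\<^sup>+y. \<integral>\<^sup>+z. (\<Prod>k\<in>J. indicator (B k) (y k, z k)) \<partial>wiener \<partial>wiener)"
    by (subst wiener.nn_integral_fst[symmetric]) (auto simp: case_prod_beta)
  also have "\<dots> = (\<integral>\<^sup>+y. (\<Prod>k\<in>J. \<integral>\<^sup>+v. indicator (B k) (y k, v) \<partial>gauss) \<partial>wiener)"
    by (rule nn_integral_cong, rule nn_integral_wiener_prod[OF J(1), where h="\<lambda>k v. indicator (B k) (_ k, v)"]) measurable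
  also have "\<dots> = (\<Prod>k\<in>J. \<integral>\<^sup>+u. \<integral>\<^sup>+v. indicator (B k) (u, v) \<partial>gauss \<partial>gauss)"
  proof (rule nn_integral_wiener_prod[OF J(1), where h="\<lambda>k u. \<integral>\<^sup>+v. indicator (B k) (u, v) \<partial>gauss"])
    show "(\<lambda>u. \<integral>\<^sup>+v. indicator (B k) (u, v) \<partial>gauss) \<in> borel_measurable borel" for k
      by (rule sigma_finite_measure.borel_measurable_nn_integral)
         (auto intro: prob_space_imp_sigma_finite prob_space_gauss simp: case_prod_beta)
  qed
  also have "\<dots> = (\<Prod>k\<in>J. emeasure (gauss \<Otimes>\<^sub>M gauss) (B k))"
  proof (intro prod.cong refl)
    fix k
    have "emeasure (gauss \<Otimes>\<^sub>M gauss) (B k) = (\<integral>\<^sup>+u. \<integral>\<^sup>+v. indicator (B k) (u, v) \<partial>gauss \<partial>gauss)"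
      by (rule sigma_finite_measure.emeasure_pair_measure[OF prob_space_imp_sigma_finite[OF prob_space_gauss] Bs])
    then show "(\<integral>\<^sup>+u. \<integral>\<^sup>+v. indicator (B k) (u, v) \<partial>gauss \<partial>gauss) = emeasure (gauss \<Otimes>\<^sub>M gauss) (B k)" by simp
  qed
  also have "\<dots> = (\<Prod>k\<in>J. emeasure (gauss \<Otimes>\<^sub>M gauss) (A k))"
  proof (intro prod.cong refl)
    fix k assume k: "k \<in> J"
    have "emeasure (gauss \<Otimes>\<^sub>M gauss) (A k) = emeasure (distr (gauss \<Otimes>\<^sub>M gauss) (gauss \<Otimes>\<^sub>M gauss) \<rho>) (A k)" by (simp add: inv)
    also have "\<dots> = emeasure (gauss \<Otimes>\<^sub>M gauss) (B k)" using k A by (simp add: emeasure_distr[OF m] B_def)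
    finally show "emeasure (gauss \<Otimes>\<^sub>M gauss) (B k) = emeasure (gauss \<Otimes>\<^sub>M gauss) (A k)" by simp
  qed
  also have "\<dots> = emeasure ?P (prod_emb UNIV (\<lambda>_. gauss \<Otimes>\<^sub>M gauss) J (Pi\<^sub>E J A))"
    by (rule P.emeasure_PiM_emb[symmetric]) (use J A in auto)
  finally show "emeasure (distr ?W ?P ?S) (prod_emb UNIV (\<lambda>_. gauss \<Otimes>\<^sub>M gauss) J (Pi\<^sub>E J A)) = emeasure ?P (prod_emb UNIV (\<lambda>_. gauss \<Otimes>\<^sub>M gauss) J (Pi\<^sub>E J A))" .
qed

lemma distr_rot: "distr (wiener \<Otimes>\<^sub>M wiener) (wiener \<Otimes>\<^sub>M wiener) (rot t) = wiener \<Otimes>\<^sub>M wiener"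
proof -
  let ?W = "wiener \<Otimes>\<^sub>M wiener" and ?P = "Pi\<^sub>M (UNIV :: nat set) (\<lambda>_. gauss \<Otimes>\<^sub>M gauss)"
  have sets: "sets (gauss \<Otimes>\<^sub>M gauss) = sets (borel \<Otimes>\<^sub>M borel)" by (intro sets_pair_measure_cong) auto
  have setsP: "sets ?P = sets (Pi\<^sub>M UNIV (\<lambda>_. borel \<Otimes>\<^sub>M borel))" by (intro sets_PiM_cong sets refl)
  have m: "rot2 t \<in> gauss \<Otimes>\<^sub>M gauss \<rightarrow>\<^sub>M gauss \<Otimes>\<^sub>M gauss" for t
    using rot2_measurable[of t] by (simp add: measurable_cong_sets[OF sets sets])
  define T where "T q = ((\<lambda>k. fst (q k)), (\<lambda>k. snd (q k)))" for q :: "nat \<Rightarrow> real \<times> real"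
  have T: "T \<in> ?P \<rightarrow>\<^sub>M ?W"
  proof -
    have c: "(\<lambda>q. q k) \<in> ?P \<rightarrow>\<^sub>M borel \<Otimes>\<^sub>M borel" for k :: nat
      unfolding measurable_cong_sets[OF setsP refl] by (rule measurable_component_singleton) simp
    have "(\<lambda>q k. fst (q k)) \<in> ?P \<rightarrow>\<^sub>M Pi\<^sub>M UNIV (\<lambda>_. borel)" "(\<lambda>q k. snd (q k)) \<in> ?P \<rightarrow>\<^sub>M Pi\<^sub>M UNIV (\<lambda>_. borel)"
      by (rule measurable_PiM_single'; use measurable_compose[OF c measurable_fst] measurable_compose[OF c measurable_snd] in simp)+
    then show ?thesis unfolding T_def
      by (intro measurable_Pair) (auto simp: measurable_cong_sets[OF refl sets_wiener])
  qed
  have S: "(\<lambda>p k. rot2 t (zipped p k)) \<in> ?W \<rightarrow>\<^sub>M ?P" for t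
  proof -
    have zm: "(\<lambda>p. zipped p k) \<in> ?W \<rightarrow>\<^sub>M gauss \<Otimes>\<^sub>M gauss" for k
      by (simp add: measurable_cong_sets[OF refl sets])
    show ?thesis
      by (rule measurable_PiM_single') (auto simp: space_pair_measure intro!: measurable_compose[OF zm m])
  qed
  \<comment> \<open>The right-hand side does not involve t. Comparing with \<open>rot 0\<close>, the
    identity, gives invariance without inverting the regrouping into pairs.\<close>
  have eq: "distr ?W ?W (rot t) = distr ?P ?W T" for t
  proof -
    have "rot t = T \<circ> (\<lambda>p k. rot2 t (zipped p k))" by (auto simp: fun_eq_iff rot_def T_def rot2_def)
    then have "distr ?W ?W (rot t) = distr (distr ?W ?P (\<lambda>p k. rot2 t (zipped p k))) ?W T"
      using distr_distr[OF T S] by metis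
    then show ?thesis by (simp add: distr_wiener_pair[OF m distr_rot2])
  qed
  have "rot 0 = id" by (auto simp: rot_def fun_eq_iff)
  then have "distr ?W ?W (rot 0) = ?W" by (simp add: id_def)
  then show ?thesis using eq[of t] eq[of 0] by simp
qed

interpretation wflow: flow "wiener \<Otimes>\<^sub>M wiener" rot
proof
  show "rot s (rot t x) = rot (s + t) x" for s t x
    by (auto simp: rot_def cos_add sin_add algebra_simps fun_eq_iff)
  show "rot 0 x = x" for x by (auto simp: rot_def)
qed (auto simp: distr_rot)

section \<open>Gaussian series\<close>

lemma Lp_2_eq_LL: "Lp M 2 = LL M 2"
proof -
  have "\<bar>x\<bar> powr 2 = \<bar>x\<bar>\<^sup>2" for x :: real by (simp add: powr_numeral)
  then show ?thesis by (simp add: Lp_def LL_def)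
qed

lemma nn_integral_sq_eq_nrm:
  assumes "f \<in> LL M 2"
  shows "(\<integral>\<^sup>+x. ennreal ((f x)\<^sup>2) \<partial>M) = ennreal ((nrm M 2 f)\<^sup>2)"
  using assms nrm_power[of 2 M f] by (subst nn_integral_eq_integral) (auto simp: LL_2_iff)

lemma LL_2_I:
  assumes [measurable]: "f \<in> borel_measurable M" and "(\<integral>\<^sup>+x. ennreal ((f x)\<^sup>2) \<partial>M) < \<infinity>"
  shows "f \<in> LL M 2"
  unfolding LL_2_iff by (intro conjI integrableI_nonneg) (use assms in auto)

lemma nn_tendsto_iff_nrm:
  assumes "\<And>n. f n \<in> LL M 2"
  shows "(\<lambda>n. \<integral>\<^sup>+x. ennreal ((f n x)\<^sup>2) \<partial>M) \<longlonglongrightarrow> 0 \<longleftrightarrow> (\<lambda>n. nrm M 2 (f n)) \<longlonglongrightarrow> 0"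
proof -
  have "(\<lambda>n. \<integral>\<^sup>+x. ennreal ((f n x)\<^sup>2) \<partial>M) \<longlonglongrightarrow> 0 \<longleftrightarrow> (\<lambda>n. ennreal ((nrm M 2 (f n))\<^sup>2)) \<longlonglongrightarrow> ennreal 0"
    by (simp add: nn_integral_sq_eq_nrm assms)
  also have "\<dots> \<longleftrightarrow> (\<lambda>n. (nrm M 2 (f n))\<^sup>2) \<longlonglongrightarrow> 0"
    by (rule tendsto_ennreal_iff) auto
  also have "\<dots> \<longleftrightarrow> (\<lambda>n. nrm M 2 (f n)) \<longlonglongrightarrow> 0"
  proof
    assume "(\<lambda>n. (nrm M 2 (f n))\<^sup>2) \<longlonglongrightarrow> 0"
    from tendsto_real_sqrt[OF this] show "(\<lambda>n. nrm M 2 (f n)) \<longlonglongrightarrow> 0" by (simp add: nrm_nonneg)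
  next
    assume "(\<lambda>n. nrm M 2 (f n)) \<longlonglongrightarrow> 0"
    from tendsto_power[OF this, of 2] show "(\<lambda>n. (nrm M 2 (f n))\<^sup>2) \<longlonglongrightarrow> 0" by simp
  qed
  finally show ?thesis .
qed

lemma integral_gauss_moments:
  "integrable gauss (\<lambda>x. \<bar>x\<bar> ^ p)" "(\<integral>x. x \<partial>gauss) = 0" "(\<integral>x. x\<^sup>2 \<partial>gauss) = 1"
proof -
  show "integrable gauss (\<lambda>x. \<bar>x\<bar> ^ p)"
    by (subst integrable_density) (auto simp: integrable_std_normal_moment_abs)
  show "(\<integral>x. x \<partial>gauss) = 0"
    by (subst integral_density) (use integral_std_normal_moment_odd[of 0] in auto)
  show "(\<integral>x. x\<^sup>2 \<partial>gauss) = 1"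
    by (subst integral_density) (use integral_std_normal_moment_even[of 1] in \<open>auto simp: numeral_2_eq_2\<close>)
qed

text \<open>Allows the coordinates of a second Wiener copy to serve as the noise, so that one theory
  of Gaussian series covers both this copy and the given G.\<close>

lemma iid_wiener: "iid_std_normal wiener (\<lambda>k y. y k)"
proof -
  have d: "distr wiener gauss (\<lambda>y. y k) = gauss" for k
    unfolding wiener_def by (rule distr_PiM_component) (auto intro: prob_space_gauss)
  have d': "distr wiener borel (\<lambda>y. y k) = gauss" for k
  proof -
    have "distr wiener borel (\<lambda>y. y k) = distr wiener gauss (\<lambda>y. y k)" by (intro distr_cong) auto
    then show ?thesis by (simp only: d)
  qed
  have "wiener.indep_vars (\<lambda>_. borel) (\<lambda>k y. y k) UNIV"
  proof (subst wiener.indep_vars_iff_distr_eq_PiM)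
    show "(\<lambda>y. y i) \<in> borel_measurable wiener" for i by measurable
    have "distr wiener (Pi\<^sub>M UNIV (\<lambda>_. borel)) (\<lambda>x. \<lambda>i\<in>UNIV. x i) = distr wiener wiener (\<lambda>x. x)"
      by (intro distr_cong) (auto simp: sets_wiener)
    also have "\<dots> = wiener" by simp
    also have "\<dots> = Pi\<^sub>M UNIV (\<lambda>i. distr wiener borel (\<lambda>y. y i))" unfolding d' by (rule wiener_def)
    finally show "distr wiener (Pi\<^sub>M UNIV (\<lambda>_. borel)) (\<lambda>x. \<lambda>i\<in>UNIV. x i) = Pi\<^sub>M UNIV (\<lambda>i. distr wiener borel (\<lambda>y. y i))" .
  qed auto
  moreover have "distributed wiener lborel (\<lambda>y. y k) (\<lambda>x. ennreal (std_normal_density x))" for k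
  proof -
    have "distr wiener lborel (\<lambda>y. y k) = distr wiener borel (\<lambda>y. y k)" by (intro distr_cong) auto
    then show ?thesis unfolding distributed_def by (auto simp: d')
  qed
  ultimately show ?thesis unfolding iid_std_normal_def using wiener.prob_space_axioms by blast
qed

locale iid_gauss =
  fixes M :: "'b measure" and G :: "nat \<Rightarrow> 'b \<Rightarrow> real"
  assumes iid: "iid_std_normal M G"

sublocale iid_gauss \<subseteq> prob_space M
  using iid by (simp add: iid_std_normal_def)

sublocale iid_gauss \<subseteq> WM: pair_prob_space wiener M ..

context iid_gauss
begin

lemma G_distributed: "distributed M lborel (G k) (\<lambda>x. ennreal (std_normal_density x))"
  using iid by (simp add: iid_std_normal_def)

lemma G_measurable [measurable]: "G k \<in> borel_measurable M"
  using distributed_measurable[OF G_distributed[of k]] by simp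

lemma G_distr: "distr M borel (G k) = gauss"
proof -
  have "distr M borel (G k) = distr M lborel (G k)" by (intro distr_cong) auto
  then show ?thesis using distributed_distr_eq_density[OF G_distributed[of k]] by simp
qed

lemma G_indep: "finite K \<Longrightarrow> indep_vars (\<lambda>_. borel) G K"
  using iid indep_vars_subset unfolding iid_std_normal_def by blast

lemma G_LL: "G k \<in> LL M p"
proof -
  have "integrable (distr M borel (G k)) (\<lambda>x. \<bar>x\<bar> ^ p)"
    using integral_gauss_moments(1)[of p] by (simp add: G_distr)
  then show ?thesis by (subst (asm) integrable_distr_eq) (auto simp: LL_def)
qed

lemma G_product_integrable: "integrable M (\<lambda>w. G j w * G k w)"
  by (intro Cauchy_Schwarz_LL(1) G_LL)

lemma G_orthonormal: "(\<integral>w. G j w * G k w \<partial>M) = (if j = k then 1 else 0)"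
proof (cases "j = k")
  case True
  have "(\<integral>w. (G k w)\<^sup>2 \<partial>M) = (\<integral>x. x\<^sup>2 \<partial>distr M borel (G k))" by (rule integral_distr[symmetric]) auto
  then show ?thesis using True by (simp add: G_distr integral_gauss_moments power2_eq_square[symmetric])
next
  case False
  have i: "integrable M (G k)" for k using G_LL[of k 1] by (simp add: LL_def integrable_abs_iff)
  have z: "(\<integral>w. G k w \<partial>M) = 0" for k
  proof -
    have "(\<integral>w. G k w \<partial>M) = (\<integral>x. x \<partial>distr M borel (G k))" by (rule integral_distr[symmetric]) auto
    then show ?thesis by (simp add: G_distr integral_gauss_moments)
  qed
  have "(\<integral>w. (\<Prod>i\<in>{j, k}. G i w) \<partial>M) = (\<Prod>i\<in>{j, k}. \<integral>w. G i w \<partial>M)"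
    by (rule indep_vars_lebesgue_integral) (auto intro: G_indep i)
  then show ?thesis using False by (simp add: z)
qed

lemma G_linear_norm:
  assumes K: "finite K"
  shows "(\<integral>\<^sup>+w. ennreal ((\<Sum>k\<in>K. a k * G k w)\<^sup>2) \<partial>M) = ennreal (\<Sum>k\<in>K. (a k)\<^sup>2)"
proof -
  have e: "(\<Sum>k\<in>K. a k * G k w)\<^sup>2 = (\<Sum>j\<in>K. \<Sum>k\<in>K. a j * a k * (G j w * G k w))" for w
    unfolding power2_eq_square sum_product by (intro sum.cong) (auto simp: mult_ac)
  have i: "integrable M (\<lambda>w. (\<Sum>k\<in>K. a k * G k w)\<^sup>2)"
    unfolding e by (intro Bochner_Integration.integrable_sum integrable_mult_right G_product_integrable)
  have "(\<integral>w. (\<Sum>k\<in>K. a k * G k w)\<^sup>2 \<partial>M) = (\<Sum>j\<in>K. \<Sum>k\<in>K. a j * a k * (if j = k then 1 else 0))"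
    unfolding e by (simp add: Bochner_Integration.integral_sum Bochner_Integration.integrable_sum G_product_integrable G_orthonormal cong: sum.cong)
  also have "\<dots> = (\<Sum>k\<in>K. (a k)\<^sup>2)" using K by (simp add: power2_eq_square if_distrib cong: if_cong sum.cong)
  finally show ?thesis using i by (simp add: nn_integral_eq_integral)
qed

text \<open>The noise is orthonormal, so a finite series has the L^2 norm of its coefficient vector;
  all later passages between gradients and series use this isometry.\<close>

lemma linear_norm:
  assumes K: "finite K" and [measurable]: "\<And>k. a k \<in> borel_measurable wiener"
  shows "(\<integral>\<^sup>+p. ennreal ((\<Sum>k\<in>K. a k (fst p) * G k (snd p))\<^sup>2) \<partial>(wiener \<Otimes>\<^sub>M M))
     = (\<integral>\<^sup>+y. ennreal (\<Sum>k\<in>K. (a k y)\<^sup>2) \<partial>wiener)"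
proof -
  have "(\<integral>\<^sup>+p. ennreal ((\<Sum>k\<in>K. a k (fst p) * G k (snd p))\<^sup>2) \<partial>(wiener \<Otimes>\<^sub>M M))
     = (\<integral>\<^sup>+y. \<integral>\<^sup>+w. ennreal ((\<Sum>k\<in>K. a k y * G k w)\<^sup>2) \<partial>M \<partial>wiener)"
    by (subst nn_integral_fst[symmetric]) auto
  then show ?thesis by (simp add: G_linear_norm[OF K])
qed

lemma linear_cos:
  assumes K: "finite K"
  shows "(\<integral>w. cos (s * (\<Sum>k\<in>K. a k * G k w)) \<partial>M) = exp (- (s\<^sup>2 / 2) * (\<Sum>k\<in>K. (a k)\<^sup>2))"
proof -
  have c: "char (distr M borel (\<lambda>w. c * G k w)) t = complex_of_real (exp (- (c * t)\<^sup>2 / 2))" for c k t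
  proof -
    have "char (distr M borel (\<lambda>w. c * G k w)) t = (CLINT w|M. iexp (t * (c * G k w)))"
      unfolding char_def by (rule integral_distr) auto
    also have "\<dots> = (CLINT x|distr M borel (G k). iexp ((c * t) * x))"
      by (subst integral_distr) (auto simp: mult_ac)
    also have "\<dots> = char std_normal_distribution (c * t)" unfolding G_distr char_def ..
    finally show ?thesis by (simp add: char_std_normal_distribution)
  qed
  have "indep_vars (\<lambda>_. borel) (\<lambda>k w. a k * G k w) K"
    by (rule indep_vars_compose2[OF G_indep[OF K]]) auto
  from char_distr_sum[OF this, of s]
  have "char (distr M borel (\<lambda>w. \<Sum>k\<in>K. a k * G k w)) s = (\<Prod>k\<in>K. complex_of_real (exp (- (a k * s)\<^sup>2 / 2)))"
    by (simp add: c)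
  also have "\<dots> = complex_of_real (exp (\<Sum>k\<in>K. - (a k * s)\<^sup>2 / 2))" using K by (simp add: exp_sum)
  also have "(\<Sum>k\<in>K. - (a k * s)\<^sup>2 / 2) = - (s\<^sup>2 / 2) * (\<Sum>k\<in>K. (a k)\<^sup>2)"
    by (simp add: sum_distrib_left power_mult_distrib sum_negf mult_ac)
  finally have "Re (char (distr M borel (\<lambda>w. \<Sum>k\<in>K. a k * G k w)) s) = exp (- (s\<^sup>2 / 2) * (\<Sum>k\<in>K. (a k)\<^sup>2))"
    by simp
  moreover have "char (distr M borel (\<lambda>w. \<Sum>k\<in>K. a k * G k w)) s = (CLINT w|M. iexp (s * (\<Sum>k\<in>K. a k * G k w)))"
    unfolding char_def by (rule integral_distr) auto
  moreover have "Re (CLINT w|M. iexp (s * (\<Sum>k\<in>K. a k * G k w))) = (\<integral>w. Re (iexp (s * (\<Sum>k\<in>K. a k * G k w))) \<partial>M)"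
    by (rule integral_Re[symmetric]) (rule integrable_const_bound[where B=1], auto)
  ultimately show ?thesis by (simp add: Re_exp)
qed

end

text \<open>Used with two noises: the G of the theorem and the coordinates of a second Wiener copy,
  on which the rotations act. \<open>damp\<close> is built from \<open>U\<close> alone, so decay
  established for one noise is available for the other.\<close>

locale gauss_series = iid_gauss M G for M :: "'b measure" and G :: "nat \<Rightarrow> 'b \<Rightarrow> real" +
  fixes U :: "nat \<Rightarrow> (nat \<Rightarrow> real) \<Rightarrow> real"
  assumes U_measurable [measurable]: "\<And>k. U k \<in> borel_measurable wiener"
    and U_finite: "(\<integral>\<^sup>+y. (\<Sum>k. ennreal ((U k y)\<^sup>2)) \<partial>wiener) < \<infinity>"
begin

definition partial :: "nat \<Rightarrow> (nat \<Rightarrow> real) \<times> 'b \<Rightarrow> real" where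
  "partial n p = (\<Sum>k<n. U k (fst p) * G k (snd p))"

lemma U_LL: "U k \<in> LL wiener 2"
proof (rule LL_2_I)
  have "ennreal ((U k y)\<^sup>2) \<le> (\<Sum>k. ennreal ((U k y)\<^sup>2))" for y
  proof -
    have "(\<Sum>i\<in>{k}. ennreal ((U i y)\<^sup>2)) \<le> (\<Sum>k. ennreal ((U k y)\<^sup>2))" by (rule sum_le_suminf) auto
    then show ?thesis by simp
  qed
  then have "(\<integral>\<^sup>+y. ennreal ((U k y)\<^sup>2) \<partial>wiener) \<le> (\<integral>\<^sup>+y. (\<Sum>k. ennreal ((U k y)\<^sup>2)) \<partial>wiener)"
    by (rule nn_integral_mono)
  then show "(\<integral>\<^sup>+y. ennreal ((U k y)\<^sup>2) \<partial>wiener) < \<infinity>" using U_finite by (rule le_less_trans)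
qed auto

lemma U_sums: "summable (\<lambda>k. \<integral>y. (U k y)\<^sup>2 \<partial>wiener)"
proof (rule summable_suminf_not_top)
  have "(\<Sum>k. ennreal (\<integral>y. (U k y)\<^sup>2 \<partial>wiener)) = (\<Sum>k. \<integral>\<^sup>+y. ennreal ((U k y)\<^sup>2) \<partial>wiener)"
    using U_LL by (intro arg_cong[where f=suminf] ext nn_integral_eq_integral[symmetric]) (auto simp: LL_2_iff)
  also have "\<dots> = (\<integral>\<^sup>+y. (\<Sum>k. ennreal ((U k y)\<^sup>2)) \<partial>wiener)" by (rule nn_integral_suminf[symmetric]) auto
  finally show "(\<Sum>k. ennreal (\<integral>y. (U k y)\<^sup>2 \<partial>wiener)) \<noteq> \<top>" using U_finite by auto
qed auto

lemma partial_LL: "partial n \<in> LL (wiener \<Otimes>\<^sub>M M) 2"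
proof (rule LL_2_I)
  show "partial n \<in> borel_measurable (wiener \<Otimes>\<^sub>M M)" unfolding partial_def[abs_def] by measurable
  have "(\<integral>\<^sup>+p. ennreal ((partial n p)\<^sup>2) \<partial>(wiener \<Otimes>\<^sub>M M)) = (\<integral>\<^sup>+y. ennreal (\<Sum>k<n. (U k y)\<^sup>2) \<partial>wiener)"
    unfolding partial_def by (rule linear_norm) auto
  also have "\<dots> < \<infinity>" using U_LL by (subst nn_integral_eq_integral) (auto simp: LL_2_iff intro!: sum_nonneg AE_I2)
  finally show "(\<integral>\<^sup>+p. ennreal ((partial n p)\<^sup>2) \<partial>(wiener \<Otimes>\<^sub>M M)) < \<infinity>" .
qed

lemma partial_diff:
  assumes "n \<le> m"
  shows "(\<integral>p. (partial m p - partial n p)\<^sup>2 \<partial>(wiener \<Otimes>\<^sub>M M)) = (\<Sum>k\<in>{n..<m}. \<integral>y. (U k y)\<^sup>2 \<partial>wiener)"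
proof -
  have "partial m p - partial n p = (\<Sum>k\<in>{n..<m}. U k (fst p) * G k (snd p))" for p
    using sum.atLeastLessThan_concat[of 0 n m "\<lambda>k. U k (fst p) * G k (snd p)"] assms
    by (simp add: partial_def lessThan_atLeast0)
  then have "(\<integral>\<^sup>+p. ennreal ((partial m p - partial n p)\<^sup>2) \<partial>(wiener \<Otimes>\<^sub>M M)) = (\<integral>\<^sup>+y. ennreal (\<Sum>k\<in>{n..<m}. (U k y)\<^sup>2) \<partial>wiener)"
    by (simp add: linear_norm)
  also have "\<dots> = ennreal (\<Sum>k\<in>{n..<m}. \<integral>y. (U k y)\<^sup>2 \<partial>wiener)"
    using U_LL by (subst nn_integral_eq_integral) (auto simp: LL_2_iff intro!: sum_nonneg AE_I2)
  finally have "(\<integral>\<^sup>+p. ennreal ((partial m p - partial n p)\<^sup>2) \<partial>(wiener \<Otimes>\<^sub>M M)) = ennreal (\<Sum>k\<in>{n..<m}. \<integral>y. (U k y)\<^sup>2 \<partial>wiener)" .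
  moreover have "integrable (wiener \<Otimes>\<^sub>M M) (\<lambda>p. (partial m p - partial n p)\<^sup>2)"
    using LL_diff[OF partial_LL partial_LL, of m n] by (simp add: LL_2_iff)
  ultimately have "ennreal (\<integral>p. (partial m p - partial n p)\<^sup>2 \<partial>(wiener \<Otimes>\<^sub>M M)) = ennreal (\<Sum>k\<in>{n..<m}. \<integral>y. (U k y)\<^sup>2 \<partial>wiener)"
    by (simp add: nn_integral_eq_integral)
  then show ?thesis by (subst (asm) ennreal_inj) (auto intro!: sum_nonneg integral_nonneg_AE)
qed

lemma partial_limit:
  obtains S where "S \<in> LL (wiener \<Otimes>\<^sub>M M) 2" "(\<lambda>n. \<integral>p. (partial n p - S p)\<^sup>2 \<partial>(wiener \<Otimes>\<^sub>M M)) \<longlonglongrightarrow> 0"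
proof (rule L2_complete[of partial, OF partial_LL])
  fix e :: real assume "e > 0"
  from summable_Cauchy[THEN iffD1, OF U_sums, rule_format, OF this]
  obtain N where N: "\<And>m n. N \<le> m \<Longrightarrow> norm (\<Sum>k\<in>{m..<n}. \<integral>y. (U k y)\<^sup>2 \<partial>wiener) < e" by blast
  have *: "(\<integral>p. (partial m p - partial n p)\<^sup>2 \<partial>(wiener \<Otimes>\<^sub>M M)) \<le> e" if "N \<le> n" "n \<le> m" for m n
    using partial_diff[OF that(2)] N[OF that(1), of m] by simp
  show "\<exists>N. \<forall>m\<ge>N. \<forall>n\<ge>N. (\<integral>p. (partial m p - partial n p)\<^sup>2 \<partial>(wiener \<Otimes>\<^sub>M M)) \<le> e"
  proof (intro exI[of _ N] allI impI)
    fix m n assume mn: "N \<le> m" "N \<le> n"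
    show "(\<integral>p. (partial m p - partial n p)\<^sup>2 \<partial>(wiener \<Otimes>\<^sub>M M)) \<le> e"
    proof (cases "n \<le> m")
      case True then show ?thesis using mn by (intro *)
    next
      case False
      then have "(\<integral>p. (partial n p - partial m p)\<^sup>2 \<partial>(wiener \<Otimes>\<^sub>M M)) \<le> e" using mn by (intro *) auto
      then show ?thesis by (simp add: power2_commute)
    qed
  qed
qed

text \<open>\<open>damp s = exp (- s\<^sup>2 \<Gamma> / 2)\<close> with \<open>\<Gamma> = \<Sum>k. (U k)\<^sup>2\<close>; the limit form also covers the null set where \<open>\<Gamma> = \<infinity>\<close>.\<close>

definition damp :: "real \<Rightarrow> (nat \<Rightarrow> real) \<Rightarrow> real" where
  "damp s y = lim (\<lambda>n. exp (- (s\<^sup>2 / 2) * (\<Sum>k<n. (U k y)\<^sup>2)))"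

lemma damp_lim: "(\<lambda>n. exp (- (s\<^sup>2 / 2) * (\<Sum>k<n. (U k y)\<^sup>2))) \<longlonglongrightarrow> damp s y"
proof -
  have "decseq (\<lambda>n. exp (- (s\<^sup>2 / 2) * (\<Sum>k<n. (U k y)\<^sup>2)))"
    by (rule decseq_SucI) (simp add: mult_left_mono)
  then have "convergent (\<lambda>n. exp (- (s\<^sup>2 / 2) * (\<Sum>k<n. (U k y)\<^sup>2)))"
    by (rule decseq_convergent[of _ 0]) (auto simp: convergent_def)
  then show ?thesis by (simp add: damp_def convergent_LIMSEQ_iff)
qed

lemma damp_measurable [measurable]: "damp s \<in> borel_measurable wiener"
  unfolding damp_def[abs_def] by (rule borel_measurable_lim_metric) simp

lemma damp_nonneg: "0 \<le> damp s y"
  by (rule LIMSEQ_le_const[OF damp_lim]) auto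

lemma damp_le_1: "damp s y \<le> 1"
  by (rule LIMSEQ_le_const2[OF damp_lim]) (auto intro!: exI[of _ 0] mult_nonneg_nonneg sum_nonneg)

lemma damp_mono:
  assumes "\<bar>s\<bar> \<le> \<bar>t\<bar>" shows "damp t y \<le> damp s y"
proof (rule LIMSEQ_le[OF damp_lim damp_lim])
  have "s\<^sup>2 \<le> t\<^sup>2" using assms by (simp add: abs_le_square_iff)
  then show "\<exists>N. \<forall>n\<ge>N. exp (- (t\<^sup>2 / 2) * (\<Sum>k<n. (U k y)\<^sup>2)) \<le> exp (- (s\<^sup>2 / 2) * (\<Sum>k<n. (U k y)\<^sup>2))"
    by (auto intro!: mult_right_mono sum_nonneg)
qed

text \<open>Given y, a partial sum is Gaussian with variance the sum of U k y squared, so its cosine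
  averages to an exponential. Both sides pass to the limit: the left because cosine is 1-Lipschitz,
  the right by domination.\<close>

lemma series_cos:
  assumes S: "S \<in> LL (wiener \<Otimes>\<^sub>M M) 2" and lim: "(\<lambda>n. \<integral>p. (partial n p - S p)\<^sup>2 \<partial>(wiener \<Otimes>\<^sub>M M)) \<longlonglongrightarrow> 0"
    and [measurable]: "g \<in> borel_measurable wiener" and g: "\<And>y. \<bar>g y\<bar> \<le> c"
  shows "(\<integral>p. g (fst p) * cos (s * S p) \<partial>(wiener \<Otimes>\<^sub>M M)) = (\<integral>y. g y * damp s y \<partial>wiener)"
proof -
  let ?W = "wiener \<Otimes>\<^sub>M M"
  have [measurable]: "S \<in> borel_measurable ?W" "\<And>n. partial n \<in> borel_measurable ?W" using S partial_LL by (auto simp: LL_def)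
  have c0: "0 \<le> c" using g[of "\<lambda>_. 0"] by linarith
  have bd: "\<bar>g y * cos v\<bar> \<le> c" for y v
    unfolding abs_mult using mult_mono[OF g[of y] abs_cos_le_one[of v]] c0 by simp
  have int: "integrable ?W (\<lambda>p. g (fst p) * cos (s * T p))" if [measurable]: "T \<in> borel_measurable ?W" for T
    by (rule WM.integrable_const_bound[where B=c]) (use bd in auto)
  have nlim: "(\<lambda>n. nrm ?W 2 (\<lambda>p. partial n p - S p)) \<longlonglongrightarrow> 0"
    using tendsto_real_sqrt[OF lim] by (simp add: nrm_def sqrt_def)
  have 1: "(\<lambda>n. \<integral>p. g (fst p) * cos (s * partial n p) \<partial>?W) \<longlonglongrightarrow> (\<integral>p. g (fst p) * cos (s * S p) \<partial>?W)"
  proof (rule LIM_zero_cancel, rule Lim_null_comparison[OF always_eventually])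
    show "(\<lambda>n. c * \<bar>s\<bar> * nrm ?W 2 (\<lambda>p. partial n p - S p)) \<longlonglongrightarrow> 0"
      using tendsto_mult_right_zero[OF nlim, of "c * \<bar>s\<bar>"] by simp
    show "\<forall>n. norm ((\<integral>p. g (fst p) * cos (s * partial n p) \<partial>?W) - (\<integral>p. g (fst p) * cos (s * S p) \<partial>?W)) \<le> c * \<bar>s\<bar> * nrm ?W 2 (\<lambda>p. partial n p - S p)"
    proof
      fix n
      have D: "(\<lambda>p. \<bar>partial n p - S p\<bar>) \<in> LL ?W 2" using LL_diff[OF partial_LL S] by (simp add: LL_def)
      have one: "(\<lambda>_. 1) \<in> LL ?W 2" by (rule WM.LL_const)
      have cb: "\<bar>cos u - cos v\<bar> \<le> \<bar>u - v\<bar>" for u v :: real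
      proof -
        obtain z where "cos (v + (u - v)) - cos v = (u - v) * (- sin z)"
          by (rule mvt_segment[of v "u - v" cos "\<lambda>z. - sin z"]) (auto intro!: derivative_eq_intros)
        then have "\<bar>cos u - cos v\<bar> = \<bar>u - v\<bar> * \<bar>sin z\<bar>" by (simp add: abs_mult)
        also have "\<dots> \<le> \<bar>u - v\<bar> * 1" by (intro mult_left_mono) auto
        finally show ?thesis by simp
      qed
      have pw: "\<bar>g (fst p) * cos (s * partial n p) - g (fst p) * cos (s * S p)\<bar> \<le> c * \<bar>s\<bar> * \<bar>partial n p - S p\<bar>" for p
      proof -
        have "\<bar>g (fst p) * cos (s * partial n p) - g (fst p) * cos (s * S p)\<bar> = \<bar>g (fst p)\<bar> * \<bar>cos (s * partial n p) - cos (s * S p)\<bar>"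
          by (simp add: abs_mult[symmetric] algebra_simps)
        also have "\<dots> \<le> c * \<bar>s * partial n p - s * S p\<bar>" by (intro mult_mono g cb c0) auto
        also have "\<bar>s * partial n p - s * S p\<bar> = \<bar>s\<bar> * \<bar>partial n p - S p\<bar>" by (simp add: abs_mult[symmetric] algebra_simps)
        finally show ?thesis by (simp add: mult.assoc)
      qed
      have iD: "integrable ?W (\<lambda>p. \<bar>partial n p - S p\<bar>)" using Cauchy_Schwarz_LL(1)[OF D one] by simp
      have "norm ((\<integral>p. g (fst p) * cos (s * partial n p) \<partial>?W) - (\<integral>p. g (fst p) * cos (s * S p) \<partial>?W))
         = \<bar>\<integral>p. g (fst p) * cos (s * partial n p) - g (fst p) * cos (s * S p) \<partial>?W\<bar>"
        by (subst Bochner_Integration.integral_diff) (auto intro!: int)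
      also have "\<dots> \<le> (\<integral>p. \<bar>g (fst p) * cos (s * partial n p) - g (fst p) * cos (s * S p)\<bar> \<partial>?W)"
        by (rule integral_abs_bound)
      also have "\<dots> \<le> (\<integral>p. c * \<bar>s\<bar> * \<bar>partial n p - S p\<bar> \<partial>?W)"
        using iD by (intro integral_mono pw integrable_abs Bochner_Integration.integrable_diff int) auto
      also have "\<dots> = c * \<bar>s\<bar> * (\<integral>p. \<bar>partial n p - S p\<bar> \<partial>?W)" by simp
      also have "\<dots> \<le> c * \<bar>s\<bar> * nrm ?W 2 (\<lambda>p. partial n p - S p)"
        using Cauchy_Schwarz_LL(3)[OF D one] c0 by (intro mult_left_mono) (auto simp: nrm_def WM.P.prob_space)
      finally show "norm ((\<integral>p. g (fst p) * cos (s * partial n p) \<partial>?W) - (\<integral>p. g (fst p) * cos (s * S p) \<partial>?W)) \<le> c * \<bar>s\<bar> * nrm ?W 2 (\<lambda>p. partial n p - S p)" .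
    qed
  qed
  have 2: "(\<integral>p. g (fst p) * cos (s * partial n p) \<partial>?W) = (\<integral>y. g y * exp (- (s\<^sup>2 / 2) * (\<Sum>k<n. (U k y)\<^sup>2)) \<partial>wiener)" for n
  proof -
    have "(\<integral>p. g (fst p) * cos (s * partial n p) \<partial>?W) = (\<integral>y. \<integral>w. g y * cos (s * partial n (y, w)) \<partial>M \<partial>wiener)"
      using WM.integral_fst'[OF int[of "partial n"]] by simp
    then show ?thesis by (simp add: partial_def linear_cos)
  qed
  have 3: "(\<lambda>n. \<integral>y. g y * exp (- (s\<^sup>2 / 2) * (\<Sum>k<n. (U k y)\<^sup>2)) \<partial>wiener) \<longlonglongrightarrow> (\<integral>y. g y * damp s y \<partial>wiener)"
  proof (rule integral_dominated_convergence[where w="\<lambda>_. c"])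
    show "AE y in wiener. (\<lambda>n. g y * exp (- (s\<^sup>2 / 2) * (\<Sum>k<n. (U k y)\<^sup>2))) \<longlonglongrightarrow> g y * damp s y"
      by (intro AE_I2 tendsto_intros damp_lim)
    show "AE y in wiener. norm (g y * exp (- (s\<^sup>2 / 2) * (\<Sum>k<n. (U k y)\<^sup>2))) \<le> c" for n
    proof (intro AE_I2)
      fix y
      have "exp (- (s\<^sup>2 / 2) * (\<Sum>k<n. (U k y)\<^sup>2)) \<le> 1" by (auto intro!: mult_nonneg_nonneg sum_nonneg)
      then have "\<bar>g y\<bar> * exp (- (s\<^sup>2 / 2) * (\<Sum>k<n. (U k y)\<^sup>2)) \<le> c * 1" by (intro mult_mono g c0) auto
      then show "norm (g y * exp (- (s\<^sup>2 / 2) * (\<Sum>k<n. (U k y)\<^sup>2))) \<le> c" by (simp add: abs_mult)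
    qed
  qed auto
  show ?thesis using LIMSEQ_unique[OF 1[unfolded 2] 3] .
qed

end

section \<open>Calculus for functions of finitely many coordinates\<close>

interpretation W: iid_gauss wiener "\<lambda>k y. y k"
  by unfold_locales (rule iid_wiener)

lemma tendsto_fun:
  fixes p :: "'a \<Rightarrow> nat \<Rightarrow> real"
  assumes "\<And>k. ((\<lambda>t. p t k) \<longlongrightarrow> l k) F"
  shows "(p \<longlongrightarrow> l) F"
proof -
  have "limitin (product_topology (\<lambda>i. euclidean) UNIV) p l F"
    using assms by (subst limitin_componentwise) auto
  then show ?thesis by (simp add: euclidean_product_topology limitin_canonical_iff)
qed

text \<open>Sequences carry only the product topology here, so the chain rule is proved from partial
  derivatives: coordinates are switched one at a time and each switch is evaluated by the mean value
  theorem.\<close>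

lemma chain_rule_coordinates:
  fixes F :: "(nat \<Rightarrow> real) \<Rightarrow> real" and c :: "real \<Rightarrow> nat \<Rightarrow> real"
  assumes dF: "\<And>k y u. ((\<lambda>u. F (y(k := u))) has_real_derivative D k (y(k := u))) (at u)"
    and cont: "\<And>k. continuous_on UNIV (D k)"
    and dep: "\<And>y z. (\<And>i. i < n \<Longrightarrow> y i = z i) \<Longrightarrow> F y = F z"
    and c: "\<And>k. ((\<lambda>t. c t k) has_real_derivative c' k) (at t0)"
  shows "((\<lambda>t. F (c t)) has_real_derivative (\<Sum>k<n. D k (c t0) * c' k)) (at t0)"
proof -
  \<comment> \<open>The first m coordinates have already moved to time t, the others still sit at
    t0; \<open>hyb 0\<close> is constant and \<open>hyb n\<close> agrees with \<open>c\<close> as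
    far as F can see.\<close>
  define hyb where "hyb m t = (\<lambda>i. if i < m then c t i else c t0 i)" for m t
  have ct: "((\<lambda>t. c t k) \<longlongrightarrow> c t0 k) (at t0)" for k
    using DERIV_isCont[OF c[of k]] by (simp add: isCont_def)
  have "((\<lambda>t. F (hyb m t)) has_real_derivative (\<Sum>k<m. D k (c t0) * c' k)) (at t0)" for m
  proof (induction m)
    case 0 then show ?case by (simp add: hyb_def)
  next
    case (Suc m)
    have "\<exists>u. \<bar>u - c t0 m\<bar> \<le> \<bar>c t m - c t0 m\<bar> \<and>
        F (hyb (Suc m) t) - F (hyb m t) = (c t m - c t0 m) * D m ((hyb m t)(m := u))" for t
    proof -
      obtain u where "\<bar>u - c t0 m\<bar> \<le> \<bar>c t m - c t0 m\<bar>"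
        "F ((hyb m t)(m := c t0 m + (c t m - c t0 m))) - F ((hyb m t)(m := c t0 m)) = (c t m - c t0 m) * D m ((hyb m t)(m := u))"
        by (rule mvt_segment[of "c t0 m" "c t m - c t0 m" "\<lambda>u. F ((hyb m t)(m := u))" "\<lambda>u. D m ((hyb m t)(m := u))"])
           (use dF in auto)
      moreover have "(hyb m t)(m := c t0 m + (c t m - c t0 m)) = hyb (Suc m) t" "(hyb m t)(m := c t0 m) = hyb m t"
        by (auto simp: hyb_def fun_eq_iff less_Suc_eq)
      ultimately show ?thesis by metis
    qed
    then obtain u where u: "\<And>t. \<bar>u t - c t0 m\<bar> \<le> \<bar>c t m - c t0 m\<bar>"
      "\<And>t. F (hyb (Suc m) t) - F (hyb m t) = (c t m - c t0 m) * D m ((hyb m t)(m := u t))" by metis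
    have "((\<lambda>t. \<bar>c t m - c t0 m\<bar>) \<longlongrightarrow> \<bar>c t0 m - c t0 m\<bar>) (at t0)" by (intro tendsto_intros ct)
    then have a: "((\<lambda>t. \<bar>c t m - c t0 m\<bar>) \<longlongrightarrow> 0) (at t0)" by simp
    have "((\<lambda>t. u t - c t0 m) \<longlongrightarrow> 0) (at t0)"
      by (rule Lim_null_comparison[OF always_eventually a]) (simp add: u(1))
    then have ul: "(u \<longlongrightarrow> c t0 m) (at t0)" by (simp add: LIM_zero_iff)
    have "((\<lambda>t. (hyb m t)(m := u t)) \<longlongrightarrow> c t0) (at t0)"
    proof (rule tendsto_fun)
      fix k show "((\<lambda>t. ((hyb m t)(m := u t)) k) \<longlongrightarrow> c t0 k) (at t0)"
        using ul ct[of k] by (cases "k = m"; cases "k < m") (simp_all add: hyb_def)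
    qed
    moreover have "isCont (D m) (c t0)" using cont[of m] by (simp add: continuous_on_eq_continuous_at)
    ultimately have Dl: "((\<lambda>t. D m ((hyb m t)(m := u t))) \<longlongrightarrow> D m (c t0)) (at t0)"
      using isCont_tendsto_compose by blast
    have "((\<lambda>t. (c t m - c t0 m) / (t - t0)) \<longlongrightarrow> c' m) (at t0)"
      using c[of m] by (simp add: has_field_derivative_iff)
    from tendsto_mult[OF Dl this]
    have "((\<lambda>t. F (hyb (Suc m) t) - F (hyb m t)) has_real_derivative D m (c t0) * c' m) (at t0)"
      unfolding has_field_derivative_iff by (simp add: u(2) mult.commute)
    from DERIV_add[OF Suc.IH this] show ?case by simp
  qed
  from this[of n] have "((\<lambda>t. F (hyb n t)) has_real_derivative (\<Sum>k<n. D k (c t0) * c' k)) (at t0)" .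
  moreover have "(\<lambda>t. F (hyb n t)) = (\<lambda>t. F (c t))" by (rule ext, rule dep) (simp add: hyb_def)
  ultimately show ?thesis by simp
qed

lemma continuous_imp_measurable_wiener:
  fixes f :: "(nat \<Rightarrow> real) \<Rightarrow> real"
  assumes "continuous_on UNIV f" shows "f \<in> borel_measurable wiener"
proof -
  have "f \<in> borel_measurable borel" using assms by (rule borel_measurable_continuous_onI)
  moreover have "sets wiener = sets borel" unfolding sets_wiener by (rule sets_PiM_equal_borel)
  ultimately show ?thesis unfolding measurable_def by (simp add: sets_eq_imp_space_eq[of wiener borel])
qed

text \<open>Gaussian coordinates have all moments, so polynomial growth in finitely many of them
  suffices.\<close>

lemma growth_LL:
  fixes f :: "(nat \<Rightarrow> real) \<Rightarrow> real"
  assumes f: "f \<in> borel_measurable wiener" and b: "\<And>y. \<bar>f y\<bar> \<le> C * (1 + (\<Sum>i<n. \<bar>y i\<bar>)) ^ m"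
  shows "f \<in> LL wiener p"
proof -
  have q: "(\<lambda>y. 1 + (\<Sum>i<n. \<bar>y i\<bar>)) \<in> LL wiener r" for r
  proof (intro LL_add wiener.LL_const)
    show "(\<lambda>y. \<Sum>i<n. \<bar>y i\<bar>) \<in> LL wiener r"
    proof (induction n)
      case 0 show ?case using wiener.LL_const[of 0] by simp
    next
      case (Suc n)
      have "(\<lambda>y. \<bar>y n\<bar>) \<in> LL wiener r" using W.G_LL[of n r] by (auto simp: LL_def)
      from LL_add[OF Suc this] show ?case by simp
    qed
  qed
  have pos: "0 \<le> 1 + (\<Sum>i<n. \<bar>y i\<bar>)" for y :: "nat \<Rightarrow> real" by (simp add: add_nonneg_nonneg sum_nonneg)
  have i: "integrable wiener (\<lambda>y. \<bar>C\<bar> ^ p * (1 + (\<Sum>i<n. \<bar>y i\<bar>)) ^ (m * p))"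
    using LL_integrable[OF q[of "m * p"]] pos by simp
  show ?thesis
  proof (rule LL_bound[OF f i])
    fix y
    have "\<bar>f y\<bar> \<le> \<bar>C\<bar> * (1 + (\<Sum>i<n. \<bar>y i\<bar>)) ^ m"
      using b[of y] pos[of y] by (meson abs_ge_self mult_right_mono order_trans zero_le_power)
    then have "\<bar>f y\<bar> ^ p \<le> (\<bar>C\<bar> * (1 + (\<Sum>i<n. \<bar>y i\<bar>)) ^ m) ^ p" by (intro power_mono) auto
    then show "\<bar>f y\<bar> ^ p \<le> \<bar>C\<bar> ^ p * (1 + (\<Sum>i<n. \<bar>y i\<bar>)) ^ (m * p)"
      by (simp add: power_mult_distrib power_mult)
  qed
qed

section \<open>Wiener functionals along rotations\<close>

text \<open>The whole condition is chosen at once, so that the dependence on coordinates and all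
  growth bounds refer to the same n.\<close>

definition supp_bound :: "((nat \<Rightarrow> real) \<Rightarrow> real) \<Rightarrow> nat" where
  "supp_bound F = (SOME n.
     (\<forall>y z. (\<forall>i<n. y i = z i) \<longrightarrow> F y = F z) \<and>
     (\<forall>ks. continuous_on UNIV (foldr pderivative ks F) \<and>
           (\<forall>k y. (\<lambda>t. foldr pderivative ks F (y(k := t))) differentiable (at (y k))) \<and>
           (\<exists>C m. \<forall>y. \<bar>foldr pderivative ks F y\<bar> \<le> C * (1 + (\<Sum>i<n. \<bar>y i\<bar>)) ^ m)))"

lemma smooth_cylindricalD:
  assumes "smooth_cylindrical F"
  shows "\<And>y z. (\<And>i. i < supp_bound F \<Longrightarrow> y i = z i) \<Longrightarrow> F y = F z"
    "continuous_on UNIV (foldr pderivative ks F)"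
    "(\<lambda>t. foldr pderivative ks F (y(k := t))) differentiable (at (y k))"
    "\<exists>C m. \<forall>y. \<bar>foldr pderivative ks F y\<bar> \<le> C * (1 + (\<Sum>i<supp_bound F. \<bar>y i\<bar>)) ^ m"
proof -
  note * = someI_ex[OF assms[unfolded smooth_cylindrical_def], folded supp_bound_def]
  show "\<And>y z. (\<And>i. i < supp_bound F \<Longrightarrow> y i = z i) \<Longrightarrow> F y = F z"
    "continuous_on UNIV (foldr pderivative ks F)"
    "(\<lambda>t. foldr pderivative ks F (y(k := t))) differentiable (at (y k))"
    "\<exists>C m. \<forall>y. \<bar>foldr pderivative ks F y\<bar> \<le> C * (1 + (\<Sum>i<supp_bound F. \<bar>y i\<bar>)) ^ m"
    using * by blast+
qed

lemma differentiable_imp_pderivative: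
  assumes "\<And>y. (\<lambda>t. F (y(k := t))) differentiable (at (y k))"
  shows "((\<lambda>u. F (y(k := u))) has_real_derivative pderivative k F (y(k := u))) (at u)"
  using assms[of "y(k := u)"] unfolding pderivative_def
  by (simp add: DERIV_deriv_iff_real_differentiable)

lemma smooth_DERIV:
  assumes "smooth_cylindrical F"
  shows "((\<lambda>u. F (y(k := u))) has_real_derivative pderivative k F (y(k := u))) (at u)"
  by (rule differentiable_imp_pderivative) (use smooth_cylindricalD(3)[OF assms, of "[]"] in simp)

lemma smooth_LL:
  assumes "smooth_cylindrical F"
  shows "F \<in> LL wiener p" "pderivative k F \<in> LL wiener p"
proof -
  have "foldr pderivative ks F \<in> LL wiener p" for ks
    using smooth_cylindricalD(4)[OF assms, of ks] growth_LL
      continuous_imp_measurable_wiener[OF smooth_cylindricalD(2)[OF assms, of ks]] by blast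
  from this[of "[]"] this[of "[k]"] show "F \<in> LL wiener p" "pderivative k F \<in> LL wiener p" by auto
qed

lemma pderivative_eq_0:
  assumes "smooth_cylindrical F" "supp_bound F \<le> k"
  shows "pderivative k F y = 0"
proof -
  have "(\<lambda>t. F (y(k := t))) = (\<lambda>t. F y)"
    by (intro ext smooth_cylindricalD(1)[OF assms(1)]) (use assms(2) in auto)
  then show ?thesis by (simp add: pderivative_def)
qed

text \<open>The Bouleau derivative of a cylindrical functional, with the second Wiener copy as
  noise.\<close>

definition sharp :: "((nat \<Rightarrow> real) \<Rightarrow> real) \<Rightarrow> (nat \<Rightarrow> real) \<times> (nat \<Rightarrow> real) \<Rightarrow> real" where
  "sharp F p = (\<Sum>k<supp_bound F. pderivative k F (fst p) * snd p k)"

lemma sharp_eq: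
  assumes "smooth_cylindrical F" "supp_bound F \<le> n"
  shows "sharp F p = (\<Sum>k<n. pderivative k F (fst p) * snd p k)"
  unfolding sharp_def using assms pderivative_eq_0[OF assms(1)]
  by (intro sum.mono_neutral_left) auto

text \<open>The first component of \<open>rot t p\<close> has the second component as its time
  derivative; hence the derivative at every angle, not only at 0, is \<open>sharp F\<close> at the
  rotated point.\<close>

lemma rot_path_DERIV:
  assumes "smooth_cylindrical F"
  shows "((\<lambda>t. F (fst (rot t p))) has_real_derivative sharp F (rot t p)) (at t)"
  unfolding sharp_def
proof (rule chain_rule_coordinates[OF smooth_DERIV[OF assms]])
  show "continuous_on UNIV (pderivative k F)" for k using smooth_cylindricalD(2)[OF assms, of "[k]"] by simp
  show "\<And>y z. (\<And>i. i < supp_bound F \<Longrightarrow> y i = z i) \<Longrightarrow> F y = F z" by (rule smooth_cylindricalD(1)[OF assms])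
  show "((\<lambda>t. fst (rot t p) k) has_real_derivative snd (rot t p) k) (at t)" for k
    unfolding rot_def fst_conv snd_conv by (auto intro!: derivative_eq_intros)
qed

abbreviation "W2 \<equiv> wiener \<Otimes>\<^sub>M wiener"

lemma integral_fst: "f \<in> borel_measurable wiener \<Longrightarrow> (\<integral>p. f (fst p) \<partial>W2) = (\<integral>y. f y \<partial>wiener)" for f :: "_ \<Rightarrow> real"
  using integral_distr[of fst W2 wiener f] by (simp add: wiener.distr_pair_fst)

lemma LL_fst: "f \<in> LL wiener p \<Longrightarrow> (\<lambda>x. f (fst x)) \<in> LL W2 p"
  using integrable_distr[of fst W2 wiener "\<lambda>y. \<bar>f y\<bar> ^ p"] by (auto simp: LL_def wiener.distr_pair_fst)

lemma nrm_fst: "f \<in> borel_measurable wiener \<Longrightarrow> nrm W2 p (\<lambda>x. f (fst x)) = nrm wiener p f"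
  unfolding nrm_def by (subst integral_fst[of "\<lambda>y. \<bar>f y\<bar> ^ p"]) auto

text \<open>A quarter turn moves the second copy into the first slot, so integrability of functions
  of \<open>snd\<close> follows from invariance.\<close>

lemma snd_eq_rot: "snd p = fst (rot (pi/2) p)"
  by (simp add: rot_def)

lemma LL_snd: "f \<in> LL wiener p \<Longrightarrow> (\<lambda>x. f (snd x)) \<in> LL W2 p"
  unfolding snd_eq_rot by (rule wflow.LL_R[OF LL_fst])

lemma abs_rot_le: "\<bar>fst (rot t p) k\<bar> \<le> \<bar>fst p k\<bar> + \<bar>snd p k\<bar>" "\<bar>snd (rot t p) k\<bar> \<le> \<bar>fst p k\<bar> + \<bar>snd p k\<bar>"
proof -
  have *: "\<bar>a * u + b * v\<bar> \<le> \<bar>u\<bar> + \<bar>v\<bar>" if "\<bar>a\<bar> \<le> 1" "\<bar>b\<bar> \<le> 1" for a b u v :: real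
  proof -
    have "\<bar>a * u + b * v\<bar> \<le> \<bar>a\<bar> * \<bar>u\<bar> + \<bar>b\<bar> * \<bar>v\<bar>" using abs_triangle_ineq[of "a * u" "b * v"] by (simp add: abs_mult)
    also have "\<dots> \<le> 1 * \<bar>u\<bar> + 1 * \<bar>v\<bar>" using that by (intro add_mono mult_right_mono) auto
    finally show ?thesis by simp
  qed
  show "\<bar>fst (rot t p) k\<bar> \<le> \<bar>fst p k\<bar> + \<bar>snd p k\<bar>" "\<bar>snd (rot t p) k\<bar> \<le> \<bar>fst p k\<bar> + \<bar>snd p k\<bar>"
    unfolding rot_def fst_conv snd_conv by (intro *; simp)+
qed

text \<open>Since sine and cosine are at most 1 in absolute value, polynomial growth gives a
  majorant independent of the angle. It dominates all difference quotients at once.\<close>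

lemma sharp_rot_bound:
  assumes F: "smooth_cylindrical F"
  obtains B where "B \<in> wflow.LLall" "\<And>t p. \<bar>sharp F (rot t p)\<bar> \<le> B p"
proof -
  let ?n = "supp_bound F"
  have "\<forall>k. \<exists>C m. \<forall>y. \<bar>pderivative k F y\<bar> \<le> C * (1 + (\<Sum>i<?n. \<bar>y i\<bar>)) ^ m"
    using smooth_cylindricalD(4)[OF F, of "[_]"] by simp
  then obtain C m where Cm: "\<And>k y. \<bar>pderivative k F y\<bar> \<le> C k * (1 + (\<Sum>i<?n. \<bar>y i\<bar>)) ^ m k" by metis
  define a where "a k p = \<bar>fst p k\<bar> + \<bar>snd p k\<bar>" for k and p :: "(nat \<Rightarrow> real) \<times> (nat \<Rightarrow> real)"
  define B where "B p = (\<Sum>k<?n. \<bar>C k\<bar> * (1 + (\<Sum>i<?n. a i p)) ^ m k * a k p)" for p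
  have sumLL: "(\<lambda>p. \<Sum>k\<in>K. g k p) \<in> wflow.LLall" if "finite K" "\<And>k. g k \<in> wflow.LLall"
    for K :: "nat set" and g
    using that by (induction K rule: finite_induct) (auto intro: wflow.LLall_add wflow.LLall_const)
  have powLL: "(\<lambda>p. g p ^ j) \<in> wflow.LLall" if "g \<in> wflow.LLall" for g j
    using that by (induction j) (auto intro: wflow.LLall_mult wflow.LLall_const)
  have absLL: "(\<lambda>p. \<bar>g p\<bar>) \<in> wflow.LLall" if "g \<in> wflow.LLall" for g
    using that by (auto simp: wflow.LLall_iff LL_def)
  have "a k \<in> wflow.LLall" for k
    unfolding a_def[abs_def]
    by (intro wflow.LLall_add absLL) (auto simp: wflow.LLall_iff intro!: LL_fst[OF W.G_LL] LL_snd[OF W.G_LL])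
  then have "B \<in> wflow.LLall" unfolding B_def[abs_def]
    by (intro sumLL wflow.LLall_mult wflow.LLall_const powLL wflow.LLall_add) auto
  moreover have "\<bar>sharp F (rot t p)\<bar> \<le> B p" for t p
  proof -
    have "\<bar>pderivative k F (fst (rot t p)) * snd (rot t p) k\<bar> \<le> \<bar>C k\<bar> * (1 + (\<Sum>i<?n. a i p)) ^ m k * a k p" for k
    proof -
      have s0: "0 \<le> 1 + (\<Sum>i<?n. \<bar>fst (rot t p) i\<bar>)" by (simp add: add_nonneg_nonneg sum_nonneg)
      have le: "1 + (\<Sum>i<?n. \<bar>fst (rot t p) i\<bar>) \<le> 1 + (\<Sum>i<?n. a i p)"
        by (intro add_mono sum_mono order_refl) (auto simp: a_def abs_rot_le)
      have "\<bar>pderivative k F (fst (rot t p))\<bar> \<le> C k * (1 + (\<Sum>i<?n. \<bar>fst (rot t p) i\<bar>)) ^ m k" by (rule Cm)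
      also have "\<dots> \<le> \<bar>C k\<bar> * (1 + (\<Sum>i<?n. a i p)) ^ m k"
        using s0 le by (intro mult_mono power_mono) auto
      finally have 1: "\<bar>pderivative k F (fst (rot t p))\<bar> \<le> \<bar>C k\<bar> * (1 + (\<Sum>i<?n. a i p)) ^ m k" .
      have 2: "0 \<le> \<bar>C k\<bar> * (1 + (\<Sum>i<?n. a i p)) ^ m k" by (rule order_trans[OF abs_ge_zero 1])
      have 3: "\<bar>snd (rot t p) k\<bar> \<le> a k p" unfolding a_def by (rule abs_rot_le)
      show ?thesis unfolding abs_mult by (rule mult_mono[OF 1 3 2 abs_ge_zero])
    qed
    then show ?thesis unfolding sharp_def B_def by (intro order_trans[OF sum_abs] sum_mono)
  qed
  ultimately show ?thesis by (rule that)
qed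

text \<open>By the mean value theorem a quotient along the rotation is \<open>sharp F\<close> at an
  intermediate angle, so the uniform majorant permits dominated convergence.\<close>

lemma smooth_d2:
  assumes F: "smooth_cylindrical F"
  shows "wflow.d2 (\<lambda>p. F (fst p)) (sharp F)"
  unfolding wflow.d2_def
proof (intro conjI)
  obtain B where B: "B \<in> wflow.LLall" "\<And>t p. \<bar>sharp F (rot t p)\<bar> \<le> B p" using sharp_rot_bound[OF F] by blast
  have B0: "\<bar>sharp F p\<bar> \<le> B p" for p using B(2)[of 0 p] by (simp add: wflow.R_0)
  have Bnn: "0 \<le> B p" for p using B0[of p] by linarith
  have [measurable]: "F \<in> borel_measurable wiener" "pderivative k F \<in> borel_measurable wiener" for k
    using smooth_LL[OF F] by (auto simp: LL_def)
  have sm [measurable]: "sharp F \<in> borel_measurable W2" unfolding sharp_def[abs_def] by measurable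
  have qm [measurable]: "wflow.quot t (\<lambda>p. F (fst p)) \<in> borel_measurable W2" for t
    unfolding wflow.quot_def[abs_def] by measurable
  have [measurable]: "B \<in> borel_measurable W2" using B(1) by measurable
  have B2: "integrable W2 (\<lambda>p. (2 * B p)\<^sup>2)"
    using LL_integrable[OF wflow.LLall_D[OF B(1)], of 2] by (simp add: power_mult_distrib)
  show "(\<lambda>p. F (fst p)) \<in> LL W2 2" by (intro LL_fst smooth_LL F)
  show "sharp F \<in> LL W2 2"
    by (rule LL_bound[OF sm LL_integrable[OF wflow.LLall_D[OF B(1)], of 2]], rule power_mono)
       (auto intro: order_trans[OF B0 abs_ge_self])
  have qb: "\<bar>wflow.quot t (\<lambda>p. F (fst p)) p\<bar> \<le> B p" for t p
  proof (cases "t = 0")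
    case True then show ?thesis using Bnn by (simp add: wflow.quot_def)
  next
    case False
    obtain u where "F (fst (rot (0 + t) p)) - F (fst (rot 0 p)) = t * sharp F (rot u p)"
      by (rule mvt_segment[of 0 t "\<lambda>t. F (fst (rot t p))" "\<lambda>t. sharp F (rot t p)"]) (use rot_path_DERIV[OF F] in auto)
    then have "wflow.quot t (\<lambda>p. F (fst p)) p = sharp F (rot u p)"
      using False by (simp add: wflow.quot_def wflow.R_0)
    then show ?thesis using B(2) by simp
  qed
  show "((\<lambda>t. nrm W2 2 (\<lambda>x. wflow.quot t (\<lambda>p. F (fst p)) x - sharp F x)) \<longlongrightarrow> 0) (at 0)"
    unfolding tendsto_at_iff_sequentially comp_def
  proof (intro allI impI)
    fix X :: "nat \<Rightarrow> real" assume X: "\<forall>i. X i \<in> UNIV - {0}" "X \<longlonglongrightarrow> 0"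
    have "(\<lambda>n. \<integral>p. (wflow.quot (X n) (\<lambda>p. F (fst p)) p - sharp F p)\<^sup>2 \<partial>W2) \<longlonglongrightarrow> (\<integral>p. 0 \<partial>W2)"
    proof (rule integral_dominated_convergence[OF _ _ B2])
      show "AE p in W2. (\<lambda>n. (wflow.quot (X n) (\<lambda>p. F (fst p)) p - sharp F p)\<^sup>2) \<longlonglongrightarrow> 0"
      proof (intro AE_I2)
        fix p
        have "((\<lambda>t. (F (fst (rot t p)) - F (fst (rot 0 p))) / (t - 0)) \<longlongrightarrow> sharp F (rot 0 p)) (at 0)"
          using rot_path_DERIV[OF F, of p 0] unfolding has_field_derivative_iff .
        then have "((\<lambda>t. wflow.quot t (\<lambda>p. F (fst p)) p) \<longlongrightarrow> sharp F p) (at 0)"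
          by (simp add: wflow.quot_def wflow.R_0)
        then have "(\<lambda>n. wflow.quot (X n) (\<lambda>p. F (fst p)) p) \<longlonglongrightarrow> sharp F p"
          using X unfolding tendsto_at_iff_sequentially comp_def by blast
        then have "(\<lambda>n. (wflow.quot (X n) (\<lambda>p. F (fst p)) p - sharp F p)\<^sup>2) \<longlonglongrightarrow> (sharp F p - sharp F p)\<^sup>2"
          by (intro tendsto_intros)
        then show "(\<lambda>n. (wflow.quot (X n) (\<lambda>p. F (fst p)) p - sharp F p)\<^sup>2) \<longlonglongrightarrow> 0" by simp
      qed
      show "AE p in W2. norm ((wflow.quot (X n) (\<lambda>p. F (fst p)) p - sharp F p)\<^sup>2) \<le> (2 * B p)\<^sup>2" for n
      proof (intro AE_I2)
        fix p
        have "\<bar>wflow.quot (X n) (\<lambda>p. F (fst p)) p - sharp F p\<bar> \<le> 2 * B p"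
          using qb[of "X n" p] B0[of p] by linarith
        then have "\<bar>wflow.quot (X n) (\<lambda>p. F (fst p)) p - sharp F p\<bar>\<^sup>2 \<le> (2 * B p)\<^sup>2" by (intro power_mono) auto
        then show "norm ((wflow.quot (X n) (\<lambda>p. F (fst p)) p - sharp F p)\<^sup>2) \<le> (2 * B p)\<^sup>2" by simp
      qed
    qed measurable
    from tendsto_real_sqrt[OF this] show "(\<lambda>n. nrm W2 2 (\<lambda>x. wflow.quot (X n) (\<lambda>p. F (fst p)) x - sharp F x)) \<longlonglongrightarrow> 0"
      by (simp add: nrm_def sqrt_def)
  qed
qed

text \<open>Square summability is not part of \<open>has_gradient\<close>. It follows by comparison
  with one approximating cylindrical function, whose gradient has finitely many nonzero
  components.\<close>

lemma has_gradient_series: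
  assumes "has_gradient F U" and G: "iid_std_normal M G"
  shows "gauss_series M G U"
proof -
  from assms obtain \<Phi> where \<Phi>: "\<And>n. smooth_cylindrical (\<Phi> n)"
    and lim: "(\<lambda>n. \<integral>\<^sup>+ y. (\<Sum>k. ennreal ((pderivative k (\<Phi> n) y - U k y)\<^sup>2)) \<partial>wiener) \<longlonglongrightarrow> 0"
    and [measurable]: "\<And>k. U k \<in> borel_measurable wiener" unfolding has_gradient_def by blast
  have "\<forall>\<^sub>F n in sequentially. (\<integral>\<^sup>+ y. (\<Sum>k. ennreal ((pderivative k (\<Phi> n) y - U k y)\<^sup>2)) \<partial>wiener) < 1"
    by (rule order_tendstoD(2)[OF lim]) simp
  then obtain n where n: "(\<integral>\<^sup>+ y. (\<Sum>k. ennreal ((pderivative k (\<Phi> n) y - U k y)\<^sup>2)) \<partial>wiener) < 1"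
    using eventually_happens'[OF sequentially_bot] by blast
  let ?D = "\<lambda>k. pderivative k (\<Phi> n)" and ?s = "supp_bound (\<Phi> n)"
  have DLL: "?D k \<in> LL wiener 2" for k by (rule smooth_LL[OF \<Phi>])
  then have [measurable]: "?D k \<in> borel_measurable wiener" for k by (auto simp: LL_def)
  have "(\<integral>\<^sup>+ y. (\<Sum>k. ennreal ((U k y)\<^sup>2)) \<partial>wiener)
     \<le> (\<integral>\<^sup>+ y. 2 * (\<Sum>k. ennreal ((?D k y - U k y)\<^sup>2)) + 2 * (\<Sum>k<?s. ennreal ((?D k y)\<^sup>2)) \<partial>wiener)"
  proof (rule nn_integral_mono)
    fix y
    have "(\<Sum>k. ennreal ((U k y)\<^sup>2)) \<le> (\<Sum>k. 2 * ennreal ((?D k y - U k y)\<^sup>2) + 2 * ennreal ((?D k y)\<^sup>2))"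
    proof (intro suminf_le)
      fix k
      have "(a - b)\<^sup>2 \<le> 2 * b\<^sup>2 + 2 * a\<^sup>2" for a b :: real
        using zero_le_power2[of "a + b"] by (simp add: power2_eq_square algebra_simps)
      from this[of "?D k y" "?D k y - U k y"]
      have "ennreal ((U k y)\<^sup>2) \<le> ennreal (2 * (?D k y - U k y)\<^sup>2 + 2 * (?D k y)\<^sup>2)" by (intro ennreal_leI) simp
      then show "ennreal ((U k y)\<^sup>2) \<le> 2 * ennreal ((?D k y - U k y)\<^sup>2) + 2 * ennreal ((?D k y)\<^sup>2)"
        by (simp add: ennreal_plus ennreal_mult)
    qed auto
    also have "\<dots> = 2 * (\<Sum>k. ennreal ((?D k y - U k y)\<^sup>2)) + 2 * (\<Sum>k. ennreal ((?D k y)\<^sup>2))"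
      by (subst suminf_add[symmetric]) auto
    also have "(\<Sum>k. ennreal ((?D k y)\<^sup>2)) = (\<Sum>k<?s. ennreal ((?D k y)\<^sup>2))"
      by (rule suminf_finite) (auto simp: pderivative_eq_0[OF \<Phi>])
    finally show "(\<Sum>k. ennreal ((U k y)\<^sup>2)) \<le> 2 * (\<Sum>k. ennreal ((?D k y - U k y)\<^sup>2)) + 2 * (\<Sum>k<?s. ennreal ((?D k y)\<^sup>2))" .
  qed
  also have "\<dots> = 2 * (\<integral>\<^sup>+ y. (\<Sum>k. ennreal ((?D k y - U k y)\<^sup>2)) \<partial>wiener) + 2 * (\<Sum>k<?s. \<integral>\<^sup>+ y. ennreal ((?D k y)\<^sup>2) \<partial>wiener)"
    by (subst nn_integral_add) (simp_all add: nn_integral_cmult nn_integral_sum del: sum_ennreal)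
  also have "\<dots> < \<infinity>"
  proof -
    have "(\<Sum>k<?s. \<integral>\<^sup>+ y. ennreal ((?D k y)\<^sup>2) \<partial>wiener) = (\<Sum>k<?s. ennreal ((nrm wiener 2 (?D k))\<^sup>2))"
      by (simp add: nn_integral_sq_eq_nrm DLL)
    also have "\<dots> < \<infinity>" by (simp add: sum_ennreal)
    finally have 2: "(\<Sum>k<?s. \<integral>\<^sup>+ y. ennreal ((?D k y)\<^sup>2) \<partial>wiener) < \<infinity>" .
    have 1: "(\<integral>\<^sup>+ y. (\<Sum>k. ennreal ((?D k y - U k y)\<^sup>2)) \<partial>wiener) < \<infinity>" using n by (rule order.strict_trans) simp
    show ?thesis using 1 2 by (simp add: ennreal_mult_less_top ennreal_add_less_top)
  qed
  finally have fin: "(\<integral>\<^sup>+ y. (\<Sum>k. ennreal ((U k y)\<^sup>2)) \<partial>wiener) < \<infinity>" .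
  interpret iid_gauss M G by unfold_locales (rule G)
  show ?thesis by unfold_locales (use fin in auto)
qed

text \<open>Identifies the abstract gradient with differentiation along rotations: true for
  cylindrical functions, preserved by closedness, with the Gaussian isometry turning convergence of
  gradients into convergence of series.\<close>

lemma has_gradient_d2:
  assumes grad: "has_gradient F U"
    and S: "S \<in> LL W2 2" and lim: "(\<lambda>n. \<integral>p. ((\<Sum>k<n. U k (fst p) * snd p k) - S p)\<^sup>2 \<partial>W2) \<longlonglongrightarrow> 0"
  shows "wflow.d2 (\<lambda>p. F (fst p)) S"
proof -
  interpret V: gauss_series wiener "\<lambda>k y. y k" U by (rule has_gradient_series[OF grad iid_wiener])
  from grad obtain \<Phi> where \<Phi>: "\<And>n. smooth_cylindrical (\<Phi> n)"
    and lim1: "(\<lambda>n. \<integral>\<^sup>+ y. ennreal ((\<Phi> n y - F y)\<^sup>2) \<partial>wiener) \<longlonglongrightarrow> 0"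
    and lim2: "(\<lambda>n. \<integral>\<^sup>+ y. (\<Sum>k. ennreal ((pderivative k (\<Phi> n) y - U k y)\<^sup>2)) \<partial>wiener) \<longlonglongrightarrow> 0"
    and F: "F \<in> LL wiener 2" unfolding has_gradient_def Lp_2_eq_LL by blast
  have \<Phi>LL: "\<Phi> n \<in> LL wiener 2" for n by (rule smooth_LL[OF \<Phi>])
  have [measurable]: "pderivative k (\<Phi> n) \<in> borel_measurable wiener" for k n
    using smooth_LL(2)[OF \<Phi>] by (auto simp: LL_def)
  have d: "wflow.d2 (\<lambda>p. \<Phi> n (fst p)) (sharp (\<Phi> n))" for n by (rule smooth_d2[OF \<Phi>])
  have partial: "V.partial n p = (\<Sum>k<n. U k (fst p) * snd p k)" for n p by (simp add: V.partial_def)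
  have nS: "(\<lambda>n. nrm W2 2 (\<lambda>p. V.partial n p - S p)) \<longlonglongrightarrow> 0"
    using tendsto_real_sqrt[OF lim] by (simp add: nrm_def sqrt_def partial)
  show ?thesis
  proof (rule wflow.d2_closed[OF d])
    show "(\<lambda>p. F (fst p)) \<in> LL W2 2" by (rule LL_fst[OF F])
    have "(\<lambda>n. nrm wiener 2 (\<lambda>y. \<Phi> n y - F y)) \<longlonglongrightarrow> 0"
      using lim1 by (subst (asm) nn_tendsto_iff_nrm) (auto intro: LL_diff \<Phi>LL F)
    moreover have "nrm W2 2 (\<lambda>x. \<Phi> n (fst x) - F (fst x)) = nrm wiener 2 (\<lambda>y. \<Phi> n y - F y)" for n
      by (rule nrm_fst[of "\<lambda>y. \<Phi> n y - F y"]) (use LL_diff[OF \<Phi>LL F] in \<open>auto simp: LL_def\<close>)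
    ultimately show "(\<lambda>n. nrm W2 2 (\<lambda>x. \<Phi> n (fst x) - F (fst x))) \<longlonglongrightarrow> 0" by simp
    show "(\<lambda>n. nrm W2 2 (\<lambda>x. sharp (\<Phi> n) x - S x)) \<longlonglongrightarrow> 0"
    proof (rule tendstoI)
      fix e :: real assume e: "e > 0"
      have "\<forall>\<^sub>F n in sequentially. (\<integral>\<^sup>+ y. (\<Sum>k. ennreal ((pderivative k (\<Phi> n) y - U k y)\<^sup>2)) \<partial>wiener) < ennreal ((e/2)\<^sup>2)"
        by (rule order_tendstoD(2)[OF lim2]) (use e in simp)
      then show "\<forall>\<^sub>F n in sequentially. dist (nrm W2 2 (\<lambda>x. sharp (\<Phi> n) x - S x)) 0 < e"
      proof eventually_elim
        case (elim n)
        have sL: "sharp (\<Phi> n) \<in> LL W2 2" by (rule wflow.d2_LL(2)[OF d])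
        \<comment> \<open>Beyond \<open>supp_bound\<close> the cylindrical derivative is unchanged
          by adding zero terms, so both series can be truncated at the same K before the isometry is
          applied; K tends to infinity afterwards.\<close>
        have b: "nrm W2 2 (\<lambda>p. sharp (\<Phi> n) p - V.partial K p) \<le> e / 2" if K: "supp_bound (\<Phi> n) \<le> K" for K
        proof -
          have "sharp (\<Phi> n) p - V.partial K p = (\<Sum>k<K. (pderivative k (\<Phi> n) (fst p) - U k (fst p)) * snd p k)" for p
            by (simp add: sharp_eq[OF \<Phi> K] partial sum_subtractf left_diff_distrib)
          then have "(\<integral>\<^sup>+p. ennreal ((sharp (\<Phi> n) p - V.partial K p)\<^sup>2) \<partial>W2)
              = (\<integral>\<^sup>+y. ennreal (\<Sum>k<K. (pderivative k (\<Phi> n) y - U k y)\<^sup>2) \<partial>wiener)"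
            using W.linear_norm[of "{..<K}" "\<lambda>k y. pderivative k (\<Phi> n) y - U k y"] by simp
          also have "\<dots> \<le> (\<integral>\<^sup>+ y. (\<Sum>k. ennreal ((pderivative k (\<Phi> n) y - U k y)\<^sup>2)) \<partial>wiener)"
          proof (rule nn_integral_mono)
            fix y
            have "(\<Sum>k<K. ennreal ((pderivative k (\<Phi> n) y - U k y)\<^sup>2)) \<le> (\<Sum>k. ennreal ((pderivative k (\<Phi> n) y - U k y)\<^sup>2))"
              by (rule sum_le_suminf) auto
            then show "ennreal (\<Sum>k<K. (pderivative k (\<Phi> n) y - U k y)\<^sup>2) \<le> (\<Sum>k. ennreal ((pderivative k (\<Phi> n) y - U k y)\<^sup>2))"
              by (simp add: sum_ennreal)
          qed
          finally have "(\<integral>\<^sup>+p. ennreal ((sharp (\<Phi> n) p - V.partial K p)\<^sup>2) \<partial>W2) \<le> ennreal ((e/2)\<^sup>2)"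
            by (rule order_trans) (rule less_imp_le[OF elim])
          then have "ennreal ((nrm W2 2 (\<lambda>p. sharp (\<Phi> n) p - V.partial K p))\<^sup>2) \<le> ennreal ((e/2)\<^sup>2)"
            by (subst (asm) nn_integral_sq_eq_nrm) (auto intro: LL_diff sL V.partial_LL)
          then have "(nrm W2 2 (\<lambda>p. sharp (\<Phi> n) p - V.partial K p))\<^sup>2 \<le> (e/2)\<^sup>2" by simp
          then show ?thesis using e by (rule_tac power2_le_imp_le) auto
        qed
        have "(\<lambda>K. e / 2 + nrm W2 2 (\<lambda>p. V.partial K p - S p)) \<longlonglongrightarrow> e / 2 + 0"
          by (intro tendsto_intros nS)
        moreover have "nrm W2 2 (\<lambda>x. sharp (\<Phi> n) x - S x) \<le> e / 2 + nrm W2 2 (\<lambda>p. V.partial K p - S p)"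
          if "supp_bound (\<Phi> n) \<le> K" for K
          using nrm_triangle[OF _ sL V.partial_LL S, of K] b[OF that] by simp
        ultimately have "nrm W2 2 (\<lambda>x. sharp (\<Phi> n) x - S x) \<le> e / 2 + 0"
          by (intro LIMSEQ_le_const) auto
        then show ?case using e by (simp add: nrm_nonneg dist_real_def)
      qed
    qed
  qed (rule S)
qed

section \<open>Gaussian integration by parts, affine substitutions and uniqueness of the
  gradient\<close>

context flow
begin

text \<open>The generator of a measure preserving group is antisymmetric: the quotients of f h have
  mean zero. Unlike the version through \<open>dv\<close>, this one asks only for L^2
  derivatives.\<close>

lemma d2_ibp:
  assumes "d2 f g" "d2 h k"
  shows "(\<integral>x. g x * h x \<partial>M) + (\<integral>x. f x * k x \<partial>M) = 0"
proof -
  note LL = d2_LL[OF assms(1)] d2_LL[OF assms(2)]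
  have hR: "((\<lambda>t. nrm M 2 (\<lambda>x. h (R t x) - h x)) \<longlongrightarrow> 0) (at 0)"
  proof (rule tendsto_0_squeeze)
    have "((\<lambda>t. \<bar>t\<bar> * nrm M 2 k) \<longlongrightarrow> \<bar>0\<bar> * nrm M 2 k) (at 0)" by (intro tendsto_intros)
    then show "((\<lambda>t. \<bar>t\<bar> * nrm M 2 k) \<longlongrightarrow> 0) (at 0)" by simp
    show "nrm M 2 (\<lambda>x. h (R t x) - h x) \<le> \<bar>t\<bar> * nrm M 2 k" for t
      using d2_nrm_Dl[OF assms(2), of t] by (simp add: Dl_def[abs_def])
  qed (rule nrm_nonneg)
  have 1: "((\<lambda>t. \<integral>x. quot t f x * h (R t x) \<partial>M) \<longlongrightarrow> (\<integral>x. g x * h x \<partial>M)) (at 0)"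
    by (rule tendsto_inner) (use LL assms hR in \<open>auto simp: d2_def intro: LL_quot LL_R\<close>)
  have 2: "((\<lambda>t. \<integral>x. f x * quot t h x \<partial>M) \<longlongrightarrow> (\<integral>x. f x * k x \<partial>M)) (at 0)"
    by (rule d2_inner) (use assms LL in auto)
  have "(\<integral>x. quot t f x * h (R t x) \<partial>M) + (\<integral>x. f x * quot t h x \<partial>M) = 0" for t
  proof -
    have i: "integrable M (\<lambda>x. f x * h x)" "integrable M (\<lambda>x. quot t f x * h (R t x))" "integrable M (\<lambda>x. f x * quot t h x)"
      by (intro Cauchy_Schwarz_LL(1) LL LL_quot LL_R)+
    have "(\<integral>x. quot t f x * h (R t x) \<partial>M) + (\<integral>x. f x * quot t h x \<partial>M)
        = (\<integral>x. quot t f x * h (R t x) + f x * quot t h x \<partial>M)" using i by simp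
    also have "\<dots> = (\<integral>x. (f (R t x) * h (R t x) - f x * h x) / t \<partial>M)"
      by (intro Bochner_Integration.integral_cong) (auto simp: quot_def field_simps diff_divide_distrib)
    also have "\<dots> = ((\<integral>x. f (R t x) * h (R t x) \<partial>M) - (\<integral>x. f x * h x \<partial>M)) / t"
      using integrable_R[OF i(1), of t] i(1) by simp
    also have "(\<integral>x. f (R t x) * h (R t x) \<partial>M) = (\<integral>x. f x * h x \<partial>M)"
      by (rule integral_R[of "\<lambda>x. f x * h x"]) (use i(1) in auto)
    finally show ?thesis by simp
  qed
  then have "((\<lambda>t. 0) \<longlongrightarrow> (\<integral>x. g x * h x \<partial>M) + (\<integral>x. f x * k x \<partial>M)) (at (0::real))"
    using tendsto_add[OF 1 2] by simp
  then show ?thesis by (simp add: tendsto_const_iff)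
qed

end

text \<open>The rotation sends z_k to cos t z_k - sin t y_k; the quotient differs from -y_k by
  multiples of y_k and z_k whose coefficients tend to 0.\<close>

lemma snd_coordinate_d2: "wflow.d2 (\<lambda>p. snd p k) (\<lambda>p. - fst p k)"
  unfolding wflow.d2_def
proof (intro conjI)
  have y: "(\<lambda>p. fst p k) \<in> LL W2 2" by (rule LL_fst[OF W.G_LL])
  show z: "(\<lambda>p. snd p k) \<in> LL W2 2" by (rule LL_snd[OF W.G_LL])
  show "(\<lambda>p. - fst p k) \<in> LL W2 2" using LL_cmult[OF y, of "-1"] by simp
  have s: "((\<lambda>t. sin t / t) \<longlongrightarrow> 1) (at (0::real))"
    using DERIV_sin[of "0::real"] by (simp add: has_field_derivative_iff)
  have c: "((\<lambda>t. (cos t - 1) / t) \<longlongrightarrow> 0) (at (0::real))"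
    using DERIV_cos[of "0::real"] by (simp add: has_field_derivative_iff)
  have "((\<lambda>t. \<bar>1 - sin t / t\<bar> * nrm W2 2 (\<lambda>p. fst p k) + \<bar>(cos t - 1) / t\<bar> * nrm W2 2 (\<lambda>p. snd p k)) \<longlongrightarrow>
     \<bar>1 - 1\<bar> * nrm W2 2 (\<lambda>p. fst p k) + \<bar>0\<bar> * nrm W2 2 (\<lambda>p. snd p k)) (at 0)"
    by (intro tendsto_intros s c)
  then have lim: "((\<lambda>t. \<bar>1 - sin t / t\<bar> * nrm W2 2 (\<lambda>p. fst p k) + \<bar>(cos t - 1) / t\<bar> * nrm W2 2 (\<lambda>p. snd p k)) \<longlongrightarrow> 0) (at 0)" by simp
  show "((\<lambda>t. nrm W2 2 (\<lambda>p. wflow.quot t (\<lambda>p. snd p k) p - - fst p k)) \<longlongrightarrow> 0) (at 0)"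
  proof (rule tendsto_0_squeeze[OF lim])
    fix t
    have e: "(\<lambda>p. wflow.quot t (\<lambda>p. snd p k) p - - fst p k) = (\<lambda>p. (1 - sin t / t) * fst p k + ((cos t - 1) / t) * snd p k)"
      by (auto simp: fun_eq_iff wflow.quot_def rot_def diff_divide_distrib add_divide_distrib algebra_simps)
    show "nrm W2 2 (\<lambda>p. wflow.quot t (\<lambda>p. snd p k) p - - fst p k) \<le> \<bar>1 - sin t / t\<bar> * nrm W2 2 (\<lambda>p. fst p k) + \<bar>(cos t - 1) / t\<bar> * nrm W2 2 (\<lambda>p. snd p k)"
    proof -
      have pos: "0 < (2::nat)" by simp
      show ?thesis
        unfolding e nrm_cmult[OF pos, symmetric] by (rule nrm_add[OF pos LL_cmult[OF y] LL_cmult[OF z]])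
    qed
  qed (rule nrm_nonneg)
qed

text \<open>Antisymmetry of the rotation applied to F(y) and z_k: the derivative of the first,
  paired with z_k, averages to the k-th partial derivative, and the derivative of the second is
  -y_k. No density has to be differentiated.\<close>

lemma gaussian_ibp:
  assumes F: "smooth_cylindrical F"
  shows "(\<integral>y. y k * F y \<partial>wiener) = (\<integral>y. pderivative k F y \<partial>wiener)"
proof -
  let ?n = "max (supp_bound F) (Suc k)"
  have FLL: "F \<in> LL wiener 2" "pderivative j F \<in> LL wiener 2" for j using smooth_LL[OF F] by auto
  have [measurable]: "F \<in> borel_measurable wiener" "pderivative j F \<in> borel_measurable wiener" for j
    using FLL by (auto simp: LL_def)
  have i: "integrable W2 (\<lambda>p. pderivative j F (fst p) * (snd p j * snd p k))" for j
  proof (rule Cauchy_Schwarz_LL(1)[OF LL_fst[OF FLL(2)]])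
    have "(\<lambda>y. y j * y k) \<in> LL wiener 2" by (intro LL_mult(1)[of _ _ 2, simplified] W.G_LL)
    from LL_snd[OF this] show "(\<lambda>p. snd p j * snd p k) \<in> LL W2 2" .
  qed
  have t: "(\<integral>p. pderivative j F (fst p) * (snd p j * snd p k) \<partial>W2) = (if j = k then \<integral>y. pderivative k F y \<partial>wiener else 0)" for j
  proof -
    have "(\<integral>p. pderivative j F (fst p) * (snd p j * snd p k) \<partial>W2) = (\<integral>y. \<integral>z. pderivative j F y * (z j * z k) \<partial>wiener \<partial>wiener)"
      using wiener2.integral_fst'[OF i[of j]] by simp
    then show ?thesis by (simp add: W.G_orthonormal)
  qed
  have "(\<integral>p. sharp F p * snd p k \<partial>W2) = (\<integral>p. (\<Sum>j<?n. pderivative j F (fst p) * (snd p j * snd p k)) \<partial>W2)"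
    by (intro Bochner_Integration.integral_cong) (auto simp: sharp_eq[OF F, of ?n] sum_distrib_right mult.assoc)
  also have "\<dots> = (\<Sum>j<?n. if j = k then \<integral>y. pderivative k F y \<partial>wiener else 0)"
    by (subst Bochner_Integration.integral_sum) (auto simp: i t)
  also have "\<dots> = (\<integral>y. pderivative k F y \<partial>wiener)" by (simp add: less_max_iff_disj)
  finally have 1: "(\<integral>p. sharp F p * snd p k \<partial>W2) = (\<integral>y. pderivative k F y \<partial>wiener)" .
  have "(\<integral>p. F (fst p) * - fst p k \<partial>W2) = (\<integral>y. F y * - y k \<partial>wiener)"
    by (rule integral_fst[of "\<lambda>y. F y * - y k"]) measurable
  then have 2: "(\<integral>p. F (fst p) * - fst p k \<partial>W2) = - (\<integral>y. y k * F y \<partial>wiener)" by (simp add: mult.commute)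
  show ?thesis using wflow.d2_ibp[OF smooth_d2[OF F] snd_coordinate_d2[of k]] unfolding 1 2 by simp
qed

text \<open>Every partial derivative brings out one factor a. All iterated derivatives are needed
  because cylindrical smoothness quantifies over all of them.\<close>

lemma foldr_pderivative_affine:
  assumes F: "smooth_cylindrical F"
  shows "foldr pderivative ks (\<lambda>y. F (\<lambda>i. a * y i + b i)) = (\<lambda>y. a ^ length ks * foldr pderivative ks F (\<lambda>i. a * y i + b i))"
    and "((\<lambda>t. foldr pderivative ks F (\<lambda>i. a * (y(k := t)) i + b i)) has_real_derivative
       a * foldr pderivative (k # ks) F (\<lambda>i. a * y i + b i)) (at (y k))"
proof -
  have D: "((\<lambda>t. foldr pderivative ks F (\<lambda>i. a * (y(k := t)) i + b i)) has_real_derivative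
       a * foldr pderivative (k # ks) F (\<lambda>i. a * y i + b i)) (at (y k))" for ks y k
  proof -
    let ?g = "foldr pderivative ks F" and ?A = "\<lambda>i. a * y i + b i"
    have "((\<lambda>u. ?g (?A(k := u))) has_real_derivative pderivative k ?g (?A(k := a * y k + b k))) (at (a * y k + b k))"
      by (rule differentiable_imp_pderivative) (rule smooth_cylindricalD(3)[OF F])
    then have "((\<lambda>t. ?g (?A(k := a * t + b k))) has_real_derivative pderivative k ?g (?A(k := a * y k + b k)) * a) (at (y k))"
      by (rule DERIV_chain2) (auto intro!: derivative_eq_intros)
    moreover have "?A(k := a * t + b k) = (\<lambda>i. a * (y(k := t)) i + b i)" for t by auto
    moreover have "?A(k := a * y k + b k) = ?A" by auto
    ultimately show ?thesis by (simp add: mult.commute)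
  qed
  then show "((\<lambda>t. foldr pderivative ks F (\<lambda>i. a * (y(k := t)) i + b i)) has_real_derivative
       a * foldr pderivative (k # ks) F (\<lambda>i. a * y i + b i)) (at (y k))" .
  show "foldr pderivative ks (\<lambda>y. F (\<lambda>i. a * y i + b i)) = (\<lambda>y. a ^ length ks * foldr pderivative ks F (\<lambda>i. a * y i + b i))"
  proof (induction ks)
    case (Cons k ks)
    have "pderivative k (\<lambda>y. a ^ length ks * foldr pderivative ks F (\<lambda>i. a * y i + b i)) y
        = a ^ length (k # ks) * foldr pderivative (k # ks) F (\<lambda>i. a * y i + b i)" for y
      unfolding pderivative_def[of k "\<lambda>y. a ^ length ks * foldr pderivative ks F (\<lambda>i. a * y i + b i)"]
      by (rule DERIV_imp_deriv, rule DERIV_cong[OF DERIV_cmult[OF D[of ks y k]]]) simp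
    note * = this
    show ?case unfolding foldr.simps(2)[of pderivative k ks] o_apply Cons.IH using * by (intro ext) simp
  qed simp
qed

text \<open>Makes R(cos t y - sin t z) a test function in y for fixed z, and in z for fixed y; the
  correlation argument uses both.\<close>

lemma smooth_cylindrical_affine:
  assumes F: "smooth_cylindrical F"
  shows "smooth_cylindrical (\<lambda>y. F (\<lambda>i. a * y i + b i))"
  unfolding smooth_cylindrical_def
proof (intro exI[of _ "supp_bound F"] conjI allI impI)
  fix y z :: "nat \<Rightarrow> real" assume "\<forall>i<supp_bound F. y i = z i"
  then show "F (\<lambda>i. a * y i + b i) = F (\<lambda>i. a * z i + b i)"
    by (intro smooth_cylindricalD(1)[OF F]) auto
next
  fix ks
  have A: "continuous_on UNIV (\<lambda>y i. a * y i + b i)"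
    by (intro continuous_on_coordinatewise_then_product continuous_intros continuous_on_product_coordinates)
  show "continuous_on UNIV (foldr pderivative ks (\<lambda>y. F (\<lambda>i. a * y i + b i)))"
    unfolding foldr_pderivative_affine(1)[OF F]
    by (intro continuous_intros continuous_on_compose2[OF smooth_cylindricalD(2)[OF F] A]) auto
  show "(\<lambda>t. foldr pderivative ks (\<lambda>y. F (\<lambda>i. a * y i + b i)) (y(k := t))) differentiable (at (y k))" for k y
    unfolding foldr_pderivative_affine(1)[OF F]
    using DERIV_cmult[OF foldr_pderivative_affine(2)[OF F, of ks a y k b], of "a ^ length ks"]
    by (auto simp: real_differentiable_def)
  obtain C m where C: "\<And>y. \<bar>foldr pderivative ks F y\<bar> \<le> C * (1 + (\<Sum>i<supp_bound F. \<bar>y i\<bar>)) ^ m"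
    using smooth_cylindricalD(4)[OF F] by blast
  \<comment> \<open>Chosen so that 1 + |a| s + b \<le> K (1 + s) for s \<ge> 0, where b is the sum
    of the |b i|.\<close>
  define K where "K = 1 + \<bar>a\<bar> + (\<Sum>i<supp_bound F. \<bar>b i\<bar>)"
  have "\<bar>foldr pderivative ks (\<lambda>y. F (\<lambda>i. a * y i + b i)) y\<bar> \<le> (\<bar>a\<bar> ^ length ks * \<bar>C\<bar> * K ^ m) * (1 + (\<Sum>i<supp_bound F. \<bar>y i\<bar>)) ^ m" for y
  proof -
    let ?s = "\<Sum>i<supp_bound F. \<bar>y i\<bar>" and ?t = "\<Sum>i<supp_bound F. \<bar>a * y i + b i\<bar>" and ?b = "\<Sum>i<supp_bound F. \<bar>b i\<bar>"
    have nn: "0 \<le> ?s" "0 \<le> ?t" "0 \<le> ?b" by (auto intro: sum_nonneg)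
    have "?t \<le> (\<Sum>i<supp_bound F. \<bar>a\<bar> * \<bar>y i\<bar> + \<bar>b i\<bar>)"
      by (intro sum_mono) (metis abs_mult abs_triangle_ineq)
    also have "\<dots> = \<bar>a\<bar> * ?s + ?b" by (simp add: sum.distrib sum_distrib_left)
    finally have "1 + ?t \<le> 1 + \<bar>a\<bar> * ?s + ?b" by simp
    also have "\<dots> \<le> K * (1 + ?s)"
      using nn mult_nonneg_nonneg[OF nn(3) nn(1)] by (simp add: K_def algebra_simps)
    finally have le: "1 + ?t \<le> K * (1 + ?s)" .
    have "\<bar>foldr pderivative ks F (\<lambda>i. a * y i + b i)\<bar> \<le> C * (1 + ?t) ^ m" by (rule C)
    also have "\<dots> \<le> \<bar>C\<bar> * (K * (1 + ?s)) ^ m"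
      using nn le by (intro mult_mono power_mono) auto
    finally have "\<bar>a\<bar> ^ length ks * \<bar>foldr pderivative ks F (\<lambda>i. a * y i + b i)\<bar> \<le> \<bar>a\<bar> ^ length ks * (\<bar>C\<bar> * (K * (1 + ?s)) ^ m)"
      by (intro mult_left_mono) auto
    then show ?thesis unfolding foldr_pderivative_affine(1)[OF F]
      by (simp add: abs_mult power_abs power_mult_distrib mult.assoc)
  qed
  then show "\<exists>C m. \<forall>y. \<bar>foldr pderivative ks (\<lambda>y. F (\<lambda>i. a * y i + b i)) y\<bar> \<le> C * (1 + (\<Sum>i<supp_bound F. \<bar>y i\<bar>)) ^ m"
    by blast
qed

lemma pderivative_affine:
  assumes "smooth_cylindrical F"
  shows "pderivative k (\<lambda>y. F (\<lambda>i. a * y i + b i)) y = a * pderivative k F (\<lambda>i. a * y i + b i)"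
  using foldr_pderivative_affine(1)[OF assms, of "[k]"] by (simp add: fun_eq_iff)

lemma smooth_has_gradient:
  assumes "smooth_cylindrical F" shows "has_gradient F (\<lambda>k. pderivative k F)"
proof -
  have "pderivative k F \<in> borel_measurable wiener" for k using smooth_LL(2)[OF assms] by (auto simp: LL_def)
  then show ?thesis unfolding has_gradient_def Lp_2_eq_LL
    using smooth_LL(1)[OF assms] assms by (intro conjI exI[of _ "\<lambda>_. F"]) auto
qed

lemma grad_spec: "F \<in> grad_dom \<Longrightarrow> has_gradient F (grad F)"
  unfolding grad_dom_def grad_def using someI_ex[of "has_gradient F"] by blast

text \<open>Closability: both Gaussian series are L^2 derivatives of the same functional along
  rotations, hence agree, and the isometry recovers each coefficient. It is what ties the chosen
  \<open>grad\<close> of a test function to its partial derivatives.\<close>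

lemma gradient_unique:
  assumes U: "has_gradient F U" and V: "has_gradient F V"
  shows "AE y in wiener. U k y = V k y"
proof -
  interpret U: gauss_series wiener "\<lambda>k y. y k" U by (rule has_gradient_series[OF U iid_wiener])
  interpret V: gauss_series wiener "\<lambda>k y. y k" V by (rule has_gradient_series[OF V iid_wiener])
  obtain S where S: "S \<in> LL W2 2" "(\<lambda>n. \<integral>p. (U.partial n p - S p)\<^sup>2 \<partial>W2) \<longlonglongrightarrow> 0" by (rule U.partial_limit)
  obtain T where T: "T \<in> LL W2 2" "(\<lambda>n. \<integral>p. (V.partial n p - T p)\<^sup>2 \<partial>W2) \<longlonglongrightarrow> 0" by (rule V.partial_limit)
  have "AE p in W2. S p = T p"
    using wflow.d2_unique[OF has_gradient_d2[OF U S(1)] has_gradient_d2[OF V T(1)]] S(2) T(2)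
    by (simp add: U.partial_def V.partial_def)
  then have "(\<integral>p. \<bar>S p - T p\<bar> ^ 2 \<partial>W2) = (\<integral>p. 0 \<partial>W2)"
    using S(1) T(1) by (intro integral_cong_AE) (auto simp: LL_def)
  then have ST: "nrm W2 2 (\<lambda>p. S p - T p) = 0" by (simp add: nrm_def)
  have lim: "(\<lambda>n. nrm W2 2 (\<lambda>p. U.partial n p - S p) + nrm W2 2 (\<lambda>p. V.partial n p - T p)) \<longlonglongrightarrow> 0 + 0"
    using tendsto_real_sqrt[OF S(2)] tendsto_real_sqrt[OF T(2)] by (intro tendsto_intros) (simp_all add: nrm_def sqrt_def)
  have b: "nrm wiener 2 (\<lambda>y. U k y - V k y) \<le> nrm W2 2 (\<lambda>p. U.partial n p - S p) + nrm W2 2 (\<lambda>p. V.partial n p - T p)" if n: "k < n" for n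
  proof -
    have e: "U.partial n p - V.partial n p = (\<Sum>j<n. (U j (fst p) - V j (fst p)) * snd p j)" for p
      by (simp add: U.partial_def V.partial_def sum_subtractf left_diff_distrib)
    have "ennreal ((nrm wiener 2 (\<lambda>y. U k y - V k y))\<^sup>2) = (\<integral>\<^sup>+y. ennreal ((U k y - V k y)\<^sup>2) \<partial>wiener)"
      by (rule nn_integral_sq_eq_nrm[symmetric]) (intro LL_diff U.U_LL V.U_LL)
    also have "\<dots> \<le> (\<integral>\<^sup>+y. ennreal (\<Sum>j<n. (U j y - V j y)\<^sup>2) \<partial>wiener)"
      by (intro nn_integral_mono ennreal_leI member_le_sum) (use n in auto)
    also have "\<dots> = (\<integral>\<^sup>+p. ennreal ((U.partial n p - V.partial n p)\<^sup>2) \<partial>W2)"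
      unfolding e by (rule W.linear_norm[symmetric]) auto
    also have "\<dots> = ennreal ((nrm W2 2 (\<lambda>p. U.partial n p - V.partial n p))\<^sup>2)"
      by (rule nn_integral_sq_eq_nrm) (intro LL_diff U.partial_LL V.partial_LL)
    finally have "(nrm wiener 2 (\<lambda>y. U k y - V k y))\<^sup>2 \<le> (nrm W2 2 (\<lambda>p. U.partial n p - V.partial n p))\<^sup>2" by simp
    then have 1: "nrm wiener 2 (\<lambda>y. U k y - V k y) \<le> nrm W2 2 (\<lambda>p. U.partial n p - V.partial n p)"
      by (rule power2_le_imp_le) (rule nrm_nonneg)
    have "nrm W2 2 (\<lambda>p. U.partial n p - V.partial n p) \<le> nrm W2 2 (\<lambda>p. U.partial n p - S p) + nrm W2 2 (\<lambda>p. S p - V.partial n p)"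
      by (intro nrm_triangle U.partial_LL V.partial_LL S) simp
    also have "nrm W2 2 (\<lambda>p. S p - V.partial n p) \<le> nrm W2 2 (\<lambda>p. S p - T p) + nrm W2 2 (\<lambda>p. T p - V.partial n p)"
      by (intro nrm_triangle V.partial_LL S T) simp
    also have "nrm W2 2 (\<lambda>p. T p - V.partial n p) = nrm W2 2 (\<lambda>p. V.partial n p - T p)"
      unfolding nrm_def by (simp add: abs_minus_commute)
    finally show ?thesis using 1 ST by simp
  qed
  have "nrm wiener 2 (\<lambda>y. U k y - V k y) \<le> 0 + 0"
    by (rule LIMSEQ_le_const[OF lim]) (use b in \<open>auto intro!: exI[of _ "Suc k"]\<close>)
  then have z: "nrm wiener 2 (\<lambda>y. U k y - V k y) = 0" using nrm_nonneg[of wiener 2 "\<lambda>y. U k y - V k y"] by simp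
  have d: "(\<lambda>y. U k y - V k y) \<in> LL wiener 2" by (intro LL_diff U.U_LL V.U_LL)
  have "(\<integral>\<^sup>+y. ennreal ((U k y - V k y)\<^sup>2) \<partial>wiener) = 0" unfolding nn_integral_sq_eq_nrm[OF d] z by simp
  then have "AE y in wiener. ennreal ((U k y - V k y)\<^sup>2) = 0" by (subst (asm) nn_integral_0_iff_AE) auto
  then show ?thesis by eventually_elim simp
qed

text \<open>For fixed \<open>z\<close> the function \<open>y \<mapsto> R (cos t y - sin t z)\<close> is a test function, so the defining
  identity of the generator applies to it; integrating over \<open>z\<close> afterwards avoids smoothing \<open>F\<close>.\<close>

lemma correlation_deriv_smooth:
  assumes R: "smooth_cylindrical R" and gen: "is_generator F H" and t: "cos t \<noteq> 0"
  shows "((\<lambda>t. \<integral>p. R (fst p) * F (fst (rot t p)) \<partial>W2) has_real_derivative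
     tan t * (\<integral>p. R (fst p) * H (fst (rot t p)) \<partial>W2)) (at t)"
proof -
  from gen have F: "F \<in> grad_dom" and H: "H \<in> LL wiener 2"
    and ident: "\<And>R. R \<in> grad_dom \<Longrightarrow> (\<integral>y. carre_du_champ R F y \<partial>wiener) = - (\<integral>y. R y * H y \<partial>wiener)"
    by (auto simp: is_generator_def Lp_2_eq_LL)
  let ?U = "grad F" and ?n = "supp_bound R"
  note gF = grad_spec[OF F]
  have FLL: "F \<in> LL wiener 2" using gF by (simp add: has_gradient_def Lp_2_eq_LL)
  interpret U: gauss_series wiener "\<lambda>k y. y k" ?U by (rule has_gradient_series[OF gF iid_wiener])
  obtain S where S: "S \<in> LL W2 2" "(\<lambda>n. \<integral>p. (U.partial n p - S p)\<^sup>2 \<partial>W2) \<longlonglongrightarrow> 0" by (rule U.partial_limit)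
  have d: "wflow.d2 (\<lambda>p. F (fst p)) S" by (rule has_gradient_d2[OF gF S(1)]) (use S(2) in \<open>simp add: U.partial_def\<close>)
  have RLL: "R \<in> LL wiener q" "pderivative k R \<in> LL wiener q" for q k using smooth_LL[OF R] by auto
  have [measurable]: "R \<in> borel_measurable wiener" "pderivative k R \<in> borel_measurable wiener" "F \<in> borel_measurable wiener"
    "H \<in> borel_measurable wiener" "S \<in> borel_measurable W2" for k
    using RLL FLL H S by (auto simp: LL_def)
  have RW: "(\<lambda>p. R (fst (rot s p))) \<in> LL W2 q" "(\<lambda>p. pderivative k R (fst (rot s p))) \<in> LL W2 q" for s k q
    by (intro wflow.LL_R[of "\<lambda>p. R (fst p)"] wflow.LL_R[of "\<lambda>p. pderivative k R (fst p)"] LL_fst RLL)+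
  let ?J = "\<integral>p. R (fst (rot (- t) p)) * S p \<partial>W2"
  \<comment> \<open>By invariance the rotation is moved from the rough functional to the smooth
    one.\<close>
  have rotback: "(\<integral>p. R (fst p) * h (rot t p) \<partial>W2) = (\<integral>p. R (fst (rot (- t) p)) * h p \<partial>W2)"
    if [measurable]: "h \<in> borel_measurable W2" for h
    using wflow.integral_R[of "\<lambda>p. R (fst (rot (- t) p)) * h p" t] by (simp add: wflow.R_add wflow.R_0)
  have "((\<lambda>s. \<integral>p. R (fst (rot (- t) p)) * wflow.quot s (\<lambda>p. F (fst p)) p \<partial>W2) \<longlongrightarrow> ?J) (at 0)"
    by (rule wflow.d2_inner[OF d RW(1)])
  moreover have "(\<integral>p. R (fst (rot (- t) p)) * wflow.quot s (\<lambda>p. F (fst p)) p \<partial>W2)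
      = ((\<integral>p. R (fst p) * F (fst (rot (t + s) p)) \<partial>W2) - (\<integral>p. R (fst p) * F (fst (rot t p)) \<partial>W2)) / s" for s
  proof -
    have i: "integrable W2 (\<lambda>p. R (fst p) * F (fst (rot u p)))" for u
      by (intro Cauchy_Schwarz_LL(1) LL_fst RLL wflow.LL_R[of "\<lambda>p. F (fst p)"] FLL)
    have "(\<integral>p. R (fst (rot (- t) p)) * wflow.quot s (\<lambda>p. F (fst p)) p \<partial>W2)
        = (\<integral>p. R (fst p) * wflow.quot s (\<lambda>p. F (fst p)) (rot t p) \<partial>W2)"
      by (rule rotback[symmetric]) (simp add: wflow.quot_def[abs_def])
    also have "\<dots> = (\<integral>p. (R (fst p) * F (fst (rot (t + s) p)) - R (fst p) * F (fst (rot t p))) / s \<partial>W2)"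
      by (intro Bochner_Integration.integral_cong) (auto simp: wflow.quot_def wflow.R_add right_diff_distrib add.commute)
    finally show ?thesis using i by simp
  qed
  ultimately have deriv: "((\<lambda>t. \<integral>p. R (fst p) * F (fst (rot t p)) \<partial>W2) has_real_derivative ?J) (at t)"
    unfolding DERIV_def by simp
  let ?c = "cos t" and ?s = "sin t"
  have rt: "fst (rot (- t) (y, z)) = (\<lambda>i. ?c * y i + (- ?s) * z i)" for y z by (simp add: rot_def)
  let ?I = "\<lambda>k. \<integral>p. ?U k (fst p) * pderivative k R (fst (rot (- t) p)) \<partial>W2"
  \<comment> \<open>For fixed y, Gaussian integration by parts in z replaces the factor z_k by a
    partial derivative of the rotated test function, which contributes - sin t.\<close>
  have kterm: "(\<integral>p. R (fst (rot (- t) p)) * (?U k (fst p) * snd p k) \<partial>W2) = - ?s * ?I k" for k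
  proof -
    have iz: "integrable W2 (\<lambda>p. ?U k (fst p) * (snd p k * R (fst (rot (- t) p))))"
    proof (rule Cauchy_Schwarz_LL(1)[OF LL_fst[OF U.U_LL]])
      show "(\<lambda>p. snd p k * R (fst (rot (- t) p))) \<in> LL W2 2"
        by (intro LL_mult(1)[of _ _ 2, simplified] RW LL_snd[OF W.G_LL])
    qed
    have i2: "integrable W2 (\<lambda>p. ?U k (fst p) * pderivative k R (fst (rot (- t) p)))"
      by (rule Cauchy_Schwarz_LL(1)[OF LL_fst[OF U.U_LL] RW(2)])
    have "(\<integral>p. R (fst (rot (- t) p)) * (?U k (fst p) * snd p k) \<partial>W2) = (\<integral>p. ?U k (fst p) * (snd p k * R (fst (rot (- t) p))) \<partial>W2)"
      by (intro Bochner_Integration.integral_cong) (auto simp: mult_ac)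
    also have "\<dots> = (\<integral>y. \<integral>z. ?U k y * (z k * R (\<lambda>i. ?c * y i + (- ?s) * z i)) \<partial>wiener \<partial>wiener)"
      using wiener2.integral_fst'[OF iz] by (simp add: rt)
    also have "\<dots> = (\<integral>y. ?U k y * (\<integral>z. z k * R (\<lambda>i. ?c * y i + (- ?s) * z i) \<partial>wiener) \<partial>wiener)" by simp
    also have "\<dots> = (\<integral>y. ?U k y * (\<integral>z. - ?s * pderivative k R (\<lambda>i. ?c * y i + (- ?s) * z i) \<partial>wiener) \<partial>wiener)"
    proof -
      have "(\<integral>z. z k * R (\<lambda>i. ?c * y i + (- ?s) * z i) \<partial>wiener) = (\<integral>z. - ?s * pderivative k R (\<lambda>i. ?c * y i + (- ?s) * z i) \<partial>wiener)" for y
      proof -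
        have "(\<integral>z. z k * R (\<lambda>i. (- ?s) * z i + ?c * y i) \<partial>wiener) = (\<integral>z. pderivative k (\<lambda>z. R (\<lambda>i. (- ?s) * z i + ?c * y i)) z \<partial>wiener)"
          by (rule gaussian_ibp[OF smooth_cylindrical_affine[OF R]])
        then show ?thesis unfolding pderivative_affine[OF R] by (simp only: add.commute)
      qed
      then show ?thesis by simp
    qed
    also have "\<dots> = - ?s * (\<integral>y. \<integral>z. ?U k y * pderivative k R (\<lambda>i. ?c * y i + (- ?s) * z i) \<partial>wiener \<partial>wiener)"
      by (simp add: mult.left_commute)
    also have "(\<integral>y. \<integral>z. ?U k y * pderivative k R (\<lambda>i. ?c * y i + (- ?s) * z i) \<partial>wiener \<partial>wiener) = ?I k"
      using wiener2.integral_fst'[OF i2] by (simp add: rt)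
    finally show ?thesis .
  qed
  have "(\<lambda>N. \<integral>p. R (fst (rot (- t) p)) * U.partial N p \<partial>W2) \<longlonglongrightarrow> ?J"
  proof (rule tendsto_inner)
    show "(\<lambda>n. nrm W2 2 (\<lambda>x. U.partial n x - S x)) \<longlonglongrightarrow> 0"
      using tendsto_real_sqrt[OF S(2)] by (simp add: nrm_def sqrt_def)
  qed (use RW S U.partial_LL in \<open>auto simp: nrm_def\<close>)
  moreover have "(\<integral>p. R (fst (rot (- t) p)) * U.partial N p \<partial>W2) = - ?s * (\<Sum>k<?n. ?I k)" if N: "?n \<le> N" for N
  proof -
    have it: "integrable W2 (\<lambda>p. R (fst (rot (- t) p)) * (?U k (fst p) * snd p k))" for k
    proof -
      have "integrable W2 (\<lambda>p. ?U k (fst p) * (snd p k * R (fst (rot (- t) p))))"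
        by (intro Cauchy_Schwarz_LL(1) LL_fst[OF U.U_LL] LL_mult(1)[of _ _ 2, simplified] RW LL_snd[OF W.G_LL])
      then show ?thesis by (simp add: mult_ac)
    qed
    have "(\<integral>p. R (fst (rot (- t) p)) * U.partial N p \<partial>W2) = (\<Sum>k<N. - ?s * ?I k)"
      unfolding U.partial_def sum_distrib_left by (subst Bochner_Integration.integral_sum) (auto simp: it kterm)
    also have "\<dots> = - ?s * (\<Sum>k<N. ?I k)" by (simp add: sum_distrib_left)
    also have "(\<Sum>k<N. ?I k) = (\<Sum>k<?n. ?I k)"
      by (rule sum.mono_neutral_right) (use N in \<open>auto simp: pderivative_eq_0[OF R]\<close>)
    finally show ?thesis .
  qed
  then have "(\<lambda>N. \<integral>p. R (fst (rot (- t) p)) * U.partial N p \<partial>W2) \<longlonglongrightarrow> - ?s * (\<Sum>k<?n. ?I k)"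
    by (intro tendsto_eventually) (auto simp: eventually_sequentially)
  ultimately have J: "?J = - ?s * (\<Sum>k<?n. ?I k)" by (rule LIMSEQ_unique)
  \<comment> \<open>The generator identity on slices expresses the same sum with the factor cos t.
    Eliminating the sum between the two formulas leaves tan t.\<close>
  have "?c * (\<Sum>k<?n. ?I k) = - (\<integral>p. R (fst (rot (- t) p)) * H (fst p) \<partial>W2)"
  proof -
    have i2: "integrable W2 (\<lambda>p. ?U k (fst p) * pderivative k R (fst (rot (- t) p)))" for k
      by (rule Cauchy_Schwarz_LL(1)[OF LL_fst[OF U.U_LL] RW(2)])
    have iS: "integrable W2 (\<lambda>p. ?c * (\<Sum>k<?n. ?U k (fst p) * pderivative k R (fst (rot (- t) p))))"
      using i2 by (intro integrable_mult_right Bochner_Integration.integrable_sum)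
    have iH: "integrable W2 (\<lambda>p. R (fst (rot (- t) p)) * H (fst p))"
      by (intro Cauchy_Schwarz_LL(1) RW LL_fst H)
    have swap: "(\<integral>p. h p \<partial>W2) = (\<integral>z. \<integral>y. h (y, z) \<partial>wiener \<partial>wiener)" if "integrable W2 h"
      for h :: "(nat \<Rightarrow> real) \<times> (nat \<Rightarrow> real) \<Rightarrow> real"
      using wiener2.integral_snd[of "\<lambda>y z. h (y, z)"] that by (simp add: case_prod_beta')
    have slice: "(\<integral>y. ?c * (\<Sum>k<?n. ?U k y * pderivative k R (\<lambda>i. ?c * y i + (- ?s) * z i)) \<partial>wiener)
        = - (\<integral>y. R (\<lambda>i. ?c * y i + (- ?s) * z i) * H y \<partial>wiener)" for z
    proof -
      define Rz where "Rz y = R (\<lambda>i. ?c * y i + (- ?s) * z i)" for y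
      have Rz: "smooth_cylindrical Rz" unfolding Rz_def[abs_def] by (rule smooth_cylindrical_affine[OF R])
      have pd: "pderivative k Rz y = ?c * pderivative k R (\<lambda>i. ?c * y i + (- ?s) * z i)" for k y
        unfolding Rz_def[abs_def] by (rule pderivative_affine[OF R])
      have dom: "Rz \<in> grad_dom" using smooth_has_gradient[OF Rz] by (auto simp: grad_dom_def)
      interpret Z: gauss_series wiener "\<lambda>k y. y k" "grad Rz" by (rule has_gradient_series[OF grad_spec[OF dom] iid_wiener])
      have [measurable]: "pderivative k Rz \<in> borel_measurable wiener" for k using smooth_LL[OF Rz] by (auto simp: LL_def)
      \<comment> \<open>\<open>grad Rz\<close> is an unspecified choice; almost everywhere it is the
        family of partial derivatives, so the carre du champ becomes a finite sum.\<close>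
      have "AE y in wiener. \<forall>k. grad Rz k y = pderivative k Rz y"
        using gradient_unique[OF grad_spec[OF dom] smooth_has_gradient[OF Rz]] by (simp add: AE_all_countable)
      then have "AE y in wiener. carre_du_champ Rz F y = ?c * (\<Sum>k<?n. ?U k y * pderivative k R (\<lambda>i. ?c * y i + (- ?s) * z i))"
      proof eventually_elim
        case (elim y)
        have "carre_du_champ Rz F y = (\<Sum>k. ?c * pderivative k R (\<lambda>i. ?c * y i + (- ?s) * z i) * ?U k y)"
          unfolding carre_du_champ_def using elim pd by simp
        also have "\<dots> = (\<Sum>k<?n. ?c * pderivative k R (\<lambda>i. ?c * y i + (- ?s) * z i) * ?U k y)"
          by (rule suminf_finite) (auto simp: pderivative_eq_0[OF R])
        finally show ?case by (simp add: sum_distrib_left mult_ac)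
      qed
      moreover have "(\<lambda>y. pderivative k R (\<lambda>i. ?c * y i + (- ?s) * z i)) \<in> borel_measurable wiener" for k
      proof -
        have "(\<lambda>y. inverse ?c * pderivative k Rz y) \<in> borel_measurable wiener" by measurable
        then show ?thesis unfolding pd mult.assoc[symmetric] using t by simp
      qed
      ultimately have "(\<integral>y. carre_du_champ Rz F y \<partial>wiener) = (\<integral>y. ?c * (\<Sum>k<?n. ?U k y * pderivative k R (\<lambda>i. ?c * y i + (- ?s) * z i)) \<partial>wiener)"
        by (intro integral_cong_AE) (auto simp: carre_du_champ_def[abs_def])
      then show ?thesis using ident[OF dom] by (simp add: Rz_def)
    qed
    have "?c * (\<Sum>k<?n. ?I k) = (\<integral>p. ?c * (\<Sum>k<?n. ?U k (fst p) * pderivative k R (fst (rot (- t) p))) \<partial>W2)"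
      using i2 by simp
    also have "\<dots> = (\<integral>z. \<integral>y. ?c * (\<Sum>k<?n. ?U k y * pderivative k R (\<lambda>i. ?c * y i + (- ?s) * z i)) \<partial>wiener \<partial>wiener)"
      by (subst swap[OF iS]) (simp only: fst_conv rt)
    also have "\<dots> = (\<integral>z. - (\<integral>y. R (\<lambda>i. ?c * y i + (- ?s) * z i) * H y \<partial>wiener) \<partial>wiener)" by (simp only: slice)
    also have "\<dots> = - (\<integral>p. R (fst (rot (- t) p)) * H (fst p) \<partial>W2)"
      by (subst swap[OF iH]) (simp only: fst_conv rt Bochner_Integration.integral_minus)
    finally show ?thesis .
  qed
  then have "(\<Sum>k<?n. ?I k) = - (\<integral>p. R (fst (rot (- t) p)) * H (fst p) \<partial>W2) / ?c" using t by (simp add: field_simps)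
  then have "?J = tan t * (\<integral>p. R (fst (rot (- t) p)) * H (fst p) \<partial>W2)" unfolding J by (simp add: tan_def)
  also have "(\<integral>p. R (fst (rot (- t) p)) * H (fst p) \<partial>W2) = (\<integral>p. R (fst p) * H (fst (rot t p)) \<partial>W2)"
    by (rule rotback[symmetric]) measurable
  finally show ?thesis using deriv by simp
qed

section \<open>Smoothness of the autocorrelation for functionals in \<open_domain>
  \<open>D_infinity\<close>\<close>

lemma cos_nonzero: "\<bar>t\<bar> < 1 \<Longrightarrow> cos t \<noteq> 0" for t :: real
  using cos_gt_zero_pi[of t] pi_gt3 unfolding abs_less_iff by linarith

text \<open>Rotation is an isometry, so correlations depend on R continuously in L^2 uniformly in t,
  and tan is bounded on (-1, 1). Hence the derivatives along smooth approximants of R converge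
  uniformly and the limit may be differentiated.\<close>

lemma correlation_deriv:
  assumes R: "R \<in> grad_dom" and gen: "is_generator F H" and t: "\<bar>t\<bar> < 1"
  shows "((\<lambda>t. \<integral>p. R (fst p) * F (fst (rot t p)) \<partial>W2) has_real_derivative
     tan t * (\<integral>p. R (fst p) * H (fst (rot t p)) \<partial>W2)) (at t)"
proof -
  from gen have F: "F \<in> LL wiener 2" and H: "H \<in> LL wiener 2"
    by (auto simp: is_generator_def Lp_2_eq_LL grad_dom_def has_gradient_def)
  from R obtain \<Phi> where \<Phi>: "\<And>n. smooth_cylindrical (\<Phi> n)"
    and lim: "(\<lambda>n. \<integral>\<^sup>+ y. ennreal ((\<Phi> n y - R y)\<^sup>2) \<partial>wiener) \<longlonglongrightarrow> 0"
    and RLL: "R \<in> LL wiener 2" unfolding grad_dom_def has_gradient_def Lp_2_eq_LL by blast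
  have \<Phi>LL: "\<Phi> n \<in> LL wiener 2" for n by (rule smooth_LL[OF \<Phi>])
  have dLL: "(\<lambda>y. \<Phi> n y - R y) \<in> LL wiener 2" for n by (intro LL_diff \<Phi>LL RLL)
  have nl: "(\<lambda>n. nrm wiener 2 (\<lambda>y. \<Phi> n y - R y)) \<longlonglongrightarrow> 0"
    using lim by (subst (asm) nn_tendsto_iff_nrm) (auto intro: dLL)
  have est: "\<bar>(\<integral>p. \<Phi> n (fst p) * K (fst (rot t p)) \<partial>W2) - (\<integral>p. R (fst p) * K (fst (rot t p)) \<partial>W2)\<bar>
      \<le> nrm wiener 2 (\<lambda>y. \<Phi> n y - R y) * nrm wiener 2 K" if K: "K \<in> LL wiener 2" for K n t
  proof -
    have KR: "(\<lambda>p. K (fst (rot t p))) \<in> LL W2 2" by (rule wflow.LL_R[OF LL_fst[OF K]])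
    have [measurable]: "K \<in> borel_measurable wiener" "(\<lambda>y. \<Phi> n y - R y) \<in> borel_measurable wiener" using K dLL by (auto simp: LL_def)
    have "(\<integral>p. \<Phi> n (fst p) * K (fst (rot t p)) \<partial>W2) - (\<integral>p. R (fst p) * K (fst (rot t p)) \<partial>W2)
       = (\<integral>p. (\<Phi> n (fst p) - R (fst p)) * K (fst (rot t p)) \<partial>W2)"
      using Cauchy_Schwarz_LL(1)[OF LL_fst[OF \<Phi>LL] KR] Cauchy_Schwarz_LL(1)[OF LL_fst[OF RLL] KR]
      by (simp add: left_diff_distrib)
    also have "\<bar>\<dots>\<bar> \<le> nrm W2 2 (\<lambda>p. \<Phi> n (fst p) - R (fst p)) * nrm W2 2 (\<lambda>p. K (fst (rot t p)))"
      by (intro Cauchy_Schwarz_LL(2) KR LL_fst[of "\<lambda>y. \<Phi> n y - R y"] dLL)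
    also have "nrm W2 2 (\<lambda>p. \<Phi> n (fst p) - R (fst p)) = nrm wiener 2 (\<lambda>y. \<Phi> n y - R y)"
      by (rule nrm_fst[of "\<lambda>y. \<Phi> n y - R y"]) measurable
    also have "nrm W2 2 (\<lambda>p. K (fst (rot t p))) = nrm wiener 2 K"
      using wflow.nrm_R[OF LL_fst[OF K], of t] nrm_fst[of K 2] by simp
    finally show ?thesis .
  qed
  let ?b = "\<lambda>n t. \<integral>p. \<Phi> n (fst p) * F (fst (rot t p)) \<partial>W2" and ?b' = "\<lambda>n t. \<integral>p. \<Phi> n (fst p) * H (fst (rot t p)) \<partial>W2"
  let ?B = "\<lambda>t. \<integral>p. R (fst p) * F (fst (rot t p)) \<partial>W2" and ?B' = "\<lambda>t. \<integral>p. R (fst p) * H (fst (rot t p)) \<partial>W2"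
  have ptw: "(\<lambda>n. ?b n t) \<longlonglongrightarrow> ?B t" for t
  proof (rule LIM_zero_cancel, rule Lim_null_comparison[OF always_eventually])
    show "(\<lambda>n. nrm wiener 2 (\<lambda>y. \<Phi> n y - R y) * nrm wiener 2 F) \<longlonglongrightarrow> 0"
      using tendsto_mult_left_zero[OF nl] .
    show "\<forall>n. norm (?b n t - ?B t) \<le> nrm wiener 2 (\<lambda>y. \<Phi> n y - R y) * nrm wiener 2 F" using est[OF F] by simp
  qed
  define I where "I = {-1<..<1::real}"
  have tanb: "\<bar>tan x\<bar> \<le> tan 1" if "x \<in> I" for x
  proof -
    have "tan x \<le> tan 1" by (rule tan_mono_le) (use that pi_gt3 in \<open>auto simp: I_def\<close>)
    moreover have "tan (-1) \<le> tan x" by (rule tan_mono_le) (use that pi_gt3 in \<open>auto simp: I_def\<close>)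
    ultimately show ?thesis by (simp add: abs_le_iff)
  qed
  have tan1: "0 \<le> tan (1::real)" using tanb[of 0] by (auto simp: I_def)
  have "\<exists>g. \<forall>x\<in>I. (\<lambda>n. ?b n x) \<longlonglongrightarrow> g x \<and> (g has_derivative (\<lambda>h. tan x * ?B' x * h)) (at x within I)"
  proof (rule has_derivative_sequence)
    show "convex I" by (simp add: I_def)
    show "(?b n has_derivative (\<lambda>h. tan x * ?b' n x * h)) (at x within I)" if "x \<in> I" for n x
    proof -
      have "\<bar>x\<bar> < 1" using that by (auto simp: I_def)
      from correlation_deriv_smooth[OF \<Phi>[of n] gen cos_nonzero[OF this]]
      show ?thesis unfolding has_field_derivative_def by (rule has_derivative_at_withinI)
    qed
    show "0 \<in> I" by (simp add: I_def)
    show "(\<lambda>n. ?b n 0) \<longlonglongrightarrow> ?B 0" by (rule ptw)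
    fix e :: real assume e: "0 < e"
    have "(\<lambda>n. tan 1 * (nrm wiener 2 (\<lambda>y. \<Phi> n y - R y) * nrm wiener 2 H)) \<longlonglongrightarrow> tan 1 * (0 * nrm wiener 2 H)"
      by (intro tendsto_intros nl)
    then have "\<forall>\<^sub>F n in sequentially. tan 1 * (nrm wiener 2 (\<lambda>y. \<Phi> n y - R y) * nrm wiener 2 H) < e"
      by (intro order_tendstoD(2)) (use e in auto)
    then show "\<forall>\<^sub>F n in sequentially. \<forall>x\<in>I. \<forall>h. norm (tan x * ?b' n x * h - tan x * ?B' x * h) \<le> e * norm h"
    proof eventually_elim
      case (elim n)
      show ?case
      proof (intro ballI allI)
        fix x h assume x: "x \<in> I"
        have "norm (tan x * ?b' n x * h - tan x * ?B' x * h) = \<bar>tan x\<bar> * \<bar>?b' n x - ?B' x\<bar> * \<bar>h\<bar>"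
          unfolding real_norm_def abs_mult[symmetric] by (simp only: left_diff_distrib right_diff_distrib)
        also have "\<dots> \<le> tan 1 * (nrm wiener 2 (\<lambda>y. \<Phi> n y - R y) * nrm wiener 2 H) * \<bar>h\<bar>"
          by (intro mult_right_mono mult_mono tanb x est[OF H]) (auto simp: tan1)
        also have "\<dots> \<le> e * \<bar>h\<bar>" using elim by (intro mult_right_mono) auto
        finally show "norm (tan x * ?b' n x * h - tan x * ?B' x * h) \<le> e * norm h" by simp
      qed
    qed
  qed
  then obtain g where g: "\<And>x. x \<in> I \<Longrightarrow> (\<lambda>n. ?b n x) \<longlonglongrightarrow> g x"
    "\<And>x. x \<in> I \<Longrightarrow> (g has_derivative (\<lambda>h. tan x * ?B' x * h)) (at x within I)" by blast
  have eq: "g x = ?B x" if "x \<in> I" for x using LIMSEQ_unique[OF g(1)[OF that] ptw] .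
  have tI: "t \<in> I" "open I" using t by (auto simp: I_def)
  have "(?B has_derivative (\<lambda>h. tan t * ?B' t * h)) (at t within I)"
    by (rule has_derivative_transform[OF tI(1) _ g(2)[OF tI(1)]]) (simp add: eq)
  then show ?thesis unfolding has_field_derivative_def at_within_open[OF tI] .
qed

text \<open>Since tan' = 1 + tan^2, combinations of products of powers of tan with the b k are
  stable under differentiation. This produces all derivatives of b 0 without a closed
  formula.\<close>

inductive tan_closure :: "(nat \<Rightarrow> real \<Rightarrow> real) \<Rightarrow> (real \<Rightarrow> real) \<Rightarrow> bool" for b where
  "tan_closure b (b k)"
| "tan_closure b f \<Longrightarrow> tan_closure b g \<Longrightarrow> tan_closure b (\<lambda>t. f t + g t)"
| "tan_closure b f \<Longrightarrow> tan_closure b (\<lambda>t. tan t * f t)"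

lemma tan_closure_deriv:
  assumes b: "\<And>k t. \<bar>t\<bar> < 1 \<Longrightarrow> (b k has_real_derivative tan t * b (Suc k) t) (at t)"
  shows "tan_closure b f \<Longrightarrow> \<exists>g. tan_closure b g \<and> (\<forall>t. \<bar>t\<bar> < 1 \<longrightarrow> (f has_real_derivative g t) (at t))"
proof (induction rule: tan_closure.induct)
  case (1 k)
  show ?case using b tan_closure.intros by (intro exI[of _ "\<lambda>t. tan t * b (Suc k) t"]) blast
next
  case (2 f g)
  then obtain f' g' where *: "tan_closure b f'" "tan_closure b g'"
    "\<And>t. \<bar>t\<bar> < 1 \<Longrightarrow> (f has_real_derivative f' t) (at t)" "\<And>t. \<bar>t\<bar> < 1 \<Longrightarrow> (g has_real_derivative g' t) (at t)" by blast
  show ?case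
    by (rule exI[of _ "\<lambda>t. f' t + g' t"]) (auto intro!: tan_closure.intros(2) DERIV_add *)
next
  case (3 f)
  then obtain f' where *: "tan_closure b f'" "\<And>t. \<bar>t\<bar> < 1 \<Longrightarrow> (f has_real_derivative f' t) (at t)" by blast
  have "((\<lambda>t. tan t * f t) has_real_derivative f t + (tan t * (tan t * f t) + tan t * f' t)) (at t)" if t: "\<bar>t\<bar> < 1" for t
  proof -
    have "inverse ((cos t)\<^sup>2) = 1 + (tan t)\<^sup>2" using tan_sec[OF cos_nonzero[OF t]] by (simp add: power_inverse)
    then have "(tan has_real_derivative 1 + (tan t)\<^sup>2) (at t)" using DERIV_tan[OF cos_nonzero[OF t]] by simp
    from DERIV_mult[OF this *(2)[OF t]] show ?thesis by (simp add: power2_eq_square algebra_simps)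
  qed
  moreover have "tan_closure b (\<lambda>t. f t + (tan t * (tan t * f t) + tan t * f' t))"
    by (intro tan_closure.intros 3 *)
  ultimately show ?case by blast
qed

lemma D_infinity_generator:
  assumes "F \<in> D_infinity"
  shows "is_generator ((OU ^^ k) F) ((OU ^^ Suc k) F)" "1 < p \<Longrightarrow> (OU ^^ k) F \<in> Lp wiener p"
proof -
  have "(OU ^^ k) F \<in> OU_dom" using assms by (simp add: D_infinity_def)
  then have "\<exists>H. is_generator ((OU ^^ k) F) H" by (simp add: OU_dom_def)
  then have "is_generator ((OU ^^ k) F) (OU ((OU ^^ k) F))" unfolding OU_def by (rule someI_ex)
  then show "is_generator ((OU ^^ k) F) ((OU ^^ Suc k) F)" by simp
  show "1 < p \<Longrightarrow> (OU ^^ k) F \<in> Lp wiener p" using assms by (auto simp: D_infinity_def)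
qed

text \<open>The functional F is correlated with the rotated iterates of its own generator; F serves
  as test function throughout, so only membership of F in \<open>grad_dom\<close> is asked of the
  first factor.\<close>

theorem D_infinity_psi_smooth:
  assumes F: "F \<in> D_infinity"
  shows "wflow.psi_smooth (\<lambda>p. F (fst p))" "(\<lambda>p. F (fst p)) \<in> LL W2 q" "F \<in> grad_dom"
proof -
  have gen: "is_generator ((OU ^^ k) F) ((OU ^^ Suc k) F)" for k by (rule D_infinity_generator[OF F])
  show dom: "F \<in> grad_dom" using gen[of 0] by (simp add: is_generator_def)
  have big: "F \<in> LL wiener q" if "2 \<le> q" for q
  proof -
    have "F \<in> Lp wiener (real q)" using D_infinity_generator(2)[OF F, of "real q" 0] that by simp
    moreover have "\<bar>x\<bar> powr real q = \<bar>x\<bar> ^ q" for x :: real using that by (cases "x = 0") (auto simp: powr_realpow)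
    ultimately show ?thesis by (simp add: Lp_def LL_def)
  qed
  have "F \<in> LL wiener q" for q using wiener.LL_mono[OF _ big[of "max 2 q"], of q] by simp
  then show FLL: "(\<lambda>p. F (fst p)) \<in> LL W2 q" for q by (intro LL_fst)
  define b where "b k t = (\<integral>p. F (fst p) * ((OU ^^ k) F) (fst (rot t p)) \<partial>W2)" for k t
  have b: "(b k has_real_derivative tan t * b (Suc k) t) (at t)" if "\<bar>t\<bar> < 1" for k t
    unfolding b_def[abs_def] by (rule correlation_deriv[OF dom gen that])
  have "\<exists>D. \<forall>n. (tan_closure b (D n) \<and> (n = 0 \<longrightarrow> D n = b 0)) \<and> (\<forall>t. \<bar>t\<bar> < 1 \<longrightarrow> (D n has_real_derivative D (Suc n) t) (at t))"
  proof (rule dependent_nat_choice)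
    show "\<exists>x. tan_closure b x \<and> (0 = 0 \<longrightarrow> x = b 0)" using tan_closure.intros(1) by blast
    show "\<exists>y. (tan_closure b y \<and> (Suc n = 0 \<longrightarrow> y = b 0)) \<and> (\<forall>t. \<bar>t\<bar> < 1 \<longrightarrow> (x has_real_derivative y t) (at t))"
      if "tan_closure b x \<and> (n = 0 \<longrightarrow> x = b 0)" for x n
      using tan_closure_deriv[of b x, OF b] that by auto
  qed
  then obtain D where D: "D 0 = b 0" "\<And>n t. \<bar>t\<bar> < 1 \<Longrightarrow> (D n has_real_derivative D (Suc n) t) (at t)" by blast
  show "wflow.psi_smooth (\<lambda>p. F (fst p))"
    unfolding wflow.psi_smooth_def
  proof (intro conjI exI[of _ D] allI impI)
    show "(\<lambda>p. F (fst p)) \<in> LL W2 2" by (rule FLL)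
  qed (use D in \<open>auto simp: b_def\<close>)
qed

section \<open>Decay of the characteristic function\<close>

text \<open>2 - 2 cos u is minus the square of exp(iu/2) - exp(-iu/2), so the binomial theorem of
  order 2n applies; the k-th term has frequency k - n, and the constant term sits at k = n.\<close>

lemma two_minus_two_cos_power:
  fixes u :: real
  shows "(2 - 2 * cos u) ^ n = (\<Sum>k\<le>2 * n. real (2 * n choose k) * (- 1) ^ (k + n) * cos ((real k - real n) * u))"
proof -
  have sq: "(cis (u / 2) - cis (- u / 2))\<^sup>2 = - complex_of_real (2 - 2 * cos u)"
    using cos_double_sin[of "u / 2"] by (simp add: complex_eq_iff power2_eq_square)
  have "complex_of_real ((2 - 2 * cos u) ^ n) = (- 1) ^ n * (cis (u / 2) - cis (- u / 2)) ^ (2 * n)"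
    unfolding power_mult sq by (simp flip: power_mult_distrib)
  also have "\<dots> = (- 1) ^ n * (\<Sum>k\<le>2 * n. of_nat (2 * n choose k) * cis (u / 2) ^ k * (- cis (- u / 2)) ^ (2 * n - k))"
    using binomial_ring[of "cis (u / 2)" "- cis (- u / 2)" "2 * n"] by simp
  also have "\<dots> = (\<Sum>k\<le>2 * n. of_real (real (2 * n choose k) * (- 1) ^ (k + n)) * cis ((real k - real n) * u))"
    unfolding sum_distrib_left
  proof (intro sum.cong refl)
    fix k assume "k \<in> {..2 * n}"
    then have k: "k \<le> 2 * n" by simp
    have "(- cis (- u / 2)) ^ (2 * n - k) = (- 1) ^ k * cis (real (2 * n - k) * (- u / 2))"
    proof -
      have "(- 1 :: complex) ^ (2 * n - k) = (- 1) ^ k" using k by (simp add: minus_one_power_iff)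
      then show ?thesis using Complex.DeMoivre[of "- u / 2" "2 * n - k"] by (simp only: power_minus[of "cis (- u / 2)"])
    qed
    moreover have "cis (u / 2) ^ k * cis (real (2 * n - k) * (- u / 2)) = cis ((real k - real n) * u)"
    proof -
      have "real k * (u / 2) + real (2 * n - k) * (- u / 2) = (real k - real n) * u"
        using k by (simp add: of_nat_diff field_simps)
      then show ?thesis by (simp only: Complex.DeMoivre cis_mult)
    qed
    ultimately show "(- 1) ^ n * (of_nat (2 * n choose k) * cis (u / 2) ^ k * (- cis (- u / 2)) ^ (2 * n - k)) =
        of_real (real (2 * n choose k) * (- 1) ^ (k + n)) * cis ((real k - real n) * u)"
      by (simp add: power_add algebra_simps)
  qed
  finally have "Re (complex_of_real ((2 - 2 * cos u) ^ n)) =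
      Re (\<Sum>k\<le>2 * n. of_real (real (2 * n choose k) * (- 1) ^ (k + n)) * cis ((real k - real n) * u))" by simp
  then show ?thesis by (simp del: of_real_mult of_real_power)
qed

context gauss_series
begin

text \<open>Only the constant term of the expansion of \<open>(2 - 2 cos (s S))\<^sup>n\<close> survives up to an error controlled by the
  characteristic function of \<open>S\<close>.\<close>

lemma series_differences:
  assumes S: "S \<in> LL (wiener \<Otimes>\<^sub>M M) 2" and lim: "(\<lambda>n. \<integral>p. (partial n p - S p)\<^sup>2 \<partial>(wiener \<Otimes>\<^sub>M M)) \<longlonglongrightarrow> 0"
    and g [measurable]: "g \<in> borel_measurable wiener" and g1: "\<And>y. \<bar>g y\<bar> \<le> 1"
  shows "\<bar>\<integral>y. g y \<partial>wiener\<bar> \<le>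
    \<bar>\<integral>p. g (fst p) * (2 - 2 * cos (s * S p)) ^ n \<partial>(wiener \<Otimes>\<^sub>M M)\<bar> + 4 ^ n * (\<integral>y. damp s y \<partial>wiener)"
proof -
  have Sm [measurable]: "S \<in> borel_measurable (wiener \<Otimes>\<^sub>M M)" using S by (simp add: LL_def)
  have gf [measurable]: "(\<lambda>p. g (fst p)) \<in> borel_measurable (wiener \<Otimes>\<^sub>M M)"
    by (rule measurable_compose[OF measurable_fst g])
  define a where "a k = real (2 * n choose k) * (- 1) ^ (k + n)" for k
  define I where "I k = (\<integral>y. g y * damp ((real k - real n) * s) y \<partial>wiener)" for k
  define \<Lambda> where "\<Lambda> = (\<integral>y. damp s y \<partial>wiener)"
  have int_damp: "integrable wiener (damp r)" for r
    by (rule wiener.integrable_const_bound[where B = 1]) (auto simp: damp_nonneg damp_le_1)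
  have \<Lambda>0: "0 \<le> \<Lambda>" unfolding \<Lambda>_def by (intro integral_nonneg_AE) (simp add: damp_nonneg)
  have "(\<integral>p. g (fst p) * (2 - 2 * cos (s * S p)) ^ n \<partial>(wiener \<Otimes>\<^sub>M M)) =
      (\<integral>p. (\<Sum>k\<le>2 * n. a k * (g (fst p) * cos (((real k - real n) * s) * S p))) \<partial>(wiener \<Otimes>\<^sub>M M))"
    unfolding two_minus_two_cos_power by (simp add: sum_distrib_left a_def mult_ac)
  also have "\<dots> = (\<Sum>k\<le>2 * n. a k * (\<integral>p. g (fst p) * cos (((real k - real n) * s) * S p) \<partial>(wiener \<Otimes>\<^sub>M M)))"
  proof (subst Bochner_Integration.integral_sum)
    show "integrable (wiener \<Otimes>\<^sub>M M) (\<lambda>p. a k * (g (fst p) * cos (((real k - real n) * s) * S p)))" for k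
    proof (intro integrable_mult_right, rule WM.integrable_const_bound[where B = "1 * 1"])
      show "AE p in wiener \<Otimes>\<^sub>M M. norm (g (fst p) * cos (((real k - real n) * s) * S p)) \<le> 1 * 1"
        unfolding real_norm_def abs_mult by (intro AE_I2 mult_mono g1 abs_cos_le_one) auto
    qed measurable
  qed simp
  also have "\<dots> = (\<Sum>k\<le>2 * n. a k * I k)"
    unfolding I_def using series_cos[OF S lim g g1] by simp
  also have "\<dots> = a n * I n + (\<Sum>k\<in>{..2 * n} - {n}. a k * I k)"
    by (rule sum.remove) auto
  \<comment> \<open>At frequency 0 the damping equals 1 and the sign is positive. The coefficient
    binom(2n,n) is at least 1, so dropping it at the end only weakens the bound.\<close>
  also have "a n * I n = real (2 * n choose n) * (\<integral>y. g y \<partial>wiener)"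
  proof -
    have "damp 0 y = 1" for y
      using damp_lim[of 0 y] by (simp add: LIMSEQ_const_iff)
    then show ?thesis by (simp add: a_def I_def flip: mult_2)
  qed
  finally have eq: "real (2 * n choose n) * (\<integral>y. g y \<partial>wiener) =
      (\<integral>p. g (fst p) * (2 - 2 * cos (s * S p)) ^ n \<partial>(wiener \<Otimes>\<^sub>M M)) - (\<Sum>k\<in>{..2 * n} - {n}. a k * I k)"
    by simp
  \<comment> \<open>A nonzero integer multiple of s is at least |s| in absolute value, and the
    damping decreases in |s|. Summing the row of binomial coefficients then yields 4^n.\<close>
  have I: "\<bar>I k\<bar> \<le> \<Lambda>" if "k \<noteq> n" for k
  proof -
    have "1 \<le> \<bar>real k - real n\<bar>" using that by linarith
    then have "\<bar>s\<bar> \<le> \<bar>(real k - real n) * s\<bar>" by (simp add: abs_mult mult_le_cancel_right1)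
    then have le: "damp ((real k - real n) * s) y \<le> damp s y" for y by (rule damp_mono)
    have pt: "norm (g y * damp ((real k - real n) * s) y) \<le> damp s y" for y
    proof -
      have "\<bar>g y\<bar> * damp ((real k - real n) * s) y \<le> 1 * damp s y"
        by (intro mult_mono g1 le damp_nonneg) simp
      then show ?thesis by (simp add: abs_mult damp_nonneg)
    qed
    show ?thesis
      unfolding I_def \<Lambda>_def real_norm_def[symmetric]
      by (rule order_trans[OF integral_norm_bound], rule integral_mono'[OF int_damp pt damp_nonneg])
  qed
  have "\<bar>\<Sum>k\<in>{..2 * n} - {n}. a k * I k\<bar> \<le> (\<Sum>k\<in>{..2 * n} - {n}. real (2 * n choose k) * \<Lambda>)"
    by (rule order_trans[OF sum_abs], intro sum_mono)
      (auto simp: a_def abs_mult power_abs intro!: mult_left_mono I)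
  also have "\<dots> \<le> (\<Sum>k\<le>2 * n. real (2 * n choose k) * \<Lambda>)"
    by (intro sum_mono2) (auto simp: \<Lambda>0)
  also have "\<dots> = 4 ^ n * \<Lambda>"
    using choose_row_sum[of "2 * n"] by (simp add: power_mult flip: sum_distrib_right of_nat_sum)
  finally have err: "\<bar>\<Sum>k\<in>{..2 * n} - {n}. a k * I k\<bar> \<le> 4 ^ n * \<Lambda>" .
  have "1 * \<bar>\<integral>y. g y \<partial>wiener\<bar> \<le> real (2 * n choose n) * \<bar>\<integral>y. g y \<partial>wiener\<bar>"
    by (intro mult_right_mono) (auto simp: Suc_le_eq)
  also have "\<dots> = \<bar>real (2 * n choose n) * (\<integral>y. g y \<partial>wiener)\<bar>" by (simp add: abs_mult)
  finally show ?thesis unfolding eq \<Lambda>_def[symmetric] using err by linarith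
qed

end

lemma nn_tendsto_iff_integral:
  assumes "\<And>n. f n \<in> LL M 2"
  shows "(\<lambda>n. \<integral>\<^sup>+x. ennreal ((f n x)\<^sup>2) \<partial>M) \<longlonglongrightarrow> 0 \<longleftrightarrow> (\<lambda>n. \<integral>x. (f n x)\<^sup>2 \<partial>M) \<longlonglongrightarrow> 0"
proof -
  have "(\<integral>\<^sup>+x. ennreal ((f n x)\<^sup>2) \<partial>M) = ennreal (\<integral>x. (f n x)\<^sup>2 \<partial>M)" for n
    using assms[of n] by (intro nn_integral_eq_integral) (auto simp: LL_2_iff)
  then show ?thesis
    using tendsto_ennreal_iff[of "\<lambda>n. \<integral>x. (f n x)\<^sup>2 \<partial>M" sequentially 0] by simp
qed

text \<open>\<open>bouleau\<close> is a choice operator; existence of the L^2 limit of the partial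
  sums is what gives it its meaning.\<close>

lemma bouleau_spec:
  assumes "gauss_series M G (grad F)"
  shows "bouleau M G F \<in> LL (wiener \<Otimes>\<^sub>M M) 2"
    and "(\<lambda>n. \<integral>p. (gauss_series.partial G (grad F) n p - bouleau M G F p)\<^sup>2 \<partial>(wiener \<Otimes>\<^sub>M M)) \<longlonglongrightarrow> 0"
proof -
  interpret gauss_series M G "grad F" by fact
  have iff: "(\<lambda>n. \<integral>\<^sup>+(y, w). ennreal (((\<Sum>k<n. grad F k y * G k w) - S (y, w))\<^sup>2) \<partial>(wiener \<Otimes>\<^sub>M M)) \<longlonglongrightarrow> 0 \<longleftrightarrow>
      (\<lambda>n. \<integral>p. (partial n p - S p)\<^sup>2 \<partial>(wiener \<Otimes>\<^sub>M M)) \<longlonglongrightarrow> 0"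
    if S: "S \<in> LL (wiener \<Otimes>\<^sub>M M) 2" for S
    using nn_tendsto_iff_integral[of "\<lambda>n p. partial n p - S p", OF LL_diff[OF partial_LL S]]
    by (simp add: partial_def split_beta')
  obtain S where "S \<in> LL (wiener \<Otimes>\<^sub>M M) 2" "(\<lambda>n. \<integral>p. (partial n p - S p)\<^sup>2 \<partial>(wiener \<Otimes>\<^sub>M M)) \<longlonglongrightarrow> 0"
    by (rule partial_limit)
  then have "\<exists>S. S \<in> Lp (wiener \<Otimes>\<^sub>M M) 2 \<and>
      (\<lambda>n. \<integral>\<^sup>+(y, w). ennreal (((\<Sum>k<n. grad F k y * G k w) - S (y, w))\<^sup>2) \<partial>(wiener \<Otimes>\<^sub>M M)) \<longlonglongrightarrow> 0"
    unfolding Lp_2_eq_LL using iff by blast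
  from someI_ex[OF this, folded bouleau_def]
  show "bouleau M G F \<in> LL (wiener \<Otimes>\<^sub>M M) 2"
    and "(\<lambda>n. \<integral>p. (partial n p - bouleau M G F p)\<^sup>2 \<partial>(wiener \<Otimes>\<^sub>M M)) \<longlonglongrightarrow> 0"
    unfolding Lp_2_eq_LL by (auto simp: iff)
qed

text \<open>The cosine transform of the Bouleau derivative is the mean of \<open>damp\<close>, hence
  nonnegative and decreasing in |s|: exactly the two properties that let smoothness of the density
  force decay. The noise disappears from the conclusion.\<close>

lemma damp_decay:
  assumes "gauss_series M G (grad F)" and "smooth_law (wiener \<Otimes>\<^sub>M M) (bouleau M G F)"
  shows "\<exists>C. \<forall>s\<ge>1. (\<integral>y. gauss_series.damp (grad F) s y \<partial>wiener) \<le> C / s ^ n"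
proof -
  interpret gauss_series M G "grad F" by fact
  note b = bouleau_spec[OF assms(1)]
  obtain f where f: "\<And>n x. (deriv ^^ n) f differentiable (at x)" "\<And>x. 0 \<le> f x"
      "distributed (wiener \<Otimes>\<^sub>M M) lborel (bouleau M G F) (\<lambda>x. ennreal (f x))"
    using assms(2) unfolding smooth_law_def by blast
  have eq: "(\<integral>p. cos (s * bouleau M G F p) \<partial>(wiener \<Otimes>\<^sub>M M)) = (\<integral>y. damp s y \<partial>wiener)" for s
    using series_cos[OF b, of "\<lambda>_. 1" 1 s] by simp
  have int_damp: "integrable wiener (damp r)" for r
    by (rule wiener.integrable_const_bound[where B = 1]) (auto simp: damp_nonneg damp_le_1)
  have "\<exists>C. \<forall>s\<ge>1. (\<integral>p. cos (s * bouleau M G F p) \<partial>(wiener \<Otimes>\<^sub>M M)) \<le> C / s ^ n"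
  proof (rule WM.smooth_density_cos_decay[OF _ f(3) f(2) f(1)])
    show "bouleau M G F \<in> borel_measurable (wiener \<Otimes>\<^sub>M M)" using b(1) by (simp add: LL_def)
    show "0 \<le> (\<integral>p. cos (s * bouleau M G F p) \<partial>(wiener \<Otimes>\<^sub>M M))" for s
      unfolding eq by (intro integral_nonneg_AE) (simp add: damp_nonneg)
    show "(\<integral>p. cos (t * bouleau M G F p) \<partial>(wiener \<Otimes>\<^sub>M M)) \<le> (\<integral>p. cos (s * bouleau M G F p) \<partial>(wiener \<Otimes>\<^sub>M M))"
      if "\<bar>s\<bar> \<le> \<bar>t\<bar>" for s t
      unfolding eq by (rule integral_mono[OF int_damp int_damp]) (rule damp_mono[OF that])
  qed
  then show ?thesis by (simp add: eq)
qed

lemma char_decay: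
  assumes F: "F \<in> D_infinity" and decay: "\<And>n. \<exists>C. \<forall>s\<ge>1. (\<integral>y. gauss_series.damp (grad F) s y \<partial>wiener) \<le> C / s ^ n"
  shows "\<exists>C. \<forall>t\<ge>1. cmod (char (distr wiener borel F) t) \<le> C / t ^ m"
proof -
  note D = D_infinity_psi_smooth[OF F]
  have grad: "has_gradient F (grad F)" by (rule grad_spec[OF D(3)])
  interpret gauss_series wiener "\<lambda>k y. y k" "grad F"
    by (rule has_gradient_series[OF grad iid_wiener])
  have Fm: "F \<in> borel_measurable wiener" using grad by (simp add: has_gradient_def Lp_def)
  have Fm' [measurable]: "(\<lambda>p. F (fst p)) \<in> borel_measurable (wiener \<Otimes>\<^sub>M wiener)"
    by (rule measurable_compose[OF measurable_fst Fm])
  obtain S where S: "S \<in> LL W2 2" "(\<lambda>n. \<integral>p. (partial n p - S p)\<^sup>2 \<partial>W2) \<longlonglongrightarrow> 0"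
    by (rule partial_limit)
  have "wflow.d2 (\<lambda>p. F (fst p)) S"
    by (rule has_gradient_d2[OF grad S(1)]) (use S(2) in \<open>simp add: partial_def\<close>)
  \<comment> \<open>It matters that the first derivative in the chain is the series S itself: the
    oscillatory bound and the expansion into cosines have to concern the same variable.\<close>
  from wflow.smooth_chain[OF D(2,1) this] obtain X
    where X: "X 0 = (\<lambda>p. F (fst p))" "X 1 = S" "\<And>k. wflow.dv (X k) (X (Suc k))" by metis
  \<comment> \<open>With t = s^6 the bound s^(2n) (s/t)^n equals s^(6m) t^(-2m) = t^(-m).\<close>
  define n where "n = 2 * m"
  obtain C where C: "\<And>s t. 1 \<le> s \<Longrightarrow> 0 < t \<Longrightarrow>
        \<bar>\<integral>p. sin (t * F (fst p)) * (2 - 2 * cos (s * S p)) ^ n \<partial>W2\<bar> \<le> C * s ^ (2 * n) * (s / t) ^ n"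
      "\<And>s t. 1 \<le> s \<Longrightarrow> 0 < t \<Longrightarrow>
        \<bar>\<integral>p. cos (t * F (fst p)) * (2 - 2 * cos (s * S p)) ^ n \<partial>W2\<bar> \<le> C * s ^ (2 * n) * (s / t) ^ n"
    by (rule wflow.oscillatory_decay_cos[where X = X and n = n, OF X(3), unfolded X]) (rule that)
  obtain K where K: "\<And>s. 1 \<le> s \<Longrightarrow> (\<integral>y. damp s y \<partial>wiener) \<le> K / s ^ (6 * m)"
    using decay by blast
  have "cmod (char (distr wiener borel F) t) \<le> 2 * (C + 4 ^ n * K) / t ^ m" if t: "1 \<le> t" for t
  proof -
    \<comment> \<open>The sixth root makes K / s^(6m) equal to K / t^m, so both error terms have the
      same order; t \<ge> 1 gives the required s \<ge> 1.\<close>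
    define s where "s = root 6 t"
    have s: "1 \<le> s" and ts: "t = s ^ 6" using t by (auto simp: s_def)
    have rate: "C * s ^ (2 * n) * (s / t) ^ n = C / t ^ m"
    proof -
      have "s ^ (2 * n) * (s / t) ^ n * t ^ m = 1"
        using s unfolding ts n_def
        by (simp add: power_divide field_simps flip: power_mult power_add)
      then have "s ^ (2 * n) * (s / t) ^ n = 1 / t ^ m" using t by (simp only: eq_divide_eq) simp
      then show ?thesis by (simp only: mult.assoc) simp
    qed
    have tm: "s ^ (6 * m) = t ^ m" unfolding ts by (simp add: power_mult)
    have err: "4 ^ n * (\<integral>y. damp s y \<partial>wiener) \<le> 4 ^ n * K / t ^ m"
      using mult_left_mono[OF K[OF s], of "4 ^ n"] unfolding tm by simp
    have "\<bar>\<integral>y. e (t * F y) \<partial>wiener\<bar> \<le> (C + 4 ^ n * K) / t ^ m"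
      if e: "e \<in> borel_measurable borel" "\<And>u. \<bar>e u\<bar> \<le> 1"
        and b: "\<bar>\<integral>p. e (t * F (fst p)) * (2 - 2 * cos (s * S p)) ^ n \<partial>W2\<bar> \<le> C * s ^ (2 * n) * (s / t) ^ n" for e :: "real \<Rightarrow> real"
    proof -
      have "(\<lambda>y. e (t * F y)) \<in> borel_measurable wiener"
        by (rule measurable_compose[OF borel_measurable_times[OF borel_measurable_const Fm] e(1)])
      from series_differences[OF S this e(2), where s = s and n = n]
      show ?thesis using b err unfolding rate by (simp add: add_divide_distrib)
    qed
    from this[of sin] this[of cos]
    have sc: "\<bar>\<integral>y. sin (t * F y) \<partial>wiener\<bar> \<le> (C + 4 ^ n * K) / t ^ m" "\<bar>\<integral>y. cos (t * F y) \<partial>wiener\<bar> \<le> (C + 4 ^ n * K) / t ^ m"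
      using C[OF s, of t] t by auto
    have int: "integrable wiener (\<lambda>y. iexp (t * F y))"
      by (rule wiener.integrable_const_bound[where B = 1])
        (auto intro!: measurable_compose[OF Fm])
    have "char (distr wiener borel F) t = (\<integral>y. iexp (t * F y) \<partial>wiener)"
      unfolding char_def by (rule integral_distr[OF Fm]) measurable
    then have "Re (char (distr wiener borel F) t) = (\<integral>y. cos (t * F y) \<partial>wiener)"
      "Im (char (distr wiener borel F) t) = (\<integral>y. sin (t * F y) \<partial>wiener)"
      using integral_Re[OF int] integral_Im[OF int] by (auto simp: Re_exp Im_exp)
    with cmod_le[of "char (distr wiener borel F) t"] sc
    have "cmod (char (distr wiener borel F) t) \<le> (C + 4 ^ n * K) / t ^ m + (C + 4 ^ n * K) / t ^ m" by linarith
    then show ?thesis by (simp add: add_divide_distrib algebra_simps)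
  qed
  then show ?thesis by blast
qed

theorem theorem2:
  fixes F :: "(nat \<Rightarrow> real) \<Rightarrow> real"
    and M :: "'b measure" and G :: "nat \<Rightarrow> 'b \<Rightarrow> real"
  assumes "F \<in> D_infinity"
    and "iid_std_normal M G"
    and "smooth_law (wiener \<Otimes>\<^sub>M M) (bouleau M G F)"
  shows "smooth_law wiener F"
proof -
  have grad: "has_gradient F (grad F)"
    by (rule grad_spec[OF D_infinity_psi_smooth(3)[OF assms(1)]])
  have Fm: "F \<in> borel_measurable wiener" using grad by (simp add: has_gradient_def Lp_def)
  interpret real_distribution "distr wiener borel F"
    by (rule wiener.real_distribution_distr[OF Fm])
  obtain f where f: "\<And>n x. (deriv ^^ n) f differentiable (at x)" "\<And>x. 0 \<le> f x"
      "distr wiener borel F = density lborel (\<lambda>x. ennreal (f x))"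
    using char_decay_smooth_density[OF char_decay[OF assms(1)
      damp_decay[OF has_gradient_series[OF grad assms(2)] assms(3)]]] by blast
  have "f differentiable (at x)" for x using f(1)[of 0] by simp
  then have fm: "f \<in> borel_measurable borel"
    by (intro borel_measurable_continuous_onI) (auto intro!: continuous_at_imp_continuous_on differentiable_imp_continuous_within)
  have "distributed wiener lborel F (\<lambda>x. ennreal (f x))"
    unfolding distributed_def using f(3) fm Fm by (simp add: distr_cong[of wiener wiener lborel borel F F])
  with f show ?thesis unfolding smooth_law_def by blast
qed

end
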